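(* For every $C^2$ smooth radial set $K\subseteq\mathbb{R}^2$, the function $t\mapsto|C_\delta\overline{K_t}|_2$ is $C^2$ (for $t$ in a neighborhood of $0$) for every $\delta\in(0,1)$, and $$\lim_{\delta\to1^-}\frac{1}{(1-\delta)^2}\,\frac{\partial^2}{\partial t^2}|C_\delta\overline{K_t}|_2\bigg|_{t=0}\le 0 .$$ Equality holds if and only if $\rho_K$ is the restriction of a polynomial of degree $2$ (in two real variables) to the unit circle.
   Context: $|\cdot|_2$ denotes Lebesgue measure in the plane and $|\cdot|$ the Euclidean norm. A radial set in $\mathbb{R}^2$ is a set of the form $K=\{0\}\cup\{x\in\mathbb{R}^2\setminus\{0\}: |x|\le\rho_K(x/|x|)\}$ where $\rho_K:S^{1}\to[0,\infty)$ is continuous; $\rho_K$ is called its radial function. A radial body is a radial set whose radial function is strictly positive. A radial set $K$ is called $C^\beta$ smooth if $\rho_K$ is $C^\beta$ on $S^{1}$. For a radial set $K$ and real $t$ near $0$ (so that $1+t\rho_K>0$), $K_t$ is the radial body with radial function $\rho_{K_t}(v)=1+t\rho_K(v)$, and $\overline{K_t}=K_t/|K_t|_2^{1/2}$. For $\delta\in(0,1)$ and a radial body (or convex body) $L$, $C_\delta L=\{x\in\mathbb{R}^2: |L\cap(L+x)|_2\ge\delta|L|_2\}$. *)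

theory Defs
  imports "HOL-Analysis.Analysis"
begin

section \<open>Radial sets in the plane\<close>

definition radial_region :: "(real ^ 2 \<Rightarrow> real) \<Rightarrow> (real ^ 2) set" where
  "radial_region \<rho> = {0} \<union> {x. x \<noteq> 0 \<and> norm x \<le> \<rho> (x /\<^sub>R norm x)}"

definition has_radial_function :: "(real ^ 2) set \<Rightarrow> (real ^ 2 \<Rightarrow> real) \<Rightarrow> bool" where
  "has_radial_function K \<rho> \<longleftrightarrow>
     continuous_on (sphere 0 1) \<rho> \<and> (\<forall>v\<in>sphere 0 1. 0 \<le> \<rho> v) \<and> K = radial_region \<rho>"

definition radial_set :: "(real ^ 2) set \<Rightarrow> bool" where
  "radial_set K \<longleftrightarrow> (\<exists>\<rho>. has_radial_function K \<rho>)"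

text \<open>The values on the unit circle, the only ones ever used, do not depend on the choice;
  see \<open>radial_function_eq\<close> below.\<close>

definition radial_function :: "(real ^ 2) set \<Rightarrow> real ^ 2 \<Rightarrow> real" where
  "radial_function K = (SOME \<rho>. has_radial_function K \<rho>)"

lemma mem_radial_region_scaleR:
  assumes "norm v = 1" "0 < r"
  shows "r *\<^sub>R v \<in> radial_region \<rho> \<longleftrightarrow> r \<le> \<rho> v"
  using assms by (auto simp: radial_region_def)

lemma has_radial_function_unique:
  assumes "has_radial_function K \<rho>" "has_radial_function K \<sigma>" "v \<in> sphere 0 1"
  shows "\<rho> v = \<sigma> v"
proof -
  have v: "norm v = 1" and nn: "0 \<le> \<rho> v" "0 \<le> \<sigma> v"
    using assms by (auto simp: has_radial_function_def)
  have "r \<le> \<rho> v \<longleftrightarrow> r \<le> \<sigma> v" if "0 < r" for r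
    using mem_radial_region_scaleR[OF v that, of \<rho>] mem_radial_region_scaleR[OF v that, of \<sigma>] assms
    by (simp add: has_radial_function_def)
  from this[of "\<rho> v"] this[of "\<sigma> v"] nn show ?thesis
    by force
qed

lemma radial_function_eq:
  assumes "has_radial_function K \<rho>" "v \<in> sphere 0 1"
  shows "radial_function K v = \<rho> v"
  using has_radial_function_unique[OF _ assms] someI[of "has_radial_function K", OF assms(1)]
  by (simp add: radial_function_def)

section \<open>Smoothness\<close>

text \<open>Meant for open \<open>S\<close>. The differentiability clauses make the iterated derivatives
  genuine, as \<^const>\<open>deriv\<close> is unspecified at points of non-differentiability.\<close>

definition Ck_on :: "nat \<Rightarrow> real set \<Rightarrow> (real \<Rightarrow> real) \<Rightarrow> bool" where
  "Ck_on k S f \<longleftrightarrow>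
     (\<forall>j<k. \<forall>x\<in>S. (deriv ^^ j) f field_differentiable (at x)) \<and> continuous_on S ((deriv ^^ k) f)"

text \<open>Smoothness on the circle is smoothness in the angular coordinate, whose local inverses
  form the standard atlas of the circle.\<close>

definition Ck_on_circle :: "nat \<Rightarrow> (real ^ 2 \<Rightarrow> real) \<Rightarrow> bool" where
  "Ck_on_circle k \<rho> \<longleftrightarrow> Ck_on k UNIV (\<lambda>\<theta>. \<rho> (vector [cos \<theta>, sin \<theta>]))"

definition Ck_smooth_radial_set :: "nat \<Rightarrow> (real ^ 2) set \<Rightarrow> bool" where
  "Ck_smooth_radial_set k K \<longleftrightarrow> radial_set K \<and> Ck_on_circle k (radial_function K)"

section \<open>The perturbed disc, normalisation and convolution bodies\<close>

text \<open>Only relevant for \<open>t\<close> so close to \<open>0\<close> that the radial function is positive.\<close>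

definition perturbed_disc :: "(real ^ 2) set \<Rightarrow> real \<Rightarrow> (real ^ 2) set" where
  "perturbed_disc K t = radial_region (\<lambda>v. 1 + t * radial_function K v)"

definition normalized :: "(real ^ 2) set \<Rightarrow> (real ^ 2) set" where
  "normalized L = (\<lambda>x. x /\<^sub>R sqrt (measure lebesgue L)) ` L"

definition convolution_body :: "real \<Rightarrow> (real ^ 2) set \<Rightarrow> (real ^ 2) set" where
  "convolution_body \<delta> L =
     {x. measure lebesgue (L \<inter> (\<lambda>y. y + x) ` L) \<ge> \<delta> * measure lebesgue L}"

section \<open>Polynomials of degree two\<close>

text \<open>Degree exactly two. Since \<open>x\<^sup>2 + y\<^sup>2 - 1\<close> vanishes on the unit circle, the restrictions
  to the circle are the same as those of the polynomials of degree at most two.\<close>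

definition quadratic_polynomial :: "(real ^ 2 \<Rightarrow> real) \<Rightarrow> bool" where
  "quadratic_polynomial p \<longleftrightarrow>
     (\<exists>a b c d e f. (a, b, c) \<noteq> (0, 0, 0) \<and>
        (\<forall>x. p x = a * (x $ 1)\<^sup>2 + b * (x $ 1) * (x $ 2) + c * (x $ 2)\<^sup>2
                   + d * (x $ 1) + e * (x $ 2) + f))"

end

theory Submission
  imports Defs
begin

text \<open>With \<open>G(t, s, \<phi>)\<close> the area of \<open>K\<^sub>t\<close> intersected with its translate by \<open>s\<close> in
  direction \<open>\<phi>\<close>, the radial function \<open>S(t, \<phi>)\<close> of \<open>C\<^sub>\<delta> K\<^sub>t\<close> is the root of
  \<open>G(t, S, \<phi>) = \<delta> |K\<^sub>t|\<close>. By the scaling \<open>G(t, s) = s\<^sup>2 g((1 + t \<rho>) / s)\<close>, both partial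
  derivatives of \<open>G\<close> come from the variation of one functional \<open>g\<close> and are integrals over arcs
  of the boundary of \<open>K\<^sub>t\<close>. The end points of these arcs depend smoothly on \<open>(t, s)\<close> by the
  implicit function theorem, so \<open>S\<close> is twice differentiable in \<open>t\<close>, and the
  normalised volume is the integral of \<open>S\<^sup>2 / 2\<close> divided by \<open>|K\<^sub>t|\<close>. At \<open>t = 0\<close> everything is
  explicit in the angle \<open>h\<close> with \<open>S = 2 sin h\<close>, and \<open>\<delta> \<rightarrow> 1\<close> means \<open>h \<rightarrow> 0\<close>. The limit is a
  quadratic functional of \<open>\<rho>\<close>: split into the parts antiperiodic and periodic under
  \<open>\<theta> \<mapsto> \<theta> + \<pi>\<close>, it is \<open>- \<pi> / 4\<close> times the sum of the two Wirtinger deficits, whose equality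
  cases are the frequencies \<open>1\<close> and \<open>2\<close>.\<close>

section \<open>Polar coordinates in the plane\<close>

text \<open>The area of the intersection has no closed form away from the disc, so it is never
  differentiated twice directly. Its first derivatives are arc integrals whose end points are known
  only implicitly; written as differences of the primitives \<open>F1\<close>, \<open>F2\<close>,
  they can be differentiated once more as soon as the velocities of the end points are known.
  Normalising the translation to unit length turns a change of the shift into a change of the radial
  function, so one variational formula serves both variables, and the derivative in the shift
  becomes a relation of Euler type. A perturbation of the translated copy is handled by the point
  reflection that exchanges the two copies, which is why each arc in direction \<phi> is accompanied
  by one in direction \<phi> + pi. The reference value, the area of the lens of two discs, comes
  from the same derivative formula, read as a linear differential equation in the shift. As h tends
  to 0, numerators and denominators vanish together; they are all divided by h, and what remains are
  symmetric difference quotients.\<close>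

definition cis2 :: "real \<Rightarrow> real ^ 2" where
  "cis2 \<theta> = vector [cos \<theta>, sin \<theta>]"

lemma cis2_nth [simp]: "cis2 \<theta> $ 1 = cos \<theta>" "cis2 \<theta> $ 2 = sin \<theta>"
  by (simp_all add: cis2_def)

lemma vec2_eq_iff: "(x :: 'a ^ 2) = y \<longleftrightarrow> x $ 1 = y $ 1 \<and> x $ 2 = y $ 2"
  by (simp add: vec_eq_iff forall_2)

lemma norm_vec2: "norm (x :: real ^ 2) = sqrt ((x $ 1)\<^sup>2 + (x $ 2)\<^sup>2)"
  by (simp add: norm_vec_def L2_set_def sum_2)

lemma norm_cis2 [simp]: "norm (cis2 \<theta>) = 1"
  by (simp add: norm_vec2)

lemma cis2_in_sphere [simp]: "cis2 \<theta> \<in> sphere 0 1"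
  by simp

lemma sphere_cis2:
  assumes "norm (v :: real ^ 2) = 1"
  obtains \<theta> where "-pi \<le> \<theta>" "\<theta> < pi" "v = cis2 \<theta>"
proof -
  have "(v$1)\<^sup>2 + (v$2)\<^sup>2 = 1"
    using assms by (simp add: norm_vec2)
  then obtain t where t: "0 \<le> t" "t < 2*pi" "v$1 = cos t" "v$2 = sin t"
    using sincos_total_2pi by metis
  show thesis
  proof (cases "t < pi")
    case True
    then show ?thesis using t by (intro that[of t]) (auto simp: vec2_eq_iff)
  next
    case False
    then show ?thesis using t
      by (intro that[of "t - 2*pi"]) (auto simp: vec2_eq_iff cos_diff sin_diff)
  qed
qed

lemma cis2_periodic: "cis2 (\<theta> + 2 * pi) = cis2 \<theta>"
  by (simp add: vec2_eq_iff)

lemma cis2_inj: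
  assumes "cis2 a = cis2 b" "-pi \<le> a" "a < pi" "-pi \<le> b" "b < pi"
  shows "a = b"
proof -
  have "cos a = cos b" "sin a = sin b" using assms(1) by (simp_all add: vec2_eq_iff)
  then have "sin a = sin b \<and> cos a = cos b" by simp
  then obtain n :: int where n: "a = b + 2 * pi * n"
    using sin_cos_eq_iff by (auto simp: ac_simps)
  then have "\<bar>2 * pi * n\<bar> < 2 * pi" using assms by auto
  then have "\<bar>real_of_int n\<bar> < 1" by (simp add: abs_mult)
  then have "n = 0" by linarith
  then show ?thesis using n by simp
qed

lemma continuous_cis2: "continuous_on S cis2"
proof -
  have "continuous_on S (\<lambda>t. (\<chi> i. if i = 1 then cos t else sin t) :: real ^ 2)"
  proof (intro continuous_on_vec_lambda)
    show "continuous_on S (\<lambda>t. if i = 1 then cos t else sin t)" for i :: 2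
      by (cases "i = 1") (auto intro!: continuous_intros)
  qed
  moreover have "cis2 = (\<lambda>t. (\<chi> i. if i = 1 then cos t else sin t) :: real ^ 2)"
    by (auto simp: fun_eq_iff vec2_eq_iff)
  ultimately show ?thesis by (simp only:)
qed

lemma continuous_on_cis2 [continuous_intros]:
  "continuous_on S f \<Longrightarrow> continuous_on S (\<lambda>x. cis2 (f x))"
  using continuous_on_compose2[OF continuous_cis2[of UNIV]] by auto

lemma borel_measurable_vec2:
  "(\<lambda>(a, b). vector [a, b] :: real ^ 2) \<in> borel_measurable (borel \<Otimes>\<^sub>M borel)"
proof -
  have "(\<lambda>(a, b). vector [a, b] :: real ^ 2) = (\<lambda>p. \<chi> i. if i = 1 then fst p else snd p)"
    by (auto simp: fun_eq_iff vec2_eq_iff)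
  moreover have "continuous_on UNIV (\<lambda>p::real\<times>real. (\<chi> i. if i = 1 then fst p else snd p) :: real ^ 2)"
  proof (intro continuous_on_vec_lambda)
    show "continuous_on UNIV (\<lambda>p::real\<times>real. if i = 1 then fst p else snd p)" for i :: 2
      by (cases "i = 1") (auto intro!: continuous_intros)
  qed
  ultimately have "continuous_on UNIV (\<lambda>(a, b). vector [a, b] :: real ^ 2)" by simp
  then show ?thesis by (metis borel_measurable_continuous_onI borel_prod)
qed

text \<open>Agreement on boxes determines the measure. The product form is what makes Fubini
  applicable to angle and radius.\<close>

lemma lborel_vec2: "(lborel :: (real ^ 2) measure) =
   distr (lborel \<Otimes>\<^sub>M lborel) borel (\<lambda>(a, b). vector [a, b])"
proof (rule lborel_eqI)
  have meas: "(\<lambda>(a, b). vector [a, b] :: real ^ 2) \<in> borel_measurable (lborel \<Otimes>\<^sub>M lborel)"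
    using borel_measurable_vec2 by simp
  fix l u :: "real ^ 2" assume lu: "\<And>b. b \<in> Basis \<Longrightarrow> l \<bullet> b \<le> u \<bullet> b"
  have le: "l $ 1 \<le> u $ 1" "l $ 2 \<le> u $ 2"
    using lu[of "axis 1 1"] lu[of "axis 2 1"] by (auto simp: inner_axis axis_in_Basis_iff)
  have pre: "(\<lambda>(a, b). vector [a, b]) -` box l u \<inter> space (lborel \<Otimes>\<^sub>M lborel) = {l$1<..<u$1} \<times> {l$2<..<u$2}"
    by (auto simp: mem_box_cart forall_2 space_pair_measure)
  have "emeasure (distr (lborel \<Otimes>\<^sub>M lborel) borel (\<lambda>(a, b). vector [a, b] :: real^2)) (box l u)
     = emeasure (lborel \<Otimes>\<^sub>M lborel) ({l$1<..<u$1} \<times> {l$2<..<u$2})"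
    by (subst emeasure_distr[OF meas]) (auto simp: pre)
  also have "\<dots> = emeasure lborel {l$1<..<u$1} * emeasure lborel {l$2<..<u$2}"
    by (rule lborel.emeasure_pair_measure_Times) auto
  also have "\<dots> = ennreal ((u$1-l$1) * (u$2-l$2))"
    using le by (simp add: ennreal_mult)
  also have "(u$1-l$1) * (u$2-l$2) = (\<Prod>b\<in>Basis. (u - l) \<bullet> b)"
    by (simp add: Basis_vec_def cart_eq_inner_axis[symmetric] UNIV_2 inner_axis prod.insert axis_eq_axis inner_diff_left)
  finally show "emeasure (distr (lborel \<Otimes>\<^sub>M lborel) borel (\<lambda>(a, b). vector [a, b])) (box l u) = ennreal (\<Prod>b\<in>Basis. (u - l) \<bullet> b)" .
qed simp

lemma cis2_has_derivative:
  assumes "(f has_derivative f') (at x within S)"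
  shows "((\<lambda>x. cis2 (f x)) has_derivative (\<lambda>d. f' d *\<^sub>R cis2 (f x + pi / 2))) (at x within S)"
proof -
  have eq: "cis2 t = cos t *\<^sub>R axis 1 1 + sin t *\<^sub>R axis 2 1" for t
    by (simp add: vec2_eq_iff axis_def)
  show ?thesis
    unfolding eq
    by (rule derivative_eq_intros assms refl)+
       (auto simp: fun_eq_iff vec2_eq_iff axis_def cos_add sin_add)
qed

lemma negligible_horizontal: "negligible {x :: real ^ 2. x $ 2 = 0}"
  using negligible_hyperplane[of "axis 2 1 :: real ^ 2" 0]
  by (simp add: inner_axis axis_eq_0_iff inner_commute)

lemma polar_measurable:
  "(\<lambda>(\<theta>, r). r *\<^sub>R cis2 \<theta>) \<in> borel_measurable (borel \<Otimes>\<^sub>M borel)"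
proof -
  have "continuous_on UNIV (\<lambda>p :: real \<times> real. snd p *\<^sub>R cis2 (fst p))"
    by (intro continuous_intros)
  then have "(\<lambda>p :: real \<times> real. snd p *\<^sub>R cis2 (fst p)) \<in> borel_measurable borel"
    by (rule borel_measurable_continuous_onI)
  then show ?thesis by (simp add: borel_prod case_prod_beta')
qed

text \<open>Change of variables on the strip of angles in (-pi, pi) and radii in (0, R]. The strip
  misses only the closed negative half axis, which lies in a line and is negligible.\<close>

proposition measure_polar:
  fixes S :: "(real ^ 2) set"
  assumes S: "S \<in> sets borel" and bd: "\<And>x. x \<in> S \<Longrightarrow> norm x \<le> R"
  shows "measure lebesgue S =
    (LBINT \<theta>:{-pi..pi}. (LBINT r:{0..R}. indicat_real S (r *\<^sub>R cis2 \<theta>) * r))"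
proof -
  define T :: "(real ^ 2) set" where
    "T = {x. -pi < x $ 1 \<and> x $ 1 < pi \<and> 0 < x $ 2 \<and> x $ 2 \<le> R \<and> x $ 2 *\<^sub>R cis2 (x $ 1) \<in> S}"
  define g :: "real ^ 2 \<Rightarrow> real ^ 2" where "g = (\<lambda>x. x $ 2 *\<^sub>R cis2 (x $ 1))"
  define g' :: "real ^ 2 \<Rightarrow> real ^ 2 \<Rightarrow> real ^ 2" where
    "g' = (\<lambda>x d. d $ 2 *\<^sub>R cis2 (x $ 1) + (x $ 2 * d $ 1) *\<^sub>R cis2 (x $ 1 + pi / 2))"
  have nth: "((\<lambda>x. x $ i) has_derivative (\<lambda>d. d $ i)) F" for i :: 2 and F :: "(real ^ 2) filter"
    by (rule bounded_linear.has_derivative[OF bounded_linear_vec_nth has_derivative_ident])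
  have der: "(g has_derivative g' x) (at x within T)" for x
    unfolding g_def
    by (rule derivative_eq_intros cis2_has_derivative nth refl)+ (auto simp: g'_def fun_eq_iff)
  \<comment> \<open>The determinant itself is -r, negative because the angle is the first
    coordinate.\<close>
  have detg: "\<bar>det (matrix (g' x))\<bar> = x $ 2" if "x \<in> T" for x
  proof -
    have "det (matrix (g' x)) = - (x $ 2 * sin (x $ 1) * sin (x $ 1)) - x $ 2 * cos (x $ 1) * cos (x $ 1)"
      unfolding det_2 matrix_def g'_def by (simp add: axis_def cos_add sin_add)
    also have "\<dots> = - (x $ 2) * ((sin (x $ 1))\<^sup>2 + (cos (x $ 1))\<^sup>2)"
      by (simp only: power2_eq_square algebra_simps)
    finally have "det (matrix (g' x)) = - (x $ 2) * ((sin (x $ 1))\<^sup>2 + (cos (x $ 1))\<^sup>2)" .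
    then show ?thesis using that by (simp add: T_def)
  qed
  have Tb: "T \<in> sets borel"
  proof -
    have nm: "(\<lambda>x :: real ^ 2. x $ i) \<in> borel_measurable borel" for i
      by (intro borel_measurable_continuous_onI continuous_intros)
    have "(\<lambda>x :: real ^ 2. x $ 2 *\<^sub>R cis2 (x $ 1)) \<in> borel_measurable borel"
      by (intro borel_measurable_continuous_onI continuous_intros)
    then have "(\<lambda>x :: real ^ 2. x $ 2 *\<^sub>R cis2 (x $ 1)) -` S \<inter> space borel \<in> sets borel"
      using S by (rule measurable_sets)
    moreover have "{x :: real ^ 2. -pi < x $ 1 \<and> x $ 1 < pi \<and> 0 < x $ 2 \<and> x $ 2 \<le> R} \<in> sets borel"
      using nm by measurable
    moreover have "T = {x. -pi < x $ 1 \<and> x $ 1 < pi \<and> 0 < x $ 2 \<and> x $ 2 \<le> R} \<inter>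
       ((\<lambda>x :: real ^ 2. x $ 2 *\<^sub>R cis2 (x $ 1)) -` S \<inter> space borel)"
      by (auto simp: T_def)
    ultimately show ?thesis by auto
  qed
  have inj: "inj_on g T"
  proof (rule inj_onI)
    fix x y assume xy: "x \<in> T" "y \<in> T" "g x = g y"
    have "norm (g x) = norm (g y)" using xy by simp
    then have 2: "x $ 2 = y $ 2" using xy by (simp add: g_def T_def)
    then have "cis2 (x $ 1) = cis2 (y $ 1)" using xy by (simp add: g_def T_def)
    then have "x $ 1 = y $ 1" using xy by (intro cis2_inj) (auto simp: T_def)
    with 2 show "x = y" by (simp add: vec2_eq_iff)
  qed
  have gT: "g ` T = S - {x. x $ 2 = 0 \<and> x $ 1 \<le> 0}"
  proof (intro equalityI subsetI)
    fix z assume "z \<in> g ` T"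
    then obtain x where x: "x \<in> T" "z = g x" by blast
    have "\<not> (x $ 2 * sin (x $ 1) = 0 \<and> x $ 2 * cos (x $ 1) \<le> 0)"
    proof
      assume a: "x $ 2 * sin (x $ 1) = 0 \<and> x $ 2 * cos (x $ 1) \<le> 0"
      have p: "x $ 2 > 0" "-pi < x $ 1" "x $ 1 < pi" using x by (auto simp: T_def)
      then have "sin (x $ 1) = 0" using a by auto
      then have "x $ 1 = 0" using p
        by (metis neg_less_0_iff_less order_less_irrefl linorder_cases minus_equation_iff neg_0_less_iff_less sin_gt_zero sin_minus neg_less_iff_less)
      then show False using a p by simp
    qed
    then show "z \<in> S - {x. x $ 2 = 0 \<and> x $ 1 \<le> 0}" using x by (auto simp: T_def g_def)
  next
    fix z assume z: "z \<in> S - {x. x $ 2 = 0 \<and> x $ 1 \<le> 0}"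
    then have z0: "z \<noteq> 0" by auto
    obtain t where t: "-pi \<le> t" "t < pi" "z /\<^sub>R norm z = cis2 t"
      using sphere_cis2[of "z /\<^sub>R norm z"] z0 by auto
    have zt: "z = norm z *\<^sub>R cis2 t" using t z0 by (metis divideR_right norm_eq_zero)
    have "t \<noteq> -pi"
    proof
      assume "t = -pi"
      then have "z $ 2 = 0 \<and> z $ 1 \<le> 0" by (subst (1 2) zt) simp
      with z show False by simp
    qed
    then have "vector [t, norm z] \<in> T" using t z z0 zt bd by (auto simp: T_def)
    moreover have "g (vector [t, norm z]) = z" using zt by (simp add: g_def)
    ultimately show "z \<in> g ` T" by force
  qed
  have gTb: "g ` T \<in> sets borel"
  proof -
    have "closed {x :: real ^ 2. x $ 2 = 0 \<and> x $ 1 \<le> 0}"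
      by (intro closed_Collect_conj closed_Collect_eq closed_Collect_le continuous_intros)
    then show ?thesis unfolding gT using S by auto
  qed
  have bS: "bounded S" using bd by (auto simp: bounded_iff)
  then have SL: "S \<in> lmeasurable" using S by (simp add: bounded_set_imp_lmeasurable)
  have fgT: "g ` T \<in> lmeasurable"
    using bounded_subset[OF bS, of "g ` T"] gTb by (intro bounded_set_imp_lmeasurable) (auto simp: gT)
  have m1: "measure lebesgue S = measure lebesgue (g ` T)"
  proof (rule measure_negligible_symdiff[OF fgT])
    show "negligible (sym_diff (g ` T) S)"
      using negligible_horizontal by (rule negligible_subset) (auto simp: gT)
  qed
  \<comment> \<open>The constant one is taken with values in \<open>real ^ 1\<close>, the
    vector-valued form in which the change of variables theorem is stated; the real integral is
    recovered as a component.\<close>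
  have ai: "(\<lambda>x. vec 1 :: real ^ 1) absolutely_integrable_on (g ` T)"
    using fgT absolutely_integrable_on_const by blast
  have TL: "T \<in> sets lebesgue" using Tb by simp
  have ai2: "(\<lambda>x. \<bar>det (matrix (g' x))\<bar> *\<^sub>R (vec 1 :: real ^ 1)) absolutely_integrable_on T"
    and e2: "integral (g ` T) (\<lambda>x. vec 1 :: real ^ 1) = integral T (\<lambda>x. \<bar>det (matrix (g' x))\<bar> *\<^sub>R (vec 1 :: real ^ 1))"
    using has_absolute_integral_change_of_variables[OF TL der inj, of "\<lambda>x. vec 1 :: real ^ 1"] ai by blast+
  have ai3: "(\<lambda>x. (vec (x $ 2) :: real ^ 1)) absolutely_integrable_on T"
    using ai2 by (rule absolutely_integrable_spike[OF _ negligible_empty]) (auto simp: detg vec_eq_iff)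
  have e3: "integral (g ` T) (\<lambda>x. vec 1 :: real ^ 1) = integral T (\<lambda>x. (vec (x $ 2) :: real ^ 1))"
    unfolding e2 by (intro integral_cong) (auto simp: detg vec_eq_iff)
  have ai4: "(\<lambda>x. x $ 2) absolutely_integrable_on T"
    using absolutely_integrable_component[OF ai3, of "axis 1 1"] by (simp add: inner_axis)
  let ?F = "\<lambda>p. indicator T (vector [fst p, snd p]) * snd p"
  have vm: "(\<lambda>(a, b). vector [a, b] :: real ^ 2) \<in> lborel \<Otimes>\<^sub>M lborel \<rightarrow>\<^sub>M borel"
    using borel_measurable_vec2 by simp
  have Fm: "(\<lambda>x. indicat_real T x * x $ 2) \<in> borel_measurable borel"
    using Tb by (intro borel_measurable_times borel_measurable_indicator borel_measurable_continuous_onI continuous_intros)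
  have Fi: "integrable (lborel \<Otimes>\<^sub>M lborel) ?F"
  proof -
    have "integrable lebesgue (\<lambda>x. indicat_real T x * x $ 2)"
      using ai4 by (simp add: set_integrable_def)
    then have "integrable lborel (\<lambda>x. indicat_real T x * x $ 2)"
      using Fm by (simp add: integrable_completion)
    then show ?thesis
      by (subst (asm) lborel_vec2, subst (asm) integrable_distr_eq[OF vm Fm]) (simp add: case_prod_beta)
  qed
  have "measure lebesgue (g ` T) = integral (g ` T) (\<lambda>x. 1)"
    using fgT by (simp add: lmeasure_integral)
  also have "\<dots> = integral T (\<lambda>x. x $ 2)"
    using integral_component_eq[of "\<lambda>x. vec 1 :: real ^ 1" "g ` T" "axis 1 1"] 
      integral_component_eq[of "\<lambda>x. (vec (x $ 2) :: real ^ 1)" T "axis 1 1"] e3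
      set_lebesgue_integral_eq_integral(1)[OF ai3] set_lebesgue_integral_eq_integral(1)[OF ai]
    by (simp add: inner_axis)
  also have "\<dots> = (\<integral>x\<in>T. x $ 2 \<partial>lebesgue)"
    by (rule set_lebesgue_integral_eq_integral(2)[OF ai4, symmetric])
  also have "\<dots> = (\<integral>x. indicator T x * x $ 2 \<partial>lborel)"
    unfolding set_lebesgue_integral_def
    using Tb by (subst integral_completion) (auto intro!: borel_measurable_times borel_measurable_indicator borel_measurable_continuous_onI continuous_intros)
  also have "\<dots> = (\<integral>p. ?F p \<partial>(lborel \<Otimes>\<^sub>M lborel))"
    by (subst lborel_vec2, subst integral_distr[OF vm Fm]) (simp add: case_prod_beta)
  also have "\<dots> = (\<integral>\<theta>. \<integral>r. ?F (\<theta>, r) \<partial>lborel \<partial>lborel)"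
    by (rule lborel_pair.integral_fst'[symmetric, OF Fi])
  also have "\<dots> = (\<integral>\<theta>. indicat_real {-pi..pi} \<theta> *\<^sub>R (LBINT r:{0..R}. indicat_real S (r *\<^sub>R cis2 \<theta>) * r) \<partial>lborel)"
  \<comment> \<open>\<open>T\<close> uses the open interval of angles, hence the two exceptional
    points. The radius 0 is missing from \<open>T\<close> as well, but there the integrand has the
    factor \<open>r\<close>.\<close>
  proof (rule integral_discrete_difference[of "{-pi, pi}"])
    fix \<theta> :: real assume *: "\<theta> \<notin> {-pi, pi}"
    have F: "?F (\<theta>, r) = indicat_real {-pi..pi} \<theta> * (indicator {0..R} r *\<^sub>R (indicat_real S (r *\<^sub>R cis2 \<theta>) * r))" for r
      using * by (auto simp: T_def indicator_def)
    then show "(\<integral>r. ?F (\<theta>, r) \<partial>lborel) = indicat_real {-pi..pi} \<theta> *\<^sub>R (LBINT r:{0..R}. indicat_real S (r *\<^sub>R cis2 \<theta>) * r)"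
      unfolding F set_lebesgue_integral_def by (simp only: integral_mult_right_zero real_scaleR_def)
  qed auto
  finally show ?thesis using m1 by (simp add: set_lebesgue_integral_def)
qed

section \<open>Radial regions and integration along rays\<close>

lemma radial_region_image:
  assumes "\<And>v. v \<in> sphere 0 1 \<Longrightarrow> 0 \<le> \<sigma> v"
  shows "radial_region \<sigma> = (\<lambda>(v, u). (u * \<sigma> v) *\<^sub>R v) ` (sphere 0 1 \<times> {0..1})"
proof (intro equalityI subsetI)
  fix x assume x: "x \<in> radial_region \<sigma>"
  show "x \<in> (\<lambda>(v, u). (u * \<sigma> v) *\<^sub>R v) ` (sphere 0 1 \<times> {0..1})"
  proof (cases "x = 0")
    case True
    then show ?thesis by (intro image_eqI[of _ _ "(cis2 0, 0)"]) auto
  next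
    case False
    then have le: "norm x \<le> \<sigma> (x /\<^sub>R norm x)" using x by (auto simp: radial_region_def)
    moreover have "0 < norm x" using False by simp
    ultimately have p: "0 < \<sigma> (x /\<^sub>R norm x)" by linarith
    show ?thesis
    proof (intro image_eqI[of _ _ "(x /\<^sub>R norm x, norm x / \<sigma> (x /\<^sub>R norm x))"])
      show "x = (case (x /\<^sub>R norm x, norm x / \<sigma> (x /\<^sub>R norm x)) of (v, u) \<Rightarrow> (u * \<sigma> v) *\<^sub>R v)"
        using p False by simp
      show "(x /\<^sub>R norm x, norm x / \<sigma> (x /\<^sub>R norm x)) \<in> sphere 0 1 \<times> {0..1}"
        using p le False by simp
    qed
  qed
next
  fix x assume "x \<in> (\<lambda>(v, u). (u * \<sigma> v) *\<^sub>R v) ` (sphere 0 1 \<times> {0..1})"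
  then obtain v u where vu: "norm v = 1" "0 \<le> u" "u \<le> 1" "x = (u * \<sigma> v) *\<^sub>R v" by auto
  have s: "0 \<le> \<sigma> v" using assms vu by simp
  show "x \<in> radial_region \<sigma>"
  proof (cases "u * \<sigma> v = 0")
    case True
    then show ?thesis using vu by (simp add: radial_region_def)
  next
    case False
    moreover have "0 \<le> u * \<sigma> v" using s vu by simp
    ultimately have "0 < u * \<sigma> v" by linarith
    moreover have "u * \<sigma> v \<le> \<sigma> v" using vu s by (simp add: mult_left_le_one_le)
    ultimately show ?thesis using vu by (simp add: mem_radial_region_scaleR)
  qed
qed

text \<open>A continuous image of the compact cylinder of directions and relative radii in [0, 1].
  This parametrisation avoids x / |x|, which is undefined at the origin.\<close>

lemma compact_radial_region:
  assumes "continuous_on (sphere 0 1) \<sigma>" "\<And>v. v \<in> sphere 0 1 \<Longrightarrow> 0 \<le> \<sigma> v"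
  shows "compact (radial_region \<sigma>)"
proof -
  have "continuous_on (sphere 0 1 \<times> {0..1}) (\<lambda>p. (snd p * \<sigma> (fst p)) *\<^sub>R fst p)"
    by (intro continuous_intros continuous_on_compose2[OF assms(1)]) auto
  then have "compact ((\<lambda>p. (snd p * \<sigma> (fst p)) *\<^sub>R fst p) ` (sphere 0 1 \<times> {0..1}))"
    by (rule compact_continuous_image) (intro compact_Times compact_sphere compact_Icc)
  then show ?thesis using radial_region_image[of \<sigma>] assms(2) by (simp add: case_prod_beta')
qed

lemma sphere_bound:
  fixes \<sigma> :: "real ^ 2 \<Rightarrow> real"
  assumes "continuous_on (sphere 0 1) \<sigma>"
  obtains B where "0 < B" "\<And>v. v \<in> sphere 0 1 \<Longrightarrow> \<bar>\<sigma> v\<bar> \<le> B"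
proof -
  have "bounded (\<sigma> ` sphere 0 1)"
    by (intro compact_imp_bounded compact_continuous_image assms compact_sphere)
  then obtain B where "0 < B" "\<forall>y\<in>\<sigma> ` sphere 0 1. norm y \<le> B" unfolding bounded_pos by blast
  then show thesis using that[of B] by auto
qed

lemma sphere_pos_bound:
  fixes \<sigma> :: "real ^ 2 \<Rightarrow> real"
  assumes "continuous_on (sphere 0 1) \<sigma>" "\<And>v. v \<in> sphere 0 1 \<Longrightarrow> 0 < \<sigma> v"
  obtains m where "0 < m" "\<And>v. v \<in> sphere 0 1 \<Longrightarrow> m \<le> \<sigma> v"
proof -
  have "sphere (0::real^2) 1 \<noteq> {}" using cis2_in_sphere by blast
  then obtain w where "w \<in> sphere 0 1" "\<forall>v\<in>sphere 0 1. \<sigma> w \<le> \<sigma> v"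
    using continuous_attains_inf[OF compact_sphere _ assms(1)] by blast
  then show thesis using that[of "\<sigma> w"] assms(2) by auto
qed

text \<open>The contribution of one direction to the polar area of \<open>M\<close>, the weight
  \<open>r\<close> being the Jacobian. Cutting each ray at a radial function gives the area of an
  intersection, so varying that function means varying \<open>b\<close>.\<close>

definition ray_mass :: "(real ^ 2) set \<Rightarrow> real \<Rightarrow> real \<Rightarrow> real" where
  "ray_mass M \<theta> b = (LBINT r:{0..b}. indicat_real M (r *\<^sub>R cis2 \<theta>) * r)"

lemma ray_indicator_measurable:
  assumes "M \<in> sets borel"
  shows "(\<lambda>r. indicat_real M (r *\<^sub>R cis2 \<theta>)) \<in> borel_measurable borel"
proof -
  have "(\<lambda>r. r *\<^sub>R cis2 \<theta>) \<in> borel_measurable borel"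
    by (intro borel_measurable_continuous_onI continuous_intros)
  then show ?thesis using assms by simp
qed

lemma ray_integrable:
  assumes M: "M \<in> sets borel"
  shows "set_integrable lborel {a..b} (\<lambda>r. indicat_real M (r *\<^sub>R cis2 \<theta>) * r)"
proof -
  have "set_integrable lborel {a..b} (\<lambda>r::real. \<bar>r\<bar>)"
    by (intro borel_integrable_atLeastAtMost' continuous_intros)
  moreover have "set_borel_measurable lborel {a..b} (\<lambda>r. indicat_real M (r *\<^sub>R cis2 \<theta>) * r)"
    unfolding set_borel_measurable_def
    by (intro borel_measurable_scaleR borel_measurable_times) (simp_all add: ray_indicator_measurable[OF M])
  ultimately show ?thesis
    by (rule set_integrable_bound) (auto simp: indicator_def)
qed

lemma ray_mass_diff:
  assumes M: "M \<in> sets borel" and ab: "0 \<le> a" "a \<le> b"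
  shows "ray_mass M \<theta> b - ray_mass M \<theta> a = (LBINT r:{a..b}. indicat_real M (r *\<^sub>R cis2 \<theta>) * r)"
proof -
  have "ray_mass M \<theta> b - ray_mass M \<theta> a = (LBINT r:{a<..b}. indicat_real M (r *\<^sub>R cis2 \<theta>) * r)"
  proof -
    have "{0..b} = {0..a} \<union> {a<..b}" using ab by auto
    then have "ray_mass M \<theta> b = ray_mass M \<theta> a + (LBINT r:{a<..b}. indicat_real M (r *\<^sub>R cis2 \<theta>) * r)"
      unfolding ray_mass_def
      by (simp only:) (rule set_integral_Un, auto intro!: set_integrable_subset[OF ray_integrable[OF M, of a b]] ray_integrable[OF M])
    then show ?thesis by simp
  qed
  also have "\<dots> = (LBINT r:{a..b}. indicat_real M (r *\<^sub>R cis2 \<theta>) * r)"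
    unfolding set_lebesgue_integral_def
    by (rule integral_discrete_difference[of "{a}"]) (auto simp: indicator_def)
  finally show ?thesis .
qed

lemma LBINT_id: "a \<le> b \<Longrightarrow> (LBINT r:{a..b}. r) = (b\<^sup>2 - a\<^sup>2) / (2::real)"
  using ident_has_integral[of a b] borel_integrable_atLeastAtMost'[of a b "\<lambda>r. r"]
  by (subst set_borel_integral_eq_integral(2)) (auto simp: integral_unique)

lemma ray_mass_diff_bound:
  assumes M: "M \<in> sets borel" and "0 \<le> a" "0 \<le> b"
  shows "\<bar>ray_mass M \<theta> b - ray_mass M \<theta> a\<bar> \<le> \<bar>b\<^sup>2 - a\<^sup>2\<bar> / 2"
proof -
  have *: "\<bar>ray_mass M \<theta> b - ray_mass M \<theta> a\<bar> \<le> \<bar>b\<^sup>2 - a\<^sup>2\<bar> / 2" if "0 \<le> a" "a \<le> b" for a b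
  proof -
    have i: "set_integrable lborel {a..b} (\<lambda>r::real. r)"
      by (intro borel_integrable_atLeastAtMost' continuous_intros)
    have "(LBINT r:{a..b}. indicat_real M (r *\<^sub>R cis2 \<theta>) * r) \<le> (LBINT r:{a..b}. r)"
      using that by (intro set_integral_mono ray_integrable M i) (auto simp: indicator_def)
    moreover have "0 \<le> (LBINT r:{a..b}. indicat_real M (r *\<^sub>R cis2 \<theta>) * r)"
      using that unfolding set_lebesgue_integral_def by (intro Bochner_Integration.integral_nonneg) (auto simp: indicator_def)
    ultimately show ?thesis using that LBINT_id[of a b] by (simp add: ray_mass_diff M)
  qed
  show ?thesis
  proof (cases "a \<le> b")
    case True then show ?thesis using *[of a b] assms by simp
  next
    case False then show ?thesis using *[of b a] assms by (simp add: abs_minus_commute)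
  qed
qed

text \<open>Where the ray stays on one side of the boundary of \<open>M\<close>, the change of mass
  is exact. This leaves a purely quadratic error in the first variation.\<close>

lemma ray_mass_diff_const:
  assumes M: "M \<in> sets borel" and "0 \<le> a" "0 \<le> b"
    and c: "\<And>r. min a b \<le> r \<Longrightarrow> r \<le> max a b \<Longrightarrow> indicat_real M (r *\<^sub>R cis2 \<theta>) = c"
  shows "ray_mass M \<theta> b - ray_mass M \<theta> a = c * (b\<^sup>2 - a\<^sup>2) / 2"
proof -
  have *: "ray_mass M \<theta> b - ray_mass M \<theta> a = c * (b\<^sup>2 - a\<^sup>2) / 2" if "0 \<le> a" "a \<le> b"
     "\<And>r. a \<le> r \<Longrightarrow> r \<le> b \<Longrightarrow> indicat_real M (r *\<^sub>R cis2 \<theta>) = c" for a b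
  proof -
    have "(LBINT r:{a..b}. indicat_real M (r *\<^sub>R cis2 \<theta>) * r) = (LBINT r:{a..b}. c * r)"
      using that by (intro set_lebesgue_integral_cong) auto
    also have "\<dots> = c * (LBINT r:{a..b}. r)" by simp
    finally show ?thesis using that LBINT_id[of a b] by (simp add: ray_mass_diff M)
  qed
  show ?thesis
  proof (cases "a \<le> b")
    case True then show ?thesis using *[of a b] assms by simp
  next
    case False then show ?thesis using *[of b a] assms by (simp add: algebra_simps)
  qed
qed

lemma ray_mass_measurable:
  assumes M: "M \<in> sets borel" and f: "f \<in> borel_measurable borel"
  shows "(\<lambda>\<theta>. ray_mass M \<theta> (f \<theta>)) \<in> borel_measurable borel"
proof -
  have [measurable]: "(\<lambda>p. snd p *\<^sub>R cis2 (fst p)) \<in> borel_measurable (borel \<Otimes>\<^sub>M borel)"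
    using polar_measurable by (simp add: case_prod_beta')
  note M[measurable] f[measurable]
  have [measurable]: "(\<lambda>p. indicat_real M (snd p *\<^sub>R cis2 (fst p))) \<in> borel_measurable (borel \<Otimes>\<^sub>M borel)"
    by measurable
  \<comment> \<open>The cut at \<open>f\<close> is written as a condition on the pair of angle and
    radius, which makes the integrand jointly measurable; integrating out the radius then keeps
    measurability in the angle.\<close>
  have "(\<lambda>p. (if 0 \<le> snd p \<and> snd p \<le> f (fst p) then 1 else 0) * (indicat_real M (snd p *\<^sub>R cis2 (fst p)) * snd p))
      \<in> borel_measurable (borel \<Otimes>\<^sub>M lborel)"
    by measurable
  then have "(\<lambda>\<theta>. LBINT r. (if 0 \<le> r \<and> r \<le> f \<theta> then 1 else 0) * (indicat_real M (r *\<^sub>R cis2 \<theta>) * r)) \<in> borel_measurable borel"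
    by (intro lborel.borel_measurable_lebesgue_integral) (simp add: case_prod_beta')
  moreover have "(LBINT r. (if 0 \<le> r \<and> r \<le> f \<theta> then 1 else 0) * (indicat_real M (r *\<^sub>R cis2 \<theta>) * r)) = ray_mass M \<theta> (f \<theta>)" for \<theta>
    unfolding ray_mass_def set_lebesgue_integral_def
    by (intro Bochner_Integration.integral_cong) (auto simp: indicator_def)
  ultimately show ?thesis by simp
qed

lemma angle_continuous:
  assumes "continuous_on (sphere 0 1) \<sigma>"
  shows "continuous_on S (\<lambda>\<theta>. \<sigma> (cis2 \<theta>))"
  by (rule continuous_on_compose2[OF assms continuous_cis2]) auto

lemma angle_measurable:
  fixes \<sigma> :: "real ^ 2 \<Rightarrow> real"
  assumes "continuous_on (sphere 0 1) \<sigma>"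
  shows "(\<lambda>\<theta>. \<sigma> (cis2 \<theta>)) \<in> borel_measurable borel"
  using angle_continuous[OF assms] by (rule borel_measurable_continuous_onI)

lemma measure_radial_inter:
  assumes \<sigma>: "continuous_on (sphere 0 1) \<sigma>" "\<And>v. v \<in> sphere 0 1 \<Longrightarrow> 0 \<le> \<sigma> v" and M: "M \<in> sets borel"
  shows "measure lebesgue (radial_region \<sigma> \<inter> M) = (LBINT \<theta>:{-pi..pi}. ray_mass M \<theta> (\<sigma> (cis2 \<theta>)))"
proof -
  obtain B where B: "0 < B" "\<And>v. v \<in> sphere 0 1 \<Longrightarrow> \<bar>\<sigma> v\<bar> \<le> B" using sphere_bound[OF \<sigma>(1)] by blast
  have S: "radial_region \<sigma> \<inter> M \<in> sets borel"
    using compact_radial_region[of \<sigma>] \<sigma> M by (auto intro!: sets.Int[OF borel_compact])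
  have bd: "norm x \<le> B" if "x \<in> radial_region \<sigma> \<inter> M" for x
  proof (cases "x = 0")
    case False
    then have "norm x \<le> \<sigma> (x /\<^sub>R norm x)" using that by (auto simp: radial_region_def)
    also have "\<dots> \<le> B" using B(2)[of "x /\<^sub>R norm x"] False by auto
    finally show ?thesis .
  qed (use B in auto)
  have "(LBINT r:{0..B}. indicat_real (radial_region \<sigma> \<inter> M) (r *\<^sub>R cis2 \<theta>) * r) = ray_mass M \<theta> (\<sigma> (cis2 \<theta>))" for \<theta>
    unfolding ray_mass_def set_lebesgue_integral_def
  proof (rule Bochner_Integration.integral_cong)
    fix r :: real
    have "\<sigma> (cis2 \<theta>) \<le> B" using B(2)[of "cis2 \<theta>"] by auto
    then show "indicat_real {0..B} r *\<^sub>R (indicat_real (radial_region \<sigma> \<inter> M) (r *\<^sub>R cis2 \<theta>) * r) =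
      indicat_real {0..\<sigma> (cis2 \<theta>)} r *\<^sub>R (indicat_real M (r *\<^sub>R cis2 \<theta>) * r)"
      using mem_radial_region_scaleR[of "cis2 \<theta>" r \<sigma>]
      by (cases "r > 0"; cases "r = 0") (auto simp: indicator_def)
  qed simp
  then show ?thesis using measure_polar[of "radial_region \<sigma> \<inter> M" B] S bd by simp
qed

lemma set_integrable_ray_mass:
  assumes \<sigma>: "continuous_on (sphere 0 1) \<sigma>" "\<And>v. v \<in> sphere 0 1 \<Longrightarrow> 0 \<le> \<sigma> v" and M: "M \<in> sets borel"
  shows "set_integrable lborel {-pi..pi} (\<lambda>\<theta>. ray_mass M \<theta> (\<sigma> (cis2 \<theta>)))"
proof -
  have "set_integrable lborel {-pi..pi} (\<lambda>\<theta>. (\<sigma> (cis2 \<theta>))\<^sup>2)"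
    by (intro borel_integrable_atLeastAtMost' continuous_intros angle_continuous \<sigma>)
  then show ?thesis
  proof (rule set_integrable_bound)
    show "set_borel_measurable lborel {-pi..pi} (\<lambda>\<theta>. ray_mass M \<theta> (\<sigma> (cis2 \<theta>)))"
      using ray_mass_measurable[OF M angle_measurable[OF \<sigma>(1)]] unfolding set_borel_measurable_def
      by (intro borel_measurable_scaleR) auto
    have "\<bar>ray_mass M \<theta> (\<sigma> (cis2 \<theta>))\<bar> \<le> (\<sigma> (cis2 \<theta>))\<^sup>2" for \<theta>
    proof -
      have "\<bar>ray_mass M \<theta> (\<sigma> (cis2 \<theta>)) - ray_mass M \<theta> 0\<bar> \<le> \<bar>(\<sigma> (cis2 \<theta>))\<^sup>2 - 0\<^sup>2\<bar> / 2"
        using \<sigma> by (intro ray_mass_diff_bound M) auto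
      moreover have "ray_mass M \<theta> 0 = 0"
        unfolding ray_mass_def set_lebesgue_integral_def
        by (rule integral_eq_zero_AE) (auto simp: indicator_def)
      ultimately show ?thesis by auto
    qed
    then show "AE \<theta> in lborel. \<theta> \<in> {-pi..pi} \<longrightarrow> norm (ray_mass M \<theta> (\<sigma> (cis2 \<theta>))) \<le> norm ((\<sigma> (cis2 \<theta>))\<^sup>2)"
      by auto
  qed
qed

lemma measure_radial_region:
  assumes \<sigma>: "continuous_on (sphere 0 1) \<sigma>" "\<And>v. v \<in> sphere 0 1 \<Longrightarrow> 0 \<le> \<sigma> v"
  shows "measure lebesgue (radial_region \<sigma>) = integral {-pi..pi} (\<lambda>\<theta>. (\<sigma> (cis2 \<theta>))\<^sup>2 / 2)"
proof -
  have rm: "ray_mass UNIV \<theta> (\<sigma> (cis2 \<theta>)) = (\<sigma> (cis2 \<theta>))\<^sup>2 / 2" for \<theta>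
    using LBINT_id[of 0 "\<sigma> (cis2 \<theta>)"] \<sigma>(2)[of "cis2 \<theta>"] by (simp add: ray_mass_def)
  have "measure lebesgue (radial_region \<sigma> \<inter> UNIV) = (LBINT \<theta>:{-pi..pi}. (\<sigma> (cis2 \<theta>))\<^sup>2 / 2)"
    by (subst measure_radial_inter) (auto simp: \<sigma> rm)
  also have "\<dots> = integral {-pi..pi} (\<lambda>\<theta>. (\<sigma> (cis2 \<theta>))\<^sup>2 / 2)"
    by (intro set_borel_integral_eq_integral(2) borel_integrable_atLeastAtMost' continuous_intros angle_continuous \<sigma>) auto
  finally show ?thesis by simp
qed

text \<open>Each ray contributes at most |\<sigma>^2 - \<tau>^2| / 2, which is at most B d, and the
  directions have total length 2 pi.\<close>

lemma measure_radial_inter_lipschitz: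
  assumes \<sigma>: "continuous_on (sphere 0 1) \<sigma>" "\<And>v. v \<in> sphere 0 1 \<Longrightarrow> 0 \<le> \<sigma> v \<and> \<sigma> v \<le> B"
    and \<tau>: "continuous_on (sphere 0 1) \<tau>" "\<And>v. v \<in> sphere 0 1 \<Longrightarrow> 0 \<le> \<tau> v \<and> \<tau> v \<le> B"
    and M: "M \<in> sets borel" and d: "\<And>v. v \<in> sphere 0 1 \<Longrightarrow> \<bar>\<sigma> v - \<tau> v\<bar> \<le> d"
  shows "\<bar>measure lebesgue (radial_region \<sigma> \<inter> M) - measure lebesgue (radial_region \<tau> \<inter> M)\<bar> \<le> 2 * pi * B * d"
proof -
  have i: "set_integrable lborel {-pi..pi} (\<lambda>\<theta>. ray_mass M \<theta> (\<sigma> (cis2 \<theta>)))"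
    "set_integrable lborel {-pi..pi} (\<lambda>\<theta>. ray_mass M \<theta> (\<tau> (cis2 \<theta>)))"
    using \<sigma> \<tau> M by (auto intro!: set_integrable_ray_mass)
  have le: "\<bar>ray_mass M \<theta> (\<sigma> (cis2 \<theta>)) - ray_mass M \<theta> (\<tau> (cis2 \<theta>))\<bar> \<le> B * d" for \<theta>
  proof -
    let ?s = "\<sigma> (cis2 \<theta>)" and ?t = "\<tau> (cis2 \<theta>)"
    have b: "0 \<le> ?s" "?s \<le> B" "0 \<le> ?t" "?t \<le> B" "\<bar>?s - ?t\<bar> \<le> d"
      using \<sigma>(2)[of "cis2 \<theta>"] \<tau>(2)[of "cis2 \<theta>"] d[of "cis2 \<theta>"] by auto
    have "\<bar>ray_mass M \<theta> ?s - ray_mass M \<theta> ?t\<bar> \<le> \<bar>?s\<^sup>2 - ?t\<^sup>2\<bar> / 2"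
      using b by (intro ray_mass_diff_bound M) auto
    also have "?s\<^sup>2 - ?t\<^sup>2 = (?s + ?t) * (?s - ?t)" by (simp add: power2_eq_square algebra_simps)
    also have "\<bar>(?s + ?t) * (?s - ?t)\<bar> / 2 \<le> (2 * B) * d / 2"
      unfolding abs_mult using b by (intro divide_right_mono mult_mono) auto
    finally show ?thesis by simp
  qed
  have "measure lebesgue (radial_region \<sigma> \<inter> M) - measure lebesgue (radial_region \<tau> \<inter> M)
     = (LBINT \<theta>:{-pi..pi}. ray_mass M \<theta> (\<sigma> (cis2 \<theta>)) - ray_mass M \<theta> (\<tau> (cis2 \<theta>)))"
    using measure_radial_inter[OF \<sigma>(1) _ M] measure_radial_inter[OF \<tau>(1) _ M] \<sigma>(2) \<tau>(2) set_integral_diff(2)[OF i] by auto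
  also have "\<bar>\<dots>\<bar> \<le> (LBINT \<theta>:{-pi..pi}. B * d)"
  proof -
    have "norm (LBINT \<theta>:{-pi..pi}. ray_mass M \<theta> (\<sigma> (cis2 \<theta>)) - ray_mass M \<theta> (\<tau> (cis2 \<theta>)))
       \<le> (LBINT \<theta>:{-pi..pi}. norm (ray_mass M \<theta> (\<sigma> (cis2 \<theta>)) - ray_mass M \<theta> (\<tau> (cis2 \<theta>))))"
      by (intro set_integral_norm_bound set_integral_diff(1) i)
    also have "\<dots> \<le> (LBINT \<theta>:{-pi..pi}. B * d)"
      using le by (intro set_integral_mono set_integrable_abs[unfolded real_norm_def[symmetric]] set_integral_diff(1) i borel_integrable_atLeastAtMost') auto
    finally show ?thesis by simp
  qed
  also have "(LBINT \<theta>:{-pi..pi}. B * d) = 2 * pi * B * d"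
    by (simp add: set_integral_const)
  finally show ?thesis by simp
qed

section \<open>First variation of the area of an intersection of translates\<close>

text \<open>\<open>M\<close> may vary with \<open>n\<close>, provided that on all but finitely many
  rays its indicator is eventually constant near the distance \<tau>. On such a ray the change of
  mass is c (\<sigma>^2 - \<tau>^2) / 2, which differs from the linear term by at most the square of
  \<open>d n\<close>. How soon this happens depends on the ray; dominated convergence makes up for
  the missing uniformity near \<open>Z\<close>.\<close>

lemma measure_radial_inter_variation:
  fixes \<sigma> :: "nat \<Rightarrow> real ^ 2 \<Rightarrow> real" and M :: "nat \<Rightarrow> (real ^ 2) set"
  assumes \<sigma>: "\<And>n. continuous_on (sphere 0 1) (\<sigma> n)" "\<And>n v. v \<in> sphere 0 1 \<Longrightarrow> 0 \<le> \<sigma> n v"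
    and \<tau>: "continuous_on (sphere 0 1) \<tau>" "\<And>v. v \<in> sphere 0 1 \<Longrightarrow> 0 \<le> \<tau> v"
    and d: "\<And>n v. v \<in> sphere 0 1 \<Longrightarrow> \<bar>\<sigma> n v - \<tau> v\<bar> \<le> d n" "\<And>n. 0 < d n" "d \<longlonglongrightarrow> 0"
    and M: "\<And>n. M n \<in> sets borel"
    and c: "c \<in> borel_measurable borel" "\<And>\<theta>. \<bar>c \<theta>\<bar> \<le> (1::real)"
    and Z: "finite Z"
    and loc: "\<And>\<theta>. \<theta> \<in> {-pi..pi} - Z \<Longrightarrow> \<exists>\<kappa>>0. \<forall>\<^sub>F n in sequentially.
        \<forall>r. \<bar>r - \<tau> (cis2 \<theta>)\<bar> < \<kappa> \<longrightarrow> indicat_real (M n) (r *\<^sub>R cis2 \<theta>) = c \<theta>"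
  shows "(\<lambda>n. (measure lebesgue (radial_region (\<sigma> n) \<inter> M n) - measure lebesgue (radial_region \<tau> \<inter> M n)
      - (LBINT \<theta>:{-pi..pi}. c \<theta> * \<tau> (cis2 \<theta>) * (\<sigma> n (cis2 \<theta>) - \<tau> (cis2 \<theta>)))) / d n) \<longlonglongrightarrow> 0"
proof -
  obtain B where B: "0 < B" "\<And>v. v \<in> sphere 0 1 \<Longrightarrow> \<bar>\<tau> v\<bar> \<le> B" using sphere_bound[OF \<tau>(1)] by blast
  obtain E where E: "0 < E" "\<And>n. \<bar>d n\<bar> \<le> E"
    using convergent_imp_Bseq[of d] d(3) by (auto simp: convergent_def Bseq_def)
  define lin where "lin n \<theta> = c \<theta> * \<tau> (cis2 \<theta>) * (\<sigma> n (cis2 \<theta>) - \<tau> (cis2 \<theta>))" for n \<theta>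
  define h where "h n \<theta> = (ray_mass (M n) \<theta> (\<sigma> n (cis2 \<theta>)) - ray_mass (M n) \<theta> (\<tau> (cis2 \<theta>)) - lin n \<theta>) / d n" for n \<theta>
  have lin_m: "lin n \<in> borel_measurable borel" for n
    unfolding lin_def
    by (intro borel_measurable_times borel_measurable_diff c angle_measurable \<sigma> \<tau>)
  have bt: "0 \<le> \<tau> (cis2 \<theta>)" "\<tau> (cis2 \<theta>) \<le> B" for \<theta>
    using \<tau>(2)[of "cis2 \<theta>"] B(2)[of "cis2 \<theta>"] by auto
  have bs: "0 \<le> \<sigma> n (cis2 \<theta>)" "\<bar>\<sigma> n (cis2 \<theta>) - \<tau> (cis2 \<theta>)\<bar> \<le> d n" for n \<theta>
    using \<sigma>(2)[of "cis2 \<theta>" n] d(1)[of "cis2 \<theta>" n] by auto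
  have bd: "d n \<le> E" for n using E(2)[of n] by auto
  have lin_b: "\<bar>lin n \<theta>\<bar> \<le> B * d n" for n \<theta>
    unfolding lin_def abs_mult using bt[of \<theta>] bs[of n \<theta>] bd[of n] c(2)[of \<theta>] B(1)
    by (intro mult_mono mult_left_le_one_le[THEN order_trans]) (auto simp: abs_of_nonneg)
  have lin_i: "set_integrable lborel {-pi..pi} (lin n)" for n
  proof (rule set_integrable_bound[OF borel_integrable_atLeastAtMost'[of "-pi" pi "\<lambda>_. B * d n"]])
    show "set_borel_measurable lborel {-pi..pi} (lin n)"
      unfolding set_borel_measurable_def using lin_m[of n] by (intro borel_measurable_scaleR) auto
    show "AE \<theta> in lborel. \<theta> \<in> {-pi..pi} \<longrightarrow> norm (lin n \<theta>) \<le> norm (B * d n)"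
      using lin_b by (auto intro: order_trans[OF _ abs_ge_self])
  qed auto
  have rm_i: "set_integrable lborel {-pi..pi} (\<lambda>\<theta>. ray_mass (M n) \<theta> (\<sigma> n (cis2 \<theta>)))"
    "set_integrable lborel {-pi..pi} (\<lambda>\<theta>. ray_mass (M n) \<theta> (\<tau> (cis2 \<theta>)))" for n
    using \<sigma> \<tau> M by (auto intro!: set_integrable_ray_mass)
  have hm: "h n \<in> borel_measurable borel" for n
    unfolding h_def
    by (intro borel_measurable_divide borel_measurable_diff ray_mass_measurable M angle_measurable \<sigma> \<tau> lin_m) auto
  \<comment> \<open>The dominating constant for the error quotients: B + E bounds the ray masses and
    B the linear term, both relative to \<open>d n\<close>.\<close>
  have hb: "\<bar>h n \<theta>\<bar> \<le> 2 * B + E" for n \<theta>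
  proof -
    let ?s = "\<sigma> n (cis2 \<theta>)" and ?t = "\<tau> (cis2 \<theta>)"
    have "\<bar>ray_mass (M n) \<theta> ?s - ray_mass (M n) \<theta> ?t\<bar> \<le> \<bar>?s\<^sup>2 - ?t\<^sup>2\<bar> / 2"
      using bt bs by (intro ray_mass_diff_bound M) auto
    also have "?s\<^sup>2 - ?t\<^sup>2 = (?s + ?t) * (?s - ?t)" by (simp add: power2_eq_square algebra_simps)
    also have "\<bar>(?s + ?t) * (?s - ?t)\<bar> / 2 \<le> ((2 * B + 2 * E) * d n) / 2"
      unfolding abs_mult using bt[of \<theta>] bs[of n \<theta>] bd[of n] B E by (intro divide_right_mono mult_mono) auto
    finally have "\<bar>ray_mass (M n) \<theta> ?s - ray_mass (M n) \<theta> ?t\<bar> \<le> (B + E) * d n" by (simp add: algebra_simps)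
    then have "\<bar>ray_mass (M n) \<theta> ?s - ray_mass (M n) \<theta> ?t - lin n \<theta>\<bar> \<le> (2 * B + E) * d n"
      using lin_b[of n \<theta>] by (simp add: algebra_simps)
    then show ?thesis using d(2)[of n] by (simp add: h_def abs_divide pos_divide_le_eq)
  qed
  have "(\<lambda>n. LBINT \<theta>:{-pi..pi}. h n \<theta>) \<longlonglongrightarrow> (LBINT \<theta>:{-pi..pi}. 0)"
    unfolding set_lebesgue_integral_def
  proof (rule integral_dominated_convergence)
    show "integrable lborel (\<lambda>\<theta>. indicat_real {-pi..pi} \<theta> *\<^sub>R (2 * B + E))"
      using borel_integrable_atLeastAtMost'[of "-pi" pi "\<lambda>_. 2 * B + E"] by (simp add: set_integrable_def)
    show "AE \<theta> in lborel. norm (indicat_real {-pi..pi} \<theta> *\<^sub>R h n \<theta>) \<le> indicat_real {-pi..pi} \<theta> *\<^sub>R (2 * B + E)" for n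
      using hb by (auto simp: indicator_def)
    have "(\<lambda>n. indicat_real {-pi..pi} \<theta> *\<^sub>R h n \<theta>) \<longlonglongrightarrow> indicat_real {-pi..pi} \<theta> *\<^sub>R 0" if "\<theta> \<notin> Z" for \<theta>
    proof (cases "\<theta> \<in> {-pi..pi}")
      case True
      then obtain \<kappa> where \<kappa>: "0 < \<kappa>" and ev: "\<forall>\<^sub>F n in sequentially.
        \<forall>r. \<bar>r - \<tau> (cis2 \<theta>)\<bar> < \<kappa> \<longrightarrow> indicat_real (M n) (r *\<^sub>R cis2 \<theta>) = c \<theta>"
        using loc[of \<theta>] \<open>\<theta> \<notin> Z\<close> by blast
      have "\<forall>\<^sub>F n in sequentially. d n < \<kappa>" using d(3) \<kappa> by (rule order_tendstoD)
      with ev have "\<forall>\<^sub>F n in sequentially. norm (h n \<theta>) \<le> d n"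
      proof eventually_elim
        case (elim n)
        let ?s = "\<sigma> n (cis2 \<theta>)" and ?t = "\<tau> (cis2 \<theta>)"
        have "ray_mass (M n) \<theta> ?s - ray_mass (M n) \<theta> ?t = c \<theta> * (?s\<^sup>2 - ?t\<^sup>2) / 2"
        proof (rule ray_mass_diff_const[OF M])
          fix r assume "min ?t ?s \<le> r" "r \<le> max ?t ?s"
          then have "\<bar>r - ?t\<bar> < \<kappa>" using bs(2)[of n \<theta>] elim by auto
          then show "indicat_real (M n) (r *\<^sub>R cis2 \<theta>) = c \<theta>" using elim by blast
        qed (use bt bs in auto)
        \<comment> \<open>The remainder is (s^2 - t^2) / 2 - t (s - t) = (s - t)^2 / 2, times
          \<open>c \<theta>\<close>.\<close>
        then have "ray_mass (M n) \<theta> ?s - ray_mass (M n) \<theta> ?t - lin n \<theta> = c \<theta> * ((?s - ?t) * (?s - ?t)) / 2"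
          by (simp add: lin_def power2_eq_square field_simps)
        then have "h n \<theta> = c \<theta> * ((?s - ?t) * (?s - ?t)) / 2 / d n" by (simp only: h_def)
        also have "\<bar>\<dots>\<bar> \<le> 1 * (d n * d n) / 1 / d n"
          using d(2)[of n] bs(2)[of n \<theta>] c(2)[of \<theta>] unfolding abs_divide abs_mult
          by (intro divide_right_mono frac_le mult_mono) auto
        finally show ?case using d(2)[of n] by simp
      qed
      then have "(\<lambda>n. h n \<theta>) \<longlonglongrightarrow> 0"
        by (rule Lim_null_comparison) (rule d(3))
      then show ?thesis by (intro tendsto_scaleR tendsto_const)
    qed simp
    moreover have "AE \<theta> in lborel. \<theta> \<notin> Z"
      using Z by (intro AE_not_in) (simp add: finite_imp_null_set_lborel)
    ultimately show "AE \<theta> in lborel. (\<lambda>n. indicat_real {-pi..pi} \<theta> *\<^sub>R h n \<theta>) \<longlonglongrightarrow> indicat_real {-pi..pi} \<theta> *\<^sub>R 0"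
      by auto
  qed (use hm in \<open>auto intro!: borel_measurable_times\<close>)
  moreover have "(LBINT \<theta>:{-pi..pi}. h n \<theta>) = (measure lebesgue (radial_region (\<sigma> n) \<inter> M n) - measure lebesgue (radial_region \<tau> \<inter> M n)
      - (LBINT \<theta>:{-pi..pi}. lin n \<theta>)) / d n" for n
  proof -
    have "(LBINT \<theta>:{-pi..pi}. h n \<theta>) = (LBINT \<theta>:{-pi..pi}. ray_mass (M n) \<theta> (\<sigma> n (cis2 \<theta>)) - ray_mass (M n) \<theta> (\<tau> (cis2 \<theta>)) - lin n \<theta>) / d n"
      unfolding h_def by (rule set_integral_divide_zero)
    also have "\<dots> = ((LBINT \<theta>:{-pi..pi}. ray_mass (M n) \<theta> (\<sigma> n (cis2 \<theta>))) - (LBINT \<theta>:{-pi..pi}. ray_mass (M n) \<theta> (\<tau> (cis2 \<theta>))) - (LBINT \<theta>:{-pi..pi}. lin n \<theta>)) / d n"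
      by (simp add: set_integral_diff rm_i lin_i)
    finally show ?thesis
      using measure_radial_inter[OF \<sigma>(1) _ M, of n n] measure_radial_inter[OF \<tau>(1) _ M, of n] \<sigma>(2) \<tau>(2) by auto
  qed
  ultimately show ?thesis by (simp add: lin_def)
qed

text \<open>Off the boundary, membership is the sign of the continuous function |y| - \<tau>(y /
  |y|). Half of its absolute value at \<open>z\<close> is a margin for moving the point, and another
  half for moving the radial function. The origin has no direction and is treated apart: there a
  positive lower bound of \<tau> is the margin.\<close>

lemma radial_region_locally_stable:
  assumes \<tau>: "continuous_on (sphere 0 1) \<tau>" "\<And>v. v \<in> sphere 0 1 \<Longrightarrow> 0 < \<tau> v"
    and z: "z = 0 \<or> norm z \<noteq> \<tau> (z /\<^sub>R norm z)"
  obtains \<kappa> where "0 < \<kappa>"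
    "\<And>\<sigma> y. (\<And>v. v \<in> sphere 0 1 \<Longrightarrow> \<bar>\<sigma> v - \<tau> v\<bar> < \<kappa>) \<Longrightarrow> norm (y - z) < \<kappa> \<Longrightarrow> y \<in> radial_region \<sigma> \<longleftrightarrow> z \<in> radial_region \<tau>"
proof (cases "z = 0")
  case True
  obtain m where m: "0 < m" "\<And>v. v \<in> sphere 0 1 \<Longrightarrow> m \<le> \<tau> v" using sphere_pos_bound[OF \<tau>] by blast
  show thesis
  proof (rule that[of "m / 2"])
    fix \<sigma> and y :: "real ^ 2"
    assume a: "\<And>v. v \<in> sphere 0 1 \<Longrightarrow> \<bar>\<sigma> v - \<tau> v\<bar> < m / 2" "norm (y - z) < m / 2"
    have "norm y \<le> \<sigma> (y /\<^sub>R norm y)" if "y \<noteq> 0"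
      using a(1)[of "y /\<^sub>R norm y"] m(2)[of "y /\<^sub>R norm y"] a(2) True that
      by (simp add: abs_real_def split: if_splits)
    then show "y \<in> radial_region \<sigma> \<longleftrightarrow> z \<in> radial_region \<tau>"
      using True by (auto simp: radial_region_def)
  qed (use m in auto)
next
  case False
  define F where "F = (\<lambda>y. norm y - \<tau> (y /\<^sub>R norm y))"
  have "continuous_on (- {0}) F"
    unfolding F_def by (intro continuous_intros continuous_on_compose2[OF \<tau>(1)]) (auto simp: field_simps split: if_splits)
  then have "isCont F z"
    using False by (simp add: continuous_on_eq_continuous_at open_Compl)
  moreover have Fz: "F z \<noteq> 0" using z False by (simp add: F_def)
  ultimately obtain d where d: "0 < d" "\<And>y. norm (y - z) < d \<Longrightarrow> \<bar>F y - F z\<bar> < \<bar>F z\<bar> / 2"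
    unfolding continuous_at_eps_delta dist_norm
    by (metis half_gt_zero_iff zero_less_abs_iff real_norm_def)
  show thesis
  \<comment> \<open>The entry \<open>norm z\<close> keeps \<open>y\<close> away from the
    origin.\<close>
  proof (rule that[of "Min {d, norm z, \<bar>F z\<bar> / 2}"])
    fix \<sigma> and y :: "real ^ 2"
    assume a: "\<And>v. v \<in> sphere 0 1 \<Longrightarrow> \<bar>\<sigma> v - \<tau> v\<bar> < Min {d, norm z, \<bar>F z\<bar> / 2}" "norm (y - z) < Min {d, norm z, \<bar>F z\<bar> / 2}"
    have y0: "y \<noteq> 0" using a(2) by auto
    have "\<bar>\<sigma> (y /\<^sub>R norm y) - \<tau> (y /\<^sub>R norm y)\<bar> < \<bar>F z\<bar> / 2"
      using a(1)[of "y /\<^sub>R norm y"] y0 by auto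
    moreover have "\<bar>F y - F z\<bar> < \<bar>F z\<bar> / 2" using a(2) d(2)[of y] by auto
    ultimately have "norm y \<le> \<sigma> (y /\<^sub>R norm y) \<longleftrightarrow> norm z \<le> \<tau> (z /\<^sub>R norm z)"
      unfolding F_def by (auto simp: abs_real_def split: if_splits)
    then show "y \<in> radial_region \<sigma> \<longleftrightarrow> z \<in> radial_region \<tau>"
      using False y0 by (auto simp: radial_region_def)
  qed (use d False Fz in auto)
qed

section \<open>The area of a region intersected with its unit translate\<close>

definition lens_area :: "(real ^ 2 \<Rightarrow> real) \<Rightarrow> real" where
  "lens_area \<sigma> = measure lebesgue (radial_region \<sigma> \<inter> (\<lambda>y. y + cis2 0) ` radial_region \<sigma>)"

lemma uminus_radial_region: "uminus ` radial_region \<sigma> = radial_region (\<sigma> \<circ> uminus)"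
proof -
  have "x \<in> uminus ` radial_region \<sigma> \<longleftrightarrow> - x \<in> radial_region \<sigma>" for x
    by (metis (no_types, lifting) image_iff minus_minus)
  then show ?thesis by (auto simp: radial_region_def)
qed

lemma continuous_on_comp_uminus:
  assumes "continuous_on (sphere (0::real^2) 1) \<sigma>"
  shows "continuous_on (sphere 0 1) (\<sigma> \<circ> uminus)"
  unfolding o_def by (rule continuous_on_compose2[OF assms]) (auto intro!: continuous_intros)

lemma translate_mem: "y \<in> (\<lambda>y. y + a) ` S \<longleftrightarrow> y - a \<in> S" for a :: "'a :: ab_group_add"
  by (metis (no_types, lifting) add_diff_cancel diff_add_cancel image_iff)

lemma measure_uminus_image: "measure lebesgue (uminus ` S) = measure lebesgue (S :: (real ^ 2) set)"
  if "S \<in> lmeasurable"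
proof -
  have "orthogonal_transformation (uminus :: real ^ 2 \<Rightarrow> real ^ 2)"
    by (simp add: orthogonal_transformation_neg orthogonal_transformation_id)
  then show ?thesis using that by (rule measure_orthogonal_image)
qed

text \<open>The point reflection x -> u - x maps one intersection onto the other. A perturbation of
  the translated copy thereby becomes a perturbation of the copy at rest, at the price of composing
  radial functions with \<open>uminus\<close>.\<close>

lemma lens_swap:
  assumes \<sigma>: "continuous_on (sphere 0 1) \<sigma>" "\<And>v. v \<in> sphere 0 1 \<Longrightarrow> 0 \<le> \<sigma> v"
    and \<tau>: "continuous_on (sphere 0 1) \<tau>" "\<And>v. v \<in> sphere 0 1 \<Longrightarrow> 0 \<le> \<tau> v"
  shows "measure lebesgue (radial_region \<sigma> \<inter> (\<lambda>y. y + u) ` radial_region \<tau>)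
    = measure lebesgue (radial_region (\<tau> \<circ> uminus) \<inter> (\<lambda>y. y + u) ` radial_region (\<sigma> \<circ> uminus))"
proof -
  let ?A = "radial_region \<sigma> \<inter> (\<lambda>y. y + u) ` radial_region \<tau>"
  have c: "compact ?A"
    using compact_radial_region[of \<sigma>] compact_radial_region[of \<tau>] \<sigma> \<tau>
    by (intro compact_Int) (auto intro!: compact_continuous_image continuous_intros)
  have "radial_region (\<tau> \<circ> uminus) \<inter> (\<lambda>y. y + u) ` radial_region (\<sigma> \<circ> uminus) = (+) u ` (uminus ` ?A)"
  proof (rule set_eqI)
    fix x
    have "x \<in> radial_region (\<tau> \<circ> uminus) \<inter> (\<lambda>y. y + u) ` radial_region (\<sigma> \<circ> uminus)
      \<longleftrightarrow> - x \<in> radial_region \<tau> \<and> - (x - u) \<in> radial_region \<sigma>"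
      unfolding Int_iff translate_mem uminus_radial_region[symmetric]
      by (metis (no_types, lifting) image_iff minus_minus)
    also have "\<dots> \<longleftrightarrow> - (x - u) \<in> ?A" by (auto simp: translate_mem)
    also have "\<dots> \<longleftrightarrow> x \<in> (+) u ` (uminus ` ?A)"
    proof
      assume "- (x - u) \<in> ?A"
      then have "u + (- (- (x - u))) \<in> (+) u ` (uminus ` ?A)" by blast
      then show "x \<in> (+) u ` (uminus ` ?A)" by simp
    qed (auto simp: add.commute)
    finally show "x \<in> radial_region (\<tau> \<circ> uminus) \<inter> (\<lambda>y. y + u) ` radial_region (\<sigma> \<circ> uminus) \<longleftrightarrow> x \<in> (+) u ` (uminus ` ?A)" .
  qed
  then show ?thesis
    using measure_uminus_image[of ?A] lmeasurable_compact[OF c] by (simp add: measure_translation)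
qed

text \<open>Says that the boundary point in direction \<theta> lies in the copy shifted by
  \<open>cis2 0\<close>. The directions of \<open>on_shift\<close>, where the two boundaries meet,
  are the ones at which this can be unstable; they form the exceptional set of the first
  variation.\<close>

definition in_shift :: "(real ^ 2 \<Rightarrow> real) \<Rightarrow> real \<Rightarrow> bool" where
  "in_shift \<sigma> \<theta> \<longleftrightarrow> \<sigma> (cis2 \<theta>) *\<^sub>R cis2 \<theta> - cis2 0 \<in> radial_region \<sigma>"

definition on_shift :: "(real ^ 2 \<Rightarrow> real) \<Rightarrow> real \<Rightarrow> bool" where
  "on_shift \<sigma> \<theta> \<longleftrightarrow> (let z = \<sigma> (cis2 \<theta>) *\<^sub>R cis2 \<theta> - cis2 0 in z \<noteq> 0 \<and> norm z = \<sigma> (z /\<^sub>R norm z))"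

text \<open>The first variation of the area when the copy at rest moves: changing its radial
  function by \<psi> sweeps the area \<sigma> \<psi> d\<theta> along the part of its boundary inside
  the shifted copy.\<close>

definition shift_integral :: "(real ^ 2 \<Rightarrow> real) \<Rightarrow> (real ^ 2 \<Rightarrow> real) \<Rightarrow> real" where
  "shift_integral \<sigma> \<psi> = (LBINT \<theta>:{-pi..pi}. indicat_real {\<theta>. in_shift \<sigma> \<theta>} \<theta> * \<sigma> (cis2 \<theta>) * \<psi> (cis2 \<theta>))"

lemma in_shift_borel:
  assumes \<sigma>: "continuous_on (sphere 0 1) \<sigma>" "\<And>v. v \<in> sphere 0 1 \<Longrightarrow> 0 \<le> \<sigma> v"
  shows "{\<theta>. in_shift \<sigma> \<theta>} \<in> sets borel"
proof -
  have "closed ((\<lambda>\<theta>. \<sigma> (cis2 \<theta>) *\<^sub>R cis2 \<theta> - cis2 0) -` radial_region \<sigma>)"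
    using compact_imp_closed[OF compact_radial_region[of \<sigma>]] \<sigma>
    by (intro closed_vimage continuous_intros angle_continuous) auto
  then show ?thesis by (simp add: in_shift_def vimage_def borel_closed)
qed

lemma shift_integrable:
  assumes \<sigma>: "continuous_on (sphere 0 1) \<sigma>" "\<And>v. v \<in> sphere 0 1 \<Longrightarrow> 0 \<le> \<sigma> v"
    and \<psi>: "continuous_on (sphere 0 1) \<psi>"
  shows "set_integrable lborel {-pi..pi} (\<lambda>\<theta>. indicat_real {\<theta>. in_shift \<sigma> \<theta>} \<theta> * \<sigma> (cis2 \<theta>) * \<psi> (cis2 \<theta>))"
proof -
  have "set_integrable lborel {-pi..pi} (\<lambda>\<theta>. \<sigma> (cis2 \<theta>) * \<psi> (cis2 \<theta>))"
    by (intro borel_integrable_atLeastAtMost' continuous_intros angle_continuous \<sigma> \<psi>)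
  moreover have "set_borel_measurable lborel {-pi..pi} (\<lambda>\<theta>. indicat_real {\<theta>. in_shift \<sigma> \<theta>} \<theta> * \<sigma> (cis2 \<theta>) * \<psi> (cis2 \<theta>))"
    unfolding set_borel_measurable_def
    using in_shift_borel[of \<sigma>] \<sigma> angle_measurable[OF \<sigma>(1)] angle_measurable[OF \<psi>]
    by (intro borel_measurable_scaleR borel_measurable_times) auto
  ultimately show ?thesis
    by (rule set_integrable_bound) (auto simp: indicator_def)
qed

text \<open>Only the copy at rest is perturbed to first order, while the shifted one follows an
  arbitrary sequence with the same limit. This freedom lets the two copies be changed one after the
  other.\<close>

lemma half_variation:
  fixes \<sigma> :: "nat \<Rightarrow> real ^ 2 \<Rightarrow> real" and \<mu> :: "nat \<Rightarrow> real ^ 2 \<Rightarrow> real"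
  assumes \<sigma>: "\<And>n. continuous_on (sphere 0 1) (\<sigma> n)" "\<And>n v. v \<in> sphere 0 1 \<Longrightarrow> 0 \<le> \<sigma> n v"
    and \<tau>: "continuous_on (sphere 0 1) \<tau>" "\<And>v. v \<in> sphere 0 1 \<Longrightarrow> 0 < \<tau> v"
    and \<mu>: "\<And>n. continuous_on (sphere 0 1) (\<mu> n)" "\<And>n v. v \<in> sphere 0 1 \<Longrightarrow> 0 \<le> \<mu> n v"
    and d: "\<And>n v. v \<in> sphere 0 1 \<Longrightarrow> \<bar>\<sigma> n v - \<tau> v\<bar> \<le> d n" "\<And>n v. v \<in> sphere 0 1 \<Longrightarrow> \<bar>\<mu> n v - \<tau> v\<bar> \<le> d n"
      "\<And>n. 0 < d n" "d \<longlonglongrightarrow> 0"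
    and Z: "finite {\<theta> \<in> {-pi..pi}. on_shift \<tau> \<theta>}"
  shows "(\<lambda>n. (measure lebesgue (radial_region (\<sigma> n) \<inter> (\<lambda>y. y + cis2 0) ` radial_region (\<mu> n))
     - measure lebesgue (radial_region \<tau> \<inter> (\<lambda>y. y + cis2 0) ` radial_region (\<mu> n))
      - shift_integral \<tau> (\<lambda>v. \<sigma> n v - \<tau> v)) / d n) \<longlonglongrightarrow> 0"
  unfolding shift_integral_def
proof (rule measure_radial_inter_variation[OF \<sigma> \<tau>(1) _ d(1) d(3,4) _ _ _ Z])
  have t0: "\<And>v. v \<in> sphere 0 1 \<Longrightarrow> 0 \<le> \<tau> v" using \<tau>(2) by (simp add: less_imp_le)
  show "\<And>v. v \<in> sphere 0 1 \<Longrightarrow> 0 \<le> \<tau> v" by (rule t0)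
  show "(\<lambda>y. y + cis2 0) ` radial_region (\<mu> n) \<in> sets borel" for n
    using compact_translation[OF compact_radial_region[of "\<mu> n"], of "cis2 0"] \<mu>
    by (auto simp: add.commute intro: borel_compact)
  show "indicat_real {\<theta>. in_shift \<tau> \<theta>} \<in> borel_measurable borel"
    using in_shift_borel[of \<tau>] \<tau>(1) t0 by simp
  show "\<bar>indicat_real {\<theta>. in_shift \<tau> \<theta>} \<theta>\<bar> \<le> 1" for \<theta> by (simp add: indicator_def)
  fix \<theta> assume \<theta>: "\<theta> \<in> {-pi..pi} - {\<theta> \<in> {-pi..pi}. on_shift \<tau> \<theta>}"
  define z where "z = \<tau> (cis2 \<theta>) *\<^sub>R cis2 \<theta> - cis2 0"
  have "z = 0 \<or> norm z \<noteq> \<tau> (z /\<^sub>R norm z)" using \<theta> by (auto simp: on_shift_def z_def Let_def)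
  then obtain \<kappa> where \<kappa>: "0 < \<kappa>"
    "\<And>\<sigma> y. (\<And>v. v \<in> sphere 0 1 \<Longrightarrow> \<bar>\<sigma> v - \<tau> v\<bar> < \<kappa>) \<Longrightarrow> norm (y - z) < \<kappa> \<Longrightarrow> y \<in> radial_region \<sigma> \<longleftrightarrow> z \<in> radial_region \<tau>"
    using radial_region_locally_stable[OF \<tau>(1)] \<tau>(2) by blast
  have "\<forall>\<^sub>F n in sequentially. d n < \<kappa>" using d(4) \<kappa>(1) by (rule order_tendstoD)
  then have "\<forall>\<^sub>F n in sequentially. \<forall>r. \<bar>r - \<tau> (cis2 \<theta>)\<bar> < \<kappa> \<longrightarrow>
    indicat_real ((\<lambda>y. y + cis2 0) ` radial_region (\<mu> n)) (r *\<^sub>R cis2 \<theta>) = indicat_real {\<theta>. in_shift \<tau> \<theta>} \<theta>"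
  proof eventually_elim
    case (elim n)
    show ?case
    proof (intro allI impI)
      fix r assume r: "\<bar>r - \<tau> (cis2 \<theta>)\<bar> < \<kappa>"
      have "r *\<^sub>R cis2 \<theta> - cis2 0 - z = (r - \<tau> (cis2 \<theta>)) *\<^sub>R cis2 \<theta>" by (simp add: z_def algebra_simps)
      then have "norm (r *\<^sub>R cis2 \<theta> - cis2 0 - z) < \<kappa>" using r by simp
      moreover have "\<bar>\<mu> n v - \<tau> v\<bar> < \<kappa>" if "v \<in> sphere 0 1" for v using d(2)[OF that, of n] elim by simp
      ultimately have "r *\<^sub>R cis2 \<theta> - cis2 0 \<in> radial_region (\<mu> n) \<longleftrightarrow> z \<in> radial_region \<tau>"
        by (intro \<kappa>(2)) auto
      then show "indicat_real ((\<lambda>y. y + cis2 0) ` radial_region (\<mu> n)) (r *\<^sub>R cis2 \<theta>) = indicat_real {\<theta>. in_shift \<tau> \<theta>} \<theta>"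
        by (simp add: indicator_def translate_mem in_shift_def z_def)
    qed
  qed
  then show "\<exists>\<kappa>>0. \<forall>\<^sub>F n in sequentially. \<forall>r. \<bar>r - \<tau> (cis2 \<theta>)\<bar> < \<kappa> \<longrightarrow>
    indicat_real ((\<lambda>y. y + cis2 0) ` radial_region (\<mu> n)) (r *\<^sub>R cis2 \<theta>) = indicat_real {\<theta>. in_shift \<tau> \<theta>} \<theta>"
    using \<kappa>(1) by blast
qed

text \<open>Telescoping through the mixed intersection of the old copy at rest with the new shifted
  copy. After \<open>lens_swap\<close> the second difference is another instance of
  \<open>half_variation\<close>, with the shifted copy constant.\<close>

lemma lens_area_variation:
  fixes \<sigma> :: "nat \<Rightarrow> real ^ 2 \<Rightarrow> real"
  assumes \<sigma>: "\<And>n. continuous_on (sphere 0 1) (\<sigma> n)" "\<And>n v. v \<in> sphere 0 1 \<Longrightarrow> 0 \<le> \<sigma> n v"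
    and \<tau>: "continuous_on (sphere 0 1) \<tau>" "\<And>v. v \<in> sphere 0 1 \<Longrightarrow> 0 < \<tau> v"
    and d: "\<And>n v. v \<in> sphere 0 1 \<Longrightarrow> \<bar>\<sigma> n v - \<tau> v\<bar> \<le> d n" "\<And>n. 0 < d n" "d \<longlonglongrightarrow> 0"
    and Z: "finite {\<theta> \<in> {-pi..pi}. on_shift \<tau> \<theta>}" "finite {\<theta> \<in> {-pi..pi}. on_shift (\<tau> \<circ> uminus) \<theta>}"
  shows "(\<lambda>n. (lens_area (\<sigma> n) - lens_area \<tau> - shift_integral \<tau> (\<lambda>v. \<sigma> n v - \<tau> v)
     - shift_integral (\<tau> \<circ> uminus) (\<lambda>v. \<sigma> n (-v) - \<tau> (-v))) / d n) \<longlonglongrightarrow> 0"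
proof -
  have t0: "\<And>v. v \<in> sphere 0 1 \<Longrightarrow> 0 \<le> \<tau> v" using \<tau>(2) by (simp add: less_imp_le)
  let ?X = "\<lambda>\<sigma> \<mu>. measure lebesgue (radial_region \<sigma> \<inter> (\<lambda>y. y + cis2 0) ` radial_region \<mu>)"
  have 1: "(\<lambda>n. (?X (\<sigma> n) (\<sigma> n) - ?X \<tau> (\<sigma> n) - shift_integral \<tau> (\<lambda>v. \<sigma> n v - \<tau> v)) / d n) \<longlonglongrightarrow> 0"
    by (rule half_variation[OF \<sigma> \<tau> \<sigma> d(1,1,2,3) Z(1)])
  have 2: "(\<lambda>n. (?X (\<sigma> n \<circ> uminus) (\<tau> \<circ> uminus) - ?X (\<tau> \<circ> uminus) (\<tau> \<circ> uminus)
      - shift_integral (\<tau> \<circ> uminus) (\<lambda>v. (\<sigma> n \<circ> uminus) v - (\<tau> \<circ> uminus) v)) / d n) \<longlonglongrightarrow> 0"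
    using \<sigma> \<tau> d Z(2) t0
    by (intro half_variation continuous_on_comp_uminus) (auto simp: less_imp_le)
  have 3: "?X (\<sigma> n \<circ> uminus) (\<tau> \<circ> uminus) = ?X \<tau> (\<sigma> n)" for n
    using \<sigma> \<tau>(1) t0 by (intro lens_swap[symmetric]) auto
  have 4: "?X (\<tau> \<circ> uminus) (\<tau> \<circ> uminus) = ?X \<tau> \<tau>"
    using \<tau>(1) t0 by (intro lens_swap[symmetric]) auto
  show ?thesis
    using tendsto_add[OF 1 2] unfolding 3 4 add_divide_distrib[symmetric] lens_area_def
    by (simp add: algebra_simps)
qed

text \<open>The family contains what rescaling produces, with parameters 1 / s and t / s, and the
  result is a total derivative in both. It is tested along sequences because the variation formula
  is sequential.\<close>

lemma lens_area_has_derivative: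
  assumes p: "continuous_on (sphere 0 1) p"
    and pos: "\<And>v. v \<in> sphere 0 1 \<Longrightarrow> 0 < l + m * p v"
    and Z: "finite {\<theta> \<in> {-pi..pi}. on_shift (\<lambda>v. l + m * p v) \<theta>}"
      "finite {\<theta> \<in> {-pi..pi}. on_shift (\<lambda>v. l + m * p (-v)) \<theta>}"
  shows "((\<lambda>(a, b). lens_area (\<lambda>v. a + b * p v)) has_derivative
     (\<lambda>(a, b). a * (shift_integral (\<lambda>v. l + m * p v) (\<lambda>_. 1) + shift_integral (\<lambda>v. l + m * p (-v)) (\<lambda>_. 1))
       + b * (shift_integral (\<lambda>v. l + m * p v) p + shift_integral (\<lambda>v. l + m * p (-v)) (\<lambda>v. p (-v))))) (at (l, m))"
    (is "(?f has_derivative ?D) _")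
proof -
  let ?\<tau> = "\<lambda>v. l + m * p v"
  obtain P where P: "0 < P" "\<And>v. v \<in> sphere 0 1 \<Longrightarrow> \<bar>p v\<bar> \<le> P" using sphere_bound[OF p] by blast
  obtain k where k: "0 < k" "\<And>v. v \<in> sphere 0 1 \<Longrightarrow> k \<le> l + m * p v"
    using sphere_pos_bound[of ?\<tau>, OF continuous_on_add[OF continuous_on_const continuous_on_mult_left[OF p]]] pos by blast
  have pm: "continuous_on (sphere 0 1) (\<lambda>v. p (-v))" using continuous_on_comp_uminus[OF p] by (simp add: o_def)
  have bl: "bounded_linear ?D"
    by (auto simp: case_prod_beta' intro!: bounded_linear_add bounded_linear_mult_const bounded_linear_fst bounded_linear_snd)
  have cc: "continuous_on (sphere 0 1) (\<lambda>v. a + b * p v)" for a b by (intro continuous_intros p)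
  have cm: "continuous_on (sphere 0 1) (\<lambda>v. a + b * p (-v))" for a b by (intro continuous_intros pm)
  have "((\<lambda>y. norm (?f y - ?f (l, m) - ?D (y - (l, m))) / norm (y - (l, m))) \<longlongrightarrow> 0) (at (l, m))"
    unfolding tendsto_at_iff_sequentially
  proof (intro allI impI)
    fix X :: "nat \<Rightarrow> real \<times> real"
    assume X: "\<forall>i. X i \<in> UNIV - {(l, m)}" "X \<longlonglongrightarrow> (l, m)"
    \<comment> \<open>As |p| is at most \<open>P\<close>, this bounds the uniform distance between
      the two radial functions.\<close>
    define d where "d n = (1 + P) * norm (X n - (l, m))" for n
    have dX: "d \<longlonglongrightarrow> 0"
      unfolding d_def using X(2) by (auto intro!: tendsto_mult_right_zero tendsto_norm_zero simp: LIM_zero_iff)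
    have dp: "0 < d n" for n using X(1) P(1) by (auto simp: d_def)
    have diff: "\<bar>(fst (X n) + snd (X n) * p v) - (l + m * p v)\<bar> \<le> d n" if "v \<in> sphere 0 1" for n v
    proof -
      have le: "\<bar>fst (X n - (l, m))\<bar> \<le> norm (X n - (l, m))" "\<bar>snd (X n - (l, m))\<bar> \<le> norm (X n - (l, m))"
        using norm_fst_le[of "fst (X n - (l, m))" "snd (X n - (l, m))"] norm_snd_le[of "snd (X n - (l, m))" "fst (X n - (l, m))"]
        unfolding prod.collapse by auto
      have "\<bar>(fst (X n) + snd (X n) * p v) - (l + m * p v)\<bar> = \<bar>fst (X n - (l, m)) + snd (X n - (l, m)) * p v\<bar>"
        by (simp add: algebra_simps)
      also have "\<dots> \<le> \<bar>fst (X n - (l, m))\<bar> + \<bar>snd (X n - (l, m))\<bar> * \<bar>p v\<bar>"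
        by (metis abs_mult abs_triangle_ineq)
      also have "\<dots> \<le> norm (X n - (l, m)) + norm (X n - (l, m)) * P"
        using P that le by (intro add_mono mult_mono) auto
      finally show ?thesis by (simp add: d_def algebra_simps)
    qed
    have "\<forall>\<^sub>F n in sequentially. d n < k" using dX k(1) by (rule order_tendstoD)
    \<comment> \<open>The first \<open>N\<close> terms are dropped so that all radial functions are
      nonnegative.\<close>
    then obtain N where N: "\<And>n. n \<ge> N \<Longrightarrow> d n < k" by (auto simp: eventually_sequentially)
    define \<sigma> where "\<sigma> n v = fst (X (n + N)) + snd (X (n + N)) * p v" for n v
    have "(\<lambda>n. (lens_area (\<sigma> n) - lens_area ?\<tau> - shift_integral ?\<tau> (\<lambda>v. \<sigma> n v - ?\<tau> v)
     - shift_integral (?\<tau> \<circ> uminus) (\<lambda>v. \<sigma> n (-v) - ?\<tau> (-v))) / d (n + N)) \<longlonglongrightarrow> 0"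
    proof (rule lens_area_variation)
      show "continuous_on (sphere 0 1) (\<sigma> n)" for n unfolding \<sigma>_def by (rule cc)
      show "0 \<le> \<sigma> n v" if "v \<in> sphere 0 1" for n v
        using diff[OF that, of "n + N"] k(2)[OF that] N[of "n + N"] by (auto simp: \<sigma>_def)
      show "\<bar>\<sigma> n v - (l + m * p v)\<bar> \<le> d (n + N)" if "v \<in> sphere 0 1" for n v
        using diff[OF that, of "n + N"] by (simp add: \<sigma>_def)
      show "(\<lambda>n. d (n + N)) \<longlonglongrightarrow> 0" using dX by (rule LIMSEQ_ignore_initial_segment)
    qed (use pos dp Z cc in \<open>auto simp: o_def\<close>)
    moreover have "shift_integral ?\<tau> (\<lambda>v. \<sigma> n v - ?\<tau> v) + shift_integral (?\<tau> \<circ> uminus) (\<lambda>v. \<sigma> n (-v) - ?\<tau> (-v)) = ?D (X (n + N) - (l, m))" for n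
    proof -
      have lin: "shift_integral s (\<lambda>v. a * 1 + b * q v) = a * shift_integral s (\<lambda>_. 1) + b * shift_integral s q"
        if "continuous_on (sphere 0 1) s" "\<And>v. v \<in> sphere 0 1 \<Longrightarrow> 0 \<le> s v" "continuous_on (sphere 0 1) q" for s q a b
      proof -
        have "set_integrable lborel {-pi..pi} (\<lambda>\<theta>. indicat_real {\<theta>. in_shift s \<theta>} \<theta> * s (cis2 \<theta>) * (\<lambda>_. 1) (cis2 \<theta>))"
           "set_integrable lborel {-pi..pi} (\<lambda>\<theta>. indicat_real {\<theta>. in_shift s \<theta>} \<theta> * s (cis2 \<theta>) * q (cis2 \<theta>))"
          using that by (intro shift_integrable continuous_on_const; simp)+
        note i = set_integrable_mult_right[OF this(1), of a] set_integrable_mult_right[OF this(2), of b]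
        have "shift_integral s (\<lambda>v. a * 1 + b * q v) = (LBINT \<theta>:{-pi..pi}. a * (indicat_real {\<theta>. in_shift s \<theta>} \<theta> * s (cis2 \<theta>) * 1) + b * (indicat_real {\<theta>. in_shift s \<theta>} \<theta> * s (cis2 \<theta>) * q (cis2 \<theta>)))"
          unfolding shift_integral_def by (simp add: algebra_simps)
        also have "\<dots> = a * shift_integral s (\<lambda>_. 1) + b * shift_integral s q"
          unfolding shift_integral_def using i by (subst set_integral_add) (auto simp del: mult_1_right)
        finally show ?thesis .
      qed
      define a b where ab: "a = fst (X (n + N)) - l" "b = snd (X (n + N)) - m"
      have e: "(\<lambda>v. \<sigma> n v - ?\<tau> v) = (\<lambda>v. a * 1 + b * p v)" "(\<lambda>v. \<sigma> n (-v) - ?\<tau> (-v)) = (\<lambda>v. a * 1 + b * p (-v))"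
        by (auto simp: \<sigma>_def ab algebra_simps)
      have "0 \<le> l + m * p (- v)" if "v \<in> sphere 0 1" for v using pos[of "- v"] that by simp
      moreover have "X (n + N) - (l, m) = (a, b)" by (simp add: ab prod_eq_iff)
      ultimately show ?thesis unfolding e o_def
        using pos by (subst (1 2) lin) (auto simp: less_imp_le cc cm p pm algebra_simps)
    qed
    ultimately have "(\<lambda>n. (lens_area (\<sigma> n) - lens_area ?\<tau> - ?D (X (n + N) - (l, m))) / d (n + N)) \<longlonglongrightarrow> 0"
      by (simp only: diff_diff_eq add.assoc)
    then have "(\<lambda>n. (1 + P) * \<bar>(lens_area (\<sigma> n) - lens_area ?\<tau> - ?D (X (n + N) - (l, m))) / d (n + N)\<bar>) \<longlonglongrightarrow> 0"
      by (intro tendsto_mult_right_zero tendsto_rabs_zero)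
    moreover have "(1 + P) * \<bar>(lens_area (\<sigma> n) - lens_area ?\<tau> - ?D (X (n + N) - (l, m))) / d (n + N)\<bar>
      = norm (?f (X (n + N)) - ?f (l, m) - ?D (X (n + N) - (l, m))) / norm (X (n + N) - (l, m))" for n
    proof -
      have "?f (X (n + N)) = lens_area (\<sigma> n)" by (simp add: \<sigma>_def[abs_def] case_prod_beta')
      then show ?thesis using P(1) by (simp add: d_def abs_mult)
    qed
    ultimately have "(\<lambda>n. norm (?f (X (n + N)) - ?f (l, m) - ?D (X (n + N) - (l, m))) / norm (X (n + N) - (l, m))) \<longlonglongrightarrow> 0"
      by simp
    then show "((\<lambda>y. norm (?f y - ?f (l, m) - ?D (y - (l, m))) / norm (y - (l, m))) \<circ> X) \<longlonglongrightarrow> 0"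
      unfolding o_def by (rule LIMSEQ_offset)
  qed
  with bl show ?thesis
    by (simp add: has_derivative_iff_norm)
qed

section \<open>End points of the boundary arcs\<close>

text \<open>Continuity of \<open>g\<close> is assumed, so differentiability of \<open>F\<close> at
  the single point suffices. Its expansion gives A h + K b = o(|h| + |b|) for the increments h and
  b, used first to get b = O(h) and then to get the limit of b / h.\<close>

lemma implicit_has_real_derivative:
  fixes F :: "real \<times> real \<Rightarrow> real"
  assumes F: "(F has_derivative (\<lambda>(a, b). A * a + K * b)) (at (t0, g t0))"
    and K: "K \<noteq> 0" and g: "isCont g t0" and eq: "\<forall>\<^sub>F t in nhds t0. F (t, g t) = F (t0, g t0)"
  shows "(g has_real_derivative - A / K) (at t0)"
proof -
  have "(\<lambda>h. (g (t0 + h) - g t0) / h - (- A / K)) \<midarrow>0\<rightarrow> 0"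
  proof (rule LIM_I)
    fix r :: real assume r: "0 < r"
    \<comment> \<open>With an error rate of at most |K| / 2, the bound |K| |b| <= (|K| / 2) (|h| +
      |b|) + |A| |h| gives |b| <= C |h|. The second entry in \<open>e\<close> then brings the final
      quotient down to r / 2.\<close>
    define C where "C = 2 * (\<bar>A\<bar> + \<bar>K\<bar>) / \<bar>K\<bar>"
    define e where "e = min (\<bar>K\<bar> / 2) (r * \<bar>K\<bar> / (2 * (1 + C)))"
    have C0: "0 \<le> C" by (simp add: C_def)
    have e: "0 < e" "e \<le> \<bar>K\<bar> / 2" "e \<le> r * \<bar>K\<bar> / (2 * (1 + C))"
      using K r C0 unfolding e_def by (simp, intro min.cobounded1, intro min.cobounded2)
    obtain d where d: "0 < d" "\<And>y. norm (y - (t0, g t0)) < d \<Longrightarrow>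
        norm (F y - F (t0, g t0) - (\<lambda>(a, b). A * a + K * b) (y - (t0, g t0))) \<le> e * norm (y - (t0, g t0))"
      using F e(1) unfolding has_derivative_at_alt by blast
    have "\<forall>\<^sub>F t in nhds t0. \<bar>g t - g t0\<bar> < d / 2"
      using g d(1) unfolding continuous_at_eps_delta eventually_nhds_metric dist_real_def by (metis half_gt_zero)
    moreover have "\<forall>\<^sub>F t in nhds t0. \<bar>t - t0\<bar> < d / 2"
      unfolding eventually_nhds_metric dist_real_def using d(1) by (intro exI[of _ "d/2"]) auto
    ultimately have "\<forall>\<^sub>F t in nhds t0. \<bar>g t - g t0\<bar> < d / 2 \<and> \<bar>t - t0\<bar> < d / 2 \<and> F (t, g t) = F (t0, g t0)"
      using eq by eventually_elim auto
    then obtain k where k: "0 < k" "\<And>t. \<bar>t - t0\<bar> < k \<Longrightarrow> \<bar>g t - g t0\<bar> < d / 2 \<and> \<bar>t - t0\<bar> < d / 2 \<and> F (t, g t) = F (t0, g t0)"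
      unfolding eventually_nhds_metric dist_real_def by blast
    show "\<exists>s>0. \<forall>x. x \<noteq> 0 \<and> norm (x - 0) < s \<longrightarrow> norm ((g (t0 + x) - g t0) / x - - A / K - 0) < r"
    proof (intro exI[of _ k] conjI k(1) allI impI)
      fix h :: real assume h: "h \<noteq> 0 \<and> norm (h - 0) < k"
      define b where "b = g (t0 + h) - g t0"
      have kk: "\<bar>b\<bar> < d / 2" "\<bar>h\<bar> < d / 2" "F (t0 + h, g (t0 + h)) = F (t0, g t0)"
        using k(2)[of "t0 + h"] h by (auto simp: b_def)
      have nb: "norm (h, b) \<le> \<bar>h\<bar> + \<bar>b\<bar>" using norm_Pair_le[of h b] by simp
      have df: "(t0 + h, g (t0 + h)) - (t0, g t0) = (h, b)" by (simp add: b_def)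
      have "norm ((h, b)) < d" using nb kk by linarith
      then have "\<bar>A * h + K * b\<bar> \<le> e * norm (h, b)"
        using d(2)[of "(t0 + h, g (t0 + h))"] kk unfolding df by (simp add: abs_minus_commute)
      also have "\<dots> \<le> e * (\<bar>h\<bar> + \<bar>b\<bar>)" using nb e by (intro mult_left_mono) auto
      finally have le: "\<bar>A * h + K * b\<bar> \<le> e * (\<bar>h\<bar> + \<bar>b\<bar>)" .
      have "\<bar>K\<bar> * \<bar>b\<bar> \<le> \<bar>A * h + K * b\<bar> + \<bar>A\<bar> * \<bar>h\<bar>"
        unfolding abs_mult[symmetric] by linarith
      also have "\<dots> \<le> \<bar>K\<bar> / 2 * (\<bar>h\<bar> + \<bar>b\<bar>) + \<bar>A\<bar> * \<bar>h\<bar>"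
      proof -
        have "e * (\<bar>h\<bar> + \<bar>b\<bar>) \<le> \<bar>K\<bar> / 2 * (\<bar>h\<bar> + \<bar>b\<bar>)" by (rule mult_right_mono[OF e(2)]) linarith
        then show ?thesis using le by linarith
      qed
      finally have "\<bar>K\<bar> * \<bar>b\<bar> \<le> 2 * (\<bar>A\<bar> + \<bar>K\<bar>) * \<bar>h\<bar>"
        using mult_nonneg_nonneg[OF abs_ge_zero[of K] abs_ge_zero[of h]]
        unfolding distrib_left distrib_right times_divide_eq_left mult.assoc by linarith
      then have bC: "\<bar>b\<bar> \<le> C * \<bar>h\<bar>" using K by (simp add: C_def field_simps)
      have "(g (t0 + h) - g t0) / h - - A / K = (A * h + K * b) / (K * h)"
        using K h by (simp add: b_def field_simps)
      then have "\<bar>(g (t0 + h) - g t0) / h - - A / K\<bar> = \<bar>A * h + K * b\<bar> / (\<bar>K\<bar> * \<bar>h\<bar>)"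
        by (simp add: abs_divide abs_mult)
      also have "\<dots> \<le> e * ((1 + C) * \<bar>h\<bar>) / (\<bar>K\<bar> * \<bar>h\<bar>)"
        using le bC e by (intro divide_right_mono order_trans[OF le] mult_left_mono) (auto simp: algebra_simps)
      also have "\<dots> = e * (1 + C) / \<bar>K\<bar>" using h by simp
      also have "\<dots> \<le> r * \<bar>K\<bar> / (2 * (1 + C)) * (1 + C) / \<bar>K\<bar>"
        using e C0 by (intro divide_right_mono mult_right_mono) auto
      also have "\<dots> = r / 2"
      proof -
        have "r * k / (2 * q) * q / k = r / 2" if "q \<noteq> 0" "k \<noteq> 0" for q k :: real using that by (simp add: field_simps)
        moreover have "1 + C \<noteq> 0" "\<bar>K\<bar> \<noteq> 0" using C0 K by auto
        ultimately show ?thesis by blast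
      qed
      also have "\<dots> < r" using r by simp
      finally show "norm ((g (t0 + h) - g t0) / h - - A / K - 0) < r" by simp
    qed
  qed
  then show ?thesis unfolding DERIV_def by (rule LIM_zero_cancel)
qed

definition wy1 :: "(real \<Rightarrow> real) \<Rightarrow> real \<Rightarrow> real \<Rightarrow> real \<Rightarrow> real \<Rightarrow> real" where
  "wy1 f t s \<phi> \<beta> = (1 + t * f (\<phi> + \<beta>)) * cos \<beta> - s"

definition wy2 :: "(real \<Rightarrow> real) \<Rightarrow> real \<Rightarrow> real \<Rightarrow> real \<Rightarrow> real \<Rightarrow> real" where
  "wy2 f t s \<phi> \<beta> = (1 + t * f (\<phi> + \<beta>)) * sin \<beta>"

definition wn :: "(real \<Rightarrow> real) \<Rightarrow> real \<Rightarrow> real \<Rightarrow> real \<Rightarrow> real \<Rightarrow> real" where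
  "wn f t s \<phi> \<beta> = sqrt ((wy1 f t s \<phi> \<beta>)\<^sup>2 + (wy2 f t s \<phi> \<beta>)\<^sup>2)"

text \<open>The polar angle in (0, pi) written as an arc cotangent: a single smooth branch on the
  open upper half plane, including the points with \<open>wy1\<close> equal to 0.\<close>

definition wang :: "(real \<Rightarrow> real) \<Rightarrow> real \<Rightarrow> real \<Rightarrow> real \<Rightarrow> real \<Rightarrow> real" where
  "wang f t s \<phi> \<beta> = pi / 2 - arctan (wy1 f t s \<phi> \<beta> / wy2 f t s \<phi> \<beta>)"

text \<open>In coordinates rotated by \<open>-\<phi>\<close>, the boundary point at angle \<open>\<phi> + \<beta>\<close> shifted by \<open>-s\<close>
  has polar coordinates \<open>wn\<close>, \<open>wang\<close> as long as it lies in the upper half plane;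
  it belongs to the perturbed disc iff \<open>wgap \<le> 0\<close>.\<close>

definition wgap :: "(real \<Rightarrow> real) \<Rightarrow> real \<Rightarrow> real \<Rightarrow> real \<Rightarrow> real \<Rightarrow> real" where
  "wgap f t s \<phi> \<beta> = wn f t s \<phi> \<beta> - 1 - t * f (\<phi> + wang f t s \<phi> \<beta>)"

text \<open>The rate of change of \<open>wgap\<close> when the shifted point moves with velocity (a,
  b) and the explicit \<open>t\<close> is held fixed. The three partial derivatives that follow
  insert the velocities belonging to \<open>t\<close>, \<open>s\<close> and \<open>\<beta>\<close>;
  the one in \<open>t\<close> also has the explicit term.\<close>

definition wpart :: "(real \<Rightarrow> real) \<Rightarrow> (real \<Rightarrow> real) \<Rightarrow> real \<Rightarrow> real \<Rightarrow> real \<Rightarrow> real \<Rightarrow> real \<Rightarrow> real \<Rightarrow> real" where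
  "wpart f f' t s \<phi> \<beta> a b =
     (wy1 f t s \<phi> \<beta> * a + wy2 f t s \<phi> \<beta> * b) / wn f t s \<phi> \<beta>
     + t * f' (\<phi> + wang f t s \<phi> \<beta>) * (a * wy2 f t s \<phi> \<beta> - b * wy1 f t s \<phi> \<beta>) / (wn f t s \<phi> \<beta>)\<^sup>2"

definition wgap_t :: "(real \<Rightarrow> real) \<Rightarrow> (real \<Rightarrow> real) \<Rightarrow> real \<Rightarrow> real \<Rightarrow> real \<Rightarrow> real \<Rightarrow> real" where
  "wgap_t f f' t s \<phi> \<beta> = wpart f f' t s \<phi> \<beta> (f (\<phi> + \<beta>) * cos \<beta>) (f (\<phi> + \<beta>) * sin \<beta>) - f (\<phi> + wang f t s \<phi> \<beta>)"

definition wgap_s :: "(real \<Rightarrow> real) \<Rightarrow> (real \<Rightarrow> real) \<Rightarrow> real \<Rightarrow> real \<Rightarrow> real \<Rightarrow> real \<Rightarrow> real" where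
  "wgap_s f f' t s \<phi> \<beta> = wpart f f' t s \<phi> \<beta> (-1) 0"

definition wgap_b :: "(real \<Rightarrow> real) \<Rightarrow> (real \<Rightarrow> real) \<Rightarrow> real \<Rightarrow> real \<Rightarrow> real \<Rightarrow> real \<Rightarrow> real" where
  "wgap_b f f' t s \<phi> \<beta> = wpart f f' t s \<phi> \<beta>
     (t * f' (\<phi> + \<beta>) * cos \<beta> - (1 + t * f (\<phi> + \<beta>)) * sin \<beta>)
     (t * f' (\<phi> + \<beta>) * sin \<beta> + (1 + t * f (\<phi> + \<beta>)) * cos \<beta>)"

text \<open>The direction, relative to \<phi>, in which the boundary crosses that of the translate
  in the upper half plane. Uniqueness of the root is supplied by
  \<open>root_structure\<close>.\<close>

definition hit :: "(real \<Rightarrow> real) \<Rightarrow> real \<Rightarrow> real \<Rightarrow> real \<Rightarrow> real" where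
  "hit f t s \<phi> = (THE \<beta>. 0 < \<beta> \<and> \<beta> < pi \<and> wgap f t s \<phi> \<beta> = 0)"

lemma wn_pos: "0 < wy2 f t s \<phi> \<beta> \<Longrightarrow> 0 < wn f t s \<phi> \<beta>"
  by (simp add: wn_def add_nonneg_pos)

lemma wgap_chain:
  assumes der: "\<And>x. (f has_real_derivative f' x) (at x)"
    and y1: "(Y1 has_derivative Y1') (at x)" and y2: "(Y2 has_derivative Y2') (at x)" and pos: "0 < Y2 x"
    and T: "(T has_derivative T') (at x)"
  shows "((\<lambda>x. sqrt ((Y1 x)\<^sup>2 + (Y2 x)\<^sup>2) - 1 - T x * f (\<phi> + (pi / 2 - arctan (Y1 x / Y2 x)))) has_derivative
     (\<lambda>h. (Y1 x * Y1' h + Y2 x * Y2' h) / sqrt ((Y1 x)\<^sup>2 + (Y2 x)\<^sup>2)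
       + T x * f' (\<phi> + (pi / 2 - arctan (Y1 x / Y2 x))) * (Y1' h * Y2 x - Y2' h * Y1 x) / (sqrt ((Y1 x)\<^sup>2 + (Y2 x)\<^sup>2))\<^sup>2
       - T' h * f (\<phi> + (pi / 2 - arctan (Y1 x / Y2 x))))) (at x)"
proof -
  have n: "0 < (Y1 x)\<^sup>2 + (Y2 x)\<^sup>2" using pos by (simp add: add_nonneg_pos)
  have q: "((\<lambda>x. Y1 x / Y2 x) has_derivative (\<lambda>h. (Y1' h * Y2 x - Y1 x * Y2' h) / (Y2 x * Y2 x))) (at x)"
    using has_derivative_divide'[OF y1 y2] pos by simp
  note a = DERIV_compose_FDERIV[OF DERIV_arctan q]
  have b: "((\<lambda>x. \<phi> + (pi / 2 - arctan (Y1 x / Y2 x))) has_derivative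
      (\<lambda>h. - ((Y1' h * Y2 x - Y1 x * Y2' h) / (Y2 x * Y2 x) * inverse (1 + (Y1 x / Y2 x)\<^sup>2)))) (at x)"
    by (rule derivative_eq_intros a refl)+ simp
  have d: "((\<lambda>x. sqrt ((Y1 x)\<^sup>2 + (Y2 x)\<^sup>2)) has_derivative (\<lambda>h. (Y1 x * Y1' h + Y2 x * Y2' h) / sqrt ((Y1 x)\<^sup>2 + (Y2 x)\<^sup>2))) (at x)"
  proof -
    have S: "((\<lambda>x. (Y1 x)\<^sup>2 + (Y2 x)\<^sup>2) has_derivative (\<lambda>h. 2 * (Y1 x * Y1' h + Y2 x * Y2' h))) (at x)"
      by (rule derivative_eq_intros y1 y2 refl)+ (simp add: fun_eq_iff algebra_simps)
    have "2 * a * (inverse r / 2) = a / r" for a r :: real by (simp add: field_simps)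
    then show ?thesis using DERIV_compose_FDERIV[OF DERIV_real_sqrt[OF n] S] by (simp only:)
  qed
  have e: "(Y1' h * Y2 x - Y1 x * Y2' h) / (Y2 x * Y2 x) * inverse (1 + (Y1 x / Y2 x)\<^sup>2)
     = (Y1' h * Y2 x - Y2' h * Y1 x) / (sqrt ((Y1 x)\<^sup>2 + (Y2 x)\<^sup>2))\<^sup>2" for h
  proof -
    have "1 + (Y1 x / Y2 x)\<^sup>2 = ((Y1 x)\<^sup>2 + (Y2 x)\<^sup>2) / (Y2 x * Y2 x)"
      using pos by (simp add: field_simps power2_eq_square)
    then show ?thesis using n pos by (simp add: mult.commute)
  qed
  note c = DERIV_compose_FDERIV[OF der b[unfolded e]]
  show ?thesis
    by (rule has_derivative_eq_rhs[OF has_derivative_diff[OF has_derivative_diff[OF d has_derivative_const] has_derivative_mult[OF T c]]])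
      (simp add: fun_eq_iff algebra_simps)
qed

lemma wpart_linear:
  "wpart f f' t s \<phi> \<beta> (u * a1 + v * a2 + w * a3) (u * b1 + v * b2 + w * b3)
   = u * wpart f f' t s \<phi> \<beta> a1 b1 + v * wpart f f' t s \<phi> \<beta> a2 b2 + w * wpart f f' t s \<phi> \<beta> a3 b3"
  unfolding wpart_def divide_inverse by (simp add: algebra_simps)

text \<open>Here \<open>s\<close> is a function of \<open>t\<close>, because the crossing angle will
  be followed along the solution of the volume equation.\<close>

lemma wgap_has_derivative:
  assumes der: "\<And>x. (f has_real_derivative f' x) (at x)"
    and pos: "0 < wy2 f (t0) (s t0) \<phi> \<beta>0"
    and s: "(s has_real_derivative s') (at t0)"
  shows "((\<lambda>(t, \<beta>). wgap f t (s t) \<phi> \<beta>) has_derivative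
     (\<lambda>(a, b). (wgap_t f f' t0 (s t0) \<phi> \<beta>0 + wgap_s f f' t0 (s t0) \<phi> \<beta>0 * s') * a + wgap_b f f' t0 (s t0) \<phi> \<beta>0 * b)) (at (t0, \<beta>0))"
proof -
  have fst': "((\<lambda>p. fst p :: real) has_derivative (\<lambda>p. fst p)) F" for F :: "(real \<times> real) filter"
    by (rule has_derivative_fst[OF has_derivative_ident])
  have snd': "((\<lambda>p. snd p :: real) has_derivative (\<lambda>p. snd p)) F" for F :: "(real \<times> real) filter"
    by (rule has_derivative_snd[OF has_derivative_ident])
  have fd: "((\<lambda>p. f (\<phi> + snd p)) has_derivative (\<lambda>h. snd h * f' (\<phi> + \<beta>0))) (at (t0, \<beta>0))"
    using DERIV_compose_FDERIV[OF der has_derivative_add[OF has_derivative_const snd'], of \<phi> "(t0, \<beta>0)" UNIV] by simp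
  have sd: "((\<lambda>p. s (fst p)) has_derivative (\<lambda>h. fst h * s')) (at (t0, \<beta>0))"
    using DERIV_compose_FDERIV[OF _ fst', of s s' "(t0, \<beta>0)" UNIV] s by simp
  have cd: "((\<lambda>p. cos (snd p)) has_derivative (\<lambda>h. snd h * - sin \<beta>0)) (at (t0, \<beta>0))"
    using DERIV_compose_FDERIV[OF DERIV_cos snd', of "(t0, \<beta>0)" UNIV] by simp
  have sid: "((\<lambda>p. sin (snd p)) has_derivative (\<lambda>h. snd h * cos \<beta>0)) (at (t0, \<beta>0))"
    using DERIV_compose_FDERIV[OF DERIV_sin snd', of "(t0, \<beta>0)" UNIV] by simp
  have 1: "((\<lambda>p. wy1 f (fst p) (s (fst p)) \<phi> (snd p)) has_derivative
     (\<lambda>h. fst h * (f (\<phi> + \<beta>0) * cos \<beta>0) - fst h * s' + snd h * (t0 * f' (\<phi> + \<beta>0) * cos \<beta>0 - (1 + t0 * f (\<phi> + \<beta>0)) * sin \<beta>0))) (at (t0, \<beta>0))"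
    unfolding wy1_def
    by (rule derivative_eq_intros fst' snd' fd sd cd refl)+ (simp add: fun_eq_iff algebra_simps)
  have 2: "((\<lambda>p. wy2 f (fst p) (s (fst p)) \<phi> (snd p)) has_derivative
     (\<lambda>h. fst h * (f (\<phi> + \<beta>0) * sin \<beta>0) + snd h * (t0 * f' (\<phi> + \<beta>0) * sin \<beta>0 + (1 + t0 * f (\<phi> + \<beta>0)) * cos \<beta>0))) (at (t0, \<beta>0))"
    unfolding wy2_def
    by (rule derivative_eq_intros fst' snd' fd sid refl)+ (simp add: fun_eq_iff algebra_simps)
  have "((\<lambda>p. wgap f (fst p) (s (fst p)) \<phi> (snd p)) has_derivative
     (\<lambda>h. (wgap_t f f' t0 (s t0) \<phi> \<beta>0 + wgap_s f f' t0 (s t0) \<phi> \<beta>0 * s') * fst h + wgap_b f f' t0 (s t0) \<phi> \<beta>0 * snd h)) (at (t0, \<beta>0))"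
    unfolding wgap_def wn_def wang_def
  proof (rule has_derivative_eq_rhs[OF wgap_chain[OF der 1 2 _ fst']])
    show "(\<lambda>h. (wy1 f (fst (t0, \<beta>0)) (s (fst (t0, \<beta>0))) \<phi> (snd (t0, \<beta>0)) *
      (fst h * (f (\<phi> + \<beta>0) * cos \<beta>0) - fst h * s' + snd h * (t0 * f' (\<phi> + \<beta>0) * cos \<beta>0 - (1 + t0 * f (\<phi> + \<beta>0)) * sin \<beta>0)) +
      wy2 f (fst (t0, \<beta>0)) (s (fst (t0, \<beta>0))) \<phi> (snd (t0, \<beta>0)) *
      (fst h * (f (\<phi> + \<beta>0) * sin \<beta>0) + snd h * (t0 * f' (\<phi> + \<beta>0) * sin \<beta>0 + (1 + t0 * f (\<phi> + \<beta>0)) * cos \<beta>0))) /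
     sqrt ((wy1 f (fst (t0, \<beta>0)) (s (fst (t0, \<beta>0))) \<phi> (snd (t0, \<beta>0)))\<^sup>2 + (wy2 f (fst (t0, \<beta>0)) (s (fst (t0, \<beta>0))) \<phi> (snd (t0, \<beta>0)))\<^sup>2) +
     fst (t0, \<beta>0) * f' (\<phi> + (pi / 2 - arctan (wy1 f (fst (t0, \<beta>0)) (s (fst (t0, \<beta>0))) \<phi> (snd (t0, \<beta>0)) / wy2 f (fst (t0, \<beta>0)) (s (fst (t0, \<beta>0))) \<phi> (snd (t0, \<beta>0))))) *
     ((fst h * (f (\<phi> + \<beta>0) * cos \<beta>0) - fst h * s' + snd h * (t0 * f' (\<phi> + \<beta>0) * cos \<beta>0 - (1 + t0 * f (\<phi> + \<beta>0)) * sin \<beta>0)) * wy2 f (fst (t0, \<beta>0)) (s (fst (t0, \<beta>0))) \<phi> (snd (t0, \<beta>0)) -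
      (fst h * (f (\<phi> + \<beta>0) * sin \<beta>0) + snd h * (t0 * f' (\<phi> + \<beta>0) * sin \<beta>0 + (1 + t0 * f (\<phi> + \<beta>0)) * cos \<beta>0)) * wy1 f (fst (t0, \<beta>0)) (s (fst (t0, \<beta>0))) \<phi> (snd (t0, \<beta>0))) /
     (sqrt ((wy1 f (fst (t0, \<beta>0)) (s (fst (t0, \<beta>0))) \<phi> (snd (t0, \<beta>0)))\<^sup>2 + (wy2 f (fst (t0, \<beta>0)) (s (fst (t0, \<beta>0))) \<phi> (snd (t0, \<beta>0)))\<^sup>2))\<^sup>2 -
     fst h * f (\<phi> + (pi / 2 - arctan (wy1 f (fst (t0, \<beta>0)) (s (fst (t0, \<beta>0))) \<phi> (snd (t0, \<beta>0)) / wy2 f (fst (t0, \<beta>0)) (s (fst (t0, \<beta>0))) \<phi> (snd (t0, \<beta>0)))))) =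
    (\<lambda>h. (wgap_t f f' t0 (s t0) \<phi> \<beta>0 + wgap_s f f' t0 (s t0) \<phi> \<beta>0 * s') * fst h + wgap_b f f' t0 (s t0) \<phi> \<beta>0 * snd h)" (is "?L = ?R")
    proof
      fix h :: "real \<times> real"
      let ?c = "t0 * f' (\<phi> + \<beta>0) * cos \<beta>0 - (1 + t0 * f (\<phi> + \<beta>0)) * sin \<beta>0"
      let ?d = "t0 * f' (\<phi> + \<beta>0) * sin \<beta>0 + (1 + t0 * f (\<phi> + \<beta>0)) * cos \<beta>0"
      have "wpart f f' t0 (s t0) \<phi> \<beta>0 (fst h * (f (\<phi> + \<beta>0) * cos \<beta>0) - fst h * s' + snd h * ?c)
         (fst h * (f (\<phi> + \<beta>0) * sin \<beta>0) + snd h * ?d) - fst h * f (\<phi> + wang f t0 (s t0) \<phi> \<beta>0)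
        = (wgap_t f f' t0 (s t0) \<phi> \<beta>0 + wgap_s f f' t0 (s t0) \<phi> \<beta>0 * s') * fst h + wgap_b f f' t0 (s t0) \<phi> \<beta>0 * snd h"
        using wpart_linear[of f f' t0 "s t0" \<phi> \<beta>0 "fst h" "f (\<phi> + \<beta>0) * cos \<beta>0" "fst h * s'" "-1" "snd h" ?c "f (\<phi> + \<beta>0) * sin \<beta>0" 0 ?d]
        unfolding wgap_t_def wgap_s_def wgap_b_def by (simp add: algebra_simps)
      then show "?L h = ?R h"
        unfolding wpart_def fst_conv snd_conv wn_def wang_def .
    qed
  qed (use pos in simp)
  then show ?thesis by (simp add: case_prod_beta')
qed

section \<open>Existence and smoothness of the crossing angle\<close>

lemma periodic_int:
  fixes g :: "real \<Rightarrow> 'a"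
  assumes "\<And>x. g (x + 2 * pi) = g x"
  shows "g (x + of_int n * (2 * pi)) = g x"
proof -
  interpret periodic_fun_simple g "2 * pi" by unfold_locales (rule assms)
  show ?thesis by (rule plus_of_int)
qed

lemma periodic_bounded:
  fixes g :: "real \<Rightarrow> real"
  assumes per: "\<And>x. g (x + 2 * pi) = g x" and c: "continuous_on UNIV g"
  obtains M where "0 < M" "\<And>x. \<bar>g x\<bar> \<le> M"
proof -
  have "bounded (g ` {0..2*pi})"
    by (intro compact_imp_bounded compact_continuous_image continuous_on_subset[OF c]) auto
  then obtain M where M: "0 < M" "\<forall>y\<in>g ` {0..2*pi}. norm y \<le> M" unfolding bounded_pos by blast
  have "\<bar>g x\<bar> \<le> M" for x
  proof -
    define n where "n = \<lfloor>x / (2 * pi)\<rfloor>"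
    have "of_int n \<le> x / (2 * pi)" "x / (2 * pi) < of_int n + 1" by (auto simp: n_def)
    then have "x - of_int n * (2 * pi) \<in> {0..2*pi}" by (auto simp: field_simps)
    then have "\<bar>g (x - of_int n * (2 * pi))\<bar> \<le> M" using M(2) by auto
    moreover have "g (x - of_int n * (2 * pi)) = g x"
      using periodic_int[of g "x - of_int n * (2 * pi)" n] per by simp
    ultimately show ?thesis by simp
  qed
  with M(1) show thesis by (rule that)
qed

text \<open>The sign pattern on all of (0, pi) yields continuity of the root by comparison with test
  angles and identifies the arc inside the translate; the transversality condition on
  \<open>wgap_b\<close> yields differentiability.\<close>

definition root_prop :: "(real \<Rightarrow> real) \<Rightarrow> (real \<Rightarrow> real) \<Rightarrow> real \<Rightarrow> real \<Rightarrow> real \<Rightarrow> bool" where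
  "root_prop f f' t s \<phi> \<longleftrightarrow> 0 < hit f t s \<phi> \<and> hit f t s \<phi> < pi \<and>
     (\<forall>x. 0 < x \<and> x < pi \<longrightarrow> 0 < wy2 f t s \<phi> x \<and> (wgap f t s \<phi> x < 0 \<longleftrightarrow> x < hit f t s \<phi>)
        \<and> (wgap f t s \<phi> x > 0 \<longleftrightarrow> hit f t s \<phi> < x)) \<and> 0 < wgap_b f f' t s \<phi> (hit f t s \<phi>)"

lemma root_prop_zero: "root_prop f f' t s \<phi> \<Longrightarrow> wgap f t s \<phi> (hit f t s \<phi>) = 0"
  unfolding root_prop_def by (metis linorder_neqE_linordered_idom order_less_irrefl)

locale c1_periodic =
  fixes f f' :: "real \<Rightarrow> real"
  assumes per: "\<And>x. f (x + 2 * pi) = f x"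
    and der: "\<And>x. (f has_real_derivative f' x) (at x)"
    and contf': "continuous_on UNIV f'"
begin

lemma contf: "continuous_on UNIV f"
  using der by (meson DERIV_isCont continuous_at_imp_continuous_on)

lemma contf_comp [continuous_intros]: "continuous_on S g \<Longrightarrow> continuous_on S (\<lambda>x. f (g x))"
  using continuous_on_compose2[OF contf] by auto

lemma contf'_comp [continuous_intros]: "continuous_on S g \<Longrightarrow> continuous_on S (\<lambda>x. f' (g x))"
  using continuous_on_compose2[OF contf'] by auto

lemma per': "f' (x + 2 * pi) = f' x"
proof -
  have "((\<lambda>x. f (x + 2 * pi)) has_real_derivative f' (x + 2 * pi)) (at x)"
    using DERIV_shift[of f "f' (x + 2 * pi)" x "2 * pi"] der by simp
  then have "(f has_real_derivative f' (x + 2 * pi)) (at x)" by (simp add: per)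
  then show ?thesis using der by (rule DERIV_unique)
qed

lemma reflected: "c1_periodic (\<lambda>x. f (- x)) (\<lambda>x. - f' (- x))"
proof
  show "f (- (x + 2 * pi)) = f (- x)" for x using per[of "- (x + 2 * pi)"] by simp
  show "((\<lambda>x. f (- x)) has_real_derivative - f' (- x)) (at x)" for x
  proof -
    have "(uminus has_real_derivative -1) (at x)" by (auto intro!: derivative_eq_intros)
    from DERIV_chain2[OF der this] show ?thesis by simp
  qed
  show "continuous_on UNIV (\<lambda>x. - f' (- x))" by (intro continuous_intros)
qed

definition bnd :: real where
  "bnd = (SOME M. 0 < M \<and> (\<forall>x. \<bar>f x\<bar> \<le> M) \<and> (\<forall>x. \<bar>f' x\<bar> \<le> M))"

lemma bnd: "0 < bnd" "\<bar>f x\<bar> \<le> bnd" "\<bar>f' x\<bar> \<le> bnd"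
proof -
  obtain M1 M2 where "0 < M1" "\<And>x. \<bar>f x\<bar> \<le> M1" "0 < M2" "\<And>x. \<bar>f' x\<bar> \<le> M2"
    using periodic_bounded[OF per contf] periodic_bounded[OF per' contf'] by metis
  then have "0 < max M1 M2 \<and> (\<forall>x. \<bar>f x\<bar> \<le> max M1 M2) \<and> (\<forall>x. \<bar>f' x\<bar> \<le> max M1 M2)"
    by (auto simp: le_max_iff_disj)
  then have "0 < bnd \<and> (\<forall>x. \<bar>f x\<bar> \<le> bnd) \<and> (\<forall>x. \<bar>f' x\<bar> \<le> bnd)"
    unfolding bnd_def by (rule someI)
  then show "0 < bnd" "\<bar>f x\<bar> \<le> bnd" "\<bar>f' x\<bar> \<le> bnd" by auto
qed

lemma tf_bound: "\<bar>t * f x\<bar> \<le> \<bar>t\<bar> * bnd" "\<bar>t * f' x\<bar> \<le> \<bar>t\<bar> * bnd"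
  using bnd by (auto simp: abs_mult intro!: mult_left_mono)

lemma f_lipschitz: "\<bar>f x - f y\<bar> \<le> bnd * \<bar>x - y\<bar>"
proof -
  have *: "\<bar>f x - f y\<bar> \<le> bnd * \<bar>x - y\<bar>" if xy: "x < y" for x y
  proof -
    obtain z where "f y - f x = (y - x) * f' z" using MVT2[OF xy, of f f'] der by auto
    then have "\<bar>f x - f y\<bar> = \<bar>f' z\<bar> * \<bar>x - y\<bar>" by (metis abs_minus_commute abs_mult mult.commute)
    then show ?thesis using bnd(3)[of z] by (simp add: mult_right_mono)
  qed
  show ?thesis using *[of x y] *[of y x] by (cases x y rule: linorder_cases) (auto simp: abs_minus_commute)
qed

lemma wcont:
  fixes t s \<phi> \<beta> :: "'p :: metric_space \<Rightarrow> real"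
  assumes "continuous_on T t" "continuous_on T s" "continuous_on T \<phi>" "continuous_on T \<beta>"
    and pos: "\<And>p. p \<in> T \<Longrightarrow> 0 < wy2 f (t p) (s p) (\<phi> p) (\<beta> p)"
  shows "continuous_on T (\<lambda>p. wgap f (t p) (s p) (\<phi> p) (\<beta> p))"
    "continuous_on T (\<lambda>p. wgap_t f f' (t p) (s p) (\<phi> p) (\<beta> p))"
    "continuous_on T (\<lambda>p. wgap_s f f' (t p) (s p) (\<phi> p) (\<beta> p))"
    "continuous_on T (\<lambda>p. wgap_b f f' (t p) (s p) (\<phi> p) (\<beta> p))"
proof -
  have n: "\<forall>p\<in>T. wn f (t p) (s p) (\<phi> p) (\<beta> p) \<noteq> 0" using wn_pos[OF pos] by force
  then have n2: "\<forall>p\<in>T. (wn f (t p) (s p) (\<phi> p) (\<beta> p))\<^sup>2 \<noteq> 0" by simp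
  have y2: "\<forall>p\<in>T. wy2 f (t p) (s p) (\<phi> p) (\<beta> p) \<noteq> 0" using pos by force
  have c1: "continuous_on T (\<lambda>p. wy1 f (t p) (s p) (\<phi> p) (\<beta> p))"
    unfolding wy1_def by (intro continuous_intros assms)
  have c2: "continuous_on T (\<lambda>p. wy2 f (t p) (s p) (\<phi> p) (\<beta> p))"
    unfolding wy2_def by (intro continuous_intros assms)
  have cn: "continuous_on T (\<lambda>p. wn f (t p) (s p) (\<phi> p) (\<beta> p))"
    unfolding wn_def by (intro continuous_intros c1 c2)
  have ca: "continuous_on T (\<lambda>p. wang f (t p) (s p) (\<phi> p) (\<beta> p))"
    unfolding wang_def by (intro continuous_intros c1 c2 y2)
  show "continuous_on T (\<lambda>p. wgap f (t p) (s p) (\<phi> p) (\<beta> p))"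
    unfolding wgap_def by (intro continuous_intros assms cn ca)
  show "continuous_on T (\<lambda>p. wgap_t f f' (t p) (s p) (\<phi> p) (\<beta> p))"
    unfolding wgap_t_def wpart_def by (intro continuous_intros assms cn ca c1 c2 n n2)
  show "continuous_on T (\<lambda>p. wgap_s f f' (t p) (s p) (\<phi> p) (\<beta> p))"
    unfolding wgap_s_def wpart_def by (intro continuous_intros assms cn ca c1 c2 n n2)
  show "continuous_on T (\<lambda>p. wgap_b f f' (t p) (s p) (\<phi> p) (\<beta> p))"
    unfolding wgap_b_def wpart_def by (intro continuous_intros assms cn ca c1 c2 n n2)
qed

text \<open>The sign of \<open>wgap\<close> at a fixed test angle tells on which side of it the root
  lies. Strict signs persist under small changes of the parameters, so the root is squeezed between
  test angles.\<close>

lemma hit_continuous: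
  fixes t s \<phi> :: "'p :: metric_space \<Rightarrow> real"
  assumes c: "continuous_on T t" "continuous_on T s" "continuous_on T \<phi>"
    and rp: "\<And>p. p \<in> T \<Longrightarrow> root_prop f f' (t p) (s p) (\<phi> p)"
  shows "continuous_on T (\<lambda>p. hit f (t p) (s p) (\<phi> p))"
  unfolding continuous_on_def
proof
  fix p0 assume p0: "p0 \<in> T"
  have inT: "\<forall>\<^sub>F p in at p0 within T. p \<in> T" by (simp add: eventually_at_filter)
  have cw: "((\<lambda>p. wgap f (t p) (s p) (\<phi> p) x) \<longlongrightarrow> wgap f (t p0) (s p0) (\<phi> p0) x) (at p0 within T)"
    if "0 < x" "x < pi" for x
  proof -
    have "continuous_on T (\<lambda>p. wgap f (t p) (s p) (\<phi> p) x)"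
      using rp that by (intro wcont c) (auto simp: root_prop_def)
    then show ?thesis using p0 by (simp add: continuous_on_def)
  qed
  have h0: "0 < hit f (t p0) (s p0) (\<phi> p0)" "hit f (t p0) (s p0) (\<phi> p0) < pi"
    using rp[OF p0] by (auto simp: root_prop_def)
  show "((\<lambda>p. hit f (t p) (s p) (\<phi> p)) \<longlongrightarrow> hit f (t p0) (s p0) (\<phi> p0)) (at p0 within T)"
  proof (rule order_tendstoI)
    fix l assume l: "l < hit f (t p0) (s p0) (\<phi> p0)"
    show "\<forall>\<^sub>F p in at p0 within T. l < hit f (t p) (s p) (\<phi> p)"
    proof (cases "0 < l")
      case False
      show ?thesis using inT
      proof eventually_elim
        case (elim p) then show ?case using rp[OF elim] False by (auto simp: root_prop_def)
      qed
    next
      case True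
      then have lp: "0 < l" "l < pi" using l h0 by auto
      have "wgap f (t p0) (s p0) (\<phi> p0) l < 0" using rp[OF p0] l lp by (auto simp: root_prop_def)
      then have "\<forall>\<^sub>F p in at p0 within T. wgap f (t p) (s p) (\<phi> p) l < 0" by (rule order_tendstoD(2)[OF cw[OF lp]])
      with inT show ?thesis
      proof eventually_elim
        case (elim p) then show ?case using rp[of p] lp by (auto simp: root_prop_def)
      qed
    qed
  next
    fix l assume l: "hit f (t p0) (s p0) (\<phi> p0) < l"
    show "\<forall>\<^sub>F p in at p0 within T. hit f (t p) (s p) (\<phi> p) < l"
    proof (cases "l < pi")
      case False
      show ?thesis using inT
      proof eventually_elim
        case (elim p) then show ?case using rp[OF elim] False by (auto simp: root_prop_def)
      qed
    next
      case True
      then have lp: "0 < l" "l < pi" using l h0 by auto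
      have "wgap f (t p0) (s p0) (\<phi> p0) l > 0" using rp[OF p0] l lp by (auto simp: root_prop_def)
      then have "\<forall>\<^sub>F p in at p0 within T. wgap f (t p) (s p) (\<phi> p) l > 0" by (rule order_tendstoD(1)[OF cw[OF lp]])
      with inT show ?thesis
      proof eventually_elim
        case (elim p) then show ?case using rp[of p] lp by (auto simp: root_prop_def)
      qed
    qed
  qed
qed

lemma hit_has_derivative:
  assumes T: "open T" "t0 \<in> T" and s: "\<And>t. t \<in> T \<Longrightarrow> isCont s t" "(s has_real_derivative s') (at t0)"
    and rp: "\<And>t. t \<in> T \<Longrightarrow> root_prop f f' t (s t) \<phi>"
  shows "((\<lambda>t. hit f t (s t) \<phi>) has_real_derivative
     - (wgap_t f f' t0 (s t0) \<phi> (hit f t0 (s t0) \<phi>) + wgap_s f f' t0 (s t0) \<phi> (hit f t0 (s t0) \<phi>) * s')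
       / wgap_b f f' t0 (s t0) \<phi> (hit f t0 (s t0) \<phi>)) (at t0)"
proof (rule implicit_has_real_derivative[OF wgap_has_derivative[OF der _ s(2)]])
  show "0 < wy2 f t0 (s t0) \<phi> (hit f t0 (s t0) \<phi>)" "wgap_b f f' t0 (s t0) \<phi> (hit f t0 (s t0) \<phi>) \<noteq> 0"
    using rp[OF T(2)] by (auto simp: root_prop_def)
  have "continuous_on T (\<lambda>t. hit f t (s t) \<phi>)"
    using rp s(1) by (intro hit_continuous) (auto intro!: continuous_intros continuous_at_imp_continuous_on)
  then show "isCont (\<lambda>t. hit f t (s t) \<phi>) t0"
    using T by (simp add: continuous_on_eq_continuous_at)
  have "\<forall>\<^sub>F t in nhds t0. t \<in> T" using T by (auto simp: eventually_nhds)
  then show "\<forall>\<^sub>F t in nhds t0. (case (t, hit f t (s t) \<phi>) of (t, \<beta>) \<Rightarrow> wgap f t (s t) \<phi> \<beta>) =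
     (case (t0, hit f t0 (s t0) \<phi>) of (t, \<beta>) \<Rightarrow> wgap f t (s t) \<phi> \<beta>)"
    by eventually_elim (use root_prop_zero[OF rp] T in simp)
qed

text \<open>At t = 0 the shifted boundary point has distance N from the origin with N^2 = 1 + s^2 -
  2 s cos x. The derivative of N degenerates at 0 and pi, so near these angles the sign of the gap
  is read off directly, and monotonicity is used only on [c, pi - c]. The margins depend on
  \<open>a\<close>, \<open>b\<close> and \<open>bnd\<close> alone, hence the uniformity in
  \<open>s\<close> and \<phi>.\<close>

lemma root_structure:
  assumes ab: "0 < a" "a < b" "b < 2"
  obtains \<tau> where "0 < \<tau>" "\<tau> * bnd \<le> 1 / 2"
    "\<And>t s \<phi>. \<bar>t\<bar> < \<tau> \<Longrightarrow> a \<le> s \<Longrightarrow> s \<le> b \<Longrightarrow> root_prop f f' t s \<phi>"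
proof -
  \<comment> \<open>Here cos c is the midpoint of b / 2 and 1, so that 2 cos x - s >= 1 - b / 2
    whenever x <= c and s <= b.\<close>
  define c where "c = arccos ((1 + b / 2) / 2)"
  have cosc: "cos c = (1 + b / 2) / 2" unfolding c_def by (rule cos_arccos) (use ab in auto)
  have c: "0 < c" "c < pi / 2"
  proof -
    have "c \<noteq> 0" using cosc ab by auto
    moreover have "0 \<le> c" "c \<le> pi" unfolding c_def by (intro arccos_lbound arccos_ubound; use ab in simp)+
    ultimately show "0 < c" by simp
    show "c < pi / 2"
    proof (rule ccontr)
      assume "\<not> c < pi / 2"
      then have "cos c \<le> cos (pi / 2)" using \<open>c \<le> pi\<close> by (intro cos_monotone_0_pi_le) auto
      then show False using cosc ab by simp
    qed
  qed
  have sinc: "0 < sin c" using c by (intro sin_gt_zero) auto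
  define k where "k = a * (1 - b / 2)"
  have k: "0 < k" "k \<le> 1"
  proof -
    show "0 < k" using ab by (simp add: k_def)
    have "k \<le> 2 * (1 / 2)" unfolding k_def
    proof (cases "a \<le> 1")
      case True then show "a * (1 - b / 2) \<le> 2 * (1 / 2)" using ab mult_mono[of a 1 "1 - b/2" 1] by auto
    next
      case False then show "a * (1 - b / 2) \<le> 2 * (1 / 2)" using ab by (intro mult_mono) auto
    qed
    then show "k \<le> 1" by simp
  qed
  \<comment> \<open>The gap at t = 0 is at most - k / 2 on (0, c] and at least a^2 / 4 on [pi - c,
    pi).\<close>
  define \<kappa> where "\<kappa> = min (k / 2) (a\<^sup>2 / 4)"
  have \<kappa>: "0 < \<kappa>" "\<kappa> \<le> k / 2" "\<kappa> \<le> a\<^sup>2 / 4" using k ab by (auto simp: \<kappa>_def)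
  \<comment> \<open>The three conditions in turn: radii stay in [1/2, 3/2]; \<open>wgap\<close>, in
    which t f enters twice, changes by less than \<kappa>; and the errors in the derivative, at most
    7/2 + 4 times \<open>\<tau> * bnd\<close>, stay below a sin c / 2.\<close>
  define \<tau> where "\<tau> = min (1 / 2) (min (\<kappa> / 2) (a * sin c / 16)) / bnd"
  have \<tau>: "0 < \<tau>" "\<tau> * bnd \<le> 1 / 2" "\<tau> * bnd \<le> \<kappa> / 2" "\<tau> * bnd \<le> a * sin c / 16"
    using bnd(1) \<kappa> ab sinc by (auto simp: \<tau>_def)
  have main: "root_prop f f' t s \<phi>" if t: "\<bar>t\<bar> < \<tau>" and s: "a \<le> s" "s \<le> b" for t s \<phi>
  proof -
    have tb: "\<bar>t\<bar> * bnd < \<tau> * bnd" using t bnd(1) by simp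
    have r: "1 / 2 \<le> 1 + t * f x" "1 + t * f x \<le> 3 / 2" for x using tf_bound(1)[of t x] tb \<tau>(2) by auto
    have y2: "0 < wy2 f t s \<phi> x" if "0 < x" "x < pi" for x
      using r(1)[of "\<phi> + x"] sin_gt_zero[OF that] by (simp add: wy2_def)
    define N0 where "N0 x = sqrt ((cos x - s)\<^sup>2 + (sin x)\<^sup>2)" for x
    have N0sq: "(N0 x)\<^sup>2 = 1 + s\<^sup>2 - 2 * s * cos x" for x
    proof -
      have "(cos x - s)\<^sup>2 + (sin x)\<^sup>2 = 1 + s\<^sup>2 - 2 * s * cos x"
        using sin_cos_squared_add[of x] by (simp add: power2_eq_square algebra_simps)
      then show ?thesis unfolding N0_def real_sqrt_pow2[OF sum_power2_ge_zero] .
    qed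
    have N0: "0 \<le> N0 x" for x by (simp add: N0_def)
    \<comment> \<open>The reverse triangle inequality in complex form: the perturbed and unperturbed
      vectors differ by t f times e^(ix).\<close>
    have close: "\<bar>wgap f t s \<phi> x - (N0 x - 1)\<bar> < \<kappa>" for x
    proof -
      have "wn f t s \<phi> x = cmod (Complex (wy1 f t s \<phi> x) (wy2 f t s \<phi> x))" by (simp add: wn_def cmod_def)
      moreover have "N0 x = cmod (Complex (cos x - s) (sin x))" by (simp add: N0_def cmod_def)
      ultimately have "\<bar>wn f t s \<phi> x - N0 x\<bar> \<le> cmod (Complex (wy1 f t s \<phi> x) (wy2 f t s \<phi> x) - Complex (cos x - s) (sin x))"
        by (metis norm_triangle_ineq3)
      also have "Complex (wy1 f t s \<phi> x) (wy2 f t s \<phi> x) - Complex (cos x - s) (sin x) = of_real (t * f (\<phi> + x)) * cis x"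
        by (simp add: wy1_def wy2_def complex_eq_iff algebra_simps)
      also have "cmod \<dots> = \<bar>t * f (\<phi> + x)\<bar>" by (simp add: norm_mult abs_mult)
      also have "\<dots> \<le> \<bar>t\<bar> * bnd" by (rule tf_bound)
      finally show ?thesis
        using tf_bound(1)[of t "\<phi> + wang f t s \<phi> x"] tb \<tau>(3) by (simp add: wgap_def)
    qed
    have inner: "wgap f t s \<phi> x < 0" if "0 < x" "x \<le> c" for x
    proof -
      have "cos c \<le> cos x" using that c by (intro cos_monotone_0_pi_le) auto
      then have "s * (2 * cos x - s) \<ge> a * (1 - b / 2)"
        using s ab cosc by (intro mult_mono) auto
      then have "(N0 x)\<^sup>2 \<le> 1 - k" unfolding N0sq k_def by (simp add: power2_eq_square algebra_simps)
      also have "\<dots> \<le> (1 - k / 2)\<^sup>2" by (simp add: power2_eq_square algebra_simps)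
      finally have "N0 x \<le> 1 - k / 2" by (rule power2_le_imp_le) (use k in simp)
      then show ?thesis using close[of x] \<kappa>(2) by linarith
    qed
    have outer: "wgap f t s \<phi> x > 0" if "pi - c \<le> x" "x < pi" for x
    proof -
      have "cos x \<le> cos (pi - c)" using that c by (intro cos_monotone_0_pi_le) auto
      moreover have "0 < cos c" unfolding cosc using ab by (intro divide_pos_pos add_pos_pos) auto
      ultimately have "cos x \<le> 0" unfolding cos_pi_minus by linarith
      then have "s * cos x \<le> 0" using s ab by (simp add: mult_nonneg_nonpos)
      moreover have "a\<^sup>2 \<le> s\<^sup>2" using s ab by (intro power_mono) auto
      ultimately have ge: "1 + a\<^sup>2 \<le> (N0 x)\<^sup>2" unfolding N0sq by linarith
      have "a * a \<le> 2 * 2" using ab by (intro mult_mono) auto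
      then have "a\<^sup>2 * a\<^sup>2 \<le> 8 * a\<^sup>2" by (intro mult_right_mono) (auto simp: power2_eq_square)
      then have "(1 + a\<^sup>2 / 4)\<^sup>2 \<le> 1 + a\<^sup>2" by (simp add: power2_eq_square algebra_simps)
      then have "(1 + a\<^sup>2 / 4)\<^sup>2 \<le> (N0 x)\<^sup>2" using ge by linarith
      then have "1 + a\<^sup>2 / 4 \<le> N0 x" using N0 by (rule power2_le_imp_le)
      then show ?thesis using close[of x] \<kappa>(3) by linarith
    qed
    have mid: "0 < wgap_b f f' t s \<phi> x" if x: "c \<le> x" "x \<le> pi - c" for x
    proof -
      have x0: "0 < x" "x < pi" using x c by auto
      define y1 y2 n where yn: "y1 = wy1 f t s \<phi> x" "y2 = wy2 f t s \<phi> x" "n = wn f t s \<phi> x"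
      define r0 q where rq: "r0 = 1 + t * f (\<phi> + x)" "q = t * f' (\<phi> + x)"
      define g where "g = t * f' (\<phi> + wang f t s \<phi> x)"
      have n: "0 < n" using wn_pos[OF y2[OF x0]] by (simp add: yn)
      have yle: "\<bar>y1\<bar> \<le> n" "\<bar>y2\<bar> \<le> n"
        unfolding yn wn_def by (simp_all add: real_le_rsqrt)
      have rb: "1 / 2 \<le> r0" "r0 \<le> 3 / 2" using r by (auto simp: rq)
      have qb: "\<bar>q\<bar> \<le> \<tau> * bnd" "\<bar>g\<bar> \<le> \<tau> * bnd" unfolding rq g_def using tf_bound(2) tb by (meson less_imp_le order_trans)+
      define Y1 Y2 where Y: "Y1 = q * cos x - r0 * sin x" "Y2 = q * sin x + r0 * cos x"
      have Yb: "\<bar>Y1\<bar> \<le> 2" "\<bar>Y2\<bar> \<le> 2"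
      proof -
        have "\<bar>q * cos x\<bar> \<le> 1/2" "\<bar>q * sin x\<bar> \<le> 1/2" "\<bar>r0 * sin x\<bar> \<le> 3/2" "\<bar>r0 * cos x\<bar> \<le> 3/2"
          unfolding abs_mult using qb(1) \<tau>(2) rb mult_mono[of "\<bar>q\<bar>" "1/2" "\<bar>cos x\<bar>" 1] mult_mono[of "\<bar>q\<bar>" "1/2" "\<bar>sin x\<bar>" 1]
            mult_mono[of "\<bar>r0\<bar>" "3/2" "\<bar>cos x\<bar>" 1] mult_mono[of "\<bar>r0\<bar>" "3/2" "\<bar>sin x\<bar>" 1] by auto
        then show "\<bar>Y1\<bar> \<le> 2" "\<bar>Y2\<bar> \<le> 2" unfolding Y by linarith+
      qed
      \<comment> \<open>The term s r0 sin x survives at t = 0 and is bounded below on [c, pi - c];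
        the rest carries the factor \<open>q\<close>, which is of order t.\<close>
      have e1: "y1 * Y1 + y2 * Y2 = q * (r0 - s * cos x) + s * r0 * sin x"
      proof -
        have "y1 = r0 * cos x - s" "y2 = r0 * sin x" by (simp_all add: yn wy1_def wy2_def rq)
        moreover have "(sin x)\<^sup>2 + (cos x)\<^sup>2 = 1" by simp
        ultimately show ?thesis unfolding Y by algebra
      qed
      have cx: "\<bar>cos x\<bar> \<le> cos c"
      proof -
        have "cos x \<le> cos c" using x c by (intro cos_monotone_0_pi_le) auto
        moreover have "cos (pi - c) \<le> cos x" using x c by (intro cos_monotone_0_pi_le) auto
        ultimately show ?thesis by auto
      qed
      have sx: "sin c \<le> sin x"
      proof (rule power2_le_imp_le)
        have "(cos x)\<^sup>2 \<le> (cos c)\<^sup>2" using cx by (metis abs_ge_zero power2_abs power_mono)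
        then show "(sin c)\<^sup>2 \<le> (sin x)\<^sup>2" by (simp add: sin_squared_eq)
        show "0 \<le> sin x" using sin_gt_zero[OF x0] by simp
      qed
      have "a * (1 / 2) * sin c \<le> s * r0 * sin x"
        using ab s rb sx sinc by (intro mult_mono) auto
      moreover have "\<bar>q * (r0 - s * cos x)\<bar> \<le> (\<tau> * bnd) * (7 / 2)"
      proof -
        have "\<bar>s * cos x\<bar> \<le> 2 * 1" unfolding abs_mult using s ab by (intro mult_mono) auto
        then have "\<bar>r0 - s * cos x\<bar> \<le> 7 / 2" using rb by linarith
        then show ?thesis unfolding abs_mult using qb by (intro mult_mono) auto
      qed
      ultimately have l1: "a * sin c / 2 - \<tau> * bnd * (7 / 2) \<le> y1 * Y1 + y2 * Y2" unfolding e1 by linarith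
      have l2: "- (\<tau> * bnd * 4) \<le> g * (Y1 * y2 - Y2 * y1) / n"
      proof -
        have "\<bar>Y1 * y2 - Y2 * y1\<bar> \<le> \<bar>Y1\<bar> * \<bar>y2\<bar> + \<bar>Y2\<bar> * \<bar>y1\<bar>"
          unfolding abs_mult[symmetric] by linarith
        also have "\<dots> \<le> 2 * n + 2 * n" using Yb yle n by (intro add_mono mult_mono) auto
        finally have "\<bar>Y1 * y2 - Y2 * y1\<bar> \<le> 4 * n" by simp
        then have "\<bar>g * (Y1 * y2 - Y2 * y1) / n\<bar> \<le> (\<tau> * bnd) * (4 * n) / n"
          unfolding abs_divide abs_mult using qb n by (intro frac_le mult_mono) auto
        also have "\<dots> = \<tau> * bnd * 4" using n by simp
        finally have *: "\<bar>g * (Y1 * y2 - Y2 * y1) / n\<bar> \<le> \<tau> * bnd * 4" .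
        have "- c \<le> x" if "\<bar>x\<bar> \<le> c" for x c :: real using that by linarith
        from this[OF *] show ?thesis .
      qed
      have "0 < \<tau> * bnd" using \<tau>(1) bnd(1) by simp
      moreover have "0 < p + q" if "w / 2 - u * (7 / 2) \<le> p" "- (u * 4) \<le> q" "u \<le> w / 16" "0 < w" "0 < u"
        for p q u w :: real using that by linarith
      ultimately have "0 < (y1 * Y1 + y2 * Y2) + g * (Y1 * y2 - Y2 * y1) / n"
        using l1 l2 \<tau>(4) mult_pos_pos[OF ab(1) sinc] by blast
      moreover have "n * wgap_b f f' t s \<phi> x = (y1 * Y1 + y2 * Y2) + g * (Y1 * y2 - Y2 * y1) / n"
        using n unfolding wgap_b_def wpart_def yn[symmetric] rq[symmetric] Y[symmetric] g_def[symmetric]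
        by (simp add: field_simps power2_eq_square)
      ultimately show ?thesis using n by (metis zero_less_mult_pos)
    qed
    have derb: "(wgap f t s \<phi> has_real_derivative wgap_b f f' t s \<phi> x) (at x)" if "0 < x" "x < pi" for x
    proof -
      have "((\<lambda>(t, \<beta>). wgap f t s \<phi> \<beta>) has_derivative (\<lambda>(a, b). (wgap_t f f' t s \<phi> x + wgap_s f f' t s \<phi> x * 0) * a + wgap_b f f' t s \<phi> x * b)) (at (t, x))"
        using wgap_has_derivative[OF der, of t "\<lambda>_. s" \<phi> x 0] y2[OF that] by simp
      moreover have "((\<lambda>x. (t, x)) has_derivative (\<lambda>h. (0, h))) (at x)" by (intro derivative_eq_intros) auto
      ultimately have "((\<lambda>y. case (t, y) of (t, \<beta>) \<Rightarrow> wgap f t s \<phi> \<beta>) has_derivative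
         (\<lambda>h. case (0, h) of (a, b) \<Rightarrow> (wgap_t f f' t s \<phi> x + wgap_s f f' t s \<phi> x * 0) * a + wgap_b f f' t s \<phi> x * b)) (at x)"
        by (rule has_derivative_compose[rotated])
      then show ?thesis by (simp add: has_field_derivative_def)
    qed
    have cm: "0 < c" "c < pi - c" using c by auto
    have mono: "wgap f t s \<phi> x < wgap f t s \<phi> y" if "c \<le> x" "x < y" "y \<le> pi - c" for x y
      using that c by (intro DERIV_pos_imp_increasing[OF that(2)]) (meson derb mid order_trans less_le_trans le_less_trans less_imp_le order_refl diff_less_eq less_add_same_cancel1 leD not_le_imp_less)
    have "continuous_on {c..pi - c} (wgap f t s \<phi>)"
      using derb c by (intro continuous_at_imp_continuous_on ballI DERIV_isCont[OF derb]) auto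
    then obtain r0 where r0: "c \<le> r0" "r0 \<le> pi - c" "wgap f t s \<phi> r0 = 0"
      using IVT'[of "wgap f t s \<phi>" c 0 "pi - c"] inner[of c] outer[of "pi - c"] c by force
    have r0': "c < r0" "r0 < pi - c" using r0 inner[of c] outer[of "pi - c"] c by (auto simp: order_less_le)
    have lt: "wgap f t s \<phi> x < 0" if "0 < x" "x < r0" for x
      using inner[of x] mono[of x r0] r0 that by (cases "x \<le> c") auto
    have gt: "wgap f t s \<phi> x > 0" if "r0 < x" "x < pi" for x
      using outer[of x] mono[of r0 x] r0 that by (cases "pi - c \<le> x") auto
    have hit: "hit f t s \<phi> = r0"
      unfolding hit_def
    proof (rule the_equality)
      show "0 < r0 \<and> r0 < pi \<and> wgap f t s \<phi> r0 = 0" using r0' r0 c by auto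
      show "\<beta> = r0" if "0 < \<beta> \<and> \<beta> < pi \<and> wgap f t s \<phi> \<beta> = 0" for \<beta>
        using that lt[of \<beta>] gt[of \<beta>] by (cases \<beta> r0 rule: linorder_cases) auto
    qed
    show ?thesis
      unfolding root_prop_def hit
    proof (intro conjI allI impI iffI)
      show "0 < r0" "r0 < pi" using r0' c by auto
      show "0 < wgap_b f f' t s \<phi> r0" using mid r0 by simp
      fix x assume x: "0 < x \<and> x < pi"
      show "0 < wy2 f t s \<phi> x" using x y2 by simp
      show "x < r0" if "wgap f t s \<phi> x < 0" using that gt[of x] r0 x by (cases x r0 rule: linorder_cases) auto
      show "wgap f t s \<phi> x < 0" if "x < r0" using that x lt by simp
      show "r0 < x" if "wgap f t s \<phi> x > 0" using that lt[of x] r0 x by (cases x r0 rule: linorder_cases) auto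
      show "wgap f t s \<phi> x > 0" if "r0 < x" using that x gt by simp
    qed
  qed
  show thesis by (rule that[OF \<tau>(1,2) main])
qed

end

lemma hit_disc:
  assumes "0 < s" "s < 2"
  shows "hit f 0 s \<phi> = arccos (s / 2)"
proof -
  have eq: "wgap f 0 s \<phi> \<beta> = sqrt (1 + s * (s - 2 * cos \<beta>)) - 1" for \<beta>
  proof -
    have "(cos \<beta> - s)\<^sup>2 + (sin \<beta>)\<^sup>2 = 1 + s * (s - 2 * cos \<beta>)"
      using sin_cos_squared_add[of \<beta>] by (simp add: power2_eq_square algebra_simps)
    then show ?thesis by (simp add: wgap_def wn_def wy1_def wy2_def)
  qed
  have z: "wgap f 0 s \<phi> \<beta> = 0 \<longleftrightarrow> cos \<beta> = s / 2" for \<beta>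
    using assms by (auto simp: eq)
  show ?thesis
    unfolding hit_def z
  proof (rule the_equality)
    show "0 < arccos (s / 2) \<and> arccos (s / 2) < pi \<and> cos (arccos (s / 2)) = s / 2"
      using assms arccos_lt_bounded[of "s / 2"] by simp
    show "\<beta> = arccos (s / 2)" if "0 < \<beta> \<and> \<beta> < pi \<and> cos \<beta> = s / 2" for \<beta>
      using that by (metis arccos_cos less_imp_le)
  qed
qed

text \<open>At the crossing the shifted point is the mirror image (- cos \<alpha>, sin \<alpha>), of
  length 1 and angle pi - \<alpha>. Every f' is multiplied by t = 0, so only the two values of f at
  the crossing directions remain.\<close>

lemma wgap_partials_disc:
  assumes "0 < \<alpha>" "\<alpha> < pi / 2" "s = 2 * cos \<alpha>"
  shows "wgap_t f f' 0 s \<phi> \<alpha> = - f (\<phi> + \<alpha>) * cos (2 * \<alpha>) - f (\<phi> + (pi - \<alpha>))"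
    "wgap_s f f' 0 s \<phi> \<alpha> = cos \<alpha>" "wgap_b f f' 0 s \<phi> \<alpha> = sin (2 * \<alpha>)"
proof -
  have sp: "0 < sin \<alpha>" using assms by (intro sin_gt_zero) auto
  have y1: "wy1 f 0 s \<phi> \<alpha> = - cos \<alpha>" and y2: "wy2 f 0 s \<phi> \<alpha> = sin \<alpha>" using assms by (simp_all add: wy1_def wy2_def)
  have n: "wn f 0 s \<phi> \<alpha> = 1" by (simp add: wn_def y1 y2)
  have a: "wang f 0 s \<phi> \<alpha> = pi - \<alpha>"
  proof -
    have "arctan (- cos \<alpha> / sin \<alpha>) = \<alpha> - pi / 2"
    proof (rule arctan_unique)
      show "- (pi / 2) < \<alpha> - pi / 2" "\<alpha> - pi / 2 < pi / 2" using assms by auto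
      show "tan (\<alpha> - pi / 2) = - cos \<alpha> / sin \<alpha>" by (simp add: tan_def sin_diff cos_diff)
    qed
    then show ?thesis by (simp add: wang_def y1 y2)
  qed
  show "wgap_t f f' 0 s \<phi> \<alpha> = - f (\<phi> + \<alpha>) * cos (2 * \<alpha>) - f (\<phi> + (pi - \<alpha>))"
  proof -
    have c: "cos (2 * \<alpha>) = cos \<alpha> * cos \<alpha> - sin \<alpha> * sin \<alpha>" by (simp add: cos_double power2_eq_square)
    show ?thesis unfolding wgap_t_def wpart_def y1 y2 n a c by (simp add: algebra_simps)
  qed
  show "wgap_s f f' 0 s \<phi> \<alpha> = cos \<alpha>" by (simp add: wgap_s_def wpart_def y1 y2 n)
  show "wgap_b f f' 0 s \<phi> \<alpha> = sin (2 * \<alpha>)" by (simp add: wgap_b_def wpart_def y1 y2 n sin_double)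
qed

section \<open>The area function of the perturbed disc\<close>

definition rot2 :: "real \<Rightarrow> real ^ 2 \<Rightarrow> real ^ 2" where
  "rot2 \<phi> v = v $ 1 *\<^sub>R cis2 \<phi> + v $ 2 *\<^sub>R cis2 (\<phi> + pi / 2)"

text \<open>Exchanges the half planes, so that the crossing below the axis can be treated as an
  upper crossing of the reflected radial function.\<close>

definition refl2 :: "real ^ 2 \<Rightarrow> real ^ 2" where
  "refl2 v = vector [v $ 1, - v $ 2]"

lemma rot2_cis2 [simp]: "rot2 \<phi> (cis2 \<beta>) = cis2 (\<phi> + \<beta>)"
  by (simp add: rot2_def vec2_eq_iff cos_add sin_add algebra_simps)

lemma rot2_nth: "rot2 \<phi> v $ 1 = v $ 1 * cos \<phi> - v $ 2 * sin \<phi>" "rot2 \<phi> v $ 2 = v $ 1 * sin \<phi> + v $ 2 * cos \<phi>"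
  by (simp_all add: rot2_def cos_add sin_add)

lemma norm_rot2 [simp]: "norm (rot2 \<phi> v) = norm v"
proof -
  have "(rot2 \<phi> v $ 1)\<^sup>2 + (rot2 \<phi> v $ 2)\<^sup>2 = (v $ 1)\<^sup>2 + (v $ 2)\<^sup>2"
    unfolding rot2_nth using sin_cos_squared_add[of \<phi>] by algebra
  then show ?thesis by (simp add: norm_vec2)
qed

lemma linear_rot2: "linear (rot2 \<phi>)"
  by (rule linearI) (simp_all add: vec2_eq_iff rot2_nth algebra_simps)

lemma rot2_minus: "rot2 \<phi> (- v) = rot2 (\<phi> + pi) v"
  by (simp add: vec2_eq_iff rot2_nth)

lemma rot2_inverse: "rot2 \<phi> (rot2 (- \<phi>) v) = v"
proof -
  have "v $ 1 * cos \<phi> * cos \<phi> + v $ 1 * sin \<phi> * sin \<phi> = v $ 1" "v $ 2 * cos \<phi> * cos \<phi> + v $ 2 * sin \<phi> * sin \<phi> = v $ 2"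
    using sin_cos_squared_add[of \<phi>] by algebra+
  then show ?thesis by (simp add: vec2_eq_iff rot2_nth algebra_simps)
qed

lemma continuous_on_rot2: "continuous_on S (rot2 \<phi>)"
  by (intro linear_continuous_on linear_conv_bounded_linear[THEN iffD1] linear_rot2)

lemma refl2_nth [simp]: "refl2 v $ 1 = v $ 1" "refl2 v $ 2 = - v $ 2"
  by (simp_all add: refl2_def)

lemma refl2_cis2: "refl2 (cis2 \<beta>) = cis2 (- \<beta>)"
  by (simp add: vec2_eq_iff)

lemma norm_refl2 [simp]: "norm (refl2 v) = norm v"
  by (simp add: norm_vec2)

lemma refl2_scaleR: "refl2 (c *\<^sub>R v) = c *\<^sub>R refl2 v"
  by (simp add: vec2_eq_iff)

lemma refl2_eq_0 [simp]: "refl2 v = 0 \<longleftrightarrow> v = 0"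
  by (metis norm_eq_zero norm_refl2)

lemma shift_refl:
  "in_shift \<sigma> (- \<beta>) \<longleftrightarrow> in_shift (\<sigma> \<circ> refl2) \<beta>"
  "on_shift \<sigma> (- \<beta>) \<longleftrightarrow> on_shift (\<sigma> \<circ> refl2) \<beta>"
proof -
  have z: "\<sigma> (cis2 (- \<beta>)) *\<^sub>R cis2 (- \<beta>) - cis2 0 = refl2 ((\<sigma> \<circ> refl2) (cis2 \<beta>) *\<^sub>R cis2 \<beta> - cis2 0)"
    by (simp add: refl2_cis2 vec2_eq_iff)
  show "in_shift \<sigma> (- \<beta>) \<longleftrightarrow> in_shift (\<sigma> \<circ> refl2) \<beta>"
    unfolding in_shift_def z by (simp add: radial_region_def refl2_scaleR)
  show "on_shift \<sigma> (- \<beta>) \<longleftrightarrow> on_shift (\<sigma> \<circ> refl2) \<beta>"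
    unfolding on_shift_def z by (simp add: Let_def refl2_scaleR)
qed

text \<open>Division by \<open>s\<close> normalises the shift to length one: the shifted boundary
  point is (\<open>wy1\<close>, \<open>wy2\<close>) / s, and both sides of the membership condition
  scale alike.\<close>

lemma shift_iff_wgap:
  assumes s: "0 < s" and \<sigma>: "\<And>\<beta>. \<sigma> (cis2 \<beta>) = (1 + t * f (\<phi> + \<beta>)) / s" and pos: "0 < wy2 f t s \<phi> \<beta>"
  shows "in_shift \<sigma> \<beta> \<longleftrightarrow> wgap f t s \<phi> \<beta> \<le> 0" "on_shift \<sigma> \<beta> \<longleftrightarrow> wgap f t s \<phi> \<beta> = 0"
proof -
  define z where "z = \<sigma> (cis2 \<beta>) *\<^sub>R cis2 \<beta> - cis2 0"
  have z12: "z $ 1 = wy1 f t s \<phi> \<beta> / s" "z $ 2 = wy2 f t s \<phi> \<beta> / s"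
    using s by (simp_all add: z_def \<sigma> wy1_def wy2_def field_simps)
  have z0: "z \<noteq> 0"
  proof
    assume "z = 0"
    then have "wy2 f t s \<phi> \<beta> / s = 0" using z12 by simp
    then show False using pos s by simp
  qed
  have nz: "norm z = wn f t s \<phi> \<beta> / s"
  proof -
    have "(z $ 1)\<^sup>2 + (z $ 2)\<^sup>2 = ((wy1 f t s \<phi> \<beta>)\<^sup>2 + (wy2 f t s \<phi> \<beta>)\<^sup>2) / s\<^sup>2"
      by (simp add: z12 power_divide add_divide_distrib)
    then show ?thesis using s by (simp add: norm_vec2 wn_def real_sqrt_divide)
  qed
  have n: "0 < wn f t s \<phi> \<beta>" by (rule wn_pos[OF pos])
  have dir: "z /\<^sub>R norm z = cis2 (wang f t s \<phi> \<beta>)"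
  proof -
    let ?q = "wy1 f t s \<phi> \<beta> / wy2 f t s \<phi> \<beta>"
    have sq: "sqrt (1 + ?q\<^sup>2) = wn f t s \<phi> \<beta> / wy2 f t s \<phi> \<beta>"
    proof -
      have "1 + ?q\<^sup>2 = ((wy1 f t s \<phi> \<beta>)\<^sup>2 + (wy2 f t s \<phi> \<beta>)\<^sup>2) / (wy2 f t s \<phi> \<beta>)\<^sup>2"
        using pos by (simp add: power_divide field_simps)
      then show ?thesis using pos by (simp add: wn_def real_sqrt_divide)
    qed
    have "cos (pi / 2 - arctan ?q) = wy1 f t s \<phi> \<beta> / wn f t s \<phi> \<beta>"
      using pos n by (simp add: cos_diff sin_arctan sq)
    moreover have "sin (pi / 2 - arctan ?q) = wy2 f t s \<phi> \<beta> / wn f t s \<phi> \<beta>"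
      using pos n by (simp add: sin_diff cos_arctan sq)
    ultimately show ?thesis using s n by (simp add: vec2_eq_iff wang_def z12 nz)
  qed
  have val: "\<sigma> (z /\<^sub>R norm z) = (1 + t * f (\<phi> + wang f t s \<phi> \<beta>)) / s" unfolding dir by (rule \<sigma>)
  have mem: "z \<in> radial_region \<sigma> \<longleftrightarrow> norm z \<le> \<sigma> (z /\<^sub>R norm z)" using z0 by (simp add: radial_region_def)
  have "z \<in> radial_region \<sigma> \<longleftrightarrow> wn f t s \<phi> \<beta> \<le> 1 + t * f (\<phi> + wang f t s \<phi> \<beta>)"
    unfolding mem val unfolding nz using s by (simp add: divide_le_cancel)
  then show "in_shift \<sigma> \<beta> \<longleftrightarrow> wgap f t s \<phi> \<beta> \<le> 0"
    unfolding in_shift_def z_def[symmetric] wgap_def by linarith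
  have "norm z = \<sigma> (z /\<^sub>R norm z) \<longleftrightarrow> wn f t s \<phi> \<beta> = 1 + t * f (\<phi> + wang f t s \<phi> \<beta>)"
    unfolding val unfolding nz using s by simp
  then show "on_shift \<sigma> \<beta> \<longleftrightarrow> wgap f t s \<phi> \<beta> = 0"
    unfolding on_shift_def z_def[symmetric] Let_def wgap_def using z0 by auto
qed

definition roots_prop :: "(real \<Rightarrow> real) \<Rightarrow> (real \<Rightarrow> real) \<Rightarrow> real \<Rightarrow> real \<Rightarrow> real \<Rightarrow> bool" where
  "roots_prop f f' t s \<phi> \<longleftrightarrow> root_prop f f' t s \<phi> \<and> root_prop (\<lambda>x. f (- x)) (\<lambda>x. - f' (- x)) t s (- \<phi>)"

text \<open>The crossing below the axis lies at the relative angle \<open>- hitm\<close>; it is the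
  upper crossing of the data reflected in the axis.\<close>

definition hitm :: "(real \<Rightarrow> real) \<Rightarrow> real \<Rightarrow> real \<Rightarrow> real \<Rightarrow> real" where
  "hitm f t s \<phi> = hit (\<lambda>x. f (- x)) t s (- \<phi>)"

text \<open>The upper half plane is settled by \<open>shift_iff_wgap\<close>, the lower one by the
  same lemma after \<open>refl2\<close>. At the three excluded angles the boundary point is on the
  axis; they are null for the integrals and harmless for finiteness.\<close>

lemma shift_structure:
  assumes s: "0 < s" and \<sigma>: "\<And>\<beta>. \<sigma> (cis2 \<beta>) = (1 + t * f (\<phi> + \<beta>)) / s" and rp: "roots_prop f f' t s \<phi>"
    and \<beta>: "\<beta> \<in> {-pi..pi} - {-pi, 0, pi}"
  shows "in_shift \<sigma> \<beta> \<longleftrightarrow> \<beta> \<in> {- hitm f t s \<phi> .. hit f t s \<phi>}"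
    "on_shift \<sigma> \<beta> \<longleftrightarrow> \<beta> = - hitm f t s \<phi> \<or> \<beta> = hit f t s \<phi>"
proof -
  have rp1: "root_prop f f' t s \<phi>" and rp2: "root_prop (\<lambda>x. f (- x)) (\<lambda>x. - f' (- x)) t s (- \<phi>)"
    using rp by (auto simp: roots_prop_def)
  have h: "0 < hit f t s \<phi>" "0 < hitm f t s \<phi>" using rp1 rp2 by (auto simp: root_prop_def hitm_def)
  consider "0 < \<beta>" "\<beta> < pi" | "0 < - \<beta>" "- \<beta> < pi" using \<beta> by fastforce
  then have "(in_shift \<sigma> \<beta> \<longleftrightarrow> \<beta> \<in> {- hitm f t s \<phi> .. hit f t s \<phi>}) \<and>
    (on_shift \<sigma> \<beta> \<longleftrightarrow> \<beta> = - hitm f t s \<phi> \<or> \<beta> = hit f t s \<phi>)"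
  proof cases
    case 1
    then have p: "0 < wy2 f t s \<phi> \<beta>" "wgap f t s \<phi> \<beta> < 0 \<longleftrightarrow> \<beta> < hit f t s \<phi>" "wgap f t s \<phi> \<beta> > 0 \<longleftrightarrow> hit f t s \<phi> < \<beta>"
      using rp1 unfolding root_prop_def by blast+
    show ?thesis
      using shift_iff_wgap[OF s \<sigma> p(1)] p(2,3) h 1 by auto
  next
    case 2
    let ?g = "\<lambda>x. f (- x)"
    have p: "0 < wy2 ?g t s (- \<phi>) (- \<beta>)" "wgap ?g t s (- \<phi>) (- \<beta>) < 0 \<longleftrightarrow> - \<beta> < hitm f t s \<phi>"
      "wgap ?g t s (- \<phi>) (- \<beta>) > 0 \<longleftrightarrow> hitm f t s \<phi> < - \<beta>"
      using rp2 2 unfolding root_prop_def hitm_def by blast+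
    define \<tau> where "\<tau> = \<sigma> \<circ> refl2"
    have "\<tau> (cis2 b) = (1 + t * ?g (- \<phi> + b)) / s" for b
      using \<sigma>[of "- b"] by (simp add: refl2_cis2 \<tau>_def)
    note A = shift_iff_wgap[OF s this p(1)]
    have "in_shift \<sigma> \<beta> \<longleftrightarrow> in_shift \<tau> (- \<beta>)" "on_shift \<sigma> \<beta> \<longleftrightarrow> on_shift \<tau> (- \<beta>)"
      using shift_refl[of \<sigma> "- \<beta>"] by (simp_all add: \<tau>_def)
    then show ?thesis using A p(2,3) h 2 by auto
  qed
  then show "in_shift \<sigma> \<beta> \<longleftrightarrow> \<beta> \<in> {- hitm f t s \<phi> .. hit f t s \<phi>}"
    "on_shift \<sigma> \<beta> \<longleftrightarrow> \<beta> = - hitm f t s \<phi> \<or> \<beta> = hit f t s \<phi>" by blast+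
qed

lemma on_shift_finite:
  assumes "0 < s" "\<And>\<beta>. \<sigma> (cis2 \<beta>) = (1 + t * f (\<phi> + \<beta>)) / s" "roots_prop f f' t s \<phi>"
  shows "finite {\<theta> \<in> {-pi..pi}. on_shift \<sigma> \<theta>}"
proof (rule finite_subset)
  show "{\<theta> \<in> {-pi..pi}. on_shift \<sigma> \<theta>} \<subseteq> {-pi, 0, pi, - hitm f t s \<phi>, hit f t s \<phi>}"
    using shift_structure(2)[OF assms] by auto
qed simp

lemma shift_integral_eq:
  assumes "0 < s" "\<And>\<beta>. \<sigma> (cis2 \<beta>) = (1 + t * f (\<phi> + \<beta>)) / s" and rp: "roots_prop f f' t s \<phi>"
    and \<sigma>: "continuous_on (sphere 0 1) \<sigma>" and \<psi>: "continuous_on (sphere 0 1) \<psi>"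
  shows "shift_integral \<sigma> \<psi> = integral {- hitm f t s \<phi> .. hit f t s \<phi>} (\<lambda>\<beta>. \<sigma> (cis2 \<beta>) * \<psi> (cis2 \<beta>))"
proof -
  have h: "0 < hit f t s \<phi>" "hit f t s \<phi> < pi" "0 < hitm f t s \<phi>" "hitm f t s \<phi> < pi"
    using rp by (auto simp: roots_prop_def root_prop_def hitm_def)
  have "shift_integral \<sigma> \<psi> = (LBINT \<beta>:{- hitm f t s \<phi> .. hit f t s \<phi>}. \<sigma> (cis2 \<beta>) * \<psi> (cis2 \<beta>))"
    unfolding shift_integral_def set_lebesgue_integral_def
  proof (rule integral_discrete_difference[of "{-pi, 0, pi}"])
    fix \<beta> :: real assume "\<beta> \<notin> {-pi, 0, pi}"
    then show "indicat_real {-pi..pi} \<beta> *\<^sub>R (indicat_real {\<theta>. in_shift \<sigma> \<theta>} \<beta> * \<sigma> (cis2 \<beta>) * \<psi> (cis2 \<beta>)) =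
       indicat_real {- hitm f t s \<phi> .. hit f t s \<phi>} \<beta> *\<^sub>R (\<sigma> (cis2 \<beta>) * \<psi> (cis2 \<beta>))"
      using shift_structure(1)[OF assms(1-3), of \<beta>] h
      by (cases "\<beta> \<in> {-pi..pi}") (auto simp: indicator_def)
  qed auto
  also have "\<dots> = integral {- hitm f t s \<phi> .. hit f t s \<phi>} (\<lambda>\<beta>. \<sigma> (cis2 \<beta>) * \<psi> (cis2 \<beta>))"
    by (intro set_borel_integral_eq_integral(2) borel_integrable_atLeastAtMost' continuous_intros angle_continuous \<sigma> \<psi>)
  finally show ?thesis .
qed

text \<open>\<open>f\<close> is the radial perturbation in the angular coordinate. The primitives
  \<open>F1\<close> and \<open>F2\<close> of f and f^2 turn arc integrals into explicit functions of
  the end points, to which the chain rule applies.\<close>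

locale perturbed = c1_periodic +
  fixes P :: "real ^ 2 \<Rightarrow> real" and F1 F2 :: "real \<Rightarrow> real"
  assumes contP: "continuous_on (sphere 0 1) P"
    and fP: "\<And>x. f x = P (cis2 x)"
    and F1: "\<And>x. (F1 has_real_derivative f x) (at x)"
    and F2: "\<And>x. (F2 has_real_derivative (f x)\<^sup>2) (at x)"
begin

definition KK :: "real \<Rightarrow> (real ^ 2) set" where
  "KK t = radial_region (\<lambda>v. 1 + t * P v)"

definition GG :: "real \<Rightarrow> real \<Rightarrow> real \<Rightarrow> real" where
  "GG t s \<phi> = measure lebesgue (KK t \<inter> (\<lambda>y. y + s *\<^sub>R cis2 \<phi>) ` KK t)"

text \<open>The integral of (1 + t f)^2 over the arc from \<open>\<phi> - hitm\<close> to
  \<open>\<phi> + hit\<close>, which is twice the area of the sector under that arc. Likewise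
  \<open>arcC\<close> is the integral of f (1 + t f).\<close>

definition arcB :: "real \<Rightarrow> real \<Rightarrow> real \<Rightarrow> real" where
  "arcB t s \<phi> = hit f t s \<phi> + hitm f t s \<phi> + 2 * t * (F1 (\<phi> + hit f t s \<phi>) - F1 (\<phi> - hitm f t s \<phi>))
     + t\<^sup>2 * (F2 (\<phi> + hit f t s \<phi>) - F2 (\<phi> - hitm f t s \<phi>))"

definition arcC :: "real \<Rightarrow> real \<Rightarrow> real \<Rightarrow> real" where
  "arcC t s \<phi> = (F1 (\<phi> + hit f t s \<phi>) - F1 (\<phi> - hitm f t s \<phi>))
     + t * (F2 (\<phi> + hit f t s \<phi>) - F2 (\<phi> - hitm f t s \<phi>))"

text \<open>\<open>CC\<close> is the derivative of \<open>GG\<close> in \<open>t\<close>, while the derivative in \<open>s\<close> is \<open>(2 * GG - BB) / s\<close>.\<close>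

definition BB where "BB t s \<phi> = arcB t s \<phi> + arcB t s (\<phi> + pi)"

definition CC where "CC t s \<phi> = arcC t s \<phi> + arcC t s (\<phi> + pi)"

lemma P_bound: "v \<in> sphere 0 1 \<Longrightarrow> \<bar>t * P v\<bar> \<le> \<bar>t\<bar> * bnd"
proof -
  assume "v \<in> sphere 0 1"
  then have "norm v = 1" by simp
  then obtain \<theta> where "v = cis2 \<theta>" by (rule sphere_cis2)
  then show ?thesis using tf_bound(1)[of t \<theta>] by (simp add: fP)
qed

lemma contP_rot: "continuous_on (sphere 0 1) (\<lambda>v. P (rot2 \<phi> v))"
  by (rule continuous_on_compose2[OF contP continuous_on_rot2]) auto

text \<open>Undoing a rotation by \<phi> and a dilation by \<open>s\<close> brings the translation
  to \<open>cis2 0\<close>. The radial function becomes a combination of 1 and the rotated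
  \<open>P\<close> with coefficients 1 / s and t / s, as in
  \<open>lens_area_has_derivative\<close>.\<close>

lemma KK_scale:
  assumes "0 < s"
  shows "KK t = (\<lambda>x. s *\<^sub>R rot2 \<phi> x) ` radial_region (\<lambda>v. 1 / s + t / s * P (rot2 \<phi> v))"
proof -
  have iff: "s *\<^sub>R rot2 \<phi> x \<in> KK t \<longleftrightarrow> x \<in> radial_region (\<lambda>v. 1 / s + t / s * P (rot2 \<phi> v))" for x
  proof (cases "x = 0")
    case True
    then show ?thesis by (simp add: KK_def radial_region_def rot2_def)
  next
    case False
    then have "rot2 \<phi> x \<noteq> 0" by (metis norm_eq_zero norm_rot2)
    moreover have "rot2 \<phi> (x /\<^sub>R norm x) = rot2 \<phi> x /\<^sub>R norm x" using linear_rot2 by (rule linear_cmul)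
    ultimately show ?thesis using False assms
      by (simp add: KK_def radial_region_def field_simps)
  qed
  show ?thesis
  proof (intro equalityI subsetI)
    fix y assume y: "y \<in> KK t"
    define x where "x = (1 / s) *\<^sub>R rot2 (- \<phi>) y"
    have "s *\<^sub>R rot2 \<phi> x = y"
      using assms linear_cmul[OF linear_rot2] by (simp add: x_def rot2_inverse)
    with y iff[of x] show "y \<in> (\<lambda>x. s *\<^sub>R rot2 \<phi> x) ` radial_region (\<lambda>v. 1 / s + t / s * P (rot2 \<phi> v))"
      by (intro image_eqI[of _ _ x]) auto
  qed (use iff in auto)
qed

lemma sigma_pos:
  assumes "0 < s" "\<bar>t\<bar> * bnd \<le> 1 / 2" "v \<in> sphere 0 1"
  shows "1 / (2 * s) \<le> 1 / s + t / s * P (rot2 \<phi> v)" "1 / s + t / s * P (rot2 \<phi> v) \<le> 3 / (2 * s)"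
proof -
  have "\<bar>t * P (rot2 \<phi> v)\<bar> \<le> 1 / 2" using P_bound[of "rot2 \<phi> v" t] assms by simp
  then have "1 / 2 \<le> 1 + t * P (rot2 \<phi> v)" "1 + t * P (rot2 \<phi> v) \<le> 3 / 2" by auto
  then show "1 / (2 * s) \<le> 1 / s + t / s * P (rot2 \<phi> v)" "1 / s + t / s * P (rot2 \<phi> v) \<le> 3 / (2 * s)"
    using assms(1) by (auto simp: field_simps)
qed

lemma cont_sigma: "continuous_on (sphere 0 1) (\<lambda>v. a + b * P (rot2 \<phi> v))"
  by (intro continuous_intros contP_rot)

lemma GG_lens:
  assumes s: "0 < s" and t: "\<bar>t\<bar> * bnd \<le> 1 / 2"
  shows "GG t s \<phi> = s\<^sup>2 * lens_area (\<lambda>v. 1 / s + t / s * P (rot2 \<phi> v))"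
proof -
  let ?L = "\<lambda>x. s *\<^sub>R rot2 \<phi> x" and ?X = "radial_region (\<lambda>v. 1 / s + t / s * P (rot2 \<phi> v))"
  have lin: "linear ?L" using linear_compose_scale_right[OF linear_rot2] .
  have inj: "inj ?L"
  proof (rule injI)
    fix x y assume "s *\<^sub>R rot2 \<phi> x = s *\<^sub>R rot2 \<phi> y"
    then have "rot2 \<phi> (x - y) = 0" using s by (simp add: linear_diff[OF linear_rot2])
    then show "x = y" by (metis norm_eq_zero norm_rot2 right_minus_eq)
  qed
  have sh: "(\<lambda>y. y + s *\<^sub>R cis2 \<phi>) ` ?L ` ?X = ?L ` (\<lambda>y. y + cis2 0) ` ?X"
    unfolding image_image by (intro image_cong refl) (simp add: linear_add[OF linear_rot2] scaleR_add_right)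
  have "KK t \<inter> (\<lambda>y. y + s *\<^sub>R cis2 \<phi>) ` KK t = ?L ` (?X \<inter> (\<lambda>y. y + cis2 0) ` ?X)"
    unfolding KK_scale[OF s, of t \<phi>] sh by (rule image_Int[OF inj, symmetric])
  moreover have "compact (?X \<inter> (\<lambda>y. y + cis2 0) ` ?X)"
  proof -
    have "compact ?X"
      using sigma_pos(1)[OF s t] s by (intro compact_radial_region cont_sigma) (meson divide_pos_pos less_imp_le order_trans zero_less_mult_iff zero_less_numeral zero_less_one)
    then show ?thesis by (intro compact_Int compact_continuous_image continuous_intros)
  qed
  ultimately have "GG t s \<phi> = \<bar>det (matrix ?L)\<bar> * measure lebesgue (?X \<inter> (\<lambda>y. y + cis2 0) ` ?X)"
    unfolding GG_def using measure_linear_image[OF lin lmeasurable_compact] by simp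
  moreover have "det (matrix ?L) = s\<^sup>2"
  proof -
    have "det (matrix ?L) = s * s * ((sin \<phi>)\<^sup>2 + (cos \<phi>)\<^sup>2)"
      unfolding det_2 matrix_def by (simp add: rot2_nth axis_def power2_eq_square algebra_simps del: sin_cos_squared_add sin_cos_squared_add2 sin_cos_squared_add3)
    then show ?thesis unfolding sin_cos_squared_add by (simp add: power2_eq_square)
  qed
  ultimately show ?thesis by (simp add: lens_area_def)
qed

lemma arc_integrals:
  assumes s: "0 < s" and rp: "roots_prop f f' t s \<phi>"
  shows "s * shift_integral (\<lambda>v. 1 / s + t / s * P (rot2 \<phi> v)) (\<lambda>_. 1) + t * shift_integral (\<lambda>v. 1 / s + t / s * P (rot2 \<phi> v)) (\<lambda>v. s * P (rot2 \<phi> v)) = arcB t s \<phi>"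
    "shift_integral (\<lambda>v. 1 / s + t / s * P (rot2 \<phi> v)) (\<lambda>v. s * P (rot2 \<phi> v)) = arcC t s \<phi>"
proof -
  let ?\<sigma> = "\<lambda>v. 1 / s + t / s * P (rot2 \<phi> v)"
  have \<sigma>: "?\<sigma> (cis2 \<beta>) = (1 + t * f (\<phi> + \<beta>)) / s" for \<beta> by (simp add: fP add_divide_distrib)
  let ?a = "- hitm f t s \<phi>" and ?b = "hit f t s \<phi>"
  have ab: "?a \<le> ?b" using rp by (auto simp: roots_prop_def root_prop_def hitm_def)
  have D1: "((\<lambda>b. F1 (\<phi> + b)) has_real_derivative f (\<phi> + x)) (at x)" for x
    using DERIV_shift[of F1 "f (\<phi> + x)" x \<phi>] F1[of "\<phi> + x"] by (simp add: add.commute)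
  have D2: "((\<lambda>b. F2 (\<phi> + b)) has_real_derivative (f (\<phi> + x))\<^sup>2) (at x)" for x
    using DERIV_shift[of F2 "(f (\<phi> + x))\<^sup>2" x \<phi>] F2[of "\<phi> + x"] by (simp add: add.commute)
  have e1: "shift_integral ?\<sigma> (\<lambda>_. 1) = (1 / s) * (?b - ?a + t * (F1 (\<phi> + ?b) - F1 (\<phi> + ?a)))"
  proof -
    have "((\<lambda>x. (1 + t * f (\<phi> + x)) / s * 1) has_integral ((1 / s) * (?b + t * F1 (\<phi> + ?b)) - (1 / s) * (?a + t * F1 (\<phi> + ?a)))) {?a..?b}"
    proof (rule fundamental_theorem_of_calculus[OF ab])
      fix x assume "x \<in> {?a..?b}"
      have "((\<lambda>b. (1 / s) * (b + t * F1 (\<phi> + b))) has_real_derivative (1 / s) * (1 + t * f (\<phi> + x))) (at x)"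
        using s by (auto intro!: derivative_eq_intros D1)
      then show "((\<lambda>b. (1 / s) * (b + t * F1 (\<phi> + b))) has_vector_derivative (1 + t * f (\<phi> + x)) / s * 1) (at x within {?a..?b})"
        by (simp add: has_real_derivative_iff_has_vector_derivative[symmetric] has_field_derivative_at_within)
    qed
    note A = integral_unique[OF this]
    show ?thesis
      unfolding shift_integral_eq[OF s \<sigma> rp cont_sigma continuous_on_const] \<sigma>
      by (rule trans[OF A]) (simp add: algebra_simps)
  qed
  have e2: "shift_integral ?\<sigma> (\<lambda>v. s * P (rot2 \<phi> v)) = (F1 (\<phi> + ?b) - F1 (\<phi> + ?a)) + t * (F2 (\<phi> + ?b) - F2 (\<phi> + ?a))"
  proof -
    have "((\<lambda>x. (1 + t * f (\<phi> + x)) / s * (s * f (\<phi> + x))) has_integral ((F1 (\<phi> + ?b) + t * F2 (\<phi> + ?b)) - (F1 (\<phi> + ?a) + t * F2 (\<phi> + ?a)))) {?a..?b}"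
    proof (rule fundamental_theorem_of_calculus[OF ab])
      fix x assume "x \<in> {?a..?b}"
      have "((\<lambda>b. F1 (\<phi> + b) + t * F2 (\<phi> + b)) has_real_derivative f (\<phi> + x) + t * (f (\<phi> + x))\<^sup>2) (at x)"
        by (auto intro!: derivative_eq_intros D1 D2)
      moreover have "f (\<phi> + x) + t * (f (\<phi> + x))\<^sup>2 = (1 + t * f (\<phi> + x)) / s * (s * f (\<phi> + x))"
        using s by (simp add: power2_eq_square field_simps)
      ultimately show "((\<lambda>b. F1 (\<phi> + b) + t * F2 (\<phi> + b)) has_vector_derivative (1 + t * f (\<phi> + x)) / s * (s * f (\<phi> + x))) (at x within {?a..?b})"
        by (simp add: has_real_derivative_iff_has_vector_derivative[symmetric] has_field_derivative_at_within)
    qed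
    note A = integral_unique[OF this]
    have c: "continuous_on (sphere 0 1) (\<lambda>v. s * P (rot2 \<phi> v))" by (intro continuous_intros contP_rot)
    show ?thesis
      unfolding shift_integral_eq[OF s \<sigma> rp cont_sigma c] unfolding \<sigma> unfolding rot2_cis2 fP[symmetric]
      by (rule trans[OF A]) (simp add: algebra_simps)
  qed
  show "shift_integral ?\<sigma> (\<lambda>v. s * P (rot2 \<phi> v)) = arcC t s \<phi>"
    unfolding e2 arcC_def by simp
  show "s * shift_integral ?\<sigma> (\<lambda>_. 1) + t * shift_integral ?\<sigma> (\<lambda>v. s * P (rot2 \<phi> v)) = arcB t s \<phi>"
    unfolding e1 e2 arcB_def using s by (simp add: field_simps power2_eq_square)
qed

text \<open>The area is s^2 times the lens area at (1 / s, t / s). In the derivative with respect to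
  \<open>s\<close>, the factor gives 2 G / s, and the two parameters give - (B + t C), where B and C
  are the partial derivatives of the lens area; s (B + t C) reassembles to
  \<open>BB\<close>.\<close>

lemma GG_has_derivative:
  assumes s: "0 < s" and t: "\<bar>t\<bar> * bnd < 1 / 2" and rp: "roots_prop f f' t s \<phi>" "roots_prop f f' t s (\<phi> + pi)"
  shows "((\<lambda>(t, s). GG t s \<phi>) has_derivative (\<lambda>(a, b). CC t s \<phi> * a + (2 * GG t s \<phi> - BB t s \<phi>) / s * b)) (at (t, s))"
proof -
  let ?p = "\<lambda>v. P (rot2 \<phi> v)"
  have pm: "?p (- v) = P (rot2 (\<phi> + pi) v)" for v by (simp add: rot2_minus)
  have val: "(1 / s + t / s * P (rot2 \<phi> (cis2 \<beta>))) = (1 + t * f (\<phi> + \<beta>)) / s" for \<phi> \<beta>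
    by (simp add: fP add_divide_distrib)
  define B C where "B = shift_integral (\<lambda>v. 1 / s + t / s * ?p v) (\<lambda>_. 1) + shift_integral (\<lambda>v. 1 / s + t / s * ?p (- v)) (\<lambda>_. 1)"
    and "C = shift_integral (\<lambda>v. 1 / s + t / s * ?p v) ?p + shift_integral (\<lambda>v. 1 / s + t / s * ?p (- v)) (\<lambda>v. ?p (- v))"
  have D: "((\<lambda>(a, b). lens_area (\<lambda>v. a + b * ?p v)) has_derivative (\<lambda>(a, b). a * B + b * C)) (at (1 / s, t / s))"
    unfolding B_def C_def
  proof (rule lens_area_has_derivative[OF contP_rot])
    show "0 < 1 / s + t / s * P (rot2 \<phi> v)" if "v \<in> sphere 0 1" for v
      using sigma_pos(1)[OF s _ that, of t \<phi>] t s by (smt (verit) divide_pos_pos)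
    show "finite {\<theta> \<in> {-pi..pi}. on_shift (\<lambda>v. 1 / s + t / s * P (rot2 \<phi> v)) \<theta>}"
      by (rule on_shift_finite[OF s val rp(1)])
    show "finite {\<theta> \<in> {-pi..pi}. on_shift (\<lambda>v. 1 / s + t / s * P (rot2 \<phi> (- v))) \<theta>}"
      unfolding pm by (rule on_shift_finite[OF s val rp(2)])
  qed
  have sC: "s * C = CC t s \<phi>"
  proof -
    have mul: "shift_integral \<sigma> (\<lambda>v. s * q v) = s * shift_integral \<sigma> q" for \<sigma> q
      unfolding shift_integral_def by (simp add: mult.left_commute[of _ s] flip: set_integral_mult_right)
    show ?thesis
      using arc_integrals(2)[OF s rp(1)] arc_integrals(2)[OF s rp(2)]
      unfolding C_def pm mul CC_def by (simp add: distrib_left)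
  qed
  have sB: "s * B + t * (s * C) = BB t s \<phi>"
  proof -
    have "s * C = arcC t s \<phi> + arcC t s (\<phi> + pi)" using sC by (simp add: CC_def)
    then show ?thesis
      using arc_integrals(1)[OF s rp(1)] arc_integrals(1)[OF s rp(2)] arc_integrals(2)[OF s rp(1)] arc_integrals(2)[OF s rp(2)]
      unfolding B_def pm BB_def by (simp add: distrib_left)
  qed
  have fst': "((\<lambda>p. fst p :: real) has_derivative (\<lambda>p. fst p)) F" for F :: "(real \<times> real) filter"
    by (rule has_derivative_fst[OF has_derivative_ident])
  have snd': "((\<lambda>p. snd p :: real) has_derivative (\<lambda>p. snd p)) F" for F :: "(real \<times> real) filter"
    by (rule has_derivative_snd[OF has_derivative_ident])
  have inner: "((\<lambda>p. (1 / snd p, fst p / snd p)) has_derivative (\<lambda>h. (- snd h / (s * s), fst h / s - t * snd h / (s * s)))) (at (t, s))"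
  proof (rule has_derivative_Pair)
    show "((\<lambda>p. 1 / snd p) has_derivative (\<lambda>h. - snd h / (s * s))) (at (t, s))"
      by (rule has_derivative_eq_rhs[OF has_derivative_divide'[OF has_derivative_const snd']]) (use s in simp_all)
    show "((\<lambda>p. fst p / snd p) has_derivative (\<lambda>h. fst h / s - t * snd h / (s * s))) (at (t, s))"
      by (rule has_derivative_eq_rhs[OF has_derivative_divide'[OF fst' snd']]) (use s in \<open>simp_all add: fun_eq_iff diff_divide_distrib\<close>)
  qed
  have D': "((\<lambda>(a, b). lens_area (\<lambda>v. a + b * ?p v)) has_derivative (\<lambda>(a, b). a * B + b * C)) (at ((\<lambda>p. (1 / snd p, fst p / snd p)) (t, s)))"
    using D by simp
  have comp: "((\<lambda>p. lens_area (\<lambda>v. 1 / snd p + fst p / snd p * ?p v)) has_derivative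
      (\<lambda>h. (- snd h / (s * s)) * B + (fst h / s - t * snd h / (s * s)) * C)) (at (t, s))"
    using has_derivative_compose[OF inner D'] by (simp add: case_prod_beta')
  have full: "((\<lambda>p. (snd p)\<^sup>2 * lens_area (\<lambda>v. 1 / snd p + fst p / snd p * ?p v)) has_derivative
      (\<lambda>h. CC t s \<phi> * fst h + (2 * GG t s \<phi> - BB t s \<phi>) / s * snd h)) (at (t, s))"
  proof (rule has_derivative_eq_rhs[OF has_derivative_mult[OF has_derivative_power[OF snd'] comp]], rule ext)
    fix h :: "real \<times> real"
    define L where "L = lens_area (\<lambda>v. 1 / s + t / s * ?p v)"
    have G: "GG t s \<phi> = s\<^sup>2 * L" unfolding L_def using t by (intro GG_lens s) simp
    have "s\<^sup>2 * ((- snd h / (s * s)) * B + (fst h / s - t * snd h / (s * s)) * C) + (2 * (snd h * s)) * L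
       = CC t s \<phi> * fst h + (2 * GG t s \<phi> - BB t s \<phi>) / s * snd h"
      unfolding G sC[symmetric] sB[symmetric] using s by (simp add: field_simps power2_eq_square)
    then show "(snd (t, s))\<^sup>2 * (- snd h / (s * s) * B + (fst h / s - t * snd h / (s * s)) * C) +
         of_nat 2 * snd h * (snd (t, s)) ^ (2 - 1) * lens_area (\<lambda>v. 1 / snd (t, s) + fst (t, s) / snd (t, s) * P (rot2 \<phi> v)) =
         CC t s \<phi> * fst h + (2 * GG t s \<phi> - BB t s \<phi>) / s * snd h"
      by (simp add: L_def)
  qed
  have "\<forall>\<^sub>F p in nhds (t, s). \<bar>fst p\<bar> * bnd < 1 / 2 \<and> 0 < snd p"
  proof -
    have "open {p :: real \<times> real. \<bar>fst p\<bar> * bnd < 1 / 2 \<and> 0 < snd p}"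
      by (intro open_Collect_conj open_Collect_less continuous_intros)
    then show ?thesis unfolding eventually_nhds using s t by (intro exI[of _ "{p. \<bar>fst p\<bar> * bnd < 1 / 2 \<and> 0 < snd p}"]) auto
  qed
  then have ev: "\<forall>\<^sub>F p in nhds (t, s). (snd p)\<^sup>2 * lens_area (\<lambda>v. 1 / snd p + fst p / snd p * ?p v) = GG (fst p) (snd p) \<phi>"
    by eventually_elim (use GG_lens in auto)
  have "((\<lambda>p. GG (fst p) (snd p) \<phi>) has_derivative (\<lambda>h. CC t s \<phi> * fst h + (2 * GG t s \<phi> - BB t s \<phi>) / s * snd h)) (at (t, s))"
  proof (rule has_derivative_transform_eventually[OF full])
    show "\<forall>\<^sub>F p in at (t, s). (snd p)\<^sup>2 * lens_area (\<lambda>v. 1 / snd p + fst p / snd p * ?p v) = GG (fst p) (snd p) \<phi>"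
      using ev by (simp add: eventually_at_filter eventually_mono)
    show "(snd (t, s))\<^sup>2 * lens_area (\<lambda>v. 1 / snd (t, s) + fst (t, s) / snd (t, s) * ?p v) = GG (fst (t, s)) (snd (t, s)) \<phi>"
      using GG_lens[OF s, of t \<phi>] t by simp
  qed simp
  then show ?thesis by (simp add: case_prod_beta')
qed

end

text \<open>A tube argument: the set where g is nonnegative is compact, so its projection to the
  parameter axis is closed, and it misses 0.\<close>

lemma tube_neg:
  fixes g :: "real \<times> 'b :: metric_space \<Rightarrow> real"
  assumes C: "compact C" and c: "0 < c" "continuous_on ({-c..c} \<times> C) g" and neg: "\<And>k. k \<in> C \<Longrightarrow> g (0, k) < 0"
  obtains \<tau> where "0 < \<tau>" "\<tau> \<le> c" "\<And>t k. \<bar>t\<bar> < \<tau> \<Longrightarrow> k \<in> C \<Longrightarrow> g (t, k) < 0"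
proof -
  let ?Z = "({-c..c} \<times> C) \<inter> g -` {0..}"
  have cp: "compact ({-c..c} \<times> C)" by (intro compact_Times C compact_Icc)
  have "closed ?Z"
    using continuous_closed_preimage[OF c(2) compact_imp_closed[OF cp]] by blast
  then have "compact ?Z" using compact_Int_closed[OF cp, of ?Z] by (simp add: Int_assoc[symmetric])
  then have "closed (fst ` ?Z)"
    by (intro compact_imp_closed compact_continuous_image continuous_intros)
  moreover have "0 \<notin> fst ` ?Z" using neg by force
  ultimately obtain e where e: "0 < e" "ball 0 e \<subseteq> - fst ` ?Z"
    by (metis ComplI open_Compl open_contains_ball)
  show thesis
  proof (rule that[of "min e c"])
    fix t k assume t: "\<bar>t\<bar> < min e c" "k \<in> C"
    show "g (t, k) < 0"
    proof (rule ccontr)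
      assume "\<not> g (t, k) < 0"
      then have "(t, k) \<in> ?Z" using t by auto
      then have "t \<in> fst ` ?Z" by force
      moreover have "t \<in> ball 0 e" using t by simp
      ultimately show False using e(2) by blast
    qed
  qed (use e c in auto)
qed

section \<open>Intersection of two discs of equal radius\<close>

lemma radial_region_const: "0 \<le> r \<Longrightarrow> radial_region (\<lambda>_. r) = cball 0 r"
  by (auto simp: radial_region_def)

lemma measure_disc:
  assumes "0 \<le> r"
  shows "measure lebesgue (cball (a :: real ^ 2) r) = pi * r\<^sup>2"
proof -
  have "measure lebesgue (cball (0 :: real ^ 2) r) = integral {-pi..pi} (\<lambda>\<theta>. r\<^sup>2 / 2)"
    using measure_radial_region[of "\<lambda>_. r"] assms by (simp add: radial_region_const)
  also have "\<dots> = pi * r\<^sup>2" by simp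
  finally have "measure lebesgue (cball (0 :: real ^ 2) r) = pi * r\<^sup>2" .
  moreover have "cball a r = (+) a ` cball 0 r" using cball_translation[of a 0 r] by simp
  ultimately show ?thesis by (simp only: measure_translation)
qed

lemma measure_scaleR2:
  assumes "S \<in> lmeasurable"
  shows "measure lebesgue ((\<lambda>x :: real ^ 2. r *\<^sub>R x) ` S) = r\<^sup>2 * measure lebesgue S"
proof -
  have "det (matrix (\<lambda>x :: real ^ 2. r *\<^sub>R x)) = r\<^sup>2"
    unfolding det_2 matrix_def by (simp add: axis_def power2_eq_square)
  then show ?thesis using measure_linear_image[of "\<lambda>x :: real ^ 2. r *\<^sub>R x" S] assms
    by (simp add: linear_scaleR)
qed

definition disc_lens :: "real \<Rightarrow> real \<Rightarrow> real \<Rightarrow> real" where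
  "disc_lens r s \<phi> = measure lebesgue (cball 0 r \<inter> (\<lambda>y. y + s *\<^sub>R cis2 \<phi>) ` cball 0 r)"

lemma compact_shift_inter: "compact S \<Longrightarrow> compact (S \<inter> (\<lambda>y. y + a) ` S)" for S :: "(real ^ 2) set"
  by (intro compact_Int compact_continuous_image continuous_intros)

lemma disc_lens_scale:
  assumes "0 < r"
  shows "disc_lens r s \<phi> = r\<^sup>2 * disc_lens 1 (s / r) \<phi>"
proof -
  have 1: "cball 0 r = (\<lambda>x :: real ^ 2. r *\<^sub>R x) ` cball 0 1"
    using cball_scale[of r "0 :: real ^ 2" 1] assms by simp
  have "cball 0 r \<inter> (\<lambda>y. y + s *\<^sub>R cis2 \<phi>) ` cball 0 r = (\<lambda>x. r *\<^sub>R x) ` (cball 0 1 \<inter> (\<lambda>y. y + (s / r) *\<^sub>R cis2 \<phi>) ` cball 0 1)"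
  proof -
    have inj: "inj (\<lambda>x :: real ^ 2. r *\<^sub>R x)" using assms by (auto intro: injI)
    have "(\<lambda>y. y + s *\<^sub>R cis2 \<phi>) ` (\<lambda>x. r *\<^sub>R x) ` cball 0 1 = (\<lambda>x. r *\<^sub>R x) ` (\<lambda>y. y + (s / r) *\<^sub>R cis2 \<phi>) ` cball 0 1"
      unfolding image_image using assms by (intro image_cong refl) (simp add: scaleR_add_right)
    then show ?thesis unfolding 1 by (simp only: image_Int[OF inj])
  qed
  then show ?thesis
    unfolding disc_lens_def
    using measure_scaleR2[OF lmeasurable_compact[OF compact_shift_inter[of "cball 0 1" "(s / r) *\<^sub>R cis2 \<phi>"]], of r] by simp
qed

text \<open>By the parallelogram law the intersection lies in the disc about the midpoint of the
  centres with squared radius 1 - s^2 / 4. The bound is crude but vanishes at s = 2, which fixes the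
  constant of integration in \<open>disc_lens_eq\<close>.\<close>

lemma disc_lens_upper:
  shows "2 < s \<Longrightarrow> disc_lens 1 s \<phi> = 0" "0 \<le> s \<Longrightarrow> s \<le> 2 \<Longrightarrow> disc_lens 1 s \<phi> \<le> pi * (1 - s\<^sup>2 / 4)"
proof -
  have mid: "(norm (y - (s / 2) *\<^sub>R cis2 \<phi>))\<^sup>2 \<le> 1 - s\<^sup>2 / 4"
    if "y \<in> cball 0 1 \<inter> (\<lambda>y. y + s *\<^sub>R cis2 \<phi>) ` cball 0 1" for y
  proof -
    have a: "(norm y)\<^sup>2 \<le> 1" using that by (simp add: power_le_one)
    have "y - s *\<^sub>R cis2 \<phi> \<in> cball 0 1" using that by (simp add: translate_mem)
    then have b: "(norm (y - s *\<^sub>R cis2 \<phi>))\<^sup>2 \<le> 1" by (simp add: power_le_one)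
    have n: "(norm (y - c *\<^sub>R cis2 \<phi>))\<^sup>2 = (norm y)\<^sup>2 - 2 * c * (y \<bullet> cis2 \<phi>) + c\<^sup>2" for c
    proof -
      have "(norm (y - c *\<^sub>R cis2 \<phi>))\<^sup>2 = y \<bullet> y - c * (y \<bullet> cis2 \<phi>) - (c * (cis2 \<phi> \<bullet> y) - c * (c * (cis2 \<phi> \<bullet> cis2 \<phi>)))"
        unfolding power2_norm_eq_inner by (simp add: inner_diff_left inner_diff_right right_diff_distrib)
      moreover have "cis2 \<phi> \<bullet> cis2 \<phi> = 1" by (simp add: dot_square_norm)
      ultimately show ?thesis unfolding inner_commute[of "cis2 \<phi>" y]
        using power2_norm_eq_inner[of y] by (simp add: power2_eq_square)
    qed
    have "(norm (y - (s / 2) *\<^sub>R cis2 \<phi>))\<^sup>2 = ((norm y)\<^sup>2 + (norm (y - s *\<^sub>R cis2 \<phi>))\<^sup>2) / 2 - s\<^sup>2 / 4"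
      unfolding n by (simp add: power2_eq_square field_simps)
    then show ?thesis using a b by simp
  qed
  show "disc_lens 1 s \<phi> = 0" if s: "2 < s"
  proof -
    have "2 * 2 < s * s" using s by (intro mult_strict_mono) auto
    then have "1 - s\<^sup>2 / 4 < 0" by (simp add: power2_eq_square)
    then have "cball 0 1 \<inter> (\<lambda>y. y + s *\<^sub>R cis2 \<phi>) ` cball 0 1 = {}"
      using order.strict_trans1[OF order_trans[OF zero_le_power2 mid]] by blast
    then show ?thesis unfolding disc_lens_def by simp
  qed
  show "disc_lens 1 s \<phi> \<le> pi * (1 - s\<^sup>2 / 4)" if s: "0 \<le> s" "s \<le> 2"
  proof -
    have "s * s \<le> 2 * 2" using s by (intro mult_mono) auto
    then have nn: "0 \<le> 1 - s\<^sup>2 / 4" by (simp add: power2_eq_square)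
    have "disc_lens 1 s \<phi> \<le> measure lebesgue (cball ((s / 2) *\<^sub>R cis2 \<phi>) (sqrt (1 - s\<^sup>2 / 4)))"
      unfolding disc_lens_def
    proof (rule measure_mono_fmeasurable)
      show "cball 0 1 \<inter> (\<lambda>y. y + s *\<^sub>R cis2 \<phi>) ` cball 0 1 \<subseteq> cball ((s / 2) *\<^sub>R cis2 \<phi>) (sqrt (1 - s\<^sup>2 / 4))"
      proof
        fix y assume "y \<in> cball 0 1 \<inter> (\<lambda>y. y + s *\<^sub>R cis2 \<phi>) ` cball 0 1"
        from real_le_rsqrt[OF mid[OF this]] show "y \<in> cball ((s / 2) *\<^sub>R cis2 \<phi>) (sqrt (1 - s\<^sup>2 / 4))"
          by (simp add: dist_norm norm_minus_commute)
      qed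
      show "cball 0 1 \<inter> (\<lambda>y. y + s *\<^sub>R cis2 \<phi>) ` cball 0 1 \<in> sets lebesgue"
        using lmeasurable_compact[OF compact_shift_inter[of "cball 0 1" "s *\<^sub>R cis2 \<phi>"]] by auto
    qed simp
    also have "\<dots> = pi * (1 - s\<^sup>2 / 4)" using nn by (subst measure_disc) auto
    finally show ?thesis .
  qed
qed

text \<open>The area of the intersection of two unit discs at distance \<open>s\<close>, as two
  circular segments of half angle arccos (s / 2); \<open>disc_lens_eq\<close> proves that it is this
  area.\<close>

definition flens :: "real \<Rightarrow> real" where
  "flens s = 2 * arccos (s / 2) - sin (2 * arccos (s / 2))"

lemma arccos_half: "0 < s \<Longrightarrow> s < 2 \<Longrightarrow> 0 < arccos (s / 2) \<and> arccos (s / 2) < pi / 2 \<and> cos (arccos (s / 2)) = s / 2"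
  using arccos_lt_bounded[of "s / 2"] arccos_less_mono[of "s/2" 0] by (simp add: arccos_0)

lemma flens_derivative:
  assumes "0 < s" "s < 2"
  shows "(flens has_real_derivative - 2 * sin (arccos (s / 2))) (at s)"
proof -
  let ?\<alpha> = "arccos (s / 2)"
  have sq: "sin ?\<alpha> = sqrt (1 - (s / 2)\<^sup>2)" using assms by (intro sin_arccos) auto
  have sp: "0 < sin ?\<alpha>" using arccos_half[OF assms] by (intro sin_gt_zero) auto
  have d: "((\<lambda>s. arccos (s / 2)) has_real_derivative - 1 / (2 * sin ?\<alpha>)) (at s)"
  proof -
    have "((\<lambda>s. s / 2) has_real_derivative 1 / 2) (at s)" by (auto intro!: derivative_eq_intros)
    moreover have "(arccos has_real_derivative inverse (- sqrt (1 - (s / 2)\<^sup>2))) (at (s / 2))"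
      using assms by (intro DERIV_arccos) auto
    ultimately have "((\<lambda>s. arccos (s / 2)) has_real_derivative inverse (- sqrt (1 - (s / 2)\<^sup>2)) * (1 / 2)) (at s)"
      by (rule DERIV_chain2[rotated])
    moreover have "inverse (- sqrt (1 - (s / 2)\<^sup>2)) * (1 / 2) = - 1 / (2 * sin ?\<alpha>)"
      unfolding sq[symmetric] by (simp add: field_simps)
    ultimately show ?thesis by (simp only:)
  qed
  have "(flens has_real_derivative 2 * (- 1 / (2 * sin ?\<alpha>)) - cos (2 * ?\<alpha>) * (2 * (- 1 / (2 * sin ?\<alpha>)))) (at s)"
    unfolding flens_def by (rule DERIV_diff[OF DERIV_cmult[OF d] DERIV_chain2[OF DERIV_sin DERIV_cmult[OF d]]])
  moreover have "2 * (- 1 / (2 * sin ?\<alpha>)) - cos (2 * ?\<alpha>) * (2 * (- 1 / (2 * sin ?\<alpha>))) = - 2 * sin ?\<alpha>"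
    using sp unfolding cos_double_sin by (simp add: field_simps power2_eq_square)
  ultimately show ?thesis by (simp only:)
qed

lemma flens_less: "0 < a \<Longrightarrow> a < b \<Longrightarrow> b < 2 \<Longrightarrow> flens b < flens a"
proof (rule DERIV_neg_imp_decreasing[of a b flens])
  fix x assume "0 < a" "a < b" "b < 2" "a \<le> x" "x \<le> b"
  then have x: "0 < x" "x < 2" by auto
  have "0 < sin (arccos (x / 2))" using arccos_half[OF x] by (intro sin_gt_zero) auto
  then show "\<exists>y. (flens has_real_derivative y) (at x) \<and> y < 0"
    using flens_derivative[OF x] by (intro exI[of _ "- 2 * sin (arccos (x / 2))"]) auto
qed

lemma flens_isCont: "0 < s \<Longrightarrow> s < 2 \<Longrightarrow> isCont flens s"
  using flens_derivative DERIV_isCont by blast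

text \<open>With s = 2 sin h the deficit from the full disc is 2 h + sin 2h. Hence the volume
  equation at t = 0 reads pi (1 - \<delta>) = 2 h + sin 2h.\<close>

lemma flens_sin: "0 < h \<Longrightarrow> h < pi / 2 \<Longrightarrow> flens (2 * sin h) = pi - 2 * h - sin (2 * h)"
proof -
  assume h: "0 < h" "h < pi / 2"
  have "arccos (sin h) = pi / 2 - h"
    using arccos_cos[of "pi / 2 - h"] h by (simp add: cos_diff)
  then show ?thesis by (simp add: flens_def right_diff_distrib sin_diff)
qed

context c1_periodic
begin

lemma roots_structure:
  assumes ab: "0 < a" "a < b" "b < 2"
  shows "\<exists>\<tau>>0. \<tau> * bnd \<le> 1 / 2 \<and> (\<forall>t s \<phi>. \<bar>t\<bar> < \<tau> \<longrightarrow> a \<le> s \<longrightarrow> s \<le> b \<longrightarrow> roots_prop f f' t s \<phi>)"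
proof -
  interpret R: c1_periodic "\<lambda>x. f (- x)" "\<lambda>x. - f' (- x)" by (rule reflected)
  have "\<exists>\<tau>>0. \<tau> * bnd \<le> 1 / 2 \<and> (\<forall>t s \<phi>. \<bar>t\<bar> < \<tau> \<longrightarrow> a \<le> s \<longrightarrow> s \<le> b \<longrightarrow> root_prop f f' t s \<phi>)"
    by (rule root_structure[OF ab]) blast
  then obtain \<tau>1 where 1: "0 < \<tau>1" "\<tau>1 * bnd \<le> 1 / 2"
    and 11: "\<forall>t s \<phi>. \<bar>t\<bar> < \<tau>1 \<longrightarrow> a \<le> s \<longrightarrow> s \<le> b \<longrightarrow> root_prop f f' t s \<phi>" by blast
  have "\<exists>\<tau>>0. \<forall>t s \<phi>. \<bar>t\<bar> < \<tau> \<longrightarrow> a \<le> s \<longrightarrow> s \<le> b \<longrightarrow> root_prop (\<lambda>x. f (- x)) (\<lambda>x. - f' (- x)) t s \<phi>"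
    by (rule R.root_structure[OF ab]) blast
  then obtain \<tau>2 where 2: "0 < \<tau>2"
    and 22: "\<forall>t s \<phi>. \<bar>t\<bar> < \<tau>2 \<longrightarrow> a \<le> s \<longrightarrow> s \<le> b \<longrightarrow> root_prop (\<lambda>x. f (- x)) (\<lambda>x. - f' (- x)) t s \<phi>" by blast
  show ?thesis
  proof (intro exI[of _ "min \<tau>1 \<tau>2"] conjI allI impI)
    have "min \<tau>1 \<tau>2 * bnd \<le> \<tau>1 * bnd" using bnd(1) by (intro mult_right_mono) auto
    then show "min \<tau>1 \<tau>2 * bnd \<le> 1 / 2" using 1(2) by linarith
    show "0 < min \<tau>1 \<tau>2" using 1(1) 2 by simp
    fix t s \<phi> assume "\<bar>t\<bar> < min \<tau>1 \<tau>2" "a \<le> s" "s \<le> b"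
    then show "roots_prop f f' t s \<phi>" using 11 22 by (simp add: roots_prop_def)
  qed
qed

lemma hits_continuous:
  fixes t s \<phi> :: "'p :: metric_space \<Rightarrow> real"
  assumes c: "continuous_on T t" "continuous_on T s" "continuous_on T \<phi>"
    and rp: "\<And>p. p \<in> T \<Longrightarrow> roots_prop f f' (t p) (s p) (\<phi> p)"
  shows "continuous_on T (\<lambda>p. hit f (t p) (s p) (\<phi> p))" "continuous_on T (\<lambda>p. hitm f (t p) (s p) (\<phi> p))"
proof -
  interpret R: c1_periodic "\<lambda>x. f (- x)" "\<lambda>x. - f' (- x)" by (rule reflected)
  show "continuous_on T (\<lambda>p. hit f (t p) (s p) (\<phi> p))"
    using rp by (intro hit_continuous c) (auto simp: roots_prop_def)
  show "continuous_on T (\<lambda>p. hitm f (t p) (s p) (\<phi> p))"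
    unfolding hitm_def using rp by (intro R.hit_continuous c continuous_intros) (auto simp: roots_prop_def)
qed

end

lemma rot2_2pi: "rot2 (\<phi> + 2 * pi) = rot2 \<phi>"
  by (simp add: fun_eq_iff vec2_eq_iff rot2_nth)

text \<open>The two copies are changed one at a time, as in \<open>lens_area_variation\<close>, each
  costing at most 2 pi B d.\<close>

lemma lens_area_lipschitz:
  assumes \<sigma>: "continuous_on (sphere 0 1) \<sigma>" "\<And>v. v \<in> sphere 0 1 \<Longrightarrow> 0 \<le> \<sigma> v \<and> \<sigma> v \<le> B"
    and \<tau>: "continuous_on (sphere 0 1) \<tau>" "\<And>v. v \<in> sphere 0 1 \<Longrightarrow> 0 \<le> \<tau> v \<and> \<tau> v \<le> B"
    and d: "\<And>v. v \<in> sphere 0 1 \<Longrightarrow> \<bar>\<sigma> v - \<tau> v\<bar> \<le> d"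
  shows "\<bar>lens_area \<sigma> - lens_area \<tau>\<bar> \<le> 4 * pi * B * d"
proof -
  let ?X = "\<lambda>\<sigma> \<mu>. measure lebesgue (radial_region \<sigma> \<inter> (\<lambda>y. y + cis2 0) ` radial_region \<mu>)"
  have bor: "(\<lambda>y. y + cis2 0) ` radial_region \<sigma> \<in> sets borel"
    if "continuous_on (sphere 0 1) \<sigma>" "\<And>v. v \<in> sphere 0 1 \<Longrightarrow> 0 \<le> \<sigma> v" for \<sigma>
    using compact_radial_region[OF that] by (intro borel_compact compact_continuous_image continuous_intros) auto
  have um: "- v \<in> sphere 0 1" if "v \<in> sphere (0 :: real ^ 2) 1" for v using that by simp
  have 1: "\<bar>?X \<sigma> \<sigma> - ?X \<tau> \<sigma>\<bar> \<le> 2 * pi * B * d"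
    by (rule measure_radial_inter_lipschitz[OF \<sigma> \<tau> bor d]) (use \<sigma> in auto)
  have 2: "\<bar>?X (\<sigma> \<circ> uminus) (\<tau> \<circ> uminus) - ?X (\<tau> \<circ> uminus) (\<tau> \<circ> uminus)\<bar> \<le> 2 * pi * B * d"
    using \<sigma> \<tau> d um
    by (intro measure_radial_inter_lipschitz continuous_on_comp_uminus bor) auto
  have 3: "?X (\<sigma> \<circ> uminus) (\<tau> \<circ> uminus) = ?X \<tau> \<sigma>" "?X (\<tau> \<circ> uminus) (\<tau> \<circ> uminus) = ?X \<tau> \<tau>"
    using \<sigma> \<tau> by (auto intro!: lens_swap[symmetric])
  show ?thesis using 1 2 unfolding 3 lens_area_def by linarith
qed

section \<open>Areas of the perturbed disc and bounds uniform in the direction\<close>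

context perturbed
begin

definition AA :: "real \<Rightarrow> real" where "AA t = measure lebesgue (KK t)"

definition m1 where "m1 = integral {-pi..pi} f"
definition m2 where "m2 = integral {-pi..pi} (\<lambda>x. (f x)\<^sup>2)"

lemma one_plus_bounds:
  assumes "\<bar>t\<bar> * bnd \<le> 1 / 2" "v \<in> sphere 0 1"
  shows "1 / 2 \<le> 1 + t * P v" "1 + t * P v \<le> 3 / 2"
  using P_bound[OF assms(2), of t] assms(1) by auto

lemma compact_KK: "\<bar>t\<bar> * bnd \<le> 1 / 2 \<Longrightarrow> compact (KK t)"
  unfolding KK_def
proof (rule compact_radial_region)
  assume t: "\<bar>t\<bar> * bnd \<le> 1 / 2"
  show "continuous_on (sphere 0 1) (\<lambda>v. 1 + t * P v)" by (intro continuous_intros contP)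
  show "0 \<le> 1 + t * P v" if "v \<in> sphere 0 1" for v using one_plus_bounds(1)[OF t that] by linarith
qed

lemma AA_eq:
  assumes "\<bar>t\<bar> * bnd \<le> 1 / 2"
  shows "AA t = pi + t * m1 + t\<^sup>2 * m2 / 2"
proof -
  have "AA t = integral {-pi..pi} (\<lambda>\<theta>. (1 + t * P (cis2 \<theta>))\<^sup>2 / 2)"
    unfolding AA_def KK_def
  proof (rule measure_radial_region)
    show "continuous_on (sphere 0 1) (\<lambda>v. 1 + t * P v)" by (intro continuous_intros contP)
    show "0 \<le> 1 + t * P v" if "v \<in> sphere 0 1" for v using one_plus_bounds(1)[OF assms that] by linarith
  qed
  also have "\<dots> = integral {-pi..pi} (\<lambda>\<theta>. 1 / 2 + (t * f \<theta> + t\<^sup>2 / 2 * (f \<theta>)\<^sup>2))"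
    by (intro integral_cong) (simp add: fP power2_eq_square field_simps)
  also have "\<dots> = integral {-pi..pi} (\<lambda>\<theta>. 1 / 2) + (integral {-pi..pi} (\<lambda>\<theta>. t * f \<theta>) + integral {-pi..pi} (\<lambda>\<theta>. t\<^sup>2 / 2 * (f \<theta>)\<^sup>2))"
    by (subst integral_add, (intro integrable_continuous_real continuous_intros)+,
        subst integral_add, (intro integrable_continuous_real continuous_intros)+, simp)
  also have "\<dots> = pi + t * m1 + t\<^sup>2 * m2 / 2"
    by (simp add: m1_def m2_def)
  finally show ?thesis .
qed

lemma KK_sandwich:
  assumes "\<bar>t\<bar> * bnd \<le> 1 / 2"
  shows "cball 0 (1 - \<bar>t\<bar> * bnd) \<subseteq> KK t" "KK t \<subseteq> cball 0 (1 + \<bar>t\<bar> * bnd)"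
proof -
  have b: "1 - \<bar>t\<bar> * bnd \<le> 1 + t * P (x /\<^sub>R norm x)" "1 + t * P (x /\<^sub>R norm x) \<le> 1 + \<bar>t\<bar> * bnd"
    if "x \<noteq> 0" for x
  proof -
    have "x /\<^sub>R norm x \<in> sphere 0 1" using that by simp
    from P_bound[OF this, of t] show "1 - \<bar>t\<bar> * bnd \<le> 1 + t * P (x /\<^sub>R norm x)"
      "1 + t * P (x /\<^sub>R norm x) \<le> 1 + \<bar>t\<bar> * bnd" by linarith+
  qed
  have nn: "0 \<le> \<bar>t\<bar> * bnd" using bnd(1) by simp
  show "KK t \<subseteq> cball 0 (1 + \<bar>t\<bar> * bnd)"
  proof
    fix x assume x: "x \<in> KK t"
    have "norm x \<le> 1 + \<bar>t\<bar> * bnd"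
    proof (cases "x = 0")
      case False
      then have "norm x \<le> 1 + t * P (x /\<^sub>R norm x)" using x by (auto simp: KK_def radial_region_def)
      then show ?thesis using b(2)[OF False] by linarith
    qed (use nn in simp)
    then show "x \<in> cball 0 (1 + \<bar>t\<bar> * bnd)" by simp
  qed
  show "cball 0 (1 - \<bar>t\<bar> * bnd) \<subseteq> KK t"
  proof
    fix x :: "real ^ 2" assume "x \<in> cball 0 (1 - \<bar>t\<bar> * bnd)"
    then have x: "norm x \<le> 1 - \<bar>t\<bar> * bnd" by simp
    have "x = 0 \<or> norm x \<le> 1 + t * P (x /\<^sub>R norm x)"
      using order_trans[OF x b(1)] by blast
    then show "x \<in> KK t" unfolding KK_def radial_region_def by blast
  qed
qed

text \<open>Comparison with concentric discs controls the area for every shift, including those near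
  0 or beyond 2, outside the range of \<open>roots_structure\<close>.\<close>

lemma GG_sandwich:
  assumes t: "\<bar>t\<bar> * bnd \<le> 1 / 2"
  shows "(1 - \<bar>t\<bar> * bnd)\<^sup>2 * disc_lens 1 (s / (1 - \<bar>t\<bar> * bnd)) \<phi> \<le> GG t s \<phi>"
    "GG t s \<phi> \<le> (1 + \<bar>t\<bar> * bnd)\<^sup>2 * disc_lens 1 (s / (1 + \<bar>t\<bar> * bnd)) \<phi>"
proof -
  have p: "0 < 1 - \<bar>t\<bar> * bnd" "0 < 1 + \<bar>t\<bar> * bnd" using t bnd(1) by (auto intro: add_pos_nonneg)
  note lm = lmeasurable_compact[OF compact_shift_inter]
  have "disc_lens (1 - \<bar>t\<bar> * bnd) s \<phi> \<le> GG t s \<phi>"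
    unfolding disc_lens_def GG_def using KK_sandwich(1)[OF t] lm[OF compact_KK[OF t]] lm[OF compact_cball]
    by (intro measure_mono_fmeasurable) (auto dest: fmeasurableD)
  then show "(1 - \<bar>t\<bar> * bnd)\<^sup>2 * disc_lens 1 (s / (1 - \<bar>t\<bar> * bnd)) \<phi> \<le> GG t s \<phi>"
    unfolding disc_lens_scale[OF p(1)] .
  have "GG t s \<phi> \<le> disc_lens (1 + \<bar>t\<bar> * bnd) s \<phi>"
    unfolding disc_lens_def GG_def using KK_sandwich(2)[OF t] lm[OF compact_KK[OF t]] lm[OF compact_cball]
    by (intro measure_mono_fmeasurable) (auto dest: fmeasurableD)
  then show "GG t s \<phi> \<le> (1 + \<bar>t\<bar> * bnd)\<^sup>2 * disc_lens 1 (s / (1 + \<bar>t\<bar> * bnd)) \<phi>"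
    unfolding disc_lens_scale[OF p(2)] .
qed

lemma GG_0: "GG 0 s \<phi> = disc_lens 1 s \<phi>"
  unfolding GG_def disc_lens_def KK_def using radial_region_const[of 1] by simp

lemma hits_disc: "0 < s \<Longrightarrow> s < 2 \<Longrightarrow> hit f 0 s \<phi> = arccos (s / 2) \<and> hitm f 0 s \<phi> = arccos (s / 2)"
  by (simp add: hitm_def hit_disc)

lemma BB_0: "0 < s \<Longrightarrow> s < 2 \<Longrightarrow> BB 0 s \<phi> = 4 * arccos (s / 2)"
  by (simp add: BB_def arcB_def hits_disc)

text \<open>Both sides solve s y' = 2 y - 4 arccos (s / 2), the area by
  \<open>GG_has_derivative\<close> at t = 0. Their difference divided by s^2 is therefore constant
  on (0, 2), and it tends to 0 as s tends to 2.\<close>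

lemma disc_lens_eq:
  assumes "0 < s" "s < 2"
  shows "disc_lens 1 s \<phi> = flens s"
proof -
  define h where "h x = (disc_lens 1 x \<phi> - flens x) / x\<^sup>2" for x
  have dh: "(h has_real_derivative 0) (at x)" if x: "0 < x" "x < 2" for x
  proof -
    have "0 < x / 2" "x / 2 < (x + 2) / 2" "(x + 2) / 2 < 2" using x by auto
    then obtain \<tau> where \<tau>: "0 < \<tau>" "\<forall>t s \<phi>. \<bar>t\<bar> < \<tau> \<longrightarrow> x / 2 \<le> s \<longrightarrow> s \<le> (x + 2) / 2 \<longrightarrow> roots_prop f f' t s \<phi>"
      using roots_structure by blast
    have rp: "roots_prop f f' 0 x \<phi>" for \<phi> using \<tau> x by simp
    have "((\<lambda>(t, s). GG t s \<phi>) has_derivative (\<lambda>(a, b). CC 0 x \<phi> * a + (2 * GG 0 x \<phi> - BB 0 x \<phi>) / x * b)) (at (0, x))"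
      by (rule GG_has_derivative) (use x rp in auto)
    moreover have "((\<lambda>s. (0 :: real, s)) has_derivative (\<lambda>b. (0, b))) (at x)" by (intro derivative_eq_intros) auto
    ultimately have "((\<lambda>s. case (0, s) of (t, s) \<Rightarrow> GG t s \<phi>) has_derivative (\<lambda>b. case (0, b) of (a, b) \<Rightarrow> CC 0 x \<phi> * a + (2 * GG 0 x \<phi> - BB 0 x \<phi>) / x * b)) (at x)"
      by (rule has_derivative_compose[rotated])
    then have "((\<lambda>s. disc_lens 1 s \<phi>) has_derivative (\<lambda>b. (2 * disc_lens 1 x \<phi> - 4 * arccos (x / 2)) / x * b)) (at x)"
      using x by (simp add: GG_0 BB_0)
    then have d1: "((\<lambda>s. disc_lens 1 s \<phi>) has_real_derivative (2 * disc_lens 1 x \<phi> - 4 * arccos (x / 2)) / x) (at x)"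
      by (simp only: has_field_derivative_def)
    define \<alpha> where "\<alpha> = arccos (x / 2)"
    have fl: "flens x = 2 * \<alpha> - 2 * sin \<alpha> * cos \<alpha>" by (simp add: flens_def \<alpha>_def sin_double)
    have "cos \<alpha> = x / 2" using arccos_half[OF x] by (simp add: \<alpha>_def)
    then have e: "- 2 * sin \<alpha> = (2 * flens x - 4 * \<alpha>) / x"
      unfolding fl using x by (simp add: field_simps)
    note d2 = flens_derivative[OF x, folded \<alpha>_def, unfolded e]
    have "(h has_real_derivative ((((2 * disc_lens 1 x \<phi> - 4 * \<alpha>) / x - (2 * flens x - 4 * \<alpha>) / x) * x\<^sup>2 - (disc_lens 1 x \<phi> - flens x) * (2 * x)) / (x\<^sup>2 * x\<^sup>2))) (at x)"
      unfolding h_def using x by (auto intro!: derivative_eq_intros d1[folded \<alpha>_def] d2 simp: algebra_simps)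
    moreover have "(((2 * disc_lens 1 x \<phi> - 4 * \<alpha>) / x - (2 * flens x - 4 * \<alpha>) / x) * x\<^sup>2 - (disc_lens 1 x \<phi> - flens x) * (2 * x)) = 0"
      using x by (simp add: field_simps power2_eq_square)
    ultimately show ?thesis by simp
  qed
  have const: "h x = h s" if "0 < x" "x < 2" for x
    by (rule DERIV_isconst3[of 0 2]) (use that assms dh in auto)
  have lim: "(h \<longlongrightarrow> 0) (at_left 2)"
  proof -
    have "((\<lambda>x. disc_lens 1 x \<phi>) \<longlongrightarrow> 0) (at_left 2)"
    proof (rule tendsto_sandwich[of "\<lambda>_. 0" _ _ "\<lambda>x. pi * (1 - x\<^sup>2 / 4)"])
      show "\<forall>\<^sub>F x in at_left 2. 0 \<le> disc_lens 1 x \<phi>" by (simp add: disc_lens_def)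
      have "\<forall>\<^sub>F x in at_left (2::real). x \<in> {0<..<2}" by (rule eventually_at_left_real) simp
      then show "\<forall>\<^sub>F x in at_left 2. disc_lens 1 x \<phi> \<le> pi * (1 - x\<^sup>2 / 4)"
        by eventually_elim (use disc_lens_upper(2) in auto)
      have "((\<lambda>x::real. pi * (1 - x\<^sup>2 / 4)) \<longlongrightarrow> pi * (1 - 2\<^sup>2 / 4)) (at_left 2)" by (intro tendsto_intros) simp
      then show "((\<lambda>x. pi * (1 - x\<^sup>2 / 4)) \<longlongrightarrow> 0) (at_left (2::real))" by simp
    qed simp
    moreover have "(flens \<longlongrightarrow> 0) (at_left 2)"
    proof -
      have "continuous_on {-2..2} flens"
        unfolding flens_def by (intro continuous_intros) auto
      then have "(flens \<longlongrightarrow> flens 2) (at 2 within {-2..2})" by (simp add: continuous_on_def)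
      then have "(flens \<longlongrightarrow> flens 2) (at_left 2)"
        by (simp add: at_within_Icc_at_left)
      then show ?thesis by (simp add: flens_def arccos_1)
    qed
    ultimately have "((\<lambda>x. (disc_lens 1 x \<phi> - flens x) / x\<^sup>2) \<longlongrightarrow> (0 - 0) / 2\<^sup>2) (at_left 2)"
      by (intro tendsto_intros) auto
    then show ?thesis by (simp add: h_def[abs_def])
  qed
  have "\<forall>\<^sub>F x in at_left (2::real). x \<in> {0<..<2}" by (rule eventually_at_left_real) simp
  then have "\<forall>\<^sub>F x in at_left 2. h x = h s" by eventually_elim (use const in auto)
  then have "((\<lambda>_ :: real. h s) \<longlongrightarrow> 0) (at_left 2)" using tendsto_cong[of h "\<lambda>_. h s"] lim by blast
  then have "h s = 0" by (rule tendsto_unique[OF trivial_limit_at_left_real tendsto_const])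
  then show ?thesis using assms by (simp add: h_def)
qed

lemma disc_lens_le_flens:
  assumes "0 < b" "b < 2" "b \<le> s"
  shows "disc_lens 1 s \<phi> \<le> flens b"
proof -
  have pos: "0 \<le> flens b"
    using disc_lens_eq[OF assms(1,2), of 0] by (metis disc_lens_def measure_nonneg)
  consider "s < 2" | "s = 2" | "2 < s" by linarith
  then show ?thesis
  proof cases
    case 1
    then show ?thesis using assms disc_lens_eq[of s \<phi>] flens_less[of b s] by (cases "b = s") auto
  next
    case 2 then show ?thesis using disc_lens_upper(2)[of 2 \<phi>] pos by simp
  next
    case 3 then show ?thesis using disc_lens_upper(1)[of s \<phi>] pos by simp
  qed
qed

lemma disc_lens_ge_flens:
  assumes "0 < s" "s \<le> a" "a < 2"
  shows "flens a \<le> disc_lens 1 s \<phi>"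
  using assms disc_lens_eq[of s \<phi>] flens_less[of s a] by (cases "s = a") auto

text \<open>As f is Lipschitz with constant \<open>bnd\<close>, the normalised radial functions
  differ by at most \<open>bnd\<close> (|t - t'| + |t'| |\<phi> - \<phi>'|) / s. The factor s^2 from
  the scaling absorbs this division by s and the one in the bound 3 / (2 s).\<close>

lemma GG_close:
  assumes s: "0 < s" and t: "\<bar>t\<bar> * bnd \<le> 1 / 2" "\<bar>t'\<bar> * bnd \<le> 1 / 2"
  shows "\<bar>GG t s \<phi> - GG t' s \<phi>'\<bar> \<le> 6 * pi * bnd * (\<bar>t - t'\<bar> + \<bar>t'\<bar> * \<bar>\<phi> - \<phi>'\<bar>)"
proof -
  let ?\<sigma> = "\<lambda>t \<phi> v. 1 / s + t / s * P (rot2 \<phi> v)"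
  have "\<bar>lens_area (?\<sigma> t \<phi>) - lens_area (?\<sigma> t' \<phi>')\<bar> \<le> 4 * pi * (3 / (2 * s)) * (bnd * (\<bar>t - t'\<bar> + \<bar>t'\<bar> * \<bar>\<phi> - \<phi>'\<bar>) / s)"
  proof (rule lens_area_lipschitz[OF cont_sigma _ cont_sigma])
    have b: "0 \<le> ?\<sigma> t \<phi> v \<and> ?\<sigma> t \<phi> v \<le> 3 / (2 * s)" if "v \<in> sphere 0 1" "\<bar>t\<bar> * bnd \<le> 1 / 2" for v t \<phi>
      using sigma_pos[OF s that(2,1), of \<phi>] s by (meson divide_pos_pos less_imp_le order_trans zero_less_mult_iff zero_less_numeral zero_less_one)
    then show "0 \<le> ?\<sigma> t \<phi> v \<and> ?\<sigma> t \<phi> v \<le> 3 / (2 * s)" "0 \<le> ?\<sigma> t' \<phi>' v \<and> ?\<sigma> t' \<phi>' v \<le> 3 / (2 * s)" if "v \<in> sphere 0 1" for v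
      using that t by blast+
    fix v :: "real ^ 2" assume "v \<in> sphere 0 1"
    then have "norm v = 1" by simp
    then obtain \<beta> where \<beta>: "v = cis2 \<beta>" by (rule sphere_cis2)
    have "\<bar>t * f (\<phi> + \<beta>) - t' * f (\<phi>' + \<beta>)\<bar> = \<bar>(t - t') * f (\<phi> + \<beta>) + t' * (f (\<phi> + \<beta>) - f (\<phi>' + \<beta>))\<bar>"
      by (simp add: algebra_simps)
    also have "\<dots> \<le> \<bar>t - t'\<bar> * \<bar>f (\<phi> + \<beta>)\<bar> + \<bar>t'\<bar> * \<bar>f (\<phi> + \<beta>) - f (\<phi>' + \<beta>)\<bar>"
      unfolding abs_mult[symmetric] by (rule abs_triangle_ineq)
    also have "\<dots> \<le> \<bar>t - t'\<bar> * bnd + \<bar>t'\<bar> * (bnd * \<bar>\<phi> - \<phi>'\<bar>)"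
      using bnd(2)[of "\<phi> + \<beta>"] f_lipschitz[of "\<phi> + \<beta>" "\<phi>' + \<beta>"] by (intro add_mono mult_left_mono) auto
    finally have le: "\<bar>t * f (\<phi> + \<beta>) - t' * f (\<phi>' + \<beta>)\<bar> \<le> bnd * (\<bar>t - t'\<bar> + \<bar>t'\<bar> * \<bar>\<phi> - \<phi>'\<bar>)"
      by (simp add: algebra_simps)
    have "\<bar>?\<sigma> t \<phi> v - ?\<sigma> t' \<phi>' v\<bar> = \<bar>t * f (\<phi> + \<beta>) - t' * f (\<phi>' + \<beta>)\<bar> / s"
      using s by (simp add: \<beta> fP[symmetric] abs_divide[symmetric] diff_divide_distrib[symmetric] flip: abs_of_pos)
    also have "\<dots> \<le> bnd * (\<bar>t - t'\<bar> + \<bar>t'\<bar> * \<bar>\<phi> - \<phi>'\<bar>) / s" using le s by (simp add: divide_right_mono)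
    finally show "\<bar>?\<sigma> t \<phi> v - ?\<sigma> t' \<phi>' v\<bar> \<le> bnd * (\<bar>t - t'\<bar> + \<bar>t'\<bar> * \<bar>\<phi> - \<phi>'\<bar>) / s" .
  qed
  then have "s\<^sup>2 * \<bar>lens_area (?\<sigma> t \<phi>) - lens_area (?\<sigma> t' \<phi>')\<bar> \<le> s\<^sup>2 * (4 * pi * (3 / (2 * s)) * (bnd * (\<bar>t - t'\<bar> + \<bar>t'\<bar> * \<bar>\<phi> - \<phi>'\<bar>) / s))"
    by (intro mult_left_mono) auto
  moreover have "s\<^sup>2 * (4 * pi * (3 / (2 * s)) * (q / s)) = 6 * pi * q" for q
    using s by (simp add: field_simps power2_eq_square)
  moreover have "\<bar>GG t s \<phi> - GG t' s \<phi>'\<bar> = s\<^sup>2 * \<bar>lens_area (?\<sigma> t \<phi>) - lens_area (?\<sigma> t' \<phi>')\<bar>"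
    unfolding GG_lens[OF s t(1)] GG_lens[OF s t(2)] right_diff_distrib[symmetric] by (simp add: abs_mult)
  ultimately show ?thesis by (simp add: mult.assoc)
qed

lemma GG_continuous: 
  assumes s: "0 < s" and T: "\<And>p. p \<in> T \<Longrightarrow> \<bar>fst p\<bar> * bnd \<le> 1 / 2"
  shows "continuous_on T (\<lambda>p. GG (fst p) s (snd p))"
  unfolding continuous_on_def
proof
  fix p0 assume p0: "p0 \<in> T"
  have "((\<lambda>p. 6 * pi * bnd * (\<bar>fst p - fst p0\<bar> + \<bar>fst p0\<bar> * \<bar>snd p - snd p0\<bar>)) \<longlongrightarrow> 6 * pi * bnd * (\<bar>fst p0 - fst p0\<bar> + \<bar>fst p0\<bar> * \<bar>snd p0 - snd p0\<bar>)) (at p0 within T)"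
    by (intro tendsto_intros)
  then have "((\<lambda>p. 6 * pi * bnd * (\<bar>fst p - fst p0\<bar> + \<bar>fst p0\<bar> * \<bar>snd p - snd p0\<bar>)) \<longlongrightarrow> 0) (at p0 within T)" by simp
  moreover have "\<forall>\<^sub>F p in at p0 within T. norm (GG (fst p) s (snd p) - GG (fst p0) s (snd p0)) \<le> 6 * pi * bnd * (\<bar>fst p - fst p0\<bar> + \<bar>fst p0\<bar> * \<bar>snd p - snd p0\<bar>)"
    unfolding eventually_at_filter using GG_close[OF s T T[OF p0]] by (auto intro!: always_eventually)
  ultimately have "((\<lambda>p. GG (fst p) s (snd p) - GG (fst p0) s (snd p0)) \<longlongrightarrow> 0) (at p0 within T)"
    by (rule Lim_null_comparison[rotated])
  then show "((\<lambda>p. GG (fst p) s (snd p)) \<longlongrightarrow> GG (fst p0) s (snd p0)) (at p0 within T)" by (simp add: LIM_zero_iff)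
qed

lemma contF: "continuous_on S g \<Longrightarrow> continuous_on S (\<lambda>x. F1 (g x))" "continuous_on S g \<Longrightarrow> continuous_on S (\<lambda>x. F2 (g x))"
proof -
  have "continuous_on UNIV F1" "continuous_on UNIV F2"
    using F1 F2 by (meson DERIV_isCont continuous_at_imp_continuous_on)+
  then show "continuous_on S g \<Longrightarrow> continuous_on S (\<lambda>x. F1 (g x))" "continuous_on S g \<Longrightarrow> continuous_on S (\<lambda>x. F2 (g x))"
    by (auto intro: continuous_on_compose2)
qed

lemma BB_continuous:
  fixes t s \<phi> :: "'p :: metric_space \<Rightarrow> real"
  assumes c: "continuous_on T t" "continuous_on T s" "continuous_on T \<phi>"
    and rp: "\<And>p. p \<in> T \<Longrightarrow> roots_prop f f' (t p) (s p) (\<phi> p)" "\<And>p. p \<in> T \<Longrightarrow> roots_prop f f' (t p) (s p) (\<phi> p + pi)"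
  shows "continuous_on T (\<lambda>p. BB (t p) (s p) (\<phi> p))"
  unfolding BB_def arcB_def
  by (intro continuous_intros contF c hits_continuous rp)

lemma BB_periodic:
  assumes "0 < s" "roots_prop f f' t s \<phi>" "roots_prop f f' t s (\<phi> + 2 * pi)" "roots_prop f f' t s (\<phi> + pi)" "roots_prop f f' t s (\<phi> + 2 * pi + pi)"
  shows "BB t s (\<phi> + 2 * pi) = BB t s \<phi>"
proof -
  have e: "\<phi> + 2 * pi + pi = (\<phi> + pi) + 2 * pi" by simp
  have "arcB t s (\<phi> + 2 * pi) = arcB t s \<phi>"
    using arc_integrals(1)[OF assms(1,2)] arc_integrals(1)[OF assms(1,3)] by (simp add: rot2_2pi)
  moreover have "arcB t s (\<phi> + 2 * pi + pi) = arcB t s (\<phi> + pi)"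
    using arc_integrals(1)[OF assms(1,4)] arc_integrals(1)[OF assms(1,5)] unfolding e rot2_2pi by simp
  ultimately show ?thesis by (simp add: BB_def)
qed

end

section \<open>The radial function of the convolution body\<close>

lemma eventually_nhds_0: "(\<forall>\<^sub>F t in nhds (0::real). Q t) \<longleftrightarrow> (\<exists>d>0. \<forall>t. \<bar>t\<bar> < d \<longrightarrow> Q t)"
  by (simp add: eventually_nhds_metric)

context perturbed
begin

text \<open>At t = 0 the solution is 2 sin h. Shifts below \<open>a\<close> and above
  \<open>b\<close> are settled by comparison with discs. In between, the inequality between
  \<open>2 * GG\<close> and \<open>BB\<close> says that the derivative in \<open>s\<close> is
  negative; at t = 0 it amounts to sin (2 arccos (s / 2)) > 0, and compactness in (s, \<phi>)
  carries it over to small \<open>t\<close>.\<close>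

lemma solution_region:
  assumes h: "0 < h" "h < pi / 2" and \<delta>: "pi * \<delta> = pi - 2 * h - sin (2 * h)"
  shows "\<exists>a b \<tau>. 0 < a \<and> a < b \<and> b < 2 \<and> 0 < \<tau> \<and> \<tau> * bnd \<le> 1 / 2
    \<and> (\<forall>t s \<phi>. \<bar>t\<bar> < \<tau> \<longrightarrow> a \<le> s \<longrightarrow> s \<le> b \<longrightarrow> roots_prop f f' t s \<phi>)
    \<and> (\<forall>t s \<phi>. \<bar>t\<bar> < \<tau> \<longrightarrow> 0 < s \<longrightarrow> s \<le> a \<longrightarrow> \<delta> * AA t < GG t s \<phi>)
    \<and> (\<forall>t s \<phi>. \<bar>t\<bar> < \<tau> \<longrightarrow> b \<le> s \<longrightarrow> GG t s \<phi> < \<delta> * AA t)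
    \<and> (\<forall>t s \<phi>. \<bar>t\<bar> < \<tau> \<longrightarrow> a \<le> s \<longrightarrow> s \<le> b \<longrightarrow> 2 * GG t s \<phi> < BB t s \<phi>)"
proof -
  have sh: "0 < sin h" "sin h < 1"
    using h sin_gt_zero[of h] sin_monotone_2pi[of h "pi / 2"] by auto
  \<comment> \<open>As 0 < sin h < 1, the value 2 sin h lies strictly between the two, and both lie
    in (0, 2).\<close>
  define a b where "a = sin h" and "b = sin h + 1"
  have ab: "0 < a" "a < 2 * sin h" "2 * sin h < b" "b < 2" "a < b" using sh by (auto simp: a_def b_def)
  have fl: "flens b < pi * \<delta>" "pi * \<delta> < flens a"
    using flens_less[of a "2 * sin h"] flens_less[of "2 * sin h" b] flens_sin[OF h] ab \<delta> by auto
  obtain \<tau>0 where \<tau>0: "0 < \<tau>0" "\<tau>0 * bnd \<le> 1 / 2"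
    and rp: "\<forall>t s \<phi>. \<bar>t\<bar> < \<tau>0 \<longrightarrow> a \<le> s \<longrightarrow> s \<le> b \<longrightarrow> roots_prop f f' t s \<phi>"
    using roots_structure[OF ab(1) ab(5) ab(4)] by blast
  have tb: "\<bar>t\<bar> * bnd \<le> 1 / 2" if "\<bar>t\<bar> < \<tau>0" for t
    using that \<tau>0(2) mult_right_mono[of "\<bar>t\<bar>" \<tau>0 bnd] bnd(1) by linarith
  have tA: "((\<lambda>t. \<delta> * (pi + t * m1 + t\<^sup>2 * m2 / 2)) \<longlongrightarrow> \<delta> * (pi + 0 * m1 + 0\<^sup>2 * m2 / 2)) (nhds 0)"
    by (intro tendsto_intros filterlim_ident) auto
  have dA: "((\<lambda>t. a / (1 - \<bar>t\<bar> * bnd)) \<longlongrightarrow> a / (1 - \<bar>0\<bar> * bnd)) (nhds 0)"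
    by (intro tendsto_intros filterlim_ident) auto
  have dB: "((\<lambda>t. b / (1 + \<bar>t\<bar> * bnd)) \<longlongrightarrow> b / (1 + \<bar>0\<bar> * bnd)) (nhds 0)"
    by (intro tendsto_intros filterlim_ident) auto
  have ca: "(flens \<longlongrightarrow> flens a) (nhds a)" "(flens \<longlongrightarrow> flens b) (nhds b)"
    using flens_isCont[of a] flens_isCont[of b] ab by (auto simp: continuous_at tendsto_at_iff_tendsto_nhds)
  have fA: "((\<lambda>t. (1 - \<bar>t\<bar> * bnd)\<^sup>2 * flens (a / (1 - \<bar>t\<bar> * bnd))) \<longlongrightarrow> (1 - \<bar>0\<bar> * bnd)\<^sup>2 * flens a) (nhds 0)"
    by (intro tendsto_intros filterlim_ident filterlim_compose[OF ca(1)]) (use dA in simp)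
  have fB: "((\<lambda>t. (1 + \<bar>t\<bar> * bnd)\<^sup>2 * flens (b / (1 + \<bar>t\<bar> * bnd))) \<longlongrightarrow> (1 + \<bar>0\<bar> * bnd)\<^sup>2 * flens b) (nhds 0)"
    by (intro tendsto_intros filterlim_ident filterlim_compose[OF ca(2)]) (use dB in simp)
  have ev1: "\<forall>\<^sub>F t in nhds 0. 0 < (1 - \<bar>t\<bar> * bnd)\<^sup>2 * flens (a / (1 - \<bar>t\<bar> * bnd)) - \<delta> * (pi + t * m1 + t\<^sup>2 * m2 / 2)"
    by (rule order_tendstoD(1)[OF tendsto_diff[OF fA tA]]) (use fl in \<open>simp add: mult.commute\<close>)
  have ev2: "\<forall>\<^sub>F t in nhds 0. (1 + \<bar>t\<bar> * bnd)\<^sup>2 * flens (b / (1 + \<bar>t\<bar> * bnd)) - \<delta> * (pi + t * m1 + t\<^sup>2 * m2 / 2) < 0"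
    by (rule order_tendstoD(2)[OF tendsto_diff[OF fB tA]]) (use fl in \<open>simp add: mult.commute\<close>)
  have ev3: "\<forall>\<^sub>F t in nhds 0. a / (1 - \<bar>t\<bar> * bnd) < 2"
    by (rule order_tendstoD(2)[OF dA]) (use ab in simp)
  obtain \<tau>1 where \<tau>1: "0 < \<tau>1" and T1: "\<forall>t. \<bar>t\<bar> < \<tau>1 \<longrightarrow>
     0 < (1 - \<bar>t\<bar> * bnd)\<^sup>2 * flens (a / (1 - \<bar>t\<bar> * bnd)) - \<delta> * (pi + t * m1 + t\<^sup>2 * m2 / 2) \<and>
     (1 + \<bar>t\<bar> * bnd)\<^sup>2 * flens (b / (1 + \<bar>t\<bar> * bnd)) - \<delta> * (pi + t * m1 + t\<^sup>2 * m2 / 2) < 0 \<and>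
     a / (1 - \<bar>t\<bar> * bnd) < 2"
    using eventually_conj[OF ev1 eventually_conj[OF ev2 ev3]] unfolding eventually_nhds_0 by blast
  \<comment> \<open>The area is replaced by its upper bound from \<open>GG_sandwich\<close>, whose
    joint continuity is immediate and which is exact at t = 0.\<close>
  define g where "g p = 2 * ((1 + \<bar>fst p\<bar> * bnd)\<^sup>2 * flens (fst (snd p) / (1 + \<bar>fst p\<bar> * bnd))) - BB (fst p) (fst (snd p)) (snd (snd p))"
    for p :: "real \<times> real \<times> real"
  have "\<exists>\<tau>>0. \<forall>t k. \<bar>t\<bar> < \<tau> \<longrightarrow> k \<in> {a..b} \<times> {0..2*pi} \<longrightarrow> g (t, k) < 0"
  proof (rule tube_neg[of "{a..b} \<times> {0..2*pi}" "\<tau>0 / 2" g])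
    let ?D = "{- (\<tau>0 / 2)..\<tau>0 / 2} \<times> {a..b} \<times> {0..2*pi}"
    have D: "\<bar>fst p\<bar> < \<tau>0" "a \<le> fst (snd p)" "fst (snd p) \<le> b" "0 < 1 + \<bar>fst p\<bar> * bnd" if "p \<in> ?D" for p
      using that \<tau>0(1) bnd(1) by (auto intro: add_pos_nonneg)
    have rng: "0 < fst (snd p) / (1 + \<bar>fst p\<bar> * bnd)" "fst (snd p) / (1 + \<bar>fst p\<bar> * bnd) < 2" if "p \<in> ?D" for p
    proof -
      have "0 \<le> \<bar>fst p\<bar> * bnd" using bnd(1) by simp
      then show "0 < fst (snd p) / (1 + \<bar>fst p\<bar> * bnd)" "fst (snd p) / (1 + \<bar>fst p\<bar> * bnd) < 2"
        using D[OF that] ab by (auto simp: pos_divide_less_eq)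
    qed
    have nz: "1 + \<bar>fst p\<bar> * bnd \<noteq> 0" for p :: "real \<times> real \<times> real"
      using mult_nonneg_nonneg[OF abs_ge_zero[of "fst p"] less_imp_le[OF bnd(1)]] by linarith
    have ci: "continuous_on ?D (\<lambda>p. fst (snd p) / (1 + \<bar>fst p\<bar> * bnd))"
      by (intro continuous_intros) (simp add: nz)
    have cf: "continuous_on {0<..<2} flens"
    proof (rule continuous_at_imp_continuous_on, rule ballI)
      fix x :: real assume "x \<in> {0<..<2}"
      then show "isCont flens x" by (intro flens_isCont) simp_all
    qed
    have "continuous_on ?D (\<lambda>p. flens (fst (snd p) / (1 + \<bar>fst p\<bar> * bnd)))"
      by (rule continuous_on_compose2[OF cf ci]) (intro image_subsetI, simp only: greaterThanLessThan_iff, intro conjI rng)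
    moreover have "continuous_on ?D (\<lambda>p. BB (fst p) (fst (snd p)) (snd (snd p)))"
    proof (rule BB_continuous)
      fix p assume p: "p \<in> ?D"
      show "roots_prop f f' (fst p) (fst (snd p)) (snd (snd p))" "roots_prop f f' (fst p) (fst (snd p)) (snd (snd p) + pi)"
        using rp D(1-3)[OF p] by blast+
    qed (intro continuous_intros)+
    ultimately show "continuous_on ({- (\<tau>0 / 2)..\<tau>0 / 2} \<times> {a..b} \<times> {0..2*pi}) g"
      unfolding g_def by (intro continuous_intros)
    show "g (0, k) < 0" if "k \<in> {a..b} \<times> {0..2*pi}" for k
    proof -
      obtain s \<phi> where k: "k = (s, \<phi>)" by (cases k)
      have s: "0 < s" "s < 2" using that k ab by auto
      have "0 < sin (2 * arccos (s / 2))" using arccos_half[OF s] by (intro sin_gt_zero) auto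
      then show ?thesis using s by (simp add: g_def k BB_0 flens_def)
    qed
  next
    fix \<tau> assume "0 < \<tau>" "\<And>t k. \<bar>t\<bar> < \<tau> \<Longrightarrow> k \<in> {a..b} \<times> {0..2*pi} \<Longrightarrow> g (t, k) < 0"
    then show "\<exists>\<tau>>0. \<forall>t k. \<bar>t\<bar> < \<tau> \<longrightarrow> k \<in> {a..b} \<times> {0..2*pi} \<longrightarrow> g (t, k) < 0" by blast
  qed (use \<tau>0(1) in \<open>simp_all add: compact_Times\<close>)
  then obtain \<tau>2 where \<tau>2: "0 < \<tau>2" and T2': "\<forall>t k. \<bar>t\<bar> < \<tau>2 \<longrightarrow> k \<in> {a..b} \<times> {0..2*pi} \<longrightarrow> g (t, k) < 0"
    by blast
  have T2: "\<And>t s \<phi>. \<bar>t\<bar> < \<tau>2 \<Longrightarrow> a \<le> s \<Longrightarrow> s \<le> b \<Longrightarrow> 0 \<le> \<phi> \<Longrightarrow> \<phi> \<le> 2 * pi \<Longrightarrow> g (t, s, \<phi>) < 0"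
    using T2' by simp
  define \<tau> where "\<tau> = min \<tau>0 (min \<tau>1 \<tau>2)"
  have t\<tau>: "\<bar>t\<bar> < \<tau>0" "\<bar>t\<bar> < \<tau>1" "\<bar>t\<bar> < \<tau>2" if "\<bar>t\<bar> < \<tau>" for t using that by (auto simp: \<tau>_def)
  have low: "\<delta> * AA t < GG t s \<phi>" if t: "\<bar>t\<bar> < \<tau>" and s: "0 < s" "s \<le> a" for t s \<phi>
  proof -
    have p: "0 < 1 - \<bar>t\<bar> * bnd" using tb[OF t\<tau>(1)[OF t]] by linarith
    have "flens (a / (1 - \<bar>t\<bar> * bnd)) \<le> disc_lens 1 (s / (1 - \<bar>t\<bar> * bnd)) \<phi>"
      using p s spec[OF T1, of t] t\<tau>(2)[OF t] by (intro disc_lens_ge_flens divide_right_mono) simp_all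
    then have "(1 - \<bar>t\<bar> * bnd)\<^sup>2 * flens (a / (1 - \<bar>t\<bar> * bnd)) \<le> GG t s \<phi>"
      using GG_sandwich(1)[OF tb[OF t\<tau>(1)[OF t]], of s \<phi>] by (meson mult_left_mono order_trans zero_le_power2)
    then show ?thesis using spec[OF T1, of t] t\<tau>(2)[OF t] unfolding AA_eq[OF tb[OF t\<tau>(1)[OF t]]] by linarith
  qed
  have p1: "0 < 1 + \<bar>t\<bar> * bnd" "0 \<le> \<bar>t\<bar> * bnd" for t using bnd(1) by (auto intro: add_pos_nonneg)
  have high: "GG t s \<phi> < \<delta> * AA t" if t: "\<bar>t\<bar> < \<tau>" and s: "b \<le> s" for t s \<phi>
  proof -
    have "b / (1 + \<bar>t\<bar> * bnd) < 2" using ab p1[of t] by (simp add: pos_divide_less_eq)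
    then have "disc_lens 1 (s / (1 + \<bar>t\<bar> * bnd)) \<phi> \<le> flens (b / (1 + \<bar>t\<bar> * bnd))"
      using p1[of t] s ab by (intro disc_lens_le_flens divide_right_mono) auto
    then have "GG t s \<phi> \<le> (1 + \<bar>t\<bar> * bnd)\<^sup>2 * flens (b / (1 + \<bar>t\<bar> * bnd))"
      using GG_sandwich(2)[OF tb[OF t\<tau>(1)[OF t]], of s \<phi>] by (meson mult_left_mono order_trans zero_le_power2)
    then show ?thesis using spec[OF T1, of t] t\<tau>(2)[OF t] unfolding AA_eq[OF tb[OF t\<tau>(1)[OF t]]] by linarith
  qed
  have decr: "2 * GG t s \<phi> < BB t s \<phi>" if t: "\<bar>t\<bar> < \<tau>" and s: "a \<le> s" "s \<le> b" for t s \<phi>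
  proof -
    have main: "2 * GG t s \<psi> < BB t s \<psi>" if \<psi>: "0 \<le> \<psi>" "\<psi> \<le> 2 * pi" for \<psi>
    proof -
      have "s / (1 + \<bar>t\<bar> * bnd) < 2" using ab s p1[of t] by (simp add: pos_divide_less_eq)
      then have "disc_lens 1 (s / (1 + \<bar>t\<bar> * bnd)) \<psi> = flens (s / (1 + \<bar>t\<bar> * bnd))"
        using s ab p1[of t] by (intro disc_lens_eq) auto
      then have "GG t s \<psi> \<le> (1 + \<bar>t\<bar> * bnd)\<^sup>2 * flens (s / (1 + \<bar>t\<bar> * bnd))"
        using GG_sandwich(2)[OF tb[OF t\<tau>(1)[OF t]], of s \<psi>] by simp
      moreover have "g (t, s, \<psi>) < 0" using T2 t\<tau>(3)[OF t] s \<psi> by blast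
      ultimately show ?thesis by (simp add: g_def)
    qed
    \<comment> \<open>Compactness covers the directions in [0, 2 pi]; periodicity reduces the others
      to them.\<close>
    define n where "n = \<lfloor>\<phi> / (2 * pi)\<rfloor>"
    define \<psi> where "\<psi> = \<phi> - of_int n * (2 * pi)"
    have "of_int n \<le> \<phi> / (2 * pi)" "\<phi> / (2 * pi) < of_int n + 1" by (auto simp: n_def)
    then have "0 \<le> \<psi>" "\<psi> \<le> 2 * pi" by (auto simp: \<psi>_def field_simps)
    then have "2 * GG t s \<psi> < BB t s \<psi>" by (rule main)
    moreover have "BB t s (\<psi> + of_int n * (2 * pi)) = BB t s \<psi>"
    proof (rule periodic_int)
      show "BB t s (x + 2 * pi) = BB t s x" for x
        using rp t\<tau>(1)[OF t] s ab by (intro BB_periodic) auto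
    qed
    moreover have "GG t s (\<psi> + of_int n * (2 * pi)) = GG t s \<psi>"
      by (rule periodic_int) (simp add: GG_def cis2_periodic)
    ultimately show ?thesis by (simp add: \<psi>_def)
  qed
  have "\<tau> \<le> \<tau>0" "0 < \<tau>" using \<tau>0 \<tau>1 \<tau>2 by (auto simp: \<tau>_def)
  moreover from this have "\<tau> * bnd \<le> \<tau>0 * bnd" using bnd(1) by (intro mult_right_mono) auto
  ultimately have "0 < \<tau>" "\<tau> * bnd \<le> 1 / 2" using \<tau>0(2) by linarith+
  then show ?thesis
    using ab(1,4,5) low high decr rp t\<tau>(1)
    by (intro exI[of _ a] exI[of _ b] exI[of _ \<tau>] conjI allI impI) blast+
qed

end

locale solved = perturbed +
  fixes \<delta> a b \<tau> :: real
  assumes ab: "0 < a" "a < b" "b < 2" and \<tau>: "0 < \<tau>" "\<tau> * bnd \<le> 1 / 2"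
    and rp: "\<And>t s \<phi>. \<bar>t\<bar> < \<tau> \<Longrightarrow> a \<le> s \<Longrightarrow> s \<le> b \<Longrightarrow> roots_prop f f' t s \<phi>"
    and low: "\<And>t s \<phi>. \<bar>t\<bar> < \<tau> \<Longrightarrow> 0 < s \<Longrightarrow> s \<le> a \<Longrightarrow> \<delta> * AA t < GG t s \<phi>"
    and high: "\<And>t s \<phi>. \<bar>t\<bar> < \<tau> \<Longrightarrow> b \<le> s \<Longrightarrow> GG t s \<phi> < \<delta> * AA t"
    and decr: "\<And>t s \<phi>. \<bar>t\<bar> < \<tau> \<Longrightarrow> a \<le> s \<Longrightarrow> s \<le> b \<Longrightarrow> 2 * GG t s \<phi> < BB t s \<phi>"
begin

lemma tb: "\<bar>t\<bar> < \<tau> \<Longrightarrow> \<bar>t\<bar> * bnd < 1 / 2"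
  using mult_strict_right_mono[of "\<bar>t\<bar>" \<tau> bnd] \<tau>(2) bnd(1) by linarith

lemma AA_tau: "\<bar>t\<bar> < \<tau> \<Longrightarrow> AA t = pi + t * m1 + t\<^sup>2 * m2 / 2"
  using tb by (intro AA_eq) (simp add: less_imp_le)

lemma GG_s_derivative:
  assumes "\<bar>t\<bar> < \<tau>" "a \<le> s" "s \<le> b"
  shows "((\<lambda>s. GG t s \<phi>) has_real_derivative (2 * GG t s \<phi> - BB t s \<phi>) / s) (at s)"
proof -
  have "((\<lambda>(t, s). GG t s \<phi>) has_derivative (\<lambda>(a, b). CC t s \<phi> * a + (2 * GG t s \<phi> - BB t s \<phi>) / s * b)) (at (t, s))"
    using assms ab tb rp by (intro GG_has_derivative) auto
  moreover have "((\<lambda>s. (t, s)) has_derivative (\<lambda>b. (0, b))) (at s)" by (intro derivative_eq_intros) auto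
  ultimately have "((\<lambda>s. case (t, s) of (t, s) \<Rightarrow> GG t s \<phi>) has_derivative (\<lambda>b. case (0, b) of (a, b) \<Rightarrow> CC t s \<phi> * a + (2 * GG t s \<phi> - BB t s \<phi>) / s * b)) (at s)"
    by (rule has_derivative_compose[rotated])
  then have "((\<lambda>s. GG t s \<phi>) has_derivative (\<lambda>b. (2 * GG t s \<phi> - BB t s \<phi>) / s * b)) (at s)" by simp
  then show ?thesis by (simp only: has_field_derivative_def)
qed

lemma GG_strict_decreasing:
  assumes t: "\<bar>t\<bar> < \<tau>" and xy: "a \<le> x" "x < y" "y \<le> b"
  shows "GG t y \<phi> < GG t x \<phi>"
proof (rule DERIV_neg_imp_decreasing[OF xy(2)])
  fix s assume s: "x \<le> s" "s \<le> y"
  then have s': "a \<le> s" "s \<le> b" "0 < s" using xy ab by auto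
  show "\<exists>y. ((\<lambda>s. GG t s \<phi>) has_real_derivative y) (at s) \<and> y < 0"
    using GG_s_derivative[OF t s'(1,2), of \<phi>] decr[OF t s'(1,2), of \<phi>] s'(3)
    by (intro exI[of _ "(2 * GG t s \<phi> - BB t s \<phi>) / s"]) (auto intro: divide_neg_pos)
qed

text \<open>The radial function of the convolution body of \<open>KK t\<close>.\<close>

definition SS :: "real \<Rightarrow> real \<Rightarrow> real" where
  "SS t \<phi> = (THE s. a < s \<and> s < b \<and> GG t s \<phi> = \<delta> * AA t)"

lemma SS:
  assumes t: "\<bar>t\<bar> < \<tau>"
  shows "a < SS t \<phi>" "SS t \<phi> < b" "GG t (SS t \<phi>) \<phi> = \<delta> * AA t"
proof -
  have "continuous_on {a..b} (\<lambda>s. GG t s \<phi>)"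
    using GG_s_derivative[OF t] by (intro continuous_at_imp_continuous_on ballI DERIV_isCont) auto
  then obtain s where s: "a \<le> s" "s \<le> b" "GG t s \<phi> = \<delta> * AA t"
    using IVT2'[of "\<lambda>s. GG t s \<phi>" b "\<delta> * AA t" a] low[OF t, of a \<phi>] high[OF t, of b \<phi>] ab by force
  have s': "a < s \<and> s < b \<and> GG t s \<phi> = \<delta> * AA t"
    using s low[OF t, of a \<phi>] high[OF t, of b \<phi>] ab by (cases "s = a"; cases "s = b") auto
  have "\<exists>!s. a < s \<and> s < b \<and> GG t s \<phi> = \<delta> * AA t"
  proof (rule ex1I[of _ s])
    show "a < s \<and> s < b \<and> GG t s \<phi> = \<delta> * AA t" by (rule s')
    fix s2 assume s2: "a < s2 \<and> s2 < b \<and> GG t s2 \<phi> = \<delta> * AA t"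
    show "s2 = s"
      using GG_strict_decreasing[OF t, of s s2 \<phi>] GG_strict_decreasing[OF t, of s2 s \<phi>] s' s2
      by (cases s s2 rule: linorder_cases) auto
  qed
  from theI'[OF this] show "a < SS t \<phi>" "SS t \<phi> < b" "GG t (SS t \<phi>) \<phi> = \<delta> * AA t"
    unfolding SS_def by blast+
qed

text \<open>Outside (a, b) the inequalities of the locale decide, inside it strict monotonicity
  does. The comparison therefore covers every positive \<open>s\<close>, as membership in the
  convolution body requires.\<close>

lemma SS_iff:
  assumes t: "\<bar>t\<bar> < \<tau>" and s: "0 < s"
  shows "s < SS t \<phi> \<longleftrightarrow> \<delta> * AA t < GG t s \<phi>" "SS t \<phi> < s \<longleftrightarrow> GG t s \<phi> < \<delta> * AA t"
proof -
  have 1: "\<delta> * AA t < GG t s \<phi>" if "s < SS t \<phi>"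
    using low[OF t s, of \<phi>] GG_strict_decreasing[OF t, of s "SS t \<phi>" \<phi>] SS[OF t, of \<phi>] that by (cases "s \<le> a") auto
  have 2: "GG t s \<phi> < \<delta> * AA t" if "SS t \<phi> < s"
    using high[OF t, of s \<phi>] GG_strict_decreasing[OF t, of "SS t \<phi>" s \<phi>] SS[OF t, of \<phi>] that by (cases "b \<le> s") auto
  show "s < SS t \<phi> \<longleftrightarrow> \<delta> * AA t < GG t s \<phi>" "SS t \<phi> < s \<longleftrightarrow> GG t s \<phi> < \<delta> * AA t"
    using 1 2 SS(3)[OF t, of \<phi>] by (cases s "SS t \<phi>" rule: linorder_cases; force)+
qed

lemma SS_le_iff: "\<bar>t\<bar> < \<tau> \<Longrightarrow> 0 < s \<Longrightarrow> \<delta> * AA t \<le> GG t s \<phi> \<longleftrightarrow> s \<le> SS t \<phi>"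
  using SS_iff(2)[of t s \<phi>] by (simp add: linorder_not_less[symmetric])

definition DD :: "(real \<times> real) set" where "DD = {-\<tau><..<\<tau>} \<times> UNIV"

lemma DD: "p \<in> DD \<longleftrightarrow> \<bar>fst p\<bar> < \<tau>"
  by (cases p) (auto simp: DD_def)

text \<open>As for \<open>hit\<close>: at a fixed radius the sign of the volume equation is an open
  condition in (t, \<phi>), and by \<open>SS_iff\<close> it tells on which side of that radius the
  solution lies.\<close>

lemma SS_continuous: "continuous_on DD (\<lambda>p. SS (fst p) (snd p))"
  unfolding continuous_on_def
proof
  fix p0 assume p0: "p0 \<in> DD"
  have inT: "\<forall>\<^sub>F p in at p0 within DD. p \<in> DD" by (simp add: eventually_at_filter)
  have c: "((\<lambda>p. GG (fst p) l (snd p) - \<delta> * AA (fst p)) \<longlongrightarrow> GG (fst p0) l (snd p0) - \<delta> * AA (fst p0)) (at p0 within DD)"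
    if "0 < l" for l
  proof -
    have "continuous_on DD (\<lambda>p. GG (fst p) l (snd p) - \<delta> * (pi + fst p * m1 + (fst p)\<^sup>2 * m2 / 2))"
      using tb by (intro continuous_intros GG_continuous that) (auto simp: DD less_imp_le)
    then have "continuous_on DD (\<lambda>p. GG (fst p) l (snd p) - \<delta> * AA (fst p))"
      by (rule continuous_on_cong[THEN iffD1, rotated -1]) (auto simp: DD AA_tau)
    then show ?thesis using p0 by (simp add: continuous_on_def)
  qed
  have S0: "0 < SS (fst p) (snd p)" if "p \<in> DD" for p using SS(1)[of "fst p" "snd p"] that ab by (auto simp: DD)
  show "((\<lambda>p. SS (fst p) (snd p)) \<longlongrightarrow> SS (fst p0) (snd p0)) (at p0 within DD)"
  proof (rule order_tendstoI)
    fix l assume l: "l < SS (fst p0) (snd p0)"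
    show "\<forall>\<^sub>F p in at p0 within DD. l < SS (fst p) (snd p)"
    proof (cases "0 < l")
      case False
      show ?thesis using inT
      proof eventually_elim
        case (elim p) then show ?case using S0[OF elim] False by auto
      qed
    next
      case True
      have "0 < GG (fst p0) l (snd p0) - \<delta> * AA (fst p0)" using l SS_iff(1)[of "fst p0" l "snd p0"] p0 True by (simp add: DD)
      from order_tendstoD(1)[OF c[OF True] this] inT show ?thesis
        by eventually_elim (use SS_iff(1) True in \<open>auto simp: DD\<close>)
    qed
  next
    fix l assume l: "SS (fst p0) (snd p0) < l"
    then have True: "0 < l" using S0[OF p0] by simp
    have "GG (fst p0) l (snd p0) - \<delta> * AA (fst p0) < 0" using l SS_iff(2)[of "fst p0" l "snd p0"] p0 True by (simp add: DD)
    from order_tendstoD(2)[OF c[OF True] this] inT show "\<forall>\<^sub>F p in at p0 within DD. SS (fst p) (snd p) < l"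
      by eventually_elim (use SS_iff(2) True in \<open>auto simp: DD\<close>)
  qed
qed

text \<open>The derivative of \<open>SS\<close> in \<open>t\<close> is \<open>SS * qN / qD\<close>.\<close>

definition qN where "qN t \<phi> = \<delta> * (m1 + t * m2) - CC t (SS t \<phi>) \<phi>"
definition qD where "qD t \<phi> = 2 * \<delta> * (pi + t * m1 + t\<^sup>2 * m2 / 2) - BB t (SS t \<phi>) \<phi>"

lemma qD_neg: "\<bar>t\<bar> < \<tau> \<Longrightarrow> qD t \<phi> < 0"
  using decr[of t "SS t \<phi>" \<phi>] SS[of t \<phi>] by (simp add: qD_def AA_tau)

lemma isCont_SS: "\<bar>t\<bar> < \<tau> \<Longrightarrow> isCont (\<lambda>t. SS t \<phi>) t"
proof -
  assume t: "\<bar>t\<bar> < \<tau>"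
  have "continuous_on {-\<tau><..<\<tau>} (\<lambda>t. SS (fst (t, \<phi>)) (snd (t, \<phi>)))"
    by (rule continuous_on_compose2[OF SS_continuous]) (auto simp: DD_def intro!: continuous_intros)
  moreover have "t \<in> {-\<tau><..<\<tau>}" using t by auto
  ultimately show ?thesis by (simp add: continuous_on_eq_continuous_at)
qed

lemma ev_tau: "\<bar>t\<bar> < \<tau> \<Longrightarrow> \<forall>\<^sub>F x in nhds t. \<bar>x\<bar> < \<tau>"
  unfolding eventually_nhds by (intro exI[of _ "{-\<tau><..<\<tau>}"]) auto

text \<open>Implicit differentiation of the volume equation. On the solution \<open>GG\<close> may
  be replaced by \<open>\<delta> * AA\<close>, which is the form it takes in
  \<open>qD\<close>.\<close>

lemma SS_derivative:
  assumes t: "\<bar>t\<bar> < \<tau>"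
  shows "((\<lambda>t. SS t \<phi>) has_real_derivative SS t \<phi> * (qN t \<phi> / qD t \<phi>)) (at t)"
proof -
  let ?S = "SS t \<phi>"
  note S = SS[OF t, of \<phi>]
  have S0: "0 < ?S" using S ab by simp
  have G: "((\<lambda>(t, s). GG t s \<phi>) has_derivative (\<lambda>(a, b). CC t ?S \<phi> * a + (2 * GG t ?S \<phi> - BB t ?S \<phi>) / ?S * b)) (at (t, ?S))"
    using t S S0 tb rp by (intro GG_has_derivative) auto
  have fst': "((\<lambda>p. fst p :: real) has_derivative (\<lambda>p. fst p)) F" for F :: "(real \<times> real) filter"
    by (rule has_derivative_fst[OF has_derivative_ident])
  have A: "((\<lambda>p. \<delta> * (pi + fst p * m1 + (fst p)\<^sup>2 * m2 / 2)) has_derivative (\<lambda>h. \<delta> * (m1 + t * m2) * fst h)) (at (t, ?S))"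
  proof -
    have "((\<lambda>x. \<delta> * (pi + x * m1 + x\<^sup>2 * m2 / 2)) has_real_derivative \<delta> * (m1 + t * m2)) (at (fst (t, ?S)))"
      by (auto intro!: derivative_eq_intros)
    from DERIV_compose_FDERIV[OF this fst'] show ?thesis by (simp add: mult.commute)
  qed
  have F: "((\<lambda>p. (case p of (t, s) \<Rightarrow> GG t s \<phi>) - \<delta> * (pi + fst p * m1 + (fst p)\<^sup>2 * m2 / 2)) has_derivative
     (\<lambda>(a, b). - qN t \<phi> * a + qD t \<phi> / ?S * b)) (at (t, ?S))"
    by (rule has_derivative_eq_rhs[OF has_derivative_diff[OF G A]])
       (simp add: fun_eq_iff qN_def qD_def S(3) AA_tau[OF t] left_diff_distrib mult.assoc)
  have "((\<lambda>t. SS t \<phi>) has_real_derivative - (- qN t \<phi>) / (qD t \<phi> / ?S)) (at t)"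
  proof (rule implicit_has_real_derivative[where g = "\<lambda>t. SS t \<phi>", OF F])
    show "qD t \<phi> / ?S \<noteq> 0" using qD_neg[OF t, of \<phi>] S0 by simp
    show "isCont (\<lambda>t. SS t \<phi>) t" by (rule isCont_SS[OF t])
    show "\<forall>\<^sub>F x in nhds t. (case (x, SS x \<phi>) of (t, s) \<Rightarrow> GG t s \<phi>) - \<delta> * (pi + fst (x, SS x \<phi>) * m1 + (fst (x, SS x \<phi>))\<^sup>2 * m2 / 2)
      = (case (t, SS t \<phi>) of (t, s) \<Rightarrow> GG t s \<phi>) - \<delta> * (pi + fst (t, SS t \<phi>) * m1 + (fst (t, SS t \<phi>))\<^sup>2 * m2 / 2)"
      using ev_tau[OF t] by eventually_elim (use SS(3) AA_tau t in simp)
  qed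
  then show ?thesis by (simp add: mult.commute)
qed

end

section \<open>Second derivatives by differentiation under the integral over directions\<close>

context solved
begin

text \<open>Differentiability in \<open>t\<close>, with value and derivative jointly continuous in
  (t, \<phi>). This is what the Leibniz rule over \<phi> asks for, and it is stable under the
  operations from which \<open>qq\<close> is built.\<close>

definition C1 :: "(real \<Rightarrow> real \<Rightarrow> real) \<Rightarrow> (real \<Rightarrow> real \<Rightarrow> real) \<Rightarrow> bool" where
  "C1 g g' \<longleftrightarrow> (\<forall>t \<phi>. \<bar>t\<bar> < \<tau> \<longrightarrow> ((\<lambda>t. g t \<phi>) has_real_derivative g' t \<phi>) (at t))
     \<and> continuous_on DD (\<lambda>p. g (fst p) (snd p)) \<and> continuous_on DD (\<lambda>p. g' (fst p) (snd p))"

lemma C1I: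
  assumes "\<And>t \<phi>. \<bar>t\<bar> < \<tau> \<Longrightarrow> ((\<lambda>t. g t \<phi>) has_real_derivative g' t \<phi>) (at t)"
    "continuous_on DD (\<lambda>p. g (fst p) (snd p))" "continuous_on DD (\<lambda>p. g' (fst p) (snd p))"
  shows "C1 g g'"
  using assms by (simp add: C1_def)

lemma C1D:
  assumes "C1 g g'"
  shows "\<bar>t\<bar> < \<tau> \<Longrightarrow> ((\<lambda>t. g t \<phi>) has_real_derivative g' t \<phi>) (at t)"
    "continuous_on DD (\<lambda>p. g (fst p) (snd p))" "continuous_on DD (\<lambda>p. g' (fst p) (snd p))"
  using assms by (simp_all add: C1_def)

lemma C1_fun:
  assumes "\<And>t. (c has_real_derivative c' t) (at t)" "continuous_on UNIV c'"
  shows "C1 (\<lambda>t \<phi>. c t) (\<lambda>t \<phi>. c' t)"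
proof (rule C1I)
  have "continuous_on UNIV c" using assms(1) by (meson DERIV_isCont continuous_at_imp_continuous_on)
  then show "continuous_on DD (\<lambda>p. c (fst p))"
    by (rule continuous_on_compose2) (auto intro!: continuous_intros)
  show "continuous_on DD (\<lambda>p. c' (fst p))"
    by (rule continuous_on_compose2[OF assms(2)]) (auto intro!: continuous_intros)
qed (rule assms)

lemma C1_add: "C1 g g' \<Longrightarrow> C1 k k' \<Longrightarrow> C1 (\<lambda>t \<phi>. g t \<phi> + k t \<phi>) (\<lambda>t \<phi>. g' t \<phi> + k' t \<phi>)"
  by (intro C1I) (auto intro!: DERIV_add continuous_intros dest: C1D)

lemma C1_diff: "C1 g g' \<Longrightarrow> C1 k k' \<Longrightarrow> C1 (\<lambda>t \<phi>. g t \<phi> - k t \<phi>) (\<lambda>t \<phi>. g' t \<phi> - k' t \<phi>)"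
  by (intro C1I) (auto intro!: DERIV_diff continuous_intros dest: C1D)

lemma C1_mult: "C1 g g' \<Longrightarrow> C1 k k' \<Longrightarrow> C1 (\<lambda>t \<phi>. g t \<phi> * k t \<phi>) (\<lambda>t \<phi>. g' t \<phi> * k t \<phi> + k' t \<phi> * g t \<phi>)"
  by (intro C1I) (auto intro!: DERIV_mult continuous_intros dest: C1D)

lemma C1_divide:
  assumes "C1 g g'" "C1 k k'" "\<And>t \<phi>. \<bar>t\<bar> < \<tau> \<Longrightarrow> k t \<phi> \<noteq> 0"
  shows "C1 (\<lambda>t \<phi>. g t \<phi> / k t \<phi>) (\<lambda>t \<phi>. (g' t \<phi> * k t \<phi> - g t \<phi> * k' t \<phi>) / (k t \<phi> * k t \<phi>))"
  using assms(3)
  by (intro C1I) (auto intro!: DERIV_divide continuous_intros C1D[OF assms(1)] C1D[OF assms(2)] simp: DD)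

lemma C1_comp:
  assumes F: "\<And>x. (F has_real_derivative F' x) (at x)" "continuous_on UNIV F'" and g: "C1 g g'"
  shows "C1 (\<lambda>t \<phi>. F (\<phi> + \<psi> + g t \<phi>)) (\<lambda>t \<phi>. F' (\<phi> + \<psi> + g t \<phi>) * g' t \<phi>)"
    "C1 (\<lambda>t \<phi>. F (\<phi> + \<psi> - g t \<phi>)) (\<lambda>t \<phi>. - F' (\<phi> + \<psi> - g t \<phi>) * g' t \<phi>)"
proof -
  have cF: "continuous_on UNIV F" using F(1) by (meson DERIV_isCont continuous_at_imp_continuous_on)
  have c: "continuous_on S (\<lambda>x. F (k x))" "continuous_on S (\<lambda>x. F' (k x))"
    if "continuous_on S k" for S :: "(real \<times> real) set" and k
    using continuous_on_compose2[OF cF that] continuous_on_compose2[OF F(2) that] by auto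
  show "C1 (\<lambda>t \<phi>. F (\<phi> + \<psi> + g t \<phi>)) (\<lambda>t \<phi>. F' (\<phi> + \<psi> + g t \<phi>) * g' t \<phi>)"
  proof (rule C1I)
    fix t \<phi> assume "\<bar>t\<bar> < \<tau>"
    then have "((\<lambda>t. \<phi> + \<psi> + g t \<phi>) has_real_derivative g' t \<phi>) (at t)"
      using C1D(1)[OF g, of t \<phi>] by (auto intro!: derivative_eq_intros)
    from DERIV_chain2[OF F(1) this]
    show "((\<lambda>t. F (\<phi> + \<psi> + g t \<phi>)) has_real_derivative F' (\<phi> + \<psi> + g t \<phi>) * g' t \<phi>) (at t)" .
  qed (intro continuous_intros c C1D[OF g])+
  show "C1 (\<lambda>t \<phi>. F (\<phi> + \<psi> - g t \<phi>)) (\<lambda>t \<phi>. - F' (\<phi> + \<psi> - g t \<phi>) * g' t \<phi>)"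
  proof (rule C1I)
    fix t \<phi> assume "\<bar>t\<bar> < \<tau>"
    then have "((\<lambda>t. \<phi> + \<psi> - g t \<phi>) has_real_derivative - g' t \<phi>) (at t)"
      using C1D(1)[OF g, of t \<phi>] by (auto intro!: derivative_eq_intros)
    from DERIV_chain2[OF F(1) this]
    show "((\<lambda>t. F (\<phi> + \<psi> - g t \<phi>)) has_real_derivative - F' (\<phi> + \<psi> - g t \<phi>) * g' t \<phi>) (at t)" by simp
  qed (intro continuous_intros c C1D[OF g])+
qed

lemma C1_integral:
  assumes "C1 g g'"
  shows "\<bar>t\<bar> < \<tau> \<Longrightarrow> ((\<lambda>t. integral {-pi..pi} (g t)) has_real_derivative integral {-pi..pi} (g' t)) (at t)"
    "continuous_on {-\<tau><..<\<tau>} (\<lambda>t. integral {-pi..pi} (g' t))"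
    "\<bar>t\<bar> < \<tau> \<Longrightarrow> continuous_on {-pi..pi} (g t)" "\<bar>t\<bar> < \<tau> \<Longrightarrow> continuous_on {-pi..pi} (g' t)"
proof -
  have c': "continuous_on ({-\<tau><..<\<tau>} \<times> cbox (-pi) pi) (\<lambda>(t, \<phi>). g' t \<phi>)"
    using continuous_on_subset[OF C1D(3)[OF assms], of "{-\<tau><..<\<tau>} \<times> cbox (-pi) pi"] by (auto simp: DD_def case_prod_beta')
  have sl: "continuous_on {-pi..pi} (\<lambda>\<phi>. k t \<phi>)" if "continuous_on DD (\<lambda>p. k (fst p) (snd p))" "\<bar>t\<bar> < \<tau>" for t and k :: "real \<Rightarrow> real \<Rightarrow> real"
  proof -
    have "continuous_on {-pi..pi} (\<lambda>\<phi>. k (fst (t, \<phi>)) (snd (t, \<phi>)))"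
      by (rule continuous_on_compose2[OF that(1)]) (use that(2) in \<open>auto simp: DD intro!: continuous_intros\<close>)
    then show ?thesis by simp
  qed
  show "\<bar>t\<bar> < \<tau> \<Longrightarrow> continuous_on {-pi..pi} (g t)" "\<bar>t\<bar> < \<tau> \<Longrightarrow> continuous_on {-pi..pi} (g' t)" for t
    using sl[OF C1D(2)[OF assms]] sl[OF C1D(3)[OF assms]] by auto
  show "continuous_on {-\<tau><..<\<tau>} (\<lambda>t. integral {-pi..pi} (g' t))"
    using integral_continuous_on_param[OF c'] by simp
  show "((\<lambda>t. integral {-pi..pi} (g t)) has_real_derivative integral {-pi..pi} (g' t)) (at t)" if t: "\<bar>t\<bar> < \<tau>"
  proof -
    have "((\<lambda>t. integral (cbox (-pi) pi) (g t)) has_field_derivative integral (cbox (-pi) pi) (g' t)) (at t within {-\<tau><..<\<tau>})"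
    proof (rule leibniz_rule_field_derivative[OF _ _ c'])
      fix x \<phi> assume "x \<in> {-\<tau><..<\<tau>}"
      then show "((\<lambda>t. g t \<phi>) has_field_derivative g' x \<phi>) (at x within {-\<tau><..<\<tau>})"
        using C1D(1)[OF assms, of x \<phi>] by (auto intro: has_field_derivative_at_within)
      show "g x integrable_on cbox (-pi) pi" if "x \<in> {-\<tau><..<\<tau>}" for x
        using sl[OF C1D(2)[OF assms], of x] that by (auto intro!: integrable_continuous_real)
    qed (use t in auto)
    moreover have "at t within {-\<tau><..<\<tau>} = at t" using t by (intro at_within_open) auto
    ultimately show ?thesis by simp
  qed
qed

lemma CC_continuous:
  fixes t s \<phi> :: "'p :: metric_space \<Rightarrow> real"
  assumes c: "continuous_on T t" "continuous_on T s" "continuous_on T \<phi>"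
    and rp: "\<And>p. p \<in> T \<Longrightarrow> roots_prop f f' (t p) (s p) (\<phi> p)" "\<And>p. p \<in> T \<Longrightarrow> roots_prop f f' (t p) (s p) (\<phi> p + pi)"
  shows "continuous_on T (\<lambda>p. CC (t p) (s p) (\<phi> p))"
  unfolding CC_def arcC_def
  by (intro continuous_intros contF c hits_continuous rp)

lemma rpS: "\<bar>t\<bar> < \<tau> \<Longrightarrow> roots_prop f f' t (SS t \<phi>) \<psi>"
  using SS(1,2)[of t \<phi>] by (intro rp) auto

lemma q_continuous: "continuous_on DD (\<lambda>p. qN (fst p) (snd p))" "continuous_on DD (\<lambda>p. qD (fst p) (snd p))"
  unfolding qN_def qD_def
  by (intro continuous_intros CC_continuous BB_continuous SS_continuous; simp add: rpS DD)+

definition qq where "qq t \<phi> = qN t \<phi> / qD t \<phi>"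

lemma qq_continuous: "continuous_on DD (\<lambda>p. qq (fst p) (snd p))"
proof -
  have "\<forall>p\<in>DD. qD (fst p) (snd p) \<noteq> 0"
  proof
    fix p assume "p \<in> DD"
    then have "qD (fst p) (snd p) < 0" by (intro qD_neg) (simp add: DD)
    then show "qD (fst p) (snd p) \<noteq> 0" by simp
  qed
  then show ?thesis unfolding qq_def by (intro continuous_intros q_continuous)
qed

lemma C1_SS: "C1 SS (\<lambda>t \<phi>. SS t \<phi> * qq t \<phi>)"
  using SS_derivative unfolding qq_def[symmetric]
  by (intro C1I continuous_intros SS_continuous qq_continuous) auto

text \<open>Crossing angles along the solution, for \<psi> = 0 and \<psi> = pi. The shift is
  \<open>SS t \<phi>\<close> in both cases: the arc in direction \<phi> + pi belongs to the same
  intersection, seen from the translated copy.\<close>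

definition hp where "hp \<psi> t \<phi> = hit f t (SS t \<phi>) (\<phi> + \<psi>)"
definition hm where "hm \<psi> t \<phi> = hitm f t (SS t \<phi>) (\<phi> + \<psi>)"
definition hp' where "hp' \<psi> t \<phi> =
  - (wgap_t f f' t (SS t \<phi>) (\<phi> + \<psi>) (hp \<psi> t \<phi>) + wgap_s f f' t (SS t \<phi>) (\<phi> + \<psi>) (hp \<psi> t \<phi>) * (SS t \<phi> * qq t \<phi>))
   / wgap_b f f' t (SS t \<phi>) (\<phi> + \<psi>) (hp \<psi> t \<phi>)"
definition hm' where "hm' \<psi> t \<phi> =
  - (wgap_t (\<lambda>x. f (- x)) (\<lambda>x. - f' (- x)) t (SS t \<phi>) (- (\<phi> + \<psi>)) (hm \<psi> t \<phi>)
     + wgap_s (\<lambda>x. f (- x)) (\<lambda>x. - f' (- x)) t (SS t \<phi>) (- (\<phi> + \<psi>)) (hm \<psi> t \<phi>) * (SS t \<phi> * qq t \<phi>))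
   / wgap_b (\<lambda>x. f (- x)) (\<lambda>x. - f' (- x)) t (SS t \<phi>) (- (\<phi> + \<psi>)) (hm \<psi> t \<phi>)"

lemma C1_hp: "C1 (hp \<psi>) (hp' \<psi>)"
proof (rule C1I)
  have r: "root_prop f f' t (SS t \<phi>) (\<phi> + \<psi>)" if "\<bar>t\<bar> < \<tau>" for t \<phi> using rpS[OF that] by (simp add: roots_prop_def)
  show c: "continuous_on DD (\<lambda>p. hp \<psi> (fst p) (snd p))"
    unfolding hp_def using r by (intro hit_continuous continuous_intros SS_continuous) (auto simp: DD)
  have w: "0 < wy2 f (fst p) (SS (fst p) (snd p)) (snd p + \<psi>) (hp \<psi> (fst p) (snd p))"
    "wgap_b f f' (fst p) (SS (fst p) (snd p)) (snd p + \<psi>) (hp \<psi> (fst p) (snd p)) \<noteq> 0" if "p \<in> DD" for p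
    using r[of "fst p" "snd p"] that by (auto simp: root_prop_def hp_def DD)
  show "continuous_on DD (\<lambda>p. hp' \<psi> (fst p) (snd p))"
    unfolding hp'_def using w by (intro continuous_intros wcont c SS_continuous qq_continuous) auto
  fix t \<phi> assume t: "\<bar>t\<bar> < \<tau>"
  show "((\<lambda>t. hp \<psi> t \<phi>) has_real_derivative hp' \<psi> t \<phi>) (at t)"
    unfolding hp_def hp'_def
  proof (rule hit_has_derivative[of "{-\<tau><..<\<tau>}"])
    show "((\<lambda>t. SS t \<phi>) has_real_derivative SS t \<phi> * qq t \<phi>) (at t)" using C1D(1)[OF C1_SS t] .
  qed (use t isCont_SS r in auto)
qed

lemma C1_hm: "C1 (hm \<psi>) (hm' \<psi>)"
proof (rule C1I)
  interpret R: c1_periodic "\<lambda>x. f (- x)" "\<lambda>x. - f' (- x)" by (rule reflected)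
  have r: "root_prop (\<lambda>x. f (- x)) (\<lambda>x. - f' (- x)) t (SS t \<phi>) (- (\<phi> + \<psi>))" if "\<bar>t\<bar> < \<tau>" for t \<phi>
    using rpS[OF that, of \<phi> "\<phi> + \<psi>"] by (simp add: roots_prop_def)
  show c: "continuous_on DD (\<lambda>p. hm \<psi> (fst p) (snd p))"
    unfolding hm_def hitm_def using r by (intro R.hit_continuous continuous_intros SS_continuous) (auto simp: DD)
  have w: "0 < wy2 (\<lambda>x. f (- x)) (fst p) (SS (fst p) (snd p)) (- (snd p + \<psi>)) (hm \<psi> (fst p) (snd p))"
    "wgap_b (\<lambda>x. f (- x)) (\<lambda>x. - f' (- x)) (fst p) (SS (fst p) (snd p)) (- (snd p + \<psi>)) (hm \<psi> (fst p) (snd p)) \<noteq> 0" if "p \<in> DD" for p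
    using r[of "fst p" "snd p"] that unfolding hm_def hitm_def DD root_prop_def by (blast, metis less_irrefl)
  show "continuous_on DD (\<lambda>p. hm' \<psi> (fst p) (snd p))"
    unfolding hm'_def using w by (intro continuous_intros R.wcont c SS_continuous qq_continuous) blast+
  fix t \<phi> assume t: "\<bar>t\<bar> < \<tau>"
  show "((\<lambda>t. hm \<psi> t \<phi>) has_real_derivative hm' \<psi> t \<phi>) (at t)"
    unfolding hm_def hm'_def hitm_def
  proof (rule R.hit_has_derivative[of "{-\<tau><..<\<tau>}"])
    show "((\<lambda>t. SS t \<phi>) has_real_derivative SS t \<phi> * qq t \<phi>) (at t)" using C1D(1)[OF C1_SS t] .
    show "root_prop (\<lambda>x. f (- x)) (\<lambda>x. - f' (- x)) t (SS t \<phi>) (- (\<phi> + \<psi>))" if "t \<in> {-\<tau><..<\<tau>}" for t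
      using that by (intro r) auto
    show "isCont (\<lambda>t. SS t \<phi>) t" if "t \<in> {-\<tau><..<\<tau>}" for t
      using that by (intro isCont_SS) auto
  qed (use t in auto)
qed

definition E1 where "E1 \<psi> t \<phi> = F1 (\<phi> + \<psi> + hp \<psi> t \<phi>) - F1 (\<phi> + \<psi> - hm \<psi> t \<phi>)"
definition E2 where "E2 \<psi> t \<phi> = F2 (\<phi> + \<psi> + hp \<psi> t \<phi>) - F2 (\<phi> + \<psi> - hm \<psi> t \<phi>)"
text \<open>Fixed primitives are evaluated at moving end points, so only end point terms occur. The
  double negation is the form produced by \<open>C1_diff\<close> and \<open>C1_comp\<close>.\<close>

definition E1' where "E1' \<psi> t \<phi> = f (\<phi> + \<psi> + hp \<psi> t \<phi>) * hp' \<psi> t \<phi> - (- f (\<phi> + \<psi> - hm \<psi> t \<phi>) * hm' \<psi> t \<phi>)"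
definition E2' where "E2' \<psi> t \<phi> = (f (\<phi> + \<psi> + hp \<psi> t \<phi>))\<^sup>2 * hp' \<psi> t \<phi> - (- (f (\<phi> + \<psi> - hm \<psi> t \<phi>))\<^sup>2 * hm' \<psi> t \<phi>)"

lemma C1_E: "C1 (E1 \<psi>) (E1' \<psi>)" "C1 (E2 \<psi>) (E2' \<psi>)"
proof -
  have c2: "continuous_on UNIV (\<lambda>x. (f x)\<^sup>2)" by (intro continuous_intros)
  show "C1 (E1 \<psi>) (E1' \<psi>)"
    unfolding E1_def[abs_def] E1'_def[abs_def] by (intro C1_diff C1_comp F1 contf C1_hp C1_hm)
  show "C1 (E2 \<psi>) (E2' \<psi>)"
    unfolding E2_def[abs_def] E2'_def[abs_def] by (intro C1_diff C1_comp F2 c2 C1_hp C1_hm)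
qed

definition qN' where "qN' t \<phi> = \<delta> * m2 - ((E1' 0 t \<phi> + (E2 0 t \<phi> + t * E2' 0 t \<phi>)) + (E1' pi t \<phi> + (E2 pi t \<phi> + t * E2' pi t \<phi>)))"

definition qD' where "qD' t \<phi> = 2 * \<delta> * (m1 + t * m2)
   - ((hp' 0 t \<phi> + hm' 0 t \<phi> + (2 * E1 0 t \<phi> + 2 * t * E1' 0 t \<phi>) + (2 * t * E2 0 t \<phi> + t\<^sup>2 * E2' 0 t \<phi>))
    + (hp' pi t \<phi> + hm' pi t \<phi> + (2 * E1 pi t \<phi> + 2 * t * E1' pi t \<phi>) + (2 * t * E2 pi t \<phi> + t\<^sup>2 * E2' pi t \<phi>)))"

lemma qN_eq: "qN t \<phi> = \<delta> * (m1 + t * m2) - ((E1 0 t \<phi> + t * E2 0 t \<phi>) + (E1 pi t \<phi> + t * E2 pi t \<phi>))"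
  by (simp add: qN_def CC_def arcC_def E1_def E2_def hp_def hm_def)

lemma qD_eq: "qD t \<phi> = 2 * \<delta> * (pi + t * m1 + t\<^sup>2 * m2 / 2)
   - ((hp 0 t \<phi> + hm 0 t \<phi> + 2 * t * E1 0 t \<phi> + t\<^sup>2 * E2 0 t \<phi>) + (hp pi t \<phi> + hm pi t \<phi> + 2 * t * E1 pi t \<phi> + t\<^sup>2 * E2 pi t \<phi>))"
  by (simp add: qD_def BB_def arcB_def E1_def E2_def hp_def hm_def)

lemma C1_qN: "C1 qN qN'"
proof -
  have a: "C1 (\<lambda>t \<phi>. t * E2 \<psi> t \<phi>) (\<lambda>t \<phi>. 1 * E2 \<psi> t \<phi> + E2' \<psi> t \<phi> * t)" for \<psi>
    by (rule C1_mult[OF C1_fun C1_E(2)]) (auto intro!: derivative_eq_intros continuous_intros)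
  have b: "C1 (\<lambda>t \<phi>. \<delta> * (m1 + t * m2)) (\<lambda>t \<phi>. \<delta> * m2)"
    by (rule C1_fun) (auto intro!: derivative_eq_intros continuous_intros)
  have "C1 (\<lambda>t \<phi>. \<delta> * (m1 + t * m2) - ((E1 0 t \<phi> + t * E2 0 t \<phi>) + (E1 pi t \<phi> + t * E2 pi t \<phi>)))
    (\<lambda>t \<phi>. \<delta> * m2 - ((E1' 0 t \<phi> + (1 * E2 0 t \<phi> + E2' 0 t \<phi> * t)) + (E1' pi t \<phi> + (1 * E2 pi t \<phi> + E2' pi t \<phi> * t))))"
    by (intro C1_diff C1_add a b C1_E)
  then show ?thesis
    unfolding qN_eq[abs_def] qN'_def[abs_def] by (simp add: mult.commute)
qed

lemma C1_qD: "C1 qD qD'"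
proof -
  have a: "C1 (\<lambda>t \<phi>. 2 * t * E1 \<psi> t \<phi>) (\<lambda>t \<phi>. 2 * E1 \<psi> t \<phi> + E1' \<psi> t \<phi> * (2 * t))" for \<psi>
    by (rule C1_mult[OF C1_fun C1_E(1)]) (auto intro!: derivative_eq_intros continuous_intros)
  have a2: "C1 (\<lambda>t \<phi>. t\<^sup>2 * E2 \<psi> t \<phi>) (\<lambda>t \<phi>. (2 * t) * E2 \<psi> t \<phi> + E2' \<psi> t \<phi> * t\<^sup>2)" for \<psi>
    by (rule C1_mult[OF C1_fun C1_E(2)]) (auto intro!: derivative_eq_intros continuous_intros)
  have b: "C1 (\<lambda>t \<phi>. 2 * \<delta> * (pi + t * m1 + t\<^sup>2 * m2 / 2)) (\<lambda>t \<phi>. 2 * \<delta> * (m1 + t * m2))"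
    by (rule C1_fun) (auto intro!: derivative_eq_intros continuous_intros)
  have "C1 (\<lambda>t \<phi>. 2 * \<delta> * (pi + t * m1 + t\<^sup>2 * m2 / 2)
      - ((hp 0 t \<phi> + hm 0 t \<phi> + 2 * t * E1 0 t \<phi> + t\<^sup>2 * E2 0 t \<phi>) + (hp pi t \<phi> + hm pi t \<phi> + 2 * t * E1 pi t \<phi> + t\<^sup>2 * E2 pi t \<phi>)))
    (\<lambda>t \<phi>. 2 * \<delta> * (m1 + t * m2)
   - ((hp' 0 t \<phi> + hm' 0 t \<phi> + (2 * E1 0 t \<phi> + E1' 0 t \<phi> * (2 * t)) + ((2 * t) * E2 0 t \<phi> + E2' 0 t \<phi> * t\<^sup>2))
    + (hp' pi t \<phi> + hm' pi t \<phi> + (2 * E1 pi t \<phi> + E1' pi t \<phi> * (2 * t)) + ((2 * t) * E2 pi t \<phi> + E2' pi t \<phi> * t\<^sup>2))))"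
    by (intro C1_diff C1_add a a2 b C1_hp C1_hm)
  then show ?thesis
    unfolding qD_eq[abs_def] qD'_def[abs_def] by (simp add: mult.commute)
qed

definition qq' where "qq' t \<phi> = (qN' t \<phi> * qD t \<phi> - qN t \<phi> * qD' t \<phi>) / (qD t \<phi> * qD t \<phi>)"

lemma C1_qq: "C1 qq qq'"
  unfolding qq_def[abs_def] qq'_def[abs_def]
  by (intro C1_divide C1_qN C1_qD less_imp_neq[OF qD_neg])

text \<open>The area of the convolution body of \<open>KK t\<close> in polar form. As the derivative
  of \<open>SS\<close> is \<open>SS * qq\<close>, differentiating half its square once and twice
  gives the integrands of \<open>WW1\<close> and \<open>WW2\<close>.\<close>

definition WW where "WW t = integral {-pi..pi} (\<lambda>\<phi>. (SS t \<phi>)\<^sup>2 / 2)"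
definition WW1 where "WW1 t = integral {-pi..pi} (\<lambda>\<phi>. (SS t \<phi>)\<^sup>2 * qq t \<phi>)"
definition WW2 where "WW2 t = integral {-pi..pi} (\<lambda>\<phi>. (SS t \<phi>)\<^sup>2 * (2 * (qq t \<phi>)\<^sup>2 + qq' t \<phi>))"

lemma WW_derivatives:
  assumes t: "\<bar>t\<bar> < \<tau>"
  shows "(WW has_real_derivative WW1 t) (at t)" "(WW1 has_real_derivative WW2 t) (at t)"
    "continuous_on {-\<tau><..<\<tau>} WW2"
proof -
  have S2: "C1 (\<lambda>t \<phi>. SS t \<phi> * SS t \<phi>) (\<lambda>t \<phi>. SS t \<phi> * qq t \<phi> * SS t \<phi> + SS t \<phi> * qq t \<phi> * SS t \<phi>)"
    by (rule C1_mult[OF C1_SS C1_SS])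
  have "C1 (\<lambda>t \<phi>. SS t \<phi> * SS t \<phi> * (1 / 2)) (\<lambda>t \<phi>. (SS t \<phi> * qq t \<phi> * SS t \<phi> + SS t \<phi> * qq t \<phi> * SS t \<phi>) * (1 / 2) + 0 * (SS t \<phi> * SS t \<phi>))"
    by (rule C1_mult[OF S2 C1_fun]) (auto intro!: derivative_eq_intros)
  then have 1: "C1 (\<lambda>t \<phi>. (SS t \<phi>)\<^sup>2 / 2) (\<lambda>t \<phi>. (SS t \<phi>)\<^sup>2 * qq t \<phi>)"
    by (simp add: power2_eq_square mult.assoc mult.left_commute mult.commute)
  have "C1 (\<lambda>t \<phi>. SS t \<phi> * SS t \<phi> * qq t \<phi>) (\<lambda>t \<phi>. (SS t \<phi> * qq t \<phi> * SS t \<phi> + SS t \<phi> * qq t \<phi> * SS t \<phi>) * qq t \<phi> + qq' t \<phi> * (SS t \<phi> * SS t \<phi>))"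
    by (rule C1_mult[OF S2 C1_qq])
  moreover have "(SS t \<phi> * qq t \<phi> * SS t \<phi> + SS t \<phi> * qq t \<phi> * SS t \<phi>) * qq t \<phi> + qq' t \<phi> * (SS t \<phi> * SS t \<phi>) = (SS t \<phi>)\<^sup>2 * (2 * (qq t \<phi>)\<^sup>2 + qq' t \<phi>)" for t \<phi>
    by (simp add: power2_eq_square algebra_simps)
  ultimately have 2: "C1 (\<lambda>t \<phi>. (SS t \<phi>)\<^sup>2 * qq t \<phi>) (\<lambda>t \<phi>. (SS t \<phi>)\<^sup>2 * (2 * (qq t \<phi>)\<^sup>2 + qq' t \<phi>))"
    by (simp add: power2_eq_square)
  show "(WW has_real_derivative WW1 t) (at t)" "(WW1 has_real_derivative WW2 t) (at t)"
    "continuous_on {-\<tau><..<\<tau>} WW2"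
    unfolding WW_def[abs_def] WW1_def[abs_def] WW2_def[abs_def]
    using C1_integral(1)[OF 1 t] C1_integral(1)[OF 2 t] C1_integral(2)[OF 2] by simp_all
qed

end

section \<open>Volume of the normalised convolution body\<close>

lemma Ck_on_2I:
  fixes V V1 V2 :: "real \<Rightarrow> real"
  assumes S: "open S" and V: "\<And>t. t \<in> S \<Longrightarrow> (V has_real_derivative V1 t) (at t)"
    and V1: "\<And>t. t \<in> S \<Longrightarrow> (V1 has_real_derivative V2 t) (at t)" and V2: "continuous_on S V2"
  shows "Ck_on 2 S V" "\<And>t. t \<in> S \<Longrightarrow> (deriv ^^ 2) V t = V2 t"
proof -
  have d1: "deriv V t = V1 t" if "t \<in> S" for t using V[OF that] by (rule DERIV_imp_deriv)
  have dd: "(deriv V has_real_derivative V2 t) (at t)" if "t \<in> S" for t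
    using has_field_derivative_transform_within_open[OF V1[OF that] S that] d1 by simp
  have d2: "deriv (deriv V) t = V2 t" if "t \<in> S" for t using dd[OF that] by (rule DERIV_imp_deriv)
  then show "\<And>t. t \<in> S \<Longrightarrow> (deriv ^^ 2) V t = V2 t" by (simp add: numeral_2_eq_2)
  show "Ck_on 2 S V"
    unfolding Ck_on_def
  proof (intro conjI allI impI ballI)
    fix j :: nat and x assume "j < 2" "x \<in> S"
    then show "(deriv ^^ j) V field_differentiable at x"
      using V dd by (cases j) (auto simp: field_differentiable_def less_Suc_eq)
  next
    show "continuous_on S ((deriv ^^ 2) V)"
      using V2 by (rule continuous_on_cong[THEN iffD1, rotated -1]) (auto simp: d2 numeral_2_eq_2)
  qed
qed

lemma convolution_body_scale:
  fixes L :: "(real ^ 2) set"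
  assumes L: "compact L" and c: "0 < c"
  shows "convolution_body \<delta> ((\<lambda>x. c *\<^sub>R x) ` L) = (\<lambda>x. c *\<^sub>R x) ` convolution_body \<delta> L"
proof -
  have iff: "c *\<^sub>R y \<in> convolution_body \<delta> ((\<lambda>x. c *\<^sub>R x) ` L) \<longleftrightarrow> y \<in> convolution_body \<delta> L" for y
  proof -
    have inj: "inj (\<lambda>x :: real ^ 2. c *\<^sub>R x)" using c by (auto intro: injI)
    have "(\<lambda>z. z + c *\<^sub>R y) ` (\<lambda>x. c *\<^sub>R x) ` L = (\<lambda>x. c *\<^sub>R x) ` (\<lambda>z. z + y) ` L"
      unfolding image_image by (intro image_cong refl) (simp add: scaleR_add_right)
    then have "(\<lambda>x. c *\<^sub>R x) ` L \<inter> (\<lambda>z. z + c *\<^sub>R y) ` (\<lambda>x. c *\<^sub>R x) ` L = (\<lambda>x. c *\<^sub>R x) ` (L \<inter> (\<lambda>z. z + y) ` L)"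
      by (simp only: image_Int[OF inj])
    then show ?thesis
      unfolding convolution_body_def
      using c measure_scaleR2[OF lmeasurable_compact[OF compact_shift_inter[OF L, of y]], of c] measure_scaleR2[OF lmeasurable_compact[OF L], of c]
      by (simp add: mult.left_commute)
  qed
  show ?thesis
  proof (intro equalityI subsetI)
    fix x assume x: "x \<in> convolution_body \<delta> ((\<lambda>x. c *\<^sub>R x) ` L)"
    have "x = c *\<^sub>R ((1 / c) *\<^sub>R x)" using c by simp
    with x iff[of "(1 / c) *\<^sub>R x"] show "x \<in> (\<lambda>x. c *\<^sub>R x) ` convolution_body \<delta> L" by (metis image_eqI)
  qed (use iff in auto)
qed

text \<open>The interval [-pi, pi] is compact and \<open>cis2\<close> maps it onto the circle, so
  images of closed sets of angles are closed; hence continuity in the angle descends to the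
  circle.\<close>

lemma continuous_on_sphere_angle:
  assumes S: "continuous_on {-pi..pi} S" and \<sigma>: "\<And>\<phi>. \<sigma> (cis2 \<phi>) = (S \<phi> :: real)"
  shows "continuous_on (sphere 0 1) \<sigma>"
proof (subst continuous_on_closed_vimage, simp, intro allI impI)
  fix B :: "real set" assume B: "closed B"
  have "closed ({-pi..pi} \<inter> S -` B)" using continuous_closed_preimage[OF S _ B] by simp
  then have "compact ({-pi..pi} \<inter> S -` B)" using compact_Int_closed[of "{-pi..pi}" "{-pi..pi} \<inter> S -` B"] by (simp add: Int_assoc[symmetric])
  then have "compact (cis2 ` ({-pi..pi} \<inter> S -` B))" by (rule compact_continuous_image[OF continuous_cis2])
  moreover have "cis2 ` ({-pi..pi} \<inter> S -` B) = \<sigma> -` B \<inter> sphere 0 1"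
  proof (intro equalityI subsetI)
    fix v assume v: "v \<in> \<sigma> -` B \<inter> sphere 0 1"
    then have "norm v = 1" by simp
    then obtain \<phi> where "-pi \<le> \<phi>" "\<phi> < pi" "v = cis2 \<phi>" by (rule sphere_cis2)
    then show "v \<in> cis2 ` ({-pi..pi} \<inter> S -` B)" using v \<sigma> by auto
  qed (use \<sigma> in auto)
  ultimately show "closed (\<sigma> -` B \<inter> sphere 0 1)" by (metis compact_imp_closed)
qed

context solved
begin

lemma convolution_body_radial:
  assumes t: "\<bar>t\<bar> < \<tau>" and \<delta>: "\<delta> \<le> 1"
  obtains \<sigma> where "continuous_on (sphere 0 1) \<sigma>" "\<And>\<phi>. \<sigma> (cis2 \<phi>) = SS t \<phi>" "convolution_body \<delta> (KK t) = radial_region \<sigma>"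
proof -
  \<comment> \<open>Any angle of \<open>v\<close> may be chosen, since \<open>SS t\<close> depends
    on the angle only through \<open>cis2\<close>.\<close>
  define \<sigma> where "\<sigma> v = SS t (SOME \<phi>. cis2 \<phi> = v)" for v
  have dep: "SS t \<phi> = SS t \<psi>" if "cis2 \<phi> = cis2 \<psi>" for \<phi> \<psi> using that by (simp add: SS_def GG_def)
  have \<sigma>: "\<sigma> (cis2 \<phi>) = SS t \<phi>" for \<phi>
    unfolding \<sigma>_def by (rule dep) (rule someI[of _ \<phi>], rule refl)
  have "continuous_on (sphere 0 1) \<sigma>"
    using C1_integral(3)[OF C1_SS t] \<sigma> by (rule continuous_on_sphere_angle)
  moreover have "convolution_body \<delta> (KK t) = radial_region \<sigma>"
  proof (rule set_eqI)
    fix x :: "real ^ 2"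
    show "x \<in> convolution_body \<delta> (KK t) \<longleftrightarrow> x \<in> radial_region \<sigma>"
    proof (cases "x = 0")
      case True
      have "\<delta> * AA t \<le> AA t" using mult_right_mono[OF \<delta>, of "AA t"] by (simp add: AA_def)
      then show ?thesis using True by (simp add: convolution_body_def radial_region_def AA_def)
    next
      case False
      then have "norm (x /\<^sub>R norm x) = 1" by simp
      then obtain \<phi> where \<phi>: "x /\<^sub>R norm x = cis2 \<phi>" by (rule sphere_cis2)
      have x: "x = norm x *\<^sub>R cis2 \<phi>" unfolding \<phi>[symmetric] using False by simp
      have "x \<in> convolution_body \<delta> (KK t) \<longleftrightarrow> \<delta> * AA t \<le> GG t (norm x) \<phi>"
        unfolding convolution_body_def GG_def AA_def x[symmetric] by simp
      also have "\<dots> \<longleftrightarrow> norm x \<le> SS t \<phi>" using False by (intro SS_le_iff t) simp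
      also have "\<dots> \<longleftrightarrow> x \<in> radial_region \<sigma>" using False by (simp add: radial_region_def \<phi> \<sigma>)
      finally show ?thesis .
    qed
  qed
  ultimately show thesis using that \<sigma> by blast
qed

text \<open>The dilation by AA^(-1/2) commutes with taking the convolution body and divides areas by
  \<open>AA\<close>.\<close>

lemma convolution_volume:
  assumes t: "\<bar>t\<bar> < \<tau>" and \<delta>: "\<delta> \<le> 1"
  shows "measure lebesgue (convolution_body \<delta> (normalized (KK t))) = WW t / AA t" "0 < AA t"
proof -
  obtain \<sigma> where \<sigma>: "continuous_on (sphere 0 1) \<sigma>" "\<And>\<phi>. \<sigma> (cis2 \<phi>) = SS t \<phi>" "convolution_body \<delta> (KK t) = radial_region \<sigma>"
    by (rule convolution_body_radial[OF assms]) blast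
  have pos: "0 \<le> \<sigma> v" if v: "v \<in> sphere 0 1" for v
  proof -
    have "norm v = 1" using v by simp
    then obtain \<phi> where "v = cis2 \<phi>" by (rule sphere_cis2)
    then show ?thesis using SS(1)[OF t, of \<phi>] ab \<sigma>(2) by simp
  qed
  have tb': "\<bar>t\<bar> * bnd \<le> 1 / 2" using tb[OF t] by simp
  have "pi * (1 / 2)\<^sup>2 \<le> AA t"
  proof -
    have "measure lebesgue (cball (0 :: real ^ 2) (1 / 2)) \<le> measure lebesgue (KK t)"
    proof (rule measure_mono_fmeasurable)
      show "cball 0 (1 / 2) \<subseteq> KK t" using order_trans[OF subset_cball KK_sandwich(1)[OF tb']] tb' by simp
      show "KK t \<in> lmeasurable" using compact_KK[OF tb'] by (rule lmeasurable_compact)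
    qed simp
    then show ?thesis unfolding AA_def by (subst (asm) measure_disc) auto
  qed
  then show A: "0 < AA t" by (rule less_le_trans[rotated]) simp
  have c: "0 < inverse (sqrt (AA t))" using A by simp
  have "normalized (KK t) = (\<lambda>x. inverse (sqrt (AA t)) *\<^sub>R x) ` KK t" by (simp add: normalized_def AA_def)
  then have "convolution_body \<delta> (normalized (KK t)) = (\<lambda>x. inverse (sqrt (AA t)) *\<^sub>R x) ` radial_region \<sigma>"
    using convolution_body_scale[OF compact_KK[OF tb'] c, of \<delta>] \<sigma>(3) by simp
  then have "measure lebesgue (convolution_body \<delta> (normalized (KK t))) = (inverse (sqrt (AA t)))\<^sup>2 * measure lebesgue (radial_region \<sigma>)"
    using measure_scaleR2[OF lmeasurable_compact[OF compact_radial_region[OF \<sigma>(1) pos]], of "inverse (sqrt (AA t))"] by simp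
  also have "measure lebesgue (radial_region \<sigma>) = WW t"
    using measure_radial_region[OF \<sigma>(1) pos] by (simp add: WW_def \<sigma>(2))
  also have "(inverse (sqrt (AA t)))\<^sup>2 * WW t = WW t / AA t" using A by (simp add: power_inverse divide_inverse_commute)
  finally show "measure lebesgue (convolution_body \<delta> (normalized (KK t))) = WW t / AA t" .
qed

theorem volume_C2:
  assumes \<delta>: "\<delta> \<le> 1"
  defines "V \<equiv> \<lambda>t. measure lebesgue (convolution_body \<delta> (normalized (KK t)))"
  shows "Ck_on 2 {-\<tau><..<\<tau>} V"
    "(deriv ^^ 2) V 0 = WW2 0 / pi - 2 * WW1 0 * m1 / pi\<^sup>2 - WW 0 * m2 / pi\<^sup>2 + 2 * WW 0 * m1\<^sup>2 / pi ^ 3"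
proof -
  define A where "A t = pi + t * m1 + t\<^sup>2 * m2 / 2" for t
  define V1 where "V1 t = WW1 t / A t - WW t * (m1 + t * m2) / (A t)\<^sup>2" for t
  define V2 where "V2 t = WW2 t / A t - 2 * WW1 t * (m1 + t * m2) / (A t)\<^sup>2 - WW t * m2 / (A t)\<^sup>2 + 2 * WW t * (m1 + t * m2)\<^sup>2 / (A t) ^ 3" for t
  have dA: "(A has_real_derivative m1 + t * m2) (at t)" for t
    unfolding A_def by (auto intro!: derivative_eq_intros)
  have A: "0 < A t" "AA t = A t" if "\<bar>t\<bar> < \<tau>" for t
    using convolution_volume(2)[OF that \<delta>] AA_tau[OF that] by (simp_all add: A_def)
  have VA: "V t = WW t / A t" if "\<bar>t\<bar> < \<tau>" for t
    using convolution_volume(1)[OF that \<delta>] A(2)[OF that] by (simp add: V_def)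
  have o: "open {-\<tau><..<\<tau>}" by simp
  have dV: "(V has_real_derivative V1 t) (at t)" if t: "t \<in> {-\<tau><..<\<tau>}" for t
  proof -
    have t': "\<bar>t\<bar> < \<tau>" using t by auto
    have "((\<lambda>t. WW t / A t) has_real_derivative V1 t) (at t)"
      unfolding V1_def using A(1)[OF t']
      by (auto intro!: derivative_eq_intros WW_derivatives[OF t'] dA simp: field_simps power2_eq_square)
    then show ?thesis
      by (rule has_field_derivative_transform_within_open[OF _ o t]) (use VA in auto)
  qed
  have dV1: "(V1 has_real_derivative V2 t) (at t)" if t: "t \<in> {-\<tau><..<\<tau>}" for t
  proof -
    have t': "\<bar>t\<bar> < \<tau>" using t by auto
    have A0: "A t \<noteq> 0" using A(1)[OF t'] by simp
    have lin: "((\<lambda>t. m1 + t * m2) has_real_derivative m2) (at t)" by (auto intro!: derivative_eq_intros)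
    have 1: "((\<lambda>t. WW1 t / A t) has_real_derivative (WW2 t * A t - WW1 t * (m1 + t * m2)) / (A t * A t)) (at t)"
      by (rule DERIV_divide[OF WW_derivatives(2)[OF t'] dA A0])
    have A2: "((\<lambda>t. (A t)\<^sup>2) has_real_derivative 2 * A t * (m1 + t * m2)) (at t)"
      by (auto intro!: derivative_eq_intros dA)
    have 2: "((\<lambda>t. WW t * (m1 + t * m2) / (A t)\<^sup>2) has_real_derivative ((WW1 t * (m1 + t * m2) + m2 * WW t) * (A t)\<^sup>2 - WW t * (m1 + t * m2) * (2 * A t * (m1 + t * m2))) / ((A t)\<^sup>2 * (A t)\<^sup>2)) (at t)"
      by (rule DERIV_divide[OF DERIV_mult[OF WW_derivatives(1)[OF t'] lin] A2]) (use A0 in simp)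
    have eq: "(WW2 t * A t - WW1 t * u) / (A t * A t) - ((WW1 t * u + m2 * WW t) * (A t)\<^sup>2 - WW t * u * (2 * A t * u)) / ((A t)\<^sup>2 * (A t)\<^sup>2)
        = WW2 t / A t - 2 * WW1 t * u / (A t)\<^sup>2 - WW t * m2 / (A t)\<^sup>2 + 2 * WW t * u\<^sup>2 / (A t) ^ 3" for u
      using A0 by (simp add: field_simps power2_eq_square power3_eq_cube)
    show ?thesis
      using DERIV_diff[OF 1 2] unfolding eq V1_def[abs_def] V2_def .
  qed
  have cV2: "continuous_on {-\<tau><..<\<tau>} V2"
  proof -
    have cW: "continuous_on {-\<tau><..<\<tau>} WW" "continuous_on {-\<tau><..<\<tau>} WW1"
      by (rule continuous_at_imp_continuous_on, rule ballI, rule DERIV_isCont[OF WW_derivatives(1)], force)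
         (rule continuous_at_imp_continuous_on, rule ballI, rule DERIV_isCont[OF WW_derivatives(2)], force)
    have nz: "A t \<noteq> 0" if "- \<tau> < t \<and> t < \<tau>" for t
      using A(1)[of t] that by (simp add: abs_less_iff)
    have cA: "continuous_on {-\<tau><..<\<tau>} A" unfolding A_def by (intro continuous_intros) auto
    show ?thesis
      unfolding V2_def using \<tau>(1)
      by (intro continuous_intros cW cA WW_derivatives(3)[of 0]) (simp_all add: nz)
  qed
  show "Ck_on 2 {-\<tau><..<\<tau>} V" by (rule Ck_on_2I(1)[OF o dV dV1 cV2])
  have "(deriv ^^ 2) V 0 = V2 0" by (rule Ck_on_2I(2)[OF o dV dV1 cV2]) (use \<tau> in auto)
  then show "(deriv ^^ 2) V 0 = WW2 0 / pi - 2 * WW1 0 * m1 / pi\<^sup>2 - WW 0 * m2 / pi\<^sup>2 + 2 * WW 0 * m1\<^sup>2 / pi ^ 3"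
    by (simp add: V2_def A_def)
qed

end

section \<open>The second derivative at the disc and its limit\<close>

lemma antiderivative_exists:
  fixes g :: "real \<Rightarrow> real"
  assumes "continuous_on UNIV g"
  shows "\<exists>G. \<forall>x. (G has_real_derivative g x) (at x)"
proof -
  have "\<exists>F. \<forall>x::real. (- \<infinity>) < ereal x \<longrightarrow> ereal x < \<infinity> \<longrightarrow> (F has_vector_derivative g x) (at x)"
    using assms by (intro einterval_antiderivative) (auto simp: continuous_on_eq_continuous_at)
  then show ?thesis by (auto simp: has_real_derivative_iff_has_vector_derivative)
qed

lemma periodic_primitive:
  fixes g :: "real \<Rightarrow> real"
  assumes per: "\<And>x. g (x + 2 * pi) = g x" and G: "\<And>x. (G has_real_derivative g x) (at x)"
  shows "G (x + 2 * pi) = G x + integral {-pi..pi} g"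
proof -
  have "((\<lambda>x. G (x + 2 * pi) - G x) has_real_derivative 0) (at x)" for x
  proof -
    have "((\<lambda>x. G (x + 2 * pi)) has_real_derivative g (x + 2 * pi)) (at x)"
      using DERIV_shift[of G "g (x + 2 * pi)" x "2 * pi"] G by simp
    from DERIV_diff[OF this G] show ?thesis by (simp add: per)
  qed
  then have "G (x + 2 * pi) - G x = G (-pi + 2 * pi) - G (-pi)"
    by (intro DERIV_isconst_all) auto
  moreover have "(g has_integral (G pi - G (-pi))) {-pi..pi}"
    using G by (intro fundamental_theorem_of_calculus)
      (auto simp: has_real_derivative_iff_has_vector_derivative[symmetric] intro: has_field_derivative_at_within)
  ultimately show ?thesis by (simp add: integral_unique)
qed

lemma integral_primitive:
  fixes g :: "real \<Rightarrow> real"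
  assumes G: "\<And>x. (G has_real_derivative g x) (at x)" and ab: "a \<le> b"
  shows "integral {a..b} (\<lambda>x. g (x + c)) = G (b + c) - G (a + c)"
proof -
  have "((\<lambda>x. g (x + c)) has_integral (G (b + c) - G (a + c))) {a..b}"
  proof (rule fundamental_theorem_of_calculus[OF ab])
    fix x
    have "((\<lambda>x. G (x + c)) has_real_derivative g (x + c)) (at x)"
      using DERIV_shift[of G "g (x + c)" x c] G by simp
    then show "((\<lambda>x. G (x + c)) has_vector_derivative g (x + c)) (at x within {a..b})"
      by (auto simp: has_real_derivative_iff_has_vector_derivative[symmetric] intro: has_field_derivative_at_within)
  qed
  then show ?thesis by (rule integral_unique)
qed

lemma integral_periodic_shift:
  fixes g :: "real \<Rightarrow> real"
  assumes per: "\<And>x. g (x + 2 * pi) = g x" and c: "continuous_on UNIV g"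
  shows "integral {a..a + 2 * pi} g = integral {-pi..pi} g"
    "integral {-pi..pi} (\<lambda>x. g (x + s)) = integral {-pi..pi} g"
proof -
  obtain G where G: "\<And>x. (G has_real_derivative g x) (at x)" using antiderivative_exists[OF c] by blast
  show "integral {a..a + 2 * pi} g = integral {-pi..pi} g"
    using integral_primitive[OF G, of a "a + 2 * pi" 0] periodic_primitive[OF per G, of a] by simp
  show "integral {-pi..pi} (\<lambda>x. g (x + s)) = integral {-pi..pi} g"
    using integral_primitive[OF G, of "-pi" pi s] periodic_primitive[OF per G, of "-pi + s"]
    by (simp add: algebra_simps)
qed

text \<open>Pointwise convergence as \<open>h\<close> tends to \<open>0\<close> from the right, with an eventual uniform bound:
  the input for dominated convergence, stable under sums and products.\<close>

definition bconv :: "(real \<Rightarrow> real \<Rightarrow> real) \<Rightarrow> (real \<Rightarrow> real) \<Rightarrow> bool" where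
  "bconv g l \<longleftrightarrow> (\<forall>\<phi>. ((\<lambda>h. g h \<phi>) \<longlongrightarrow> l \<phi>) (at_right 0)) \<and> (\<exists>B. \<forall>\<^sub>F h in at_right 0. \<forall>\<phi>. \<bar>g h \<phi>\<bar> \<le> B)"

lemma bconv_const_fun: "(k \<longlongrightarrow> l) (at_right 0) \<Longrightarrow> bconv (\<lambda>h \<phi>. k h) (\<lambda>\<phi>. l)"
proof -
  assume k: "(k \<longlongrightarrow> l) (at_right 0)"
  have "\<forall>\<^sub>F h in at_right 0. \<bar>k h\<bar> < \<bar>l\<bar> + 1" by (rule order_tendstoD(2)[OF tendsto_rabs[OF k]]) simp
  then have "\<forall>\<^sub>F h in at_right 0. \<forall>\<phi>::real. \<bar>k h\<bar> \<le> \<bar>l\<bar> + 1" by eventually_elim simp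
  with k show ?thesis unfolding bconv_def by blast
qed

lemma bconv_add: assumes "bconv g l" "bconv k m" shows "bconv (\<lambda>h \<phi>. g h \<phi> + k h \<phi>) (\<lambda>\<phi>. l \<phi> + m \<phi>)"
proof -
  obtain B C where B: "\<forall>\<^sub>F h in at_right 0. \<forall>\<phi>. \<bar>g h \<phi>\<bar> \<le> B" and C: "\<forall>\<^sub>F h in at_right 0. \<forall>\<phi>. \<bar>k h \<phi>\<bar> \<le> C"
    using assms unfolding bconv_def by blast
  have "\<forall>\<^sub>F h in at_right 0. \<forall>\<phi>. \<bar>g h \<phi> + k h \<phi>\<bar> \<le> B + C"
    using B C by eventually_elim (meson abs_triangle_ineq add_mono order_trans)
  moreover have "((\<lambda>h. g h \<phi> + k h \<phi>) \<longlongrightarrow> l \<phi> + m \<phi>) (at_right 0)" for \<phi>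
    using assms unfolding bconv_def by (intro tendsto_add) blast+
  ultimately show ?thesis unfolding bconv_def by blast
qed

lemma bconv_mult: assumes "bconv g l" "bconv k m" shows "bconv (\<lambda>h \<phi>. g h \<phi> * k h \<phi>) (\<lambda>\<phi>. l \<phi> * m \<phi>)"
proof -
  obtain B C where B: "\<forall>\<^sub>F h in at_right 0. \<forall>\<phi>. \<bar>g h \<phi>\<bar> \<le> B" and C: "\<forall>\<^sub>F h in at_right 0. \<forall>\<phi>. \<bar>k h \<phi>\<bar> \<le> C"
    using assms unfolding bconv_def by blast
  have "\<forall>\<^sub>F h in at_right 0. \<forall>\<phi>. \<bar>g h \<phi> * k h \<phi>\<bar> \<le> B * C"
    using B C
  proof eventually_elim
    case (elim h)
    show ?case
    proof
      fix \<phi>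
      have "\<bar>g h \<phi>\<bar> \<le> B" "\<bar>k h \<phi>\<bar> \<le> C" using elim by auto
      then show "\<bar>g h \<phi> * k h \<phi>\<bar> \<le> B * C" unfolding abs_mult by (intro mult_mono) auto
    qed
  qed
  moreover have "((\<lambda>h. g h \<phi> * k h \<phi>) \<longlongrightarrow> l \<phi> * m \<phi>) (at_right 0)" for \<phi>
    using assms unfolding bconv_def by (intro tendsto_mult) blast+
  ultimately show ?thesis unfolding bconv_def by blast
qed

lemma bconv_minus: "bconv g l \<Longrightarrow> bconv (\<lambda>h \<phi>. - g h \<phi>) (\<lambda>\<phi>. - l \<phi>)"
  unfolding bconv_def by (auto intro: tendsto_minus)

lemma bconv_diff: "bconv g l \<Longrightarrow> bconv k m \<Longrightarrow> bconv (\<lambda>h \<phi>. g h \<phi> - k h \<phi>) (\<lambda>\<phi>. l \<phi> - m \<phi>)"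
  using bconv_add[of g l "\<lambda>h \<phi>. - k h \<phi>" "\<lambda>\<phi>. - m \<phi>"] bconv_minus[of k m] by simp

lemma bconv_shift: "bconv g l \<Longrightarrow> bconv (\<lambda>h \<phi>. g h (\<phi> + c)) (\<lambda>\<phi>. l (\<phi> + c))"
  unfolding bconv_def by (auto elim!: eventually_mono)

lemma bconv_cong:
  assumes "bconv g l" and "\<forall>\<^sub>F h in at_right 0. \<forall>\<phi>. g h \<phi> = k h \<phi>"
  shows "bconv k l"
proof -
  obtain B where B: "\<forall>\<^sub>F h in at_right 0. \<forall>\<phi>. \<bar>g h \<phi>\<bar> \<le> B" using assms(1) unfolding bconv_def by blast
  have "\<forall>\<^sub>F h in at_right 0. \<forall>\<phi>. \<bar>k h \<phi>\<bar> \<le> B" using B assms(2) by eventually_elim simp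
  moreover have "((\<lambda>h. k h \<phi>) \<longlongrightarrow> l \<phi>) (at_right 0)" for \<phi>
  proof (rule Lim_transform_eventually)
    show "((\<lambda>h. g h \<phi>) \<longlongrightarrow> l \<phi>) (at_right 0)" using assms(1) unfolding bconv_def by blast
    show "\<forall>\<^sub>F h in at_right 0. g h \<phi> = k h \<phi>" using assms(2) by (rule eventually_mono) simp
  qed
  ultimately show ?thesis unfolding bconv_def by blast
qed

text \<open>The one-sided limit is tested on sequences, dropping the terms before the uniform bound
  and integrability set in.\<close>

lemma bconv_integral:
  assumes g: "bconv g l" and c: "\<forall>\<^sub>F h in at_right 0. g h integrable_on {a..b}"
  shows "((\<lambda>h. integral {a..b} (g h)) \<longlongrightarrow> integral {a..b} l) (at_right 0)"
  unfolding tendsto_at_iff_sequentially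
proof (intro allI impI)
  fix X :: "nat \<Rightarrow> real" assume X: "\<forall>i. X i \<in> {0<..} - {0}" "X \<longlonglongrightarrow> 0"
  obtain B where B: "\<forall>\<^sub>F h in at_right 0. \<forall>\<phi>. \<bar>g h \<phi>\<bar> \<le> B" using g unfolding bconv_def by blast
  have fl: "filterlim X (at_right 0) sequentially"
  proof -
    have "0 < X i" for i using X(1) by auto
    from this less_imp_neq[OF this, symmetric] show ?thesis unfolding filterlim_at using X(2) by simp
  qed
  have "\<forall>\<^sub>F n in sequentially. (\<forall>\<phi>. \<bar>g (X n) \<phi>\<bar> \<le> B) \<and> g (X n) integrable_on {a..b}"
    using eventually_conj[OF B c] fl by (auto simp: filterlim_iff)
  then obtain N where N: "\<And>n. n \<ge> N \<Longrightarrow> (\<forall>\<phi>. \<bar>g (X n) \<phi>\<bar> \<le> B) \<and> g (X n) integrable_on {a..b}"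
    unfolding eventually_sequentially by blast
  have "(\<lambda>n. integral {a..b} (g (X (n + N)))) \<longlonglongrightarrow> integral {a..b} l"
  proof (rule dominated_convergence(2))
    show "g (X (n + N)) integrable_on {a..b}" for n using N by simp
    show "(\<lambda>_. B) integrable_on {a..b}" by (rule integrable_const_ivl)
    show "norm (g (X (n + N)) x) \<le> B" for n x using N by simp
    have lim: "((\<lambda>h. g h x) \<longlongrightarrow> l x) (at_right 0)" for x using g unfolding bconv_def by blast
    show "(\<lambda>n. g (X (n + N)) x) \<longlonglongrightarrow> l x" for x
      using LIMSEQ_ignore_initial_segment[OF filterlim_compose[OF lim fl]] .
  qed
  then show "((\<lambda>h. integral {a..b} (g h)) \<circ> X) \<longlonglongrightarrow> integral {a..b} l"
    unfolding o_def by (rule LIMSEQ_offset)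
qed

lemma symmetric_quotient:
  assumes "(G has_real_derivative D) (at x)"
  shows "((\<lambda>h. (G (x + h) - G (x - h)) / h) \<longlongrightarrow> 2 * D) (at_right 0)"
proof -
  have "((\<lambda>h. G (x + h) - G (x - h)) has_real_derivative D * 1 - D * (-1)) (at 0)"
    by (rule DERIV_diff; rule DERIV_chain2[of G D]) (use assms in \<open>auto intro!: derivative_eq_intros\<close>)
  then have "((\<lambda>h. (G (x + h) - G (x - h)) / h) \<longlongrightarrow> 2 * D) (at 0)"
    by (simp add: DERIV_def)
  then show ?thesis by (rule tendsto_within_subset) simp
qed

lemma trig_limits:
  "((\<lambda>h::real. h / sin (2 * h)) \<longlongrightarrow> 1 / 2) (at_right 0)"
  "((\<lambda>h::real. tan h / h) \<longlongrightarrow> 1) (at_right 0)"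
  "((\<lambda>h::real. (2 * h + sin (2 * h)) / h) \<longlongrightarrow> 4) (at_right 0)"
  "((\<lambda>h::real. 2 * sin h / h) \<longlongrightarrow> 2) (at_right 0)"
proof -
  have q: "((\<lambda>h. F h / h) \<longlongrightarrow> D) (at_right 0)" if "(F has_real_derivative D) (at 0)" "F 0 = 0" for F :: "real \<Rightarrow> real" and D
  proof -
    have "((\<lambda>h. F h / h) \<longlongrightarrow> D) (at 0)" using that by (simp add: DERIV_def)
    then show ?thesis by (rule tendsto_within_subset) simp
  qed
  have s: "((\<lambda>h::real. sin (2 * h) / h) \<longlongrightarrow> 2) (at_right 0)"
    by (rule q) (auto intro!: derivative_eq_intros)
  have "((\<lambda>h::real. inverse (sin (2 * h) / h)) \<longlongrightarrow> inverse 2) (at_right 0)"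
    by (rule tendsto_inverse[OF s]) simp
  then show "((\<lambda>h::real. h / sin (2 * h)) \<longlongrightarrow> 1 / 2) (at_right 0)" by (simp add: inverse_eq_divide)
  show "((\<lambda>h::real. tan h / h) \<longlongrightarrow> 1) (at_right 0)"
    by (rule q) (auto intro!: derivative_eq_intros)
  show "((\<lambda>h::real. (2 * h + sin (2 * h)) / h) \<longlongrightarrow> 4) (at_right 0)"
    by (rule q) (auto intro!: derivative_eq_intros)
  show "((\<lambda>h::real. 2 * sin h / h) \<longlongrightarrow> 2) (at_right 0)"
    by (rule q) (auto intro!: derivative_eq_intros)
qed

section \<open>Explicit values at the disc\<close>

context perturbed
begin

lemma F_periodic: "F1 (x + 2 * pi) = F1 x + m1" "F2 (x + 2 * pi) = F2 x + m2"
  using periodic_primitive[of f F1 x] periodic_primitive[of "\<lambda>x. (f x)\<^sup>2" F2 x] per F1 F2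
  by (auto simp: m1_def m2_def)

text \<open>The integral of f over the short arc of half width \<open>h\<close> about
  \<open>x\<close>. At the disc such arcs are the complement of the arcs inside the
  intersection.\<close>

definition gap1 where "gap1 h x = F1 (x + h) - F1 (x - h)"
definition gap2 where "gap2 h x = F2 (x + h) - F2 (x - h)"

text \<open>The values \<open>q0\<close>, \<open>q0'\<close> at \<open>t = 0\<close> of \<open>qq\<close> and its derivative, for \<open>SS = 2 * sin h\<close>, and
  the limit \<open>L0\<close> of \<open>q0\<close> as \<open>h\<close> tends to \<open>0\<close>.\<close>

definition q0 where "q0 h \<phi> = ((2 * h + sin (2 * h)) / pi * m1 - gap1 h (\<phi> + pi / 2) - gap1 h (\<phi> - pi / 2)) / (2 * sin (2 * h))"

text \<open>The end point part in the derivative of the arc integrals: f times velocity, summed over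
  the two ends of the short arc about \<open>x\<close>, where \<open>q\<close> is the logarithmic
  derivative of the shift.\<close>

definition ends where
  "ends h q x = tan h * ((f (x + h))\<^sup>2 + (f (x - h))\<^sup>2 - q * (f (x + h) + f (x - h))) - (f (x + h) - f (x - h))\<^sup>2 / sin (2 * h)"

text \<open>The value of \<open>qN'\<close> at t = 0; \<open>d0\<close> is that of
  \<open>qD'\<close>.\<close>

definition n0 where "n0 h \<phi> = - ((2 * h + sin (2 * h)) / pi * m2) + gap2 h (\<phi> + pi / 2) + gap2 h (\<phi> - pi / 2)
   - (ends h (q0 h \<phi>) (\<phi> + pi / 2) + ends h (q0 h \<phi>) (\<phi> - pi / 2))"

definition d0 where "d0 h \<phi> = 2 * (gap1 h (\<phi> + pi / 2) + gap1 h (\<phi> - pi / 2) - (2 * h + sin (2 * h)) / pi * m1)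
   - tan h * (f (\<phi> + pi / 2 + h) + f (\<phi> + pi / 2 - h) + f (\<phi> - pi / 2 + h) + f (\<phi> - pi / 2 - h) - 4 * q0 h \<phi>)"

definition q0' where "q0' h \<phi> = (q0 h \<phi> * d0 h \<phi> - n0 h \<phi>) / (2 * sin (2 * h))"

definition L0 where "L0 \<phi> = m1 / pi - (f (\<phi> + pi / 2) + f (\<phi> - pi / 2)) / 2"

end

context solved
begin

text \<open>The arcs inside the intersection are centred at \<phi> and \<phi> + pi with half width
  pi / 2 - h, so their complement consists of the arcs of half width \<open>h\<close> about \<phi> +
  pi / 2 and \<phi> - pi / 2. As \<delta> = 1 - (2 h + sin 2h) / pi, the full integrals
  \<open>m1\<close> and \<open>m2\<close> cancel, and only quantities that are small with
  \<open>h\<close> remain.\<close>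

lemma values_at_0:
  assumes h: "0 < h" "h < pi / 2" and \<delta>: "pi * \<delta> = pi - 2 * h - sin (2 * h)"
  shows "SS 0 \<phi> = 2 * sin h" "qq 0 \<phi> = q0 h \<phi>" "qq' 0 \<phi> = q0' h \<phi>"
proof -
  define u v where uv: "u = \<phi> + pi / 2" "v = \<phi> - pi / 2"
  define \<alpha> where "\<alpha> = pi / 2 - h"
  have \<alpha>: "0 < \<alpha>" "\<alpha> < pi / 2" "2 * sin h = 2 * cos \<alpha>" using h by (auto simp: \<alpha>_def cos_diff)
  have sh: "0 < sin h" "sin h < 1" using h sin_gt_zero[of h] sin_monotone_2pi[of h "pi / 2"] by auto
  have s2: "0 < sin (2 * h)" using h by (intro sin_gt_zero) auto
  have ch: "0 < cos h" using h by (intro cos_gt_zero) auto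
  have "GG 0 (2 * sin h) \<phi> = \<delta> * AA 0"
    using disc_lens_eq[of "2 * sin h" \<phi>] sh flens_sin[OF h] \<delta> AA_tau[of 0] \<tau>(1) by (simp add: GG_0 mult.commute)
  then show S: "SS 0 \<phi> = 2 * sin h"
    using SS_iff[of 0 "2 * sin h" \<phi>] \<tau>(1) sh by (cases "SS 0 \<phi>" "2 * sin h" rule: linorder_cases) auto
  have as: "arccos (sin h) = \<alpha>" using arccos_cos[of \<alpha>] \<alpha> by simp
  have hph: "hp \<psi> 0 \<phi> = \<alpha>" "hm \<psi> 0 \<phi> = \<alpha>" for \<psi>
    using hits_disc[of "2 * sin h"] sh by (auto simp: hp_def hm_def S as)
  have dl: "\<delta> * x = x - (2 * h + sin (2 * h)) / pi * x" for x
  proof -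
    have "\<delta> = 1 - (2 * h + sin (2 * h)) / pi" using \<delta> by (simp add: field_simps)
    then have "\<delta> * x = (1 - (2 * h + sin (2 * h)) / pi) * x" by (simp only:)
    then show ?thesis by (simp add: left_diff_distrib)
  qed
  \<comment> \<open>Each end of a long arc is an end of a short one up to a full turn; the turn
    contributes \<open>m1\<close> or \<open>m2\<close> through \<open>F_periodic\<close>.\<close>
  have ang: "\<phi> + 0 + \<alpha> = u - h" "\<phi> + 0 - \<alpha> = v + h" "\<phi> + pi + \<alpha> = (v - h) + 2 * pi" "\<phi> + pi - \<alpha> = u + h"
    by (auto simp: uv \<alpha>_def)
  have E1s: "E1 0 0 \<phi> + E1 pi 0 \<phi> = m1 - (gap1 h u + gap1 h v)"
    unfolding E1_def hph ang F_periodic gap1_def by simp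
  have E2s: "E2 0 0 \<phi> + E2 pi 0 \<phi> = m2 - (gap2 h u + gap2 h v)"
    unfolding E2_def hph ang F_periodic gap2_def by simp
  have N: "qN 0 \<phi> = - ((2 * h + sin (2 * h)) / pi * m1) + (gap1 h u + gap1 h v)"
  proof -
    have "qN 0 \<phi> = \<delta> * m1 - (E1 0 0 \<phi> + E1 pi 0 \<phi>)" by (simp add: qN_eq)
    then show ?thesis unfolding E1s using dl[of m1] by linarith
  qed
  have D: "qD 0 \<phi> = - 2 * sin (2 * h)"
  proof -
    have "qD 0 \<phi> = 2 * (pi * \<delta>) - 4 * \<alpha>" by (simp add: qD_eq hph)
    then show ?thesis unfolding \<delta> \<alpha>_def by simp
  qed
  show Q: "qq 0 \<phi> = q0 h \<phi>"
  proof -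
    have gen: "(- E + (g + k)) / (- 2 * s) = (E - g - k) / (2 * s)" for E g k s :: real
    proof -
      have "- E + (g + k) = - (E - g - k)" "- 2 * s = - (2 * s)" by simp_all
      then show ?thesis by (simp only: minus_divide_divide)
    qed
    show ?thesis unfolding qq_def N D q0_def uv[symmetric] by (rule gen)
  qed
  define q where "q = q0 h \<phi>"
  \<comment> \<open>This is \<open>wgap_s\<close> times the derivative of the shift: cos \<alpha> =
    sin h, multiplied by 2 sin h and by q.\<close>
  define k where "k = 2 * (sin h)\<^sup>2 * q"
  have c2: "cos (2 * \<alpha>) = - cos (2 * h)" "sin (2 * \<alpha>) = sin (2 * h)" "cos \<alpha> = sin h"
    by (simp_all add: \<alpha>_def right_diff_distrib cos_diff sin_diff)
  note part = wgap_partials_disc[OF \<alpha>]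
  have pr: "f (v - h + 2 * pi) = f (v - h)" by (rule per)
  have H1: "hp' 0 0 \<phi> = (f (u + h) - f (u - h) * cos (2 * h) - k) / sin (2 * h)"
  proof -
    have X: "\<phi> + 0 + (pi - \<alpha>) = u + h" by (simp add: uv \<alpha>_def)
    show ?thesis
      unfolding hp'_def hph S Q part c2 ang X q_def[symmetric] k_def by (simp add: power2_eq_square algebra_simps)
  qed
  have H2: "hp' pi 0 \<phi> = (f (v + h) - f (v - h) * cos (2 * h) - k) / sin (2 * h)"
  proof -
    have X: "\<phi> + pi + (pi - \<alpha>) = v + h + 2 * pi" by (simp add: uv \<alpha>_def)
    have Y: "f (v + h + 2 * pi) = f (v + h)" by (rule per)
    show ?thesis
      unfolding hp'_def hph S Q part c2 ang X Y q_def[symmetric] k_def pr by (simp add: power2_eq_square algebra_simps)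
  qed
  have H3: "hm' 0 0 \<phi> = (f (v - h) - f (v + h) * cos (2 * h) - k) / sin (2 * h)"
  proof -
    have X: "- (- (\<phi> + 0) + \<alpha>) = v + h" "- (- (\<phi> + 0) + (pi - \<alpha>)) = v - h" by (simp_all add: uv \<alpha>_def)
    show ?thesis
      unfolding hm'_def hph S Q part c2 X q_def[symmetric] k_def by (simp add: power2_eq_square algebra_simps)
  qed
  have H4: "hm' pi 0 \<phi> = (f (u - h) - f (u + h) * cos (2 * h) - k) / sin (2 * h)"
  proof -
    have X: "- (- (\<phi> + pi) + \<alpha>) = u + h" "- (- (\<phi> + pi) + (pi - \<alpha>)) = u - h" by (simp_all add: uv \<alpha>_def)
    show ?thesis
      unfolding hm'_def hph S Q part c2 X q_def[symmetric] k_def by (simp add: power2_eq_square algebra_simps)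
  qed
  have tn: "tan h = 2 * (sin h)\<^sup>2 / sin (2 * h)"
    using sh ch by (simp add: tan_def sin_double power2_eq_square)
  have c2h: "cos (2 * h) = 1 - 2 * (sin h)\<^sup>2" by (rule cos_double_sin)
  \<comment> \<open>With w = (sin h)^2 the end point terms split into a part with the factor tan h
    and a squared difference of values over sin 2h. Both are of order h, which their separate
    summands are not.\<close>
  have alg: "(xm * (xp - xm * (1 - 2 * w) - 2 * w * q) + xp * (xm - xp * (1 - 2 * w) - 2 * w * q)) / sn
     = 2 * w / sn * (xp\<^sup>2 + xm\<^sup>2 - q * (xp + xm)) - (xp - xm)\<^sup>2 / sn" if "sn \<noteq> 0" for xm xp w sn :: real
    using that by (simp add: field_simps power2_eq_square)
  have end_u: "f (u - h) * hp' 0 0 \<phi> + f (u + h) * hm' pi 0 \<phi> = ends h q u"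
    unfolding ends_def tn H1 H4 c2h k_def using alg[of "sin (2 * h)" "f (u - h)" "f (u + h)" "(sin h)\<^sup>2"] s2
    by (simp add: add_divide_distrib)
  have end_v: "f (v - h) * hp' pi 0 \<phi> + f (v + h) * hm' 0 0 \<phi> = ends h q v"
    unfolding ends_def tn H2 H3 c2h k_def using alg[of "sin (2 * h)" "f (v - h)" "f (v + h)" "(sin h)\<^sup>2"] s2
    by (simp add: add_divide_distrib)
  have E1p: "E1' 0 0 \<phi> + E1' pi 0 \<phi> = ends h q u + ends h q v"
    unfolding end_u[symmetric] end_v[symmetric] E1'_def hph ang pr by simp
  have N': "qN' 0 \<phi> = n0 h \<phi>"
  proof -
    have "qN' 0 \<phi> = \<delta> * m2 - ((E1' 0 0 \<phi> + E1' pi 0 \<phi>) + (E2 0 0 \<phi> + E2 pi 0 \<phi>))" by (simp add: qN'_def)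
    then show ?thesis unfolding E1p E2s n0_def q_def[symmetric] uv[symmetric] using dl[of m2] by linarith
  qed
  have hs: "hp' 0 0 \<phi> + hm' 0 0 \<phi> + (hp' pi 0 \<phi> + hm' pi 0 \<phi>) = tan h * (f (u + h) + f (u - h) + f (v + h) + f (v - h) - 4 * q)"
    unfolding H1 H2 H3 H4 tn c2h k_def using s2 by (simp add: field_simps)
  have D': "qD' 0 \<phi> = d0 h \<phi>"
  proof -
    have "qD' 0 \<phi> = 2 * (\<delta> * m1) - ((hp' 0 0 \<phi> + hm' 0 0 \<phi> + (hp' pi 0 \<phi> + hm' pi 0 \<phi>)) + 2 * (E1 0 0 \<phi> + E1 pi 0 \<phi>))"
      by (simp add: qD'_def)
    moreover have "2 * X - (T + 2 * (m - g)) = 2 * (g - E) - T" if "X = m - E" for X T m g E :: real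
      using that by simp
    ultimately show ?thesis unfolding hs E1s d0_def q_def[symmetric] uv[symmetric] using dl[of m1] by simp
  qed
  have N0: "qN 0 \<phi> = q * (- 2 * sin (2 * h))"
    using Q s2 unfolding qq_def D q_def by (simp add: field_simps)
  show "qq' 0 \<phi> = q0' h \<phi>"
    unfolding qq'_def q0'_def N' D' D N0 q_def[symmetric] using s2 by (simp add: field_simps)
qed

text \<open>At t = 0 the convolution body is a disc, so its squared radius (2 sin h)^2 factors out
  of all integrals.\<close>

lemma second_derivative_at_0:
  assumes h: "0 < h" "h < pi / 2" and \<delta>: "pi * \<delta> = pi - 2 * h - sin (2 * h)"
  shows "(deriv ^^ 2) (\<lambda>t. measure lebesgue (convolution_body \<delta> (normalized (KK t)))) 0
    = (2 * sin h)\<^sup>2 * (integral {-pi..pi} (\<lambda>\<phi>. 2 * (q0 h \<phi>)\<^sup>2 + q0' h \<phi>) / pi - 2 * m1 * integral {-pi..pi} (q0 h) / pi\<^sup>2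
      - m2 / pi + 2 * m1\<^sup>2 / pi\<^sup>2)"
proof -
  have "0 < sin (2 * h)" using h by (intro sin_gt_zero) auto
  then have "pi * \<delta> \<le> pi * 1" using \<delta> h by simp
  then have d1: "\<delta> \<le> 1" by simp
  note v = values_at_0[OF assms]
  have "WW 0 = pi * (2 * sin h)\<^sup>2" "WW1 0 = (2 * sin h)\<^sup>2 * integral {-pi..pi} (q0 h)"
    "WW2 0 = (2 * sin h)\<^sup>2 * integral {-pi..pi} (\<lambda>\<phi>. 2 * (q0 h \<phi>)\<^sup>2 + q0' h \<phi>)"
    unfolding WW_def WW1_def WW2_def v by simp_all
  then show ?thesis
    unfolding volume_C2(2)[OF d1] by (simp add: field_simps power2_eq_square power3_eq_cube)
qed

end

section \<open>Limits as h tends to 0\<close>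

context perturbed
begin

lemma bconv_f: "bconv (\<lambda>h x. f (x + h)) f" "bconv (\<lambda>h x. f (x - h)) f"
proof -
  have i: "isCont f x" for x using der by (rule DERIV_isCont)
  have id: "((\<lambda>h::real. h) \<longlongrightarrow> 0) (at_right 0)" by (rule tendsto_ident_at)
  have "((\<lambda>h. f (x + h)) \<longlongrightarrow> f x) (at_right 0)" "((\<lambda>h. f (x - h)) \<longlongrightarrow> f x) (at_right 0)" for x
    using isCont_tendsto_compose[OF i tendsto_add[OF tendsto_const id], of x]
      isCont_tendsto_compose[OF i tendsto_diff[OF tendsto_const id], of x] by simp_all
  then show "bconv (\<lambda>h x. f (x + h)) f" "bconv (\<lambda>h x. f (x - h)) f"
    unfolding bconv_def using bnd(2) by (auto intro!: exI[of _ bnd] always_eventually)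
qed

text \<open>The mean value theorem gives the uniform bound that dominated convergence will
  use.\<close>

lemma bconv_quotient:
  assumes G: "\<And>x. (G has_real_derivative g x) (at x)" and b: "\<And>x. \<bar>g x\<bar> \<le> B"
  shows "bconv (\<lambda>h x. (G (x + h) - G (x - h)) / h) (\<lambda>x. 2 * g x)"
proof -
  have "\<bar>(G (x + h) - G (x - h)) / h\<bar> \<le> 2 * B" if h: "0 < h" for h x
  proof -
    obtain z where "G (x + h) - G (x - h) = (x + h - (x - h)) * g z"
      using MVT2[of "x - h" "x + h" G g] h G by auto
    then have "(G (x + h) - G (x - h)) / h = 2 * g z" using h by simp
    then show ?thesis using b[of z] by simp
  qed
  then have "\<forall>\<^sub>F h in at_right 0. \<forall>x. \<bar>(G (x + h) - G (x - h)) / h\<bar> \<le> 2 * B"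
    unfolding eventually_at_right_field by (intro exI[of _ 1]) auto
  then show ?thesis unfolding bconv_def using symmetric_quotient[OF G] by blast
qed

lemma ev_pos: "\<forall>\<^sub>F h in at_right (0::real). 0 < h \<and> h < pi / 2 \<and> 0 < sin (2 * h)"
  unfolding eventually_at_right_field
  by (intro exI[of _ "pi / 2"]) (auto intro!: sin_gt_zero)

text \<open>Numerator and denominator are both of order h. Dividing each by h leaves symmetric
  quotients of the primitive \<open>F1\<close> and the limits in \<open>trig_limits\<close>.\<close>

lemma bconv_q0: "bconv q0 L0"
proof -
  have g: "bconv (\<lambda>h x. gap1 h x / h) (\<lambda>x. 2 * f x)"
    unfolding gap1_def by (rule bconv_quotient[OF F1 bnd(2)])
  note gs = bconv_shift[OF g, of "pi / 2"] bconv_shift[OF g, of "- (pi / 2)"]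
  have "bconv (\<lambda>h \<phi>. ((2 * h + sin (2 * h)) / h * (m1 / pi) - gap1 h (\<phi> + pi / 2) / h - gap1 h (\<phi> + - (pi / 2)) / h) * (h / sin (2 * h) * (1 / 2)))
    (\<lambda>\<phi>. (4 * (m1 / pi) - 2 * f (\<phi> + pi / 2) - 2 * f (\<phi> + - (pi / 2))) * (1 / 2 * (1 / 2)))"
    by (intro bconv_mult bconv_diff gs bconv_const_fun tendsto_intros trig_limits)
  then have "bconv q0 (\<lambda>\<phi>. (4 * (m1 / pi) - 2 * f (\<phi> + pi / 2) - 2 * f (\<phi> + - (pi / 2))) * (1 / 2 * (1 / 2)))"
  proof (rule bconv_cong)
    show "\<forall>\<^sub>F h in at_right 0. \<forall>\<phi>. ((2 * h + sin (2 * h)) / h * (m1 / pi) - gap1 h (\<phi> + pi / 2) / h - gap1 h (\<phi> + - (pi / 2)) / h) * (h / sin (2 * h) * (1 / 2)) = q0 h \<phi>"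
      using ev_pos by eventually_elim (simp add: q0_def field_simps)
  qed
  moreover have "(\<lambda>\<phi>. (4 * (m1 / pi) - 2 * f (\<phi> + pi / 2) - 2 * f (\<phi> + - (pi / 2))) * (1 / 2 * (1 / 2))) = L0"
    by (simp add: fun_eq_iff L0_def field_simps)
  ultimately show ?thesis by (simp only:)
qed

text \<open>The limit of \<open>q0'\<close>, as proved next; the squares of f' come from the squared
  differences in \<open>ends\<close>.\<close>

definition L1 where "L1 \<phi> = m2 / pi - ((f' (\<phi> + pi / 2))\<^sup>2 + (f' (\<phi> - pi / 2))\<^sup>2) / 2 + (L0 \<phi>)\<^sup>2 - 2 * m1 * L0 \<phi> / pi"

lemma bconv_q0': "bconv q0' L1"
proof -
  have g1: "bconv (\<lambda>h x. gap1 h x / h) (\<lambda>x. 2 * f x)"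
    unfolding gap1_def by (rule bconv_quotient[OF F1 bnd(2)])
  have g2: "bconv (\<lambda>h x. gap2 h x / h) (\<lambda>x. 2 * (f x)\<^sup>2)"
    unfolding gap2_def
  proof (rule bconv_quotient[OF F2, of "bnd\<^sup>2"])
    show "\<bar>(f x)\<^sup>2\<bar> \<le> bnd\<^sup>2" for x using bnd(2)[of x] bnd(1) by (simp add: abs_le_square_iff[symmetric])
  qed
  have fd: "bconv (\<lambda>h x. (f (x + h) - f (x - h)) / h) (\<lambda>x. 2 * f' x)"
    by (rule bconv_quotient[OF der bnd(3)])
  \<comment> \<open>Divided by h, the squared difference over sin 2h is the product of two symmetric
    quotients with h / sin 2h, so it contributes twice the square of f'.\<close>
  have ends: "bconv (\<lambda>h \<phi>. ends h (q0 h \<phi>) (\<phi> + c) / h)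
      (\<lambda>\<phi>. 1 * (f (\<phi> + c) * f (\<phi> + c) + f (\<phi> + c) * f (\<phi> + c) - L0 \<phi> * (f (\<phi> + c) + f (\<phi> + c))) - 2 * f' (\<phi> + c) * (2 * f' (\<phi> + c)) * (1 / 2))" for c
  proof (rule bconv_cong)
    show "bconv (\<lambda>h \<phi>. tan h / h * (f (\<phi> + c + h) * f (\<phi> + c + h) + f (\<phi> + c - h) * f (\<phi> + c - h) - q0 h \<phi> * (f (\<phi> + c + h) + f (\<phi> + c - h)))
         - (f (\<phi> + c + h) - f (\<phi> + c - h)) / h * ((f (\<phi> + c + h) - f (\<phi> + c - h)) / h) * (h / sin (2 * h)))
      (\<lambda>\<phi>. 1 * (f (\<phi> + c) * f (\<phi> + c) + f (\<phi> + c) * f (\<phi> + c) - L0 \<phi> * (f (\<phi> + c) + f (\<phi> + c))) - 2 * f' (\<phi> + c) * (2 * f' (\<phi> + c)) * (1 / 2))"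
      by (intro bconv_diff bconv_mult bconv_add bconv_const_fun trig_limits bconv_q0 bconv_shift[OF bconv_f(1)] bconv_shift[OF bconv_f(2)] bconv_shift[OF fd])
    show "\<forall>\<^sub>F h in at_right 0. \<forall>\<phi>. tan h / h * (f (\<phi> + c + h) * f (\<phi> + c + h) + f (\<phi> + c - h) * f (\<phi> + c - h) - q0 h \<phi> * (f (\<phi> + c + h) + f (\<phi> + c - h)))
         - (f (\<phi> + c + h) - f (\<phi> + c - h)) / h * ((f (\<phi> + c + h) - f (\<phi> + c - h)) / h) * (h / sin (2 * h)) = ends h (q0 h \<phi>) (\<phi> + c) / h"
      using ev_pos
    proof eventually_elim
      case (elim h)
      have "T / h * A - Dd / h * (Dd / h) * (h / sn) = (T * A - Dd * Dd / sn) / h" if "sn \<noteq> 0" for T A Dd sn :: real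
        using elim that by (simp add: field_simps)
      then show ?case using elim by (simp add: ends_def power2_eq_square)
    qed
  qed
  have n: "bconv (\<lambda>h \<phi>. n0 h \<phi> / h)
      (\<lambda>\<phi>. - (4 * (m2 / pi)) + 2 * (f (\<phi> + pi / 2))\<^sup>2 + 2 * (f (\<phi> + - (pi / 2)))\<^sup>2
         - ((1 * (f (\<phi> + pi / 2) * f (\<phi> + pi / 2) + f (\<phi> + pi / 2) * f (\<phi> + pi / 2) - L0 \<phi> * (f (\<phi> + pi / 2) + f (\<phi> + pi / 2))) - 2 * f' (\<phi> + pi / 2) * (2 * f' (\<phi> + pi / 2)) * (1 / 2))
          + (1 * (f (\<phi> + - (pi / 2)) * f (\<phi> + - (pi / 2)) + f (\<phi> + - (pi / 2)) * f (\<phi> + - (pi / 2)) - L0 \<phi> * (f (\<phi> + - (pi / 2)) + f (\<phi> + - (pi / 2)))) - 2 * f' (\<phi> + - (pi / 2)) * (2 * f' (\<phi> + - (pi / 2))) * (1 / 2))))"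
  proof (rule bconv_cong)
    show "bconv (\<lambda>h \<phi>. - ((2 * h + sin (2 * h)) / h * (m2 / pi)) + gap2 h (\<phi> + pi / 2) / h + gap2 h (\<phi> + - (pi / 2)) / h
       - (ends h (q0 h \<phi>) (\<phi> + pi / 2) / h + ends h (q0 h \<phi>) (\<phi> + - (pi / 2)) / h))
      (\<lambda>\<phi>. - (4 * (m2 / pi)) + 2 * (f (\<phi> + pi / 2))\<^sup>2 + 2 * (f (\<phi> + - (pi / 2)))\<^sup>2
         - ((1 * (f (\<phi> + pi / 2) * f (\<phi> + pi / 2) + f (\<phi> + pi / 2) * f (\<phi> + pi / 2) - L0 \<phi> * (f (\<phi> + pi / 2) + f (\<phi> + pi / 2))) - 2 * f' (\<phi> + pi / 2) * (2 * f' (\<phi> + pi / 2)) * (1 / 2))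
          + (1 * (f (\<phi> + - (pi / 2)) * f (\<phi> + - (pi / 2)) + f (\<phi> + - (pi / 2)) * f (\<phi> + - (pi / 2)) - L0 \<phi> * (f (\<phi> + - (pi / 2)) + f (\<phi> + - (pi / 2)))) - 2 * f' (\<phi> + - (pi / 2)) * (2 * f' (\<phi> + - (pi / 2))) * (1 / 2))))"
      by (intro bconv_diff bconv_add ends bconv_minus bconv_const_fun tendsto_intros trig_limits bconv_shift[OF g2])
    show "\<forall>\<^sub>F h in at_right 0. \<forall>\<phi>. - ((2 * h + sin (2 * h)) / h * (m2 / pi)) + gap2 h (\<phi> + pi / 2) / h + gap2 h (\<phi> + - (pi / 2)) / h
       - (ends h (q0 h \<phi>) (\<phi> + pi / 2) / h + ends h (q0 h \<phi>) (\<phi> + - (pi / 2)) / h) = n0 h \<phi> / h"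
      using ev_pos
    proof eventually_elim
      case (elim h)
      have gen: "- (A / h * (m / pi)) + g / h + k / h - (S / h + T / h) = (- (A / pi * m) + g + k - (S + T)) / h" for A m g k S T :: real
        using elim by (simp add: field_simps)
      have pm: "\<phi> - pi / 2 = \<phi> + - (pi / 2)" for \<phi> :: real by simp
      show ?case unfolding n0_def pm by (rule allI, rule gen)
    qed
  qed
  have dd: "bconv (\<lambda>h \<phi>. d0 h \<phi> / h)
      (\<lambda>\<phi>. 2 * (2 * f (\<phi> + pi / 2) + 2 * f (\<phi> + - (pi / 2)) - 4 * (m1 / pi)) - 1 * (f (\<phi> + pi / 2) + f (\<phi> + pi / 2) + f (\<phi> + - (pi / 2)) + f (\<phi> + - (pi / 2)) - 4 * L0 \<phi>))"
  proof (rule bconv_cong)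
    show "bconv (\<lambda>h \<phi>. 2 * (gap1 h (\<phi> + pi / 2) / h + gap1 h (\<phi> + - (pi / 2)) / h - (2 * h + sin (2 * h)) / h * (m1 / pi))
        - tan h / h * (f (\<phi> + pi / 2 + h) + f (\<phi> + pi / 2 - h) + f (\<phi> + - (pi / 2) + h) + f (\<phi> + - (pi / 2) - h) - 4 * q0 h \<phi>))
      (\<lambda>\<phi>. 2 * (2 * f (\<phi> + pi / 2) + 2 * f (\<phi> + - (pi / 2)) - 4 * (m1 / pi)) - 1 * (f (\<phi> + pi / 2) + f (\<phi> + pi / 2) + f (\<phi> + - (pi / 2)) + f (\<phi> + - (pi / 2)) - 4 * L0 \<phi>))"
      by (intro bconv_diff bconv_add bconv_mult bconv_q0 bconv_const_fun tendsto_intros trig_limits bconv_shift[OF g1] bconv_shift[OF bconv_f(1)] bconv_shift[OF bconv_f(2)])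
    show "\<forall>\<^sub>F h in at_right 0. \<forall>\<phi>. 2 * (gap1 h (\<phi> + pi / 2) / h + gap1 h (\<phi> + - (pi / 2)) / h - (2 * h + sin (2 * h)) / h * (m1 / pi))
        - tan h / h * (f (\<phi> + pi / 2 + h) + f (\<phi> + pi / 2 - h) + f (\<phi> + - (pi / 2) + h) + f (\<phi> + - (pi / 2) - h) - 4 * q0 h \<phi>) = d0 h \<phi> / h"
      using ev_pos
    proof eventually_elim
      case (elim h)
      have gen: "2 * (g / h + k / h - A / h * (m / pi)) - T / h * X = (2 * (g + k - A / pi * m) - T * X) / h" for A m g k T X :: real
        using elim by (simp add: field_simps)
      have pm: "\<phi> - pi / 2 = \<phi> + - (pi / 2)" for \<phi> :: real by simp
      show ?case unfolding d0_def pm by (rule allI, rule gen)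
    qed
  qed
  have "bconv q0' (\<lambda>\<phi>. (L0 \<phi> * (2 * (2 * f (\<phi> + pi / 2) + 2 * f (\<phi> + - (pi / 2)) - 4 * (m1 / pi)) - 1 * (f (\<phi> + pi / 2) + f (\<phi> + pi / 2) + f (\<phi> + - (pi / 2)) + f (\<phi> + - (pi / 2)) - 4 * L0 \<phi>))
     - (- (4 * (m2 / pi)) + 2 * (f (\<phi> + pi / 2))\<^sup>2 + 2 * (f (\<phi> + - (pi / 2)))\<^sup>2
         - ((1 * (f (\<phi> + pi / 2) * f (\<phi> + pi / 2) + f (\<phi> + pi / 2) * f (\<phi> + pi / 2) - L0 \<phi> * (f (\<phi> + pi / 2) + f (\<phi> + pi / 2))) - 2 * f' (\<phi> + pi / 2) * (2 * f' (\<phi> + pi / 2)) * (1 / 2))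
          + (1 * (f (\<phi> + - (pi / 2)) * f (\<phi> + - (pi / 2)) + f (\<phi> + - (pi / 2)) * f (\<phi> + - (pi / 2)) - L0 \<phi> * (f (\<phi> + - (pi / 2)) + f (\<phi> + - (pi / 2)))) - 2 * f' (\<phi> + - (pi / 2)) * (2 * f' (\<phi> + - (pi / 2))) * (1 / 2))))) * (1 / 2 * (1 / 2)))"
    (is "bconv _ ?lim")
  proof (rule bconv_cong[OF bconv_mult[OF bconv_diff[OF bconv_mult[OF bconv_q0 dd] n] bconv_const_fun]])
    show "((\<lambda>h::real. h / sin (2 * h) * (1 / 2)) \<longlongrightarrow> 1 / 2 * (1 / 2)) (at_right 0)"
      by (intro tendsto_intros trig_limits)
    show "\<forall>\<^sub>F h in at_right 0. \<forall>\<phi>. (q0 h \<phi> * (d0 h \<phi> / h) - n0 h \<phi> / h) * (h / sin (2 * h) * (1 / 2)) = q0' h \<phi>"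
      using ev_pos by eventually_elim (simp add: q0'_def field_simps)
  qed
  moreover have "?lim = L1"
  proof
    fix \<phi>
    \<comment> \<open>Expressing one of the two opposite values of f through \<open>L0\<close> and
      the other one makes the remaining identity purely algebraic.\<close>
    have s: "f (\<phi> + - (pi / 2)) = 2 * (m1 / pi) - 2 * L0 \<phi> - f (\<phi> + pi / 2)"
      by (simp add: L0_def add_divide_distrib)
    have s': "\<phi> - pi / 2 = \<phi> + - (pi / 2)" by simp
    show "?lim \<phi> = L1 \<phi>"
      unfolding L1_def s' s by (simp add: power2_eq_square field_simps)
  qed
  ultimately show ?thesis by (simp only:)
qed

lemma q0_integrable:
  assumes "0 < h" "0 < sin (2 * h)"
  shows "q0 h integrable_on {a..b}" "(\<lambda>\<phi>. 2 * (q0 h \<phi>)\<^sup>2 + q0' h \<phi>) integrable_on {a..b}"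
proof -
  have c: "continuous_on {a..b} (\<lambda>\<phi>. q0 h \<phi>)"
    unfolding q0_def gap1_def using assms by (intro continuous_intros contF) auto
  then show "q0 h integrable_on {a..b}" by (rule integrable_continuous_real)
  have "continuous_on {a..b} (\<lambda>\<phi>. 2 * (q0 h \<phi>)\<^sup>2 + q0' h \<phi>)"
    unfolding q0'_def n0_def d0_def ends_def gap1_def gap2_def using assms by (intro continuous_intros contF c) auto
  then show "(\<lambda>\<phi>. 2 * (q0 h \<phi>)\<^sup>2 + q0' h \<phi>) integrable_on {a..b}" by (rule integrable_continuous_real)
qed

text \<open>The part of f with period pi; \<open>L0\<close> is \<open>m1 / pi\<close> minus its
  translate by a quarter turn.\<close>

definition evn where "evn x = (f x + f (x + pi)) / 2"

text \<open>All integrals run over a full period, so the quarter turn shifts disappear. The square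
  of \<open>L0\<close> occurs twice explicitly and once more inside \<open>L1\<close>, which is the
  origin of the coefficient 3.\<close>

lemma limit_value:
  "integral {-pi..pi} (\<lambda>\<phi>. 2 * (L0 \<phi> * L0 \<phi>) + L1 \<phi>) / pi - 2 * m1 * integral {-pi..pi} L0 / pi\<^sup>2 - m2 / pi + 2 * m1\<^sup>2 / pi\<^sup>2
   = (m2 - integral {-pi..pi} (\<lambda>x. (f' x)\<^sup>2) + 3 * integral {-pi..pi} (\<lambda>x. (evn x)\<^sup>2) - 2 * m1\<^sup>2 / pi) / pi"
proof -
  let ?I = "\<lambda>g. integral {-pi..pi} g"
  have ce: "continuous_on S (\<lambda>x. evn (g x))" if "continuous_on S g" for S :: "real set" and g
    unfolding evn_def by (intro continuous_intros that) auto
  have pe: "evn (x + 2 * pi) = evn x" for x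
    unfolding evn_def using per[of x] per[of "x + pi"] by (simp add: algebra_simps)
  have L: "L0 \<phi> = m1 / pi - evn (\<phi> + - (pi / 2))" for \<phi>
  proof -
    have "\<phi> + - (pi / 2) + pi = \<phi> + pi / 2" by simp
    then have "evn (\<phi> + - (pi / 2)) = (f (\<phi> + - (pi / 2)) + f (\<phi> + pi / 2)) / 2" unfolding evn_def by (simp only:)
    then show ?thesis by (simp add: L0_def)
  qed
  have Ie: "?I (\<lambda>\<phi>. evn (\<phi> + - (pi / 2))) = m1"
  proof -
    have "?I (\<lambda>\<phi>. evn (\<phi> + - (pi / 2))) = ?I evn"
      using pe ce[OF continuous_on_id] by (intro integral_periodic_shift(2)) auto
    also have "\<dots> = (?I f + ?I (\<lambda>x. f (x + pi))) / 2"
      unfolding evn_def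
      by (simp, subst integral_add, (intro integrable_continuous_real continuous_intros)+) simp
    also have "?I (\<lambda>x. f (x + pi)) = ?I f"
      by (rule integral_periodic_shift(2)[OF per contf])
    finally show ?thesis by (simp add: m1_def)
  qed
  have Ie2: "?I (\<lambda>\<phi>. (evn (\<phi> + - (pi / 2)))\<^sup>2) = ?I (\<lambda>x. (evn x)\<^sup>2)"
    using integral_periodic_shift(2)[of "\<lambda>x. (evn x)\<^sup>2" "- (pi / 2)"] pe ce by (auto intro!: continuous_intros)
  have If: "?I (\<lambda>\<phi>. (f' (\<phi> + c))\<^sup>2) = ?I (\<lambda>x. (f' x)\<^sup>2)" for c
    by (rule integral_periodic_shift(2)) (intro continuous_intros | simp add: per')+
  have int: "g integrable_on {-pi..pi}" if "continuous_on {-pi..pi} g" for g :: "real \<Rightarrow> real"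
    using that by (rule integrable_continuous_real)
  have IL: "?I L0 = m1"
  proof -
    have "?I L0 = ?I (\<lambda>\<phi>. m1 / pi) - ?I (\<lambda>\<phi>. evn (\<phi> + - (pi / 2)))"
      unfolding L[abs_def] by (intro integral_diff int continuous_intros ce)
    then show ?thesis unfolding Ie by simp
  qed
  have eq: "2 * (L0 \<phi> * L0 \<phi>) + L1 \<phi> = (m2 / pi + (m1 / pi)\<^sup>2) + 3 * (evn (\<phi> + - (pi / 2)))\<^sup>2 - 4 * (m1 / pi) * evn (\<phi> + - (pi / 2))
      - ((f' (\<phi> + pi / 2))\<^sup>2 / 2 + (f' (\<phi> + - (pi / 2)))\<^sup>2 / 2)" for \<phi>
    unfolding L1_def L by (simp add: power2_eq_square field_simps)
  have *: "?I (\<lambda>\<phi>. 2 * (L0 \<phi> * L0 \<phi>) + L1 \<phi>) = ?I (\<lambda>\<phi>. m2 / pi + (m1 / pi)\<^sup>2) + 3 * ?I (\<lambda>\<phi>. (evn (\<phi> + - (pi / 2)))\<^sup>2)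
      - 4 * (m1 / pi) * ?I (\<lambda>\<phi>. evn (\<phi> + - (pi / 2))) - (?I (\<lambda>\<phi>. (f' (\<phi> + pi / 2))\<^sup>2) / 2 + ?I (\<lambda>\<phi>. (f' (\<phi> + - (pi / 2)))\<^sup>2) / 2)"
  proof -
    have c: "continuous_on {-pi..pi} (\<lambda>\<phi>. (f' (\<phi> + c))\<^sup>2 / 2)" for c by (intro continuous_intros) auto
    have 1: "?I (\<lambda>\<phi>. (m2 / pi + (m1 / pi)\<^sup>2) + 3 * (evn (\<phi> + - (pi / 2)))\<^sup>2 - 4 * (m1 / pi) * evn (\<phi> + - (pi / 2)) - ((f' (\<phi> + pi / 2))\<^sup>2 / 2 + (f' (\<phi> + - (pi / 2)))\<^sup>2 / 2))
      = ?I (\<lambda>\<phi>. (m2 / pi + (m1 / pi)\<^sup>2) + 3 * (evn (\<phi> + - (pi / 2)))\<^sup>2 - 4 * (m1 / pi) * evn (\<phi> + - (pi / 2))) - ?I (\<lambda>\<phi>. (f' (\<phi> + pi / 2))\<^sup>2 / 2 + (f' (\<phi> + - (pi / 2)))\<^sup>2 / 2)"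
      by (intro integral_diff int continuous_intros ce c)
    have 2: "?I (\<lambda>\<phi>. (m2 / pi + (m1 / pi)\<^sup>2) + 3 * (evn (\<phi> + - (pi / 2)))\<^sup>2 - 4 * (m1 / pi) * evn (\<phi> + - (pi / 2)))
      = ?I (\<lambda>\<phi>. (m2 / pi + (m1 / pi)\<^sup>2) + 3 * (evn (\<phi> + - (pi / 2)))\<^sup>2) - ?I (\<lambda>\<phi>. 4 * (m1 / pi) * evn (\<phi> + - (pi / 2)))"
      by (intro integral_diff int continuous_intros ce)
    have 3: "?I (\<lambda>\<phi>. (m2 / pi + (m1 / pi)\<^sup>2) + 3 * (evn (\<phi> + - (pi / 2)))\<^sup>2) = ?I (\<lambda>\<phi>. m2 / pi + (m1 / pi)\<^sup>2) + ?I (\<lambda>\<phi>. 3 * (evn (\<phi> + - (pi / 2)))\<^sup>2)"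
      by (intro integral_add int continuous_intros ce)
    have 4: "?I (\<lambda>\<phi>. (f' (\<phi> + pi / 2))\<^sup>2 / 2 + (f' (\<phi> + - (pi / 2)))\<^sup>2 / 2) = ?I (\<lambda>\<phi>. (f' (\<phi> + pi / 2))\<^sup>2 / 2) + ?I (\<lambda>\<phi>. (f' (\<phi> + - (pi / 2)))\<^sup>2 / 2)"
      by (intro integral_add int c)
    have 5: "?I (\<lambda>\<phi>. 4 * (m1 / pi) * evn (\<phi> + - (pi / 2))) = 4 * (m1 / pi) * ?I (\<lambda>\<phi>. evn (\<phi> + - (pi / 2)))"
      "?I (\<lambda>\<phi>. 3 * (evn (\<phi> + - (pi / 2)))\<^sup>2) = 3 * ?I (\<lambda>\<phi>. (evn (\<phi> + - (pi / 2)))\<^sup>2)"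
      "?I (\<lambda>\<phi>. (f' (\<phi> + c))\<^sup>2 / 2) = ?I (\<lambda>\<phi>. (f' (\<phi> + c))\<^sup>2) / 2" for c
      by (rule integral_mult_right, rule integral_mult_right, rule integral_divide)
    show ?thesis unfolding eq unfolding 1 unfolding 2 unfolding 3 unfolding 4 unfolding 5 ..
  qed
  have I2: "?I (\<lambda>\<phi>. 2 * (L0 \<phi> * L0 \<phi>) + L1 \<phi>) = 2 * m2 + 2 * m1\<^sup>2 / pi + 3 * ?I (\<lambda>x. (evn x)\<^sup>2) - 4 * m1\<^sup>2 / pi - ?I (\<lambda>x. (f' x)\<^sup>2)"
  proof -
    have k1: "?I (\<lambda>\<phi>. m2 / pi + (m1 / pi)\<^sup>2) = 2 * m2 + 2 * m1\<^sup>2 / pi"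
      by (simp add: power2_eq_square field_simps)
    have k2: "4 * (m1 / pi) * m1 = 4 * m1\<^sup>2 / pi" by (simp add: power2_eq_square)
    have "x + 3 * y - z - (r / 2 + r / 2) = x + 3 * y - z - r" for x y z r :: real by simp
    then show ?thesis unfolding * Ie2 Ie If k1 k2 .
  qed
  show ?thesis unfolding I2 IL by (simp add: power2_eq_square field_simps)
qed

text \<open>The denominator is the square of (2 h + sin 2h) / pi, which will be 1 - \<delta>.
  Dividing it and 2 sin h by h gives the factor (2 / (4 / pi))^2 = pi^2 / 4, and
  \<open>limit_value\<close> contributes 1 / pi.\<close>

theorem limit_second_variation:
  "((\<lambda>h. (2 * sin h)\<^sup>2 * (integral {-pi..pi} (\<lambda>\<phi>. 2 * (q0 h \<phi>)\<^sup>2 + q0' h \<phi>) / pi - 2 * m1 * integral {-pi..pi} (q0 h) / pi\<^sup>2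
      - m2 / pi + 2 * m1\<^sup>2 / pi\<^sup>2) / ((2 * h + sin (2 * h)) / pi)\<^sup>2) \<longlongrightarrow>
    pi / 4 * (m2 - integral {-pi..pi} (\<lambda>x. (f' x)\<^sup>2) + 3 * integral {-pi..pi} (\<lambda>x. (evn x)\<^sup>2) - 2 * m1\<^sup>2 / pi)) (at_right 0)"
proof -
  have I1: "((\<lambda>h. integral {-pi..pi} (q0 h)) \<longlongrightarrow> integral {-pi..pi} L0) (at_right 0)"
    by (rule bconv_integral[OF bconv_q0]) (use ev_pos in \<open>eventually_elim, simp add: q0_integrable\<close>)
  have b2: "bconv (\<lambda>h \<phi>. 2 * (q0 h \<phi>)\<^sup>2 + q0' h \<phi>) (\<lambda>\<phi>. 2 * (L0 \<phi> * L0 \<phi>) + L1 \<phi>)"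
    unfolding power2_eq_square by (intro bconv_add bconv_mult bconv_const_fun tendsto_const bconv_q0 bconv_q0')
  have I2: "((\<lambda>h. integral {-pi..pi} (\<lambda>\<phi>. 2 * (q0 h \<phi>)\<^sup>2 + q0' h \<phi>)) \<longlongrightarrow> integral {-pi..pi} (\<lambda>\<phi>. 2 * (L0 \<phi> * L0 \<phi>) + L1 \<phi>)) (at_right 0)"
    by (rule bconv_integral[OF b2]) (use ev_pos in \<open>eventually_elim, simp add: q0_integrable\<close>)
  have A: "((\<lambda>h. (integral {-pi..pi} (\<lambda>\<phi>. 2 * (q0 h \<phi>)\<^sup>2 + q0' h \<phi>) / pi - 2 * m1 * integral {-pi..pi} (q0 h) / pi\<^sup>2
      - m2 / pi + 2 * m1\<^sup>2 / pi\<^sup>2) * ((2 * sin h / h) / ((2 * h + sin (2 * h)) / h / pi))\<^sup>2) \<longlongrightarrow>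
     (integral {-pi..pi} (\<lambda>\<phi>. 2 * (L0 \<phi> * L0 \<phi>) + L1 \<phi>) / pi - 2 * m1 * integral {-pi..pi} L0 / pi\<^sup>2 - m2 / pi + 2 * m1\<^sup>2 / pi\<^sup>2) * (2 / (4 / pi))\<^sup>2) (at_right 0)"
    by (intro tendsto_intros I1 I2 trig_limits) auto
  have "((\<lambda>h. (integral {-pi..pi} (\<lambda>\<phi>. 2 * (q0 h \<phi>)\<^sup>2 + q0' h \<phi>) / pi - 2 * m1 * integral {-pi..pi} (q0 h) / pi\<^sup>2
      - m2 / pi + 2 * m1\<^sup>2 / pi\<^sup>2) * ((2 * sin h / h) / ((2 * h + sin (2 * h)) / h / pi))\<^sup>2) \<longlongrightarrow>
     pi / 4 * (m2 - integral {-pi..pi} (\<lambda>x. (f' x)\<^sup>2) + 3 * integral {-pi..pi} (\<lambda>x. (evn x)\<^sup>2) - 2 * m1\<^sup>2 / pi)) (at_right 0)"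
  proof -
    have "X / pi * (2 / (4 / pi))\<^sup>2 = pi / 4 * X" for X by (simp add: power2_eq_square)
    with A show ?thesis unfolding limit_value by (simp only:)
  qed
  then show ?thesis
  proof (rule Lim_transform_eventually)
    show "\<forall>\<^sub>F h in at_right 0. (integral {-pi..pi} (\<lambda>\<phi>. 2 * (q0 h \<phi>)\<^sup>2 + q0' h \<phi>) / pi - 2 * m1 * integral {-pi..pi} (q0 h) / pi\<^sup>2
      - m2 / pi + 2 * m1\<^sup>2 / pi\<^sup>2) * ((2 * sin h / h) / ((2 * h + sin (2 * h)) / h / pi))\<^sup>2 =
      (2 * sin h)\<^sup>2 * (integral {-pi..pi} (\<lambda>\<phi>. 2 * (q0 h \<phi>)\<^sup>2 + q0' h \<phi>) / pi - 2 * m1 * integral {-pi..pi} (q0 h) / pi\<^sup>2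
      - m2 / pi + 2 * m1\<^sup>2 / pi\<^sup>2) / ((2 * h + sin (2 * h)) / pi)\<^sup>2"
      using ev_pos
    proof eventually_elim
      case (elim h)
      have "(2 * sin h / h) / ((2 * h + sin (2 * h)) / h / pi) = (2 * sin h) / ((2 * h + sin (2 * h)) / pi)"
        using elim by simp
      then show ?case by (simp only: power_divide mult.commute times_divide_eq_left)
    qed
  qed
qed

end

section \<open>Wirtinger inequalities\<close>

text \<open>The integrand differs from \<open>(g' - k g cot)\<^sup>2\<close> by the derivative of \<open>k g\<^sup>2 cot\<close>,
  which vanishes at both end points.\<close>

lemma wirtinger_segment:
  fixes g g' :: "real \<Rightarrow> real"
  assumes k: "0 < k" and der: "\<And>x. (g has_real_derivative g' x) (at x)" and cg': "continuous_on UNIV g'"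
    and zero: "g a = 0" "g (a + pi / k) = 0"
  shows "0 \<le> integral {a..a + pi / k} (\<lambda>x. (g' x)\<^sup>2 - k\<^sup>2 * (g x)\<^sup>2)"
    "integral {a..a + pi / k} (\<lambda>x. (g' x)\<^sup>2 - k\<^sup>2 * (g x)\<^sup>2) = 0 \<Longrightarrow> \<exists>c. \<forall>x\<in>{a..a + pi / k}. g x = c * sin (k * (x - a))"
proof -
  define b where "b = a + pi / k"
  have ab: "a < b" using k by (simp add: b_def)
  define S C where "S x = sin (k * (x - a))" and "C x = cos (k * (x - a))" for x
  have dS: "(S has_real_derivative k * C x) (at x)" for x
    unfolding S_def C_def by (auto intro!: derivative_eq_intros)
  have dC: "(C has_real_derivative - k * S x) (at x)" for x
    unfolding S_def C_def by (auto intro!: derivative_eq_intros)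
  have Sb: "k * (b - a) = pi" using k by (simp add: b_def)
  have Sp: "0 < S x" if "a < x" "x < b" for x
  proof -
    have "k * (x - a) < k * (b - a)" using that k by simp
    then show ?thesis unfolding S_def Sb using that k by (intro sin_gt_zero) auto
  qed
  have S0: "S a = 0" "S b = 0" "C a = 1" "C b = -1" by (simp_all add: S_def C_def Sb)
  have SC: "(S x)\<^sup>2 + (C x)\<^sup>2 = 1" for x by (simp add: S_def C_def)
  have cont_g: "continuous_on UNIV g" using der by (meson DERIV_isCont continuous_at_imp_continuous_on)
  have cSC: "continuous_on X S" "continuous_on X C" for X
    unfolding S_def C_def by (intro continuous_intros)+
  define F where "F x = k * (g x)\<^sup>2 * C x / S x" for x
  define D where "D x = (2 * k * g x * g' x * C x) / S x - k\<^sup>2 * (g x)\<^sup>2 / (S x)\<^sup>2" for x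
  have dF: "(F has_real_derivative D x) (at x)" if "a < x" "x < b" for x
  proof -
    have s: "S x \<noteq> 0" using Sp[OF that] by simp
    have n: "((\<lambda>x. k * (g x)\<^sup>2 * C x) has_real_derivative (2 * k * g x * g' x * C x - k * (g x)\<^sup>2 * (k * S x))) (at x)"
      by (auto intro!: derivative_eq_intros der dC)
    have "(F has_real_derivative ((2 * k * g x * g' x * C x - k * (g x)\<^sup>2 * (k * S x)) * S x - k * (g x)\<^sup>2 * C x * (k * C x)) / (S x * S x)) (at x)"
      unfolding F_def by (rule DERIV_divide[OF n dS s])
    moreover have "((2 * k * g x * g' x * C x - k * (g x)\<^sup>2 * (k * S x)) * S x - k * (g x)\<^sup>2 * C x * (k * C x)) / (S x * S x) = D x"
    proof -
      have "(2 * k * g x * g' x * C x - k * (g x)\<^sup>2 * (k * S x)) * S x - k * (g x)\<^sup>2 * C x * (k * C x)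
        = 2 * k * g x * g' x * C x * S x - k\<^sup>2 * (g x)\<^sup>2 * ((S x)\<^sup>2 + (C x)\<^sup>2)"
        by (simp add: power2_eq_square algebra_simps)
      then show ?thesis unfolding SC D_def using s by (simp add: field_simps power2_eq_square)
    qed
    ultimately show ?thesis by simp
  qed
  \<comment> \<open>Write F as k g C (g / S). The quotient g / S has a finite limit because both
    functions vanish at \<open>e\<close> and S has nonzero derivative there, while g tends to
    0.\<close>
  have end_lim: "(F \<longlongrightarrow> 0) (at e)" if e: "g e = 0" "S e = 0" "C e \<noteq> 0" for e
  proof -
    have q1: "((\<lambda>x. (g x - g e) / (x - e)) \<longlongrightarrow> g' e) (at e)" using der[of e] by (simp add: has_field_derivative_iff)
    have q2: "((\<lambda>x. (S x - S e) / (x - e)) \<longlongrightarrow> k * C e) (at e)" using dS[of e] by (simp add: has_field_derivative_iff)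
    have q: "((\<lambda>x. ((g x - g e) / (x - e)) / ((S x - S e) / (x - e))) \<longlongrightarrow> g' e / (k * C e)) (at e)"
      using k e(3) by (intro tendsto_divide q1 q2) auto
    have gC: "(g \<longlongrightarrow> g e) (at e)" "(C \<longlongrightarrow> C e) (at e)"
      using DERIV_isCont[OF der] DERIV_isCont[OF dC] by (auto simp: isCont_def)
    have "((\<lambda>x. k * g x * C x * (((g x - g e) / (x - e)) / ((S x - S e) / (x - e)))) \<longlongrightarrow> k * g e * C e * (g' e / (k * C e))) (at e)"
      by (rule tendsto_mult[OF tendsto_mult[OF tendsto_mult[OF tendsto_const gC(1)] gC(2)] q])
    then have "((\<lambda>x. k * g x * C x * (((g x - g e) / (x - e)) / ((S x - S e) / (x - e)))) \<longlongrightarrow> 0) (at e)" by (simp add: e)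
    then show ?thesis
    proof (rule Lim_transform_eventually)
      show "\<forall>\<^sub>F x in at e. k * g x * C x * (((g x - g e) / (x - e)) / ((S x - S e) / (x - e))) = F x"
        unfolding eventually_at_filter by (auto intro!: always_eventually simp: F_def e power2_eq_square)
    qed
  qed
  have cF: "continuous_on {a..b} F"
    unfolding continuous_on_def
  proof
    fix x assume x: "x \<in> {a..b}"
    consider "x = a" | "x = b" | "a < x" "x < b" using x by fastforce
    then have "(F \<longlongrightarrow> F x) (at x)"
    proof cases
      case 1 then show ?thesis using end_lim[of a] zero S0 by (simp add: F_def)
    next
      case 2 then show ?thesis using end_lim[of b] zero S0 by (simp add: F_def b_def)
    next
      case 3 then show ?thesis using DERIV_isCont[OF dF] by (simp add: isCont_def)
    qed
    then show "(F \<longlongrightarrow> F x) (at x within {a..b})" by (rule tendsto_within_subset) simp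
  qed
  have ID: "(D has_integral (F b - F a)) {a..b}"
    using ab cF dF by (intro fundamental_theorem_of_calculus_interior)
      (auto simp: has_real_derivative_iff_has_vector_derivative[symmetric])
  \<comment> \<open>Division by 0 yields 0, so \<open>F\<close> vanishes at both ends by convention,
    in agreement with the limits in \<open>end_lim\<close>.\<close>
  have FD: "F b - F a = 0" by (simp add: F_def S0)
  let ?E = "\<lambda>x. (g' x)\<^sup>2 - k\<^sup>2 * (g x)\<^sup>2"
  have cE: "continuous_on X ?E" for X
    using continuous_on_subset[OF cg'] continuous_on_subset[OF cont_g] by (intro continuous_intros) auto
  have IE: "(?E has_integral integral {a..b} ?E) {a..b}"
    by (intro integrable_integral integrable_continuous_real cE)
  define r where "r x = (g' x - k * g x * C x / S x)\<^sup>2" for x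
  have rE: "?E x - D x = r x" if "a < x" "x < b" for x
  proof -
    have s: "S x \<noteq> 0" using Sp[OF that] by simp
    have "k\<^sup>2 * (g x)\<^sup>2 / (S x)\<^sup>2 - k\<^sup>2 * (g x)\<^sup>2 = k\<^sup>2 * (g x)\<^sup>2 * (C x)\<^sup>2 / (S x)\<^sup>2"
    proof -
      have C2: "(C x)\<^sup>2 = 1 - (S x)\<^sup>2" using SC[of x] by linarith
      show ?thesis unfolding C2 using s by (simp add: field_simps)
    qed
    then have "?E x - D x = (g' x)\<^sup>2 - (2 * k * g x * g' x * C x) / S x + k\<^sup>2 * (g x)\<^sup>2 * (C x)\<^sup>2 / (S x)\<^sup>2"
      by (simp add: D_def)
    also have "\<dots> = r x"
      using s by (simp add: r_def power2_eq_square field_simps)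
    finally show ?thesis .
  qed
  \<comment> \<open>Only interior points are compared, because at the ends \<open>D\<close> and
    \<open>r\<close> contain divisions by zero.\<close>
  have Ir: "(r has_integral integral {a..b} ?E) {a..b}"
    unfolding cbox_interval[symmetric]
  proof (rule has_integral_spike_interior)
    show "((\<lambda>x. ?E x - D x) has_integral integral (cbox a b) ?E) (cbox a b)"
      using has_integral_diff[OF IE ID] FD by simp
    show "r x = ?E x - D x" if "x \<in> box a b" for x using rE[of x] that by (simp add: box_real)
  qed
  have r0: "0 \<le> r x" for x by (simp add: r_def)
  show "0 \<le> integral {a..a + pi / k} ?E"
    using has_integral_nonneg[OF Ir] r0 by (simp add: b_def)
  assume "integral {a..a + pi / k} ?E = 0"
  then have Ir0: "(r has_integral 0) {a..b}" using Ir by (simp add: b_def)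
  \<comment> \<open>A continuous nonnegative function with integral 0 vanishes; this is applied on
    [c, d] inside the open interval, away from the zeros of \<open>S\<close>.\<close>
  have rz: "r x = 0" if x: "a < x" "x < b" for x
  proof -
    define c d where "c = (a + x) / 2" and "d = (x + b) / 2"
    have cd: "a < c" "c < x" "x < d" "d < b" using x by (auto simp: c_def d_def)
    have ri: "r integrable_on {a..b}" using Ir0 by (rule has_integral_integrable)
    have ric: "r integrable_on {c..d}" using ri by (rule integrable_subinterval_real) (use cd in auto)
    have "integral {c..d} r \<le> integral {a..b} r"
      using ric ri r0 cd by (intro integral_subset_le) auto
    then have "integral {c..d} r = 0"
      using integral_unique[OF Ir0] integral_nonneg[OF ric r0] by simp
    then have i0: "(r has_integral 0) (cbox c d)" using ric by (simp add: has_integral_iff cbox_interval)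
    have "continuous_on (cbox c d) r"
    proof -
      have "\<forall>y\<in>cbox c d. S y \<noteq> 0" 
        using Sp[THEN less_imp_neq] cd by (metis cbox_interval atLeastAtMost_iff less_le_trans le_less_trans)
      then show ?thesis unfolding r_def
        by (intro continuous_intros continuous_on_subset[OF cg'] continuous_on_subset[OF cont_g] cSC) auto
    qed
    then show ?thesis
      by (rule has_integral_0_cbox_imp_0[OF _ _ i0]) (use r0 cd in \<open>auto simp: box_real cbox_interval\<close>)
  qed
  define m where "m = (a + b) / 2"
  have m: "a < m" "m < b" using ab by (auto simp: m_def)
  \<comment> \<open>The vanishing of \<open>r\<close> says g' = k g cot, that is, g / S has
    derivative 0.\<close>
  have q: "g x / S x = g m / S m" if "a < x" "x < b" for x
  proof (rule DERIV_isconst3[of a b x m "\<lambda>x. g x / S x"])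
    fix y assume y: "y \<in> {a<..<b}"
    then have s: "S y \<noteq> 0" using Sp[of y] by simp
    have "((\<lambda>x. g x / S x) has_real_derivative (g' y * S y - g y * (k * C y)) / (S y * S y)) (at y)"
      by (rule DERIV_divide[OF der dS s])
    moreover have "g' y - k * g y * C y / S y = 0" using rz[of y] y by (simp add: r_def)
    then have "g' y * S y - g y * (k * C y) = 0" using s by (simp add: field_simps)
    ultimately show "((\<lambda>x. g x / S x) has_real_derivative 0) (at y)" by simp
  qed (use that m in auto)
  have "g x = g m / S m * S x" if "a < x" "x < b" for x unfolding q[OF that, symmetric] using Sp[OF that] by simp
  moreover have "g x = g m / S m * S x" if "x = a \<or> x = b" for x using that zero S0 by (auto simp: b_def)
  ultimately have "\<forall>x\<in>{a..b}. g x = g m / S m * S x" by (metis atLeastAtMost_iff le_less)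
  then show "\<exists>c. \<forall>x\<in>{a..a + pi / k}. g x = c * sin (k * (x - a))"
    unfolding b_def S_def by blast
qed

lemma periodic_all:
  fixes g :: "real \<Rightarrow> real"
  assumes per: "\<And>x. g (x + T) = g x" and T: "0 < T" and z: "\<And>x. x \<in> {a..a + T} \<Longrightarrow> g x = c"
  shows "g x = c"
proof -
  interpret periodic_fun_simple g T by unfold_locales (rule per)
  define n where "n = \<lfloor>(x - a) / T\<rfloor>"
  have "of_int n \<le> (x - a) / T" "(x - a) / T < of_int n + 1" by (auto simp: n_def)
  then have "x - of_int n * T \<in> {a..a + T}" using T by (auto simp: field_simps)
  then have "g (x - of_int n * T) = c" by (rule z)
  then show ?thesis using plus_of_int[of "x - of_int n * T" n] by simp
qed

lemma integral_double_period:
  fixes g :: "real \<Rightarrow> real"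
  assumes per: "\<And>x. g (x + pi) = g x" and c: "continuous_on UNIV g"
  shows "integral {-pi..pi} g = 2 * integral {a..a + pi} g"
proof -
  obtain G where G: "\<And>x. (G has_real_derivative g x) (at x)" using antiderivative_exists[OF c] by blast
  have per2: "g (x + 2 * pi) = g x" for x using per[of x] per[of "x + pi"] by (simp add: algebra_simps)
  have "integral {a..a + pi} g = G (a + pi) - G a"
    using integral_primitive[OF G, of a "a + pi" 0] by simp
  moreover have "integral {a..a + pi} (\<lambda>x. g (x + pi)) = G (a + 2 * pi) - G (a + pi)"
    using integral_primitive[OF G, of a "a + pi" pi] unfolding add.assoc by simp
  moreover have "integral {a..a + 2 * pi} g = G (a + 2 * pi) - G a"
    using integral_primitive[OF G, of a "a + 2 * pi" 0] by simp
  moreover have "integral {a..a + 2 * pi} g = integral {-pi..pi} g"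
    by (rule integral_periodic_shift(1)[OF per2 c])
  moreover have "integral {a..a + pi} (\<lambda>x. g (x + pi)) = integral {a..a + pi} g" by (simp only: per)
  ultimately show ?thesis by linarith
qed

text \<open>An antiperiodic function changes sign, so it has a zero a, and a + pi is another one.
  The squares have period pi, hence the full integral is twice the one over [a, a + pi], which is
  the case k = 1 of \<open>wirtinger_segment\<close>.\<close>

lemma wirtinger_antiperiodic:
  fixes g g' :: "real \<Rightarrow> real"
  assumes der: "\<And>x. (g has_real_derivative g' x) (at x)" and cg': "continuous_on UNIV g'"
    and anti: "\<And>x. g (x + pi) = - g x" "\<And>x. g' (x + pi) = - g' x"
  shows "0 \<le> integral {-pi..pi} (\<lambda>x. (g' x)\<^sup>2 - (g x)\<^sup>2)"
    "integral {-pi..pi} (\<lambda>x. (g' x)\<^sup>2 - (g x)\<^sup>2) = 0 \<Longrightarrow> \<exists>A B. \<forall>x. g x = A * cos x + B * sin x"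
proof -
  have cg: "continuous_on UNIV g" using der by (meson DERIV_isCont continuous_at_imp_continuous_on)
  have "\<exists>a. g a = 0"
  proof (cases "g 0 \<le> 0")
    case True
    then have "g 0 \<le> 0" "0 \<le> g pi" using anti(1)[of 0] by auto
    then show ?thesis using IVT'[of g 0 0 pi] continuous_on_subset[OF cg] by (metis pi_ge_zero top_greatest)
  next
    case False
    then have "g pi \<le> 0" "0 \<le> g 0" using anti(1)[of 0] by auto
    then show ?thesis using IVT2'[of g pi 0 0] continuous_on_subset[OF cg] by (metis pi_ge_zero top_greatest)
  qed
  then obtain a where a: "g a = 0" by blast
  then have a': "g (a + pi / 1) = 0" using anti(1)[of a] by simp
  have dbl: "integral {-pi..pi} (\<lambda>x. (g' x)\<^sup>2 - (g x)\<^sup>2) = 2 * integral {a..a + pi} (\<lambda>x. (g' x)\<^sup>2 - (g x)\<^sup>2)"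
    by (rule integral_double_period) (auto simp: anti intro!: continuous_intros cg cg')
  note W = wirtinger_segment[OF zero_less_one der cg' a a']
  show "0 \<le> integral {-pi..pi} (\<lambda>x. (g' x)\<^sup>2 - (g x)\<^sup>2)" using W(1) dbl by simp
  assume "integral {-pi..pi} (\<lambda>x. (g' x)\<^sup>2 - (g x)\<^sup>2) = 0"
  then obtain c where c: "\<forall>x\<in>{a..a + pi}. g x = c * sin (x - a)" using W(2) dbl by auto
  \<comment> \<open>The difference is antiperiodic, so its absolute value has period pi and vanishes
    on one whole period.\<close>
  have "\<bar>g x - c * sin (x - a)\<bar> = 0" for x
  proof (rule periodic_all[of "\<lambda>x. \<bar>g x - c * sin (x - a)\<bar>" pi a])
    fix x
    have "sin (x + pi - a) = - sin (x - a)" using sin_periodic_pi[of "x - a"] by (simp add: algebra_simps)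
    then have "g (x + pi) - c * sin (x + pi - a) = - (g x - c * sin (x - a))" by (simp add: anti)
    then show "\<bar>g (x + pi) - c * sin (x + pi - a)\<bar> = \<bar>g x - c * sin (x - a)\<bar>" by (simp only: abs_minus_cancel)
  qed (use c in auto)
  then have "g x = - c * sin a * cos x + c * cos a * sin x" for x
    by (simp add: sin_diff algebra_simps)
  then show "\<exists>A B. \<forall>x. g x = A * cos x + B * sin x" by blast
qed

text \<open>Two zeros at distance pi / 2 cannot be expected, but two equal values can: g(x) - g(x +
  pi / 2) changes sign. Subtracting the common value \<kappa> gives zeros at a, a + pi / 2 and a +
  pi, so \<open>wirtinger_segment\<close> with k = 2 applies on both halves. As g has mean 0, the
  subtraction lowers the integral by 8 pi \<kappa>^2, so the bound for the shifted function implies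
  the one for g, and equality forces \<kappa> = 0.\<close>

lemma wirtinger_half_period:
  fixes g g' :: "real \<Rightarrow> real"
  assumes der: "\<And>x. (g has_real_derivative g' x) (at x)" and cg': "continuous_on UNIV g'"
    and per: "\<And>x. g (x + pi) = g x" "\<And>x. g' (x + pi) = g' x" and mean: "integral {-pi..pi} g = 0"
  shows "0 \<le> integral {-pi..pi} (\<lambda>x. (g' x)\<^sup>2 - 4 * (g x)\<^sup>2)"
    "integral {-pi..pi} (\<lambda>x. (g' x)\<^sup>2 - 4 * (g x)\<^sup>2) = 0 \<Longrightarrow> \<exists>A B. \<forall>x. g x = A * cos (2 * x) + B * sin (2 * x)"
proof -
  have cg: "continuous_on UNIV g" using der by (meson DERIV_isCont continuous_at_imp_continuous_on)
  define j where "j x = g x - g (x + pi / 2)" for x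
  have cj: "continuous_on X j" for X
    unfolding j_def by (intro continuous_intros continuous_on_subset[OF cg] continuous_on_compose2[OF cg]) auto
  have ja: "j (pi / 2) = - j 0" using per(1)[of 0] by (simp add: j_def)
  have "\<exists>a. j a = 0"
  proof (cases "j 0 \<le> 0")
    case True
    then have "j 0 \<le> 0" "0 \<le> j (pi / 2)" using ja by auto
    then show ?thesis using IVT'[of j 0 0 "pi / 2"] cj by (metis pi_half_ge_zero)
  next
    case False
    then have "j (pi / 2) \<le> 0" "0 \<le> j 0" using ja by auto
    then show ?thesis using IVT2'[of j "pi / 2" 0 0] cj by (metis pi_half_ge_zero)
  qed
  then obtain a where "j a = 0" by blast
  then have a: "g (a + pi / 2) = g a" by (simp add: j_def)
  define \<kappa> where "\<kappa> = g a"
  define p where "p x = g x - \<kappa>" for x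
  have dp: "(p has_real_derivative g' x) (at x)" for x
    unfolding p_def using DERIV_diff[OF der DERIV_const] by simp
  define b where "b = a + pi / 2"
  have pz: "p a = 0" "p b = 0" "p (b + pi / 2) = 0" "p (a + pi / 2) = 0"
    using a per(1)[of a] by (simp_all add: p_def \<kappa>_def b_def add.commute)
  have two: "(0::real) < 2" by simp
  note W1 = wirtinger_segment[OF two dp cg' pz(1) pz(4), folded b_def]
  note W2 = wirtinger_segment[OF two dp cg' pz(2) pz(3)]
  let ?E = "\<lambda>x. (g' x)\<^sup>2 - 2\<^sup>2 * (p x)\<^sup>2"
  have cp: "continuous_on UNIV p" unfolding p_def by (intro continuous_intros cg)
  have cE: "continuous_on X ?E" for X
    by (intro continuous_intros continuous_on_subset[OF cp] continuous_on_subset[OF cg']) auto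
  have sum: "integral {a..a + pi} ?E = integral {a..b} ?E + integral {b..b + pi / 2} ?E"
    using Henstock_Kurzweil_Integration.integral_combine[of a b "a + pi" ?E] integrable_continuous_real[OF cE]
    by (simp add: b_def add.commute)
  have dbl: "integral {-pi..pi} ?E = 2 * integral {a..a + pi} ?E"
    by (rule integral_double_period) (auto simp: per p_def intro!: continuous_intros cg cg')
  have expand: "integral {-pi..pi} ?E = integral {-pi..pi} (\<lambda>x. (g' x)\<^sup>2 - 4 * (g x)\<^sup>2) - 8 * pi * \<kappa>\<^sup>2"
  proof -
    have "integral {-pi..pi} ?E = integral {-pi..pi} (\<lambda>x. ((g' x)\<^sup>2 - 4 * (g x)\<^sup>2) + (8 * \<kappa> * g x - 4 * \<kappa>\<^sup>2))"
      by (intro integral_cong) (simp add: p_def power2_eq_square algebra_simps)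
    also have "\<dots> = integral {-pi..pi} (\<lambda>x. (g' x)\<^sup>2 - 4 * (g x)\<^sup>2) + integral {-pi..pi} (\<lambda>x. 8 * \<kappa> * g x - 4 * \<kappa>\<^sup>2)"
      by (intro integral_add integrable_continuous_real continuous_intros continuous_on_subset[OF cg] continuous_on_subset[OF cg']) auto
    also have "integral {-pi..pi} (\<lambda>x. 8 * \<kappa> * g x - 4 * \<kappa>\<^sup>2) = integral {-pi..pi} (\<lambda>x. 8 * \<kappa> * g x) - integral {-pi..pi} (\<lambda>x. 4 * \<kappa>\<^sup>2)"
      by (intro integral_diff integrable_continuous_real continuous_intros continuous_on_subset[OF cg]) auto
    also have "integral {-pi..pi} (\<lambda>x. 8 * \<kappa> * g x) = 8 * \<kappa> * integral {-pi..pi} g" by (rule integral_mult_right)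
    finally show ?thesis by (simp add: mean)
  qed
  have pk: "0 \<le> 8 * pi * \<kappa>\<^sup>2" by simp
  show "0 \<le> integral {-pi..pi} (\<lambda>x. (g' x)\<^sup>2 - 4 * (g x)\<^sup>2)"
    using W1(1) W2(1) sum dbl expand pk by linarith
  assume z: "integral {-pi..pi} (\<lambda>x. (g' x)\<^sup>2 - 4 * (g x)\<^sup>2) = 0"
  have i0: "8 * pi * \<kappa>\<^sup>2 = 0" "integral {a..b} ?E = 0" "integral {b..b + pi / 2} ?E = 0"
    using W1(1) W2(1) sum dbl expand pk z by linarith+
  then have k0: "\<kappa> = 0" by simp
  obtain c1 where c1: "\<forall>x\<in>{a..b}. p x = c1 * sin (2 * (x - a))" using W1(2)[OF i0(2)] by blast
  obtain c2 where c2: "\<forall>x\<in>{b..b + pi / 2}. p x = c2 * sin (2 * (x - b))" using W2(2)[OF i0(3)] by blast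
  have ab: "a < b" "b < b + pi / 2" by (simp_all add: b_def)
  \<comment> \<open>On the two halves p is c1 and c2 times a sine. Comparing the derivative at the
    junction \<open>b\<close> from both sides gives c2 = - c1, which joins them into one
    sine.\<close>
  have l: "g' b = 2 * c1 * cos (2 * (b - a))"
  proof (rule vector_derivative_unique_within_closed_interval[of a b b p])
    show "(p has_vector_derivative g' b) (at b within cbox a b)"
      using dp by (auto simp: has_real_derivative_iff_has_vector_derivative[symmetric] intro: has_field_derivative_at_within)
    have "((\<lambda>x. c1 * sin (2 * (x - a))) has_vector_derivative 2 * c1 * cos (2 * (b - a))) (at b within {a..b})"
      unfolding has_real_derivative_iff_has_vector_derivative[symmetric] by (auto intro!: derivative_eq_intros)
    then show "(p has_vector_derivative 2 * c1 * cos (2 * (b - a))) (at b within cbox a b)"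
      unfolding cbox_interval by (rule has_vector_derivative_transform[rotated 2]) (use c1 ab in auto)
  qed (use ab in auto)
  have r: "g' b = 2 * c2 * cos (2 * (b - b))"
  proof (rule vector_derivative_unique_within_closed_interval[of b "b + pi / 2" b p])
    show "(p has_vector_derivative g' b) (at b within cbox b (b + pi / 2))"
      using dp by (auto simp: has_real_derivative_iff_has_vector_derivative[symmetric] intro: has_field_derivative_at_within)
    have "((\<lambda>x. c2 * sin (2 * (x - b))) has_vector_derivative 2 * c2 * cos (2 * (b - b))) (at b within {b..b + pi / 2})"
      unfolding has_real_derivative_iff_has_vector_derivative[symmetric] by (auto intro!: derivative_eq_intros)
    then show "(p has_vector_derivative 2 * c2 * cos (2 * (b - b))) (at b within cbox b (b + pi / 2))"
      unfolding cbox_interval by (rule has_vector_derivative_transform[rotated 2]) (use c2 ab in auto)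
  qed (use ab in auto)
  have "c2 = - c1" using l r by (simp add: b_def)
  moreover have "sin (2 * (x - b)) = - sin (2 * (x - a))" for x
  proof -
    have "2 * (x - b) = 2 * (x - a) - pi" by (simp add: b_def algebra_simps)
    then show ?thesis by (simp only: sin_minus_pi)
  qed
  ultimately have c2': "\<forall>x\<in>{b..b + pi / 2}. p x = c1 * sin (2 * (x - a))" using c2 by simp
  have "g x - c1 * sin (2 * (x - a)) = 0" for x
  proof (rule periodic_all[of "\<lambda>x. g x - c1 * sin (2 * (x - a))" pi a])
    fix x
    have "2 * (x + pi - a) = 2 * (x - a) + 2 * pi" by simp
    then have "sin (2 * (x + pi - a)) = sin (2 * (x - a))" by (simp only: sin_periodic)
    then show "g (x + pi) - c1 * sin (2 * (x + pi - a)) = g x - c1 * sin (2 * (x - a))" by (simp add: per)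
  next
    fix x assume "x \<in> {a..a + pi}"
    then have "x \<in> {a..b} \<or> x \<in> {b..b + pi / 2}" by (auto simp: b_def)
    then show "g x - c1 * sin (2 * (x - a)) = 0" using c1 c2' k0 by (auto simp: p_def)
  qed simp
  then have "g x = - c1 * sin (2 * a) * cos (2 * x) + c1 * cos (2 * a) * sin (2 * x)" for x
    by (simp add: sin_diff right_diff_distrib algebra_simps)
  then show "\<exists>A B. \<forall>x. g x = A * cos (2 * x) + B * sin (2 * x)" by blast
qed

section \<open>The limiting quadratic functional and its sign\<close>

context perturbed
begin

definition second_variation :: real where
  "second_variation = m2 - integral {-pi..pi} (\<lambda>x. (f' x)\<^sup>2) + 3 * integral {-pi..pi} (\<lambda>x. (evn x)\<^sup>2) - 2 * m1\<^sup>2 / pi"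

definition odd_part where "odd_part x = (f x - f (x + pi)) / 2"
definition odd_part' where "odd_part' x = (f' x - f' (x + pi)) / 2"
text \<open>The mean of \<open>evn\<close> is subtracted to meet the mean zero hypothesis of
  \<open>wirtinger_half_period\<close>.\<close>

definition even_part where "even_part x = evn x - m1 / (2 * pi)"
definition even_part' where "even_part' x = (f' x + f' (x + pi)) / 2"

lemma parts_derivative:
  "(odd_part has_real_derivative odd_part' x) (at x)" "(even_part has_real_derivative even_part' x) (at x)"
  "continuous_on UNIV odd_part'" "continuous_on UNIV even_part'" "continuous_on UNIV odd_part" "continuous_on UNIV even_part"
proof -
  have d: "((\<lambda>x. f (x + pi)) has_real_derivative f' (x + pi)) (at x)" for x
    using DERIV_shift[of f "f' (x + pi)" x pi] der by simp
  show "(odd_part has_real_derivative odd_part' x) (at x)" for x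
    unfolding odd_part_def[abs_def] odd_part'_def by (auto intro!: derivative_eq_intros der d)
  show "(even_part has_real_derivative even_part' x) (at x)" for x
    unfolding even_part_def[abs_def] evn_def even_part'_def by (auto intro!: derivative_eq_intros der d)
  show "continuous_on UNIV odd_part'" "continuous_on UNIV even_part'" "continuous_on UNIV odd_part" "continuous_on UNIV even_part"
    unfolding odd_part'_def even_part'_def odd_part_def even_part_def evn_def by (intro continuous_intros; simp)+
qed

lemma parts_periodic:
  "odd_part (x + pi) = - odd_part x" "odd_part' (x + pi) = - odd_part' x"
  "even_part (x + pi) = even_part x" "even_part' (x + pi) = even_part' x"
proof -
  have e: "x + pi + pi = x + 2 * pi" by simp
  show "odd_part (x + pi) = - odd_part x" "odd_part' (x + pi) = - odd_part' x"
    "even_part (x + pi) = even_part x" "even_part' (x + pi) = even_part' x"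
    unfolding odd_part_def odd_part'_def even_part_def even_part'_def evn_def e per per' by (simp_all add: field_simps)
qed

lemma integral_even_part: "integral {-pi..pi} even_part = 0" "integral {-pi..pi} evn = m1"
proof -
  have cn: "continuous_on {-pi..pi} evn" unfolding evn_def by (intro continuous_intros) auto
  have "integral {-pi..pi} evn = (integral {-pi..pi} f + integral {-pi..pi} (\<lambda>x. f (x + pi))) / 2"
    unfolding evn_def
    by (simp, subst integral_add, (intro integrable_continuous_real continuous_intros)+) simp
  also have "integral {-pi..pi} (\<lambda>x. f (x + pi)) = integral {-pi..pi} f"
    by (rule integral_periodic_shift(2)[OF per contf])
  finally show e: "integral {-pi..pi} evn = m1" by (simp add: m1_def)
  have "integral {-pi..pi} even_part = integral {-pi..pi} evn - integral {-pi..pi} (\<lambda>x. m1 / (2 * pi))"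
    unfolding even_part_def[abs_def] by (intro integral_diff integrable_continuous_real cn continuous_intros)
  then show "integral {-pi..pi} even_part = 0" unfolding e by simp
qed

text \<open>The squares of \<open>evn\<close> and \<open>odd_part\<close> add up to the average of
  f^2 over x and x + pi, so mixed terms drop out, and likewise for f'. The square of
  \<open>evn\<close> receives the weight 1 + 3 = 4, and four times the contribution m1^2 / (2 pi) of
  its mean cancels the term - 2 m1^2 / pi.\<close>

lemma second_variation_split:
  "second_variation = - integral {-pi..pi} (\<lambda>x. (odd_part' x)\<^sup>2 - (odd_part x)\<^sup>2)
     - integral {-pi..pi} (\<lambda>x. (even_part' x)\<^sup>2 - 4 * (even_part x)\<^sup>2)"
proof -
  let ?I = "\<lambda>g. integral {-pi..pi} g"
  have int: "g integrable_on {-pi..pi}" if "continuous_on UNIV g" for g :: "real \<Rightarrow> real"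
    using that by (intro integrable_continuous_real) (rule continuous_on_subset, auto)
  have c: "continuous_on UNIV (\<lambda>x. (f x)\<^sup>2)" "continuous_on UNIV (\<lambda>x. (f' x)\<^sup>2)"
    "continuous_on UNIV (\<lambda>x. (f (x + pi))\<^sup>2)" "continuous_on UNIV (\<lambda>x. (f' (x + pi))\<^sup>2)" "continuous_on UNIV evn"
    unfolding evn_def by (intro continuous_intros; simp)+
  note pc = parts_derivative(3-6)
  have sh: "?I (\<lambda>x. (f (x + pi))\<^sup>2) = m2" "?I (\<lambda>x. (f' (x + pi))\<^sup>2) = ?I (\<lambda>x. (f' x)\<^sup>2)"
    using integral_periodic_shift(2)[of "\<lambda>x. (f x)\<^sup>2" pi] integral_periodic_shift(2)[of "\<lambda>x. (f' x)\<^sup>2" pi] per per' c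
    by (simp_all add: m2_def)
  have "?I (\<lambda>x. (evn x)\<^sup>2) + ?I (\<lambda>x. (odd_part x)\<^sup>2) = ?I (\<lambda>x. (evn x)\<^sup>2 + (odd_part x)\<^sup>2)"
    by (intro integral_add[symmetric] int continuous_intros c pc)
  also have "\<dots> = ?I (\<lambda>x. ((f x)\<^sup>2 + (f (x + pi))\<^sup>2) / 2)"
    by (intro integral_cong) (simp add: evn_def odd_part_def power2_eq_square field_simps)
  also have "\<dots> = (?I (\<lambda>x. (f x)\<^sup>2) + ?I (\<lambda>x. (f (x + pi))\<^sup>2)) / 2"
    by (simp add: integral_add int c)
  finally have A: "?I (\<lambda>x. (evn x)\<^sup>2) + ?I (\<lambda>x. (odd_part x)\<^sup>2) = m2" unfolding sh by (simp add: m2_def)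
  have "?I (\<lambda>x. (even_part' x)\<^sup>2) + ?I (\<lambda>x. (odd_part' x)\<^sup>2) = ?I (\<lambda>x. (even_part' x)\<^sup>2 + (odd_part' x)\<^sup>2)"
    by (intro integral_add[symmetric] int continuous_intros pc)
  also have "\<dots> = ?I (\<lambda>x. ((f' x)\<^sup>2 + (f' (x + pi))\<^sup>2) / 2)"
    by (intro integral_cong) (simp add: even_part'_def odd_part'_def power2_eq_square field_simps)
  also have "\<dots> = (?I (\<lambda>x. (f' x)\<^sup>2) + ?I (\<lambda>x. (f' (x + pi))\<^sup>2)) / 2"
    by (simp add: integral_add int c)
  finally have B: "?I (\<lambda>x. (even_part' x)\<^sup>2) + ?I (\<lambda>x. (odd_part' x)\<^sup>2) = ?I (\<lambda>x. (f' x)\<^sup>2)" unfolding sh by simp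
  have "?I (\<lambda>x. (evn x)\<^sup>2) = ?I (\<lambda>x. (even_part x)\<^sup>2 + (m1 / pi * even_part x + m1\<^sup>2 / (4 * pi\<^sup>2)))"
    by (intro integral_cong) (simp add: even_part_def power2_eq_square field_simps)
  also have "\<dots> = ?I (\<lambda>x. (even_part x)\<^sup>2) + ?I (\<lambda>x. m1 / pi * even_part x + m1\<^sup>2 / (4 * pi\<^sup>2))"
    by (intro integral_add int continuous_intros pc)
  also have "?I (\<lambda>x. m1 / pi * even_part x + m1\<^sup>2 / (4 * pi\<^sup>2)) = ?I (\<lambda>x. m1 / pi * even_part x) + ?I (\<lambda>x. m1\<^sup>2 / (4 * pi\<^sup>2))"
    by (intro integral_add int continuous_intros pc)
  also have "?I (\<lambda>x. m1 / pi * even_part x) = m1 / pi * ?I even_part" by (rule integral_mult_right)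
  finally have C: "?I (\<lambda>x. (evn x)\<^sup>2) = ?I (\<lambda>x. (even_part x)\<^sup>2) + m1\<^sup>2 / (2 * pi)"
    unfolding integral_even_part by (simp add: power2_eq_square)
  have D: "?I (\<lambda>x. (odd_part' x)\<^sup>2 - (odd_part x)\<^sup>2) = ?I (\<lambda>x. (odd_part' x)\<^sup>2) - ?I (\<lambda>x. (odd_part x)\<^sup>2)"
    by (intro integral_diff int continuous_intros pc)
  have "?I (\<lambda>x. (even_part' x)\<^sup>2 - 4 * (even_part x)\<^sup>2) = ?I (\<lambda>x. (even_part' x)\<^sup>2) - ?I (\<lambda>x. 4 * (even_part x)\<^sup>2)"
    by (intro integral_diff int continuous_intros pc)
  also have "?I (\<lambda>x. 4 * (even_part x)\<^sup>2) = 4 * ?I (\<lambda>x. (even_part x)\<^sup>2)" by (rule integral_mult_right)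
  finally have E: "?I (\<lambda>x. (even_part' x)\<^sup>2 - 4 * (even_part x)\<^sup>2) = ?I (\<lambda>x. (even_part' x)\<^sup>2) - 4 * ?I (\<lambda>x. (even_part x)\<^sup>2)" .
  have F: "2 * m1\<^sup>2 / pi = 4 * (m1\<^sup>2 / (2 * pi))" by simp
  show ?thesis unfolding second_variation_def D E F using A B C by linarith
qed

lemma second_variation_le_0: "second_variation \<le> 0"
  using wirtinger_antiperiodic(1)[OF parts_derivative(1,3) parts_periodic(1,2)]
    wirtinger_half_period(1)[OF parts_derivative(2,4) parts_periodic(3,4) integral_even_part(1)]
  unfolding second_variation_split by linarith

lemma integral_full_period_0:
  fixes G g :: "real \<Rightarrow> real"
  assumes "\<And>x. (G has_real_derivative g x) (at x)" "G pi = G (-pi)"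
  shows "integral {-pi..pi} g = 0"
  using integral_primitive[OF assms(1), of "-pi" pi 0] assms(2) by simp

lemma second_variation_eq_0_iff:
  "second_variation = 0 \<longleftrightarrow> (\<exists>m A B C D. \<forall>x. f x = m + A * cos x + B * sin x + C * cos (2 * x) + D * sin (2 * x))"
proof
  assume z: "second_variation = 0"
  note W1 = wirtinger_antiperiodic[OF parts_derivative(1,3) parts_periodic(1,2)]
  note W2 = wirtinger_half_period[OF parts_derivative(2,4) parts_periodic(3,4) integral_even_part(1)]
  have "integral {-pi..pi} (\<lambda>x. (odd_part' x)\<^sup>2 - (odd_part x)\<^sup>2) = 0"
    "integral {-pi..pi} (\<lambda>x. (even_part' x)\<^sup>2 - 4 * (even_part x)\<^sup>2) = 0"
    using W1(1) W2(1) z unfolding second_variation_split by linarith+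
  from W1(2)[OF this(1)] W2(2)[OF this(2)] obtain A B C D where
    o: "\<forall>x. odd_part x = A * cos x + B * sin x" and e: "\<forall>x. even_part x = C * cos (2 * x) + D * sin (2 * x)" by blast
  have "f x = m1 / (2 * pi) + A * cos x + B * sin x + C * cos (2 * x) + D * sin (2 * x)" for x
  proof -
    have "f x = m1 / (2 * pi) + odd_part x + even_part x" by (simp add: odd_part_def even_part_def evn_def field_simps)
    then show ?thesis using o e by simp
  qed
  then show "\<exists>m A B C D. \<forall>x. f x = m + A * cos x + B * sin x + C * cos (2 * x) + D * sin (2 * x)" by blast
next
  assume "\<exists>m A B C D. \<forall>x. f x = m + A * cos x + B * sin x + C * cos (2 * x) + D * sin (2 * x)"
  then obtain m A B C D where f: "\<And>x. f x = m + A * cos x + B * sin x + C * cos (2 * x) + D * sin (2 * x)" by blast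
  have f': "f' x = - A * sin x + B * cos x - 2 * C * sin (2 * x) + 2 * D * cos (2 * x)" for x
  proof (rule DERIV_unique[OF der])
    have fe: "f = (\<lambda>x. m + A * cos x + B * sin x + C * cos (2 * x) + D * sin (2 * x))" using f by blast
    show "(f has_real_derivative - A * sin x + B * cos x - 2 * C * sin (2 * x) + 2 * D * cos (2 * x)) (at x)"
      unfolding fe by (auto intro!: derivative_eq_intros)
  qed
  have p2: "cos (2 * (x + pi)) = cos (2 * x)" "sin (2 * (x + pi)) = sin (2 * x)" for x
    using cos_periodic[of "2 * x"] sin_periodic[of "2 * x"] by (simp_all add: distrib_left)
  have o: "odd_part x = A * cos x + B * sin x" "odd_part' x = - A * sin x + B * cos x" for x
    unfolding odd_part_def odd_part'_def f f' p2 by (simp_all add: field_simps)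
  have e1: "evn x = m + (C * cos (2 * x) + D * sin (2 * x))" for x
    unfolding evn_def f p2 by (simp add: field_simps)
  have ev': "even_part' x = - 2 * C * sin (2 * x) + 2 * D * cos (2 * x)" for x
    unfolding even_part'_def f' p2 by (simp add: field_simps)
  have i0: "integral {-pi..pi} (\<lambda>x. C * cos (2 * x) + D * sin (2 * x)) = 0"
    by (rule integral_full_period_0[of "\<lambda>x. C * sin (2 * x) / 2 - D * cos (2 * x) / 2"])
       (auto intro!: derivative_eq_intros)
  have "m1 = 2 * pi * m"
  proof -
    have "integral {-pi..pi} (\<lambda>x. m + (C * cos (2 * x) + D * sin (2 * x))) = integral {-pi..pi} (\<lambda>x. m) + integral {-pi..pi} (\<lambda>x. C * cos (2 * x) + D * sin (2 * x))"
      by (intro integral_add integrable_continuous_real continuous_intros)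
    then have "integral {-pi..pi} (\<lambda>x. m + (C * cos (2 * x) + D * sin (2 * x))) = 2 * pi * m" unfolding i0 by simp
    then show ?thesis using integral_even_part(2) unfolding e1[abs_def] by simp
  qed
  then have ev: "even_part x = C * cos (2 * x) + D * sin (2 * x)" for x
    by (simp add: even_part_def e1)
  have "integral {-pi..pi} (\<lambda>x. (odd_part' x)\<^sup>2 - (odd_part x)\<^sup>2) = 0"
  \<comment> \<open>Expanding the squares leaves multiples of cos 2x and sin 2x, whose primitive is
    periodic.\<close>
  proof (rule integral_full_period_0)
    show "((\<lambda>x. (B\<^sup>2 - A\<^sup>2) * (sin x * cos x) + A * B * ((cos x)\<^sup>2 - (sin x)\<^sup>2)) has_real_derivative (odd_part' x)\<^sup>2 - (odd_part x)\<^sup>2) (at x)" for x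
      unfolding o by (auto intro!: derivative_eq_intros simp: power2_eq_square algebra_simps)
  qed simp
  moreover have "integral {-pi..pi} (\<lambda>x. (even_part' x)\<^sup>2 - 4 * (even_part x)\<^sup>2) = 0"
  proof (rule integral_full_period_0)
    show "((\<lambda>x. 2 * ((D\<^sup>2 - C\<^sup>2) * (sin (2 * x) * cos (2 * x)) + C * D * ((cos (2 * x))\<^sup>2 - (sin (2 * x))\<^sup>2))) has_real_derivative (even_part' x)\<^sup>2 - 4 * (even_part x)\<^sup>2) (at x)" for x
      unfolding ev ev' by (auto intro!: derivative_eq_intros simp: power2_eq_square algebra_simps)
  qed simp
  ultimately show "second_variation = 0" unfolding second_variation_split by simp
qed

end

section \<open>Second variation of the volume\<close>

text \<open>The right-hand side falls continuously from pi to 0 on [0, pi / 2]; by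
  \<open>flens_sin\<close> it is the lens area for the shift 2 sin h.\<close>

lemma cap_angle_exists:
  assumes "0 < \<delta>" "\<delta> < 1"
  shows "\<exists>h. 0 < h \<and> h < pi / 2 \<and> pi * \<delta> = pi - 2 * h - sin (2 * h)"
proof -
  have p: "0 < pi * \<delta>" "pi * \<delta> < pi * 1" using assms by (auto intro: mult_strict_left_mono)
  have c: "continuous_on {0..pi / 2} (\<lambda>h. pi - 2 * h - sin (2 * h))" by (intro continuous_intros)
  have "\<exists>h\<ge>0. h \<le> pi / 2 \<and> pi - 2 * h - sin (2 * h) = pi * \<delta>"
    by (rule IVT2'[OF _ _ _ c]) (use p in auto)
  then obtain h where h: "0 \<le> h" "h \<le> pi / 2" "pi - 2 * h - sin (2 * h) = pi * \<delta>" by blast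
  moreover have "h \<noteq> 0" using h(3) p by auto
  moreover have "h \<noteq> pi / 2"
  proof
    assume "h = pi / 2"
    then have "2 * h = pi" by simp
    then show False using h(3) p(1) by (simp only:) simp
  qed
  ultimately show ?thesis by (intro exI[of _ h]) auto
qed

context perturbed
begin

lemma volume_second_variation:
  assumes h: "0 < h" "h < pi / 2" and \<delta>: "pi * \<delta> = pi - 2 * h - sin (2 * h)"
  shows "\<exists>\<epsilon>>0. Ck_on 2 {-\<epsilon><..<\<epsilon>} (\<lambda>t. measure lebesgue (convolution_body \<delta> (normalized (KK t))))"
    and "(deriv ^^ 2) (\<lambda>t. measure lebesgue (convolution_body \<delta> (normalized (KK t)))) 0
      = (2 * sin h)\<^sup>2 * (integral {-pi..pi} (\<lambda>\<phi>. 2 * (q0 h \<phi>)\<^sup>2 + q0' h \<phi>) / pi - 2 * m1 * integral {-pi..pi} (q0 h) / pi\<^sup>2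
        - m2 / pi + 2 * m1\<^sup>2 / pi\<^sup>2)"
proof -
  obtain a b \<tau> where s: "0 < a" "a < b" "b < 2" "0 < \<tau>" "\<tau> * bnd \<le> 1 / 2"
    "\<forall>t s \<phi>. \<bar>t\<bar> < \<tau> \<longrightarrow> a \<le> s \<longrightarrow> s \<le> b \<longrightarrow> roots_prop f f' t s \<phi>"
    "\<forall>t s \<phi>. \<bar>t\<bar> < \<tau> \<longrightarrow> 0 < s \<longrightarrow> s \<le> a \<longrightarrow> \<delta> * AA t < GG t s \<phi>"
    "\<forall>t s \<phi>. \<bar>t\<bar> < \<tau> \<longrightarrow> b \<le> s \<longrightarrow> GG t s \<phi> < \<delta> * AA t"
    "\<forall>t s \<phi>. \<bar>t\<bar> < \<tau> \<longrightarrow> a \<le> s \<longrightarrow> s \<le> b \<longrightarrow> 2 * GG t s \<phi> < BB t s \<phi>"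
    using solution_region[OF h \<delta>] by blast
  interpret s: solved f f' P F1 F2 \<delta> a b \<tau>
    by unfold_locales (use s in auto)
  have "0 < sin (2 * h)" using h by (intro sin_gt_zero) auto
  then have "pi * \<delta> \<le> pi * 1" using \<delta> h by linarith
  then have "\<delta> \<le> 1" by simp
  then show "\<exists>\<epsilon>>0. Ck_on 2 {-\<epsilon><..<\<epsilon>} (\<lambda>t. measure lebesgue (convolution_body \<delta> (normalized (KK t))))"
    using s.volume_C2(1) s(4) by blast
  show "(deriv ^^ 2) (\<lambda>t. measure lebesgue (convolution_body \<delta> (normalized (KK t)))) 0
      = (2 * sin h)\<^sup>2 * (integral {-pi..pi} (\<lambda>\<phi>. 2 * (q0 h \<phi>)\<^sup>2 + q0' h \<phi>) / pi - 2 * m1 * integral {-pi..pi} (q0 h) / pi\<^sup>2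
        - m2 / pi + 2 * m1\<^sup>2 / pi\<^sup>2)"
    by (rule s.second_derivative_at_0[OF h \<delta>])
qed

lemma limit_at_left_1:
  "((\<lambda>\<delta>. 1 / (1 - \<delta>)\<^sup>2 * (deriv ^^ 2) (\<lambda>t. measure lebesgue (convolution_body \<delta> (normalized (KK t)))) 0)
    \<longlongrightarrow> pi / 4 * second_variation) (at_left 1)"
proof -
  define hh where "hh \<delta> = (SOME h. 0 < h \<and> h < pi / 2 \<and> pi * \<delta> = pi - 2 * h - sin (2 * h))" for \<delta>
  have hh: "0 < hh \<delta>" "hh \<delta> < pi / 2" "pi * \<delta> = pi - 2 * hh \<delta> - sin (2 * hh \<delta>)" if "0 < \<delta>" "\<delta> < 1" for \<delta>
    using someI_ex[OF cap_angle_exists[OF that]] unfolding hh_def by blast+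
  have ev: "\<forall>\<^sub>F \<delta> in at_left 1. 0 < \<delta> \<and> \<delta> < (1::real)"
    using eventually_at_left_field[of "\<lambda>\<delta>. 0 < \<delta> \<and> \<delta> < (1::real)" 1] by (auto intro: exI[of _ 0])
  have le: "hh \<delta> \<le> pi * (1 - \<delta>) / 2" if "0 < \<delta>" "\<delta> < 1" for \<delta>
  proof -
    have "0 \<le> sin (2 * hh \<delta>)" using hh[OF that] by (intro sin_ge_zero) auto
    then show ?thesis using hh(3)[OF that] by (simp add: right_diff_distrib)
  qed
  have "((\<lambda>\<delta>. pi * (1 - \<delta>) / 2) \<longlongrightarrow> pi * (1 - 1) / 2) (at_left (1::real))" by (intro tendsto_intros) auto
  then have z: "((\<lambda>\<delta>. pi * (1 - \<delta>) / 2) \<longlongrightarrow> 0) (at_left (1::real))" by simp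
  have "(hh \<longlongrightarrow> 0) (at_left 1)"
  proof (rule tendsto_sandwich[OF _ _ tendsto_const z])
    show "\<forall>\<^sub>F \<delta> in at_left 1. 0 \<le> hh \<delta>" using ev by (rule eventually_mono) (auto intro: hh(1)[THEN less_imp_le])
    show "\<forall>\<^sub>F \<delta> in at_left 1. hh \<delta> \<le> pi * (1 - \<delta>) / 2" using ev by (rule eventually_mono) (rule le; simp)
  qed
  then have fl: "filterlim hh (at_right 0) (at_left 1)"
    by (rule tendsto_imp_filterlim_at_right) (use ev in \<open>auto elim!: eventually_mono intro: hh(1)\<close>)
  note L = filterlim_compose[OF limit_second_variation fl, folded second_variation_def]
  show ?thesis
    using L
  proof (rule Lim_transform_eventually)
    show "\<forall>\<^sub>F \<delta> in at_left 1. (2 * sin (hh \<delta>))\<^sup>2 * (integral {-pi..pi} (\<lambda>\<phi>. 2 * (q0 (hh \<delta>) \<phi>)\<^sup>2 + q0' (hh \<delta>) \<phi>) / pi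
        - 2 * m1 * integral {-pi..pi} (q0 (hh \<delta>)) / pi\<^sup>2 - m2 / pi + 2 * m1\<^sup>2 / pi\<^sup>2) / ((2 * hh \<delta> + sin (2 * hh \<delta>)) / pi)\<^sup>2
      = 1 / (1 - \<delta>)\<^sup>2 * (deriv ^^ 2) (\<lambda>t. measure lebesgue (convolution_body \<delta> (normalized (KK t)))) 0"
      using ev
    proof (rule eventually_mono)
      fix \<delta> :: real assume d: "0 < \<delta> \<and> \<delta> < 1"
      note h = hh[OF conjunct1[OF d] conjunct2[OF d]]
      have "2 * hh \<delta> + sin (2 * hh \<delta>) = pi * (1 - \<delta>)" using h(3) unfolding right_diff_distrib by linarith
      then have e: "(2 * hh \<delta> + sin (2 * hh \<delta>)) / pi = 1 - \<delta>" by simp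
      show "(2 * sin (hh \<delta>))\<^sup>2 * (integral {-pi..pi} (\<lambda>\<phi>. 2 * (q0 (hh \<delta>) \<phi>)\<^sup>2 + q0' (hh \<delta>) \<phi>) / pi
        - 2 * m1 * integral {-pi..pi} (q0 (hh \<delta>)) / pi\<^sup>2 - m2 / pi + 2 * m1\<^sup>2 / pi\<^sup>2) / ((2 * hh \<delta> + sin (2 * hh \<delta>)) / pi)\<^sup>2
      = 1 / (1 - \<delta>)\<^sup>2 * (deriv ^^ 2) (\<lambda>t. measure lebesgue (convolution_body \<delta> (normalized (KK t)))) 0"
        unfolding volume_second_variation(2)[OF h] e by simp
    qed
  qed
qed

text \<open>On the circle the monomials of degree two span the same functions as 1, cos 2x and sin
  2x, by the double angle formulas.\<close>

lemma trigonometric_iff_quadratic: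
  "(\<exists>m A B C D. \<forall>x. f x = m + A * cos x + B * sin x + C * cos (2 * x) + D * sin (2 * x))
    \<longleftrightarrow> (\<exists>p. quadratic_polynomial p \<and> (\<forall>v\<in>sphere 0 1. P v = p v))"
proof
  assume "\<exists>m A B C D. \<forall>x. f x = m + A * cos x + B * sin x + C * cos (2 * x) + D * sin (2 * x)"
  then obtain m A B C D where f: "\<And>x. f x = m + A * cos x + B * sin x + C * cos (2 * x) + D * sin (2 * x)" by blast
  define p :: "real ^ 2 \<Rightarrow> real" where
    "p x = (1 + C) * (x $ 1)\<^sup>2 + (2 * D) * (x $ 1) * (x $ 2) + (1 - C) * (x $ 2)\<^sup>2 + A * (x $ 1) + B * (x $ 2) + (m - 1)" for x
  \<comment> \<open>The polynomial x^2 + y^2 - 1, zero on the circle, has been added: 1 + C and 1 -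
    C cannot both vanish, so the degree is exactly two even when C = D = 0.\<close>
  have "(1 + C, 2 * D, 1 - C) \<noteq> (0, 0, 0)" by auto
  then have "quadratic_polynomial p" unfolding quadratic_polynomial_def p_def by blast
  moreover have "P v = p v" if "v \<in> sphere 0 1" for v
  proof -
    from that have "norm v = 1" by simp
    then obtain x where v: "v = cis2 x" using sphere_cis2 by metis
    have c: "C * (sin x)\<^sup>2 + C * (cos x)\<^sup>2 = C" "(sin x)\<^sup>2 + (cos x)\<^sup>2 = 1"
      by (simp_all flip: distrib_left)
    have "p v = m + A * cos x + B * sin x + C * ((cos x)\<^sup>2 - (sin x)\<^sup>2) + D * (2 * sin x * cos x)"
      using c by (simp add: p_def v algebra_simps)
    then show ?thesis using fP[of x] f[of x] by (simp add: v cos_double sin_double)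
  qed
  ultimately show "\<exists>p. quadratic_polynomial p \<and> (\<forall>v\<in>sphere 0 1. P v = p v)" by blast
next
  assume "\<exists>p. quadratic_polynomial p \<and> (\<forall>v\<in>sphere 0 1. P v = p v)"
  then obtain a b c d e k where p: "\<And>v. v \<in> sphere 0 1 \<Longrightarrow>
      P v = a * (v $ 1)\<^sup>2 + b * (v $ 1) * (v $ 2) + c * (v $ 2)\<^sup>2 + d * (v $ 1) + e * (v $ 2) + k"
    unfolding quadratic_polynomial_def by metis
  have "f x = ((a + c) / 2 + k) + d * cos x + e * sin x + (a - c) / 2 * cos (2 * x) + b / 2 * sin (2 * x)" for x
  proof -
    have s: "(cos x)\<^sup>2 = 1 - (sin x)\<^sup>2" by (simp add: cos_squared_eq)
    have "f x = a * (cos x)\<^sup>2 + b * cos x * sin x + c * (sin x)\<^sup>2 + d * cos x + e * sin x + k"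
      unfolding fP using p[OF cis2_in_sphere, of x] by simp
    then show ?thesis unfolding cos_double sin_double s by (simp add: field_simps)
  qed
  then show "\<exists>m A B C D. \<forall>x. f x = m + A * cos x + B * sin x + C * cos (2 * x) + D * sin (2 * x)" by blast
qed

end

theorem theorem1p7:
  fixes K :: "(real ^ 2) set"
  assumes "Ck_smooth_radial_set 2 K"
  shows "(\<forall>\<delta>\<in>{0<..<1}. \<exists>\<epsilon>>0. Ck_on 2 {-\<epsilon><..<\<epsilon>}
            (\<lambda>t. measure lebesgue (convolution_body \<delta> (normalized (perturbed_disc K t)))))
       \<and> (\<exists>l. ((\<lambda>\<delta>. 1 / (1 - \<delta>)\<^sup>2 *
                  (deriv ^^ 2) (\<lambda>t. measure lebesgue
                     (convolution_body \<delta> (normalized (perturbed_disc K t)))) 0) \<longlongrightarrow> l) (at_left 1)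
            \<and> l \<le> 0
            \<and> (l = 0 \<longleftrightarrow> (\<exists>p. quadratic_polynomial p \<and> (\<forall>v\<in>sphere 0 1. radial_function K v = p v))))"
proof -
  define P where "P = radial_function K"
  define f where "f \<theta> = P (cis2 \<theta>)" for \<theta>
  obtain \<rho> where \<rho>: "has_radial_function K \<rho>"
    using assms by (auto simp: Ck_smooth_radial_set_def radial_set_def)
  \<comment> \<open>Off the circle \<open>radial_function K\<close> depends on an arbitrary choice;
    on it, it agrees with the continuous \<open>\<rho>\<close>.\<close>
  have contP: "continuous_on (sphere 0 1) P"
  proof -
    have "continuous_on (sphere 0 1) \<rho>" using \<rho> by (simp add: has_radial_function_def)
    then show ?thesis
      by (rule continuous_on_eq) (simp only: P_def radial_function_eq[OF \<rho>])
  qed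
  have "Ck_on 2 UNIV f"
    using assms by (simp add: Ck_smooth_radial_set_def Ck_on_circle_def P_def f_def[abs_def] cis2_def)
  then have d: "(deriv ^^ j) f field_differentiable (at x)" if "j < 2" for j x
    using that by (auto simp: Ck_on_def)
  have der: "(f has_real_derivative deriv f x) (at x)" for x
    using d[of 0 x] by (simp add: field_differentiable_derivI)
  have contf': "continuous_on UNIV (deriv f)"
    using d[of 1] by (auto intro!: continuous_at_imp_continuous_on field_differentiable_imp_continuous_at)
  have contf: "continuous_on UNIV f"
    using der by (meson DERIV_isCont continuous_at_imp_continuous_on)
  obtain F1 where F1: "\<And>x. (F1 has_real_derivative f x) (at x)"
    using antiderivative_exists[OF contf] by blast
  obtain F2 where F2: "\<And>x. (F2 has_real_derivative (f x)\<^sup>2) (at x)"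
    using antiderivative_exists[OF continuous_on_power[OF contf]] by blast
  interpret perturbed f "deriv f" P F1 F2
    by unfold_locales (rule der contf' contP F1 F2 | simp add: f_def cis2_periodic)+
  have KK: "perturbed_disc K t = KK t" for t unfolding perturbed_disc_def KK_def by (simp only: P_def)
  have C2: "\<exists>\<epsilon>>0. Ck_on 2 {-\<epsilon><..<\<epsilon>} (\<lambda>t. measure lebesgue (convolution_body \<delta> (normalized (KK t))))"
    if "\<delta> \<in> {0<..<1}" for \<delta>
  proof -
    obtain h where h: "0 < h" "h < pi / 2" "pi * \<delta> = pi - 2 * h - sin (2 * h)"
    proof -
      have "0 < \<delta>" "\<delta> < 1" using \<open>\<delta> \<in> {0<..<1}\<close> by simp_all
      from cap_angle_exists[OF this] show thesis by (elim exE conjE) (rule that)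
    qed
    show ?thesis by (rule volume_second_variation(1)[OF h])
  qed
  have nonpos: "pi / 4 * second_variation \<le> 0"
    using second_variation_le_0 by (simp add: mult_nonneg_nonpos)
  have "pi / 4 * second_variation = 0 \<longleftrightarrow> second_variation = 0" by simp
  also have "\<dots> \<longleftrightarrow> (\<exists>p. quadratic_polynomial p \<and> (\<forall>v\<in>sphere 0 1. P v = p v))"
    using second_variation_eq_0_iff trigonometric_iff_quadratic by (rule trans)
  finally have eq: "pi / 4 * second_variation = 0 \<longleftrightarrow> (\<exists>p. quadratic_polynomial p \<and> (\<forall>v\<in>sphere 0 1. P v = p v))" .
  have "(\<forall>\<delta>\<in>{0<..<1}. \<exists>\<epsilon>>0. Ck_on 2 {-\<epsilon><..<\<epsilon>}
            (\<lambda>t. measure lebesgue (convolution_body \<delta> (normalized (KK t)))))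
       \<and> (\<exists>l. ((\<lambda>\<delta>. 1 / (1 - \<delta>)\<^sup>2 *
                  (deriv ^^ 2) (\<lambda>t. measure lebesgue (convolution_body \<delta> (normalized (KK t)))) 0) \<longlongrightarrow> l) (at_left 1)
            \<and> l \<le> 0
            \<and> (l = 0 \<longleftrightarrow> (\<exists>p. quadratic_polynomial p \<and> (\<forall>v\<in>sphere 0 1. P v = p v))))"
  proof (rule conjI)
    show "\<forall>\<delta>\<in>{0<..<1}. \<exists>\<epsilon>>0. Ck_on 2 {-\<epsilon><..<\<epsilon>}
        (\<lambda>t. measure lebesgue (convolution_body \<delta> (normalized (KK t))))"
      by (rule ballI) (rule C2)
  qed (rule exI[of _ "pi / 4 * second_variation"], intro conjI limit_at_left_1 nonpos eq)
  then show ?thesis unfolding KK P_def .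
qed

end
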